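(* Let $X$ be a smooth manifold with an elliptic involutive structure $V$, let $\mathcal T$ be a complete transverse atlas for the associated foliation $D_{\mathbb R}$, let $G_{\mathrm{mon}}=\mathrm{Mon}_{\mathcal T}(D_{\mathbb R})$ and $G_{\mathrm{hol}}=\mathrm{Hol}_{\mathcal T}(D_{\mathbb R})$ be the monodromy and holonomy groupoids restricted to $\mathcal T$, let $q:G_{\mathrm{mon}}\to G_{\mathrm{hol}}$ be the monodromy-to-holonomy quotient, and let $K=\ker(q)$ be the isotropy subgroupoid of monodromy loops with trivial transverse holonomy germ. Pullback along $q$ is fully faithful and induces an equivalence $$q^*:\mathrm{Coh}_{\mathrm{an}}(G_{\mathrm{hol}})\xrightarrow{\ \sim\ }\mathrm{Coh}_{\mathrm{an}}(G_{\mathrm{mon}})^{K=1},$$ where the category on the right is the full subcategory of $\mathrm{Coh}_{\mathrm{an}}(G_{\mathrm{mon}})$ of objects for which every $k\in K$ acts strictly as the identity.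
   Context: Smooth manifolds are without boundary, Hausdorff, second countable and finite-dimensional. An elliptic involutive structure (EIS) on $X$ is a complex subbundle $V\subset T_{\mathbb C}X$ with $[\Gamma(V),\Gamma(V)]\subset\Gamma(V)$ and $V+\overline V=T_{\mathbb C}X$. $D_{\mathbb R}\subset TX$ is the real involutive distribution with $D_{\mathbb R}\otimes_{\mathbb R}\mathbb C=V\cap\overline V$; its foliation is transversely holomorphic. An adapted chart is $U=B^d\times\Delta^n$ (real ball times complex polydisc) with real coordinates $t_a$ and complex coordinates $z_j$ in which $V|_U=\mathrm{span}_{\mathbb C}\{\partial/\partial t_a,\partial/\partial\overline z_j\}$. Choose a countable locally finite cover of $X$ by adapted charts $U_i=B_i^d\times\Delta_i$ and let $T_i=\{0\}\times\Delta_i\subset U_i$. The complex manifold $\mathcal T=\coprod_iT_i$ is called a complete transverse atlas. Arrows of $\mathrm{Mon}_{\mathcal T}(D_{\mathbb R})\rightrightarrows\mathcal T$ are leafwise paths between points of $\mathcal T$ modulo leafwise homotopy relative to the endpoints; arrows of $\mathrm{Hol}_{\mathcal T}(D_{\mathbb R})\rightrightarrows\mathcal T$ are obtained by identifying leafwise paths (with the same endpoints) that induce the same transverse holonomy germ. Both are complex-analytic étale groupoids with possibly non-Hausdorff arrow manifolds: source and target maps are local biholomorphisms. For such a groupoid $G=(G_1\rightrightarrows G_0)$ with source $s$ and target $t$, $\mathrm{Coh}_{\mathrm{an}}(G)$ is the category whose objects are coherent $\mathcal O_{G_0}$-modules $\mathcal F$ equipped with an isomorphism $\alpha:s^*\mathcal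 F\xrightarrow{\cong}t^*\mathcal F$ of coherent $\mathcal O_{G_1}$-modules satisfying the unit and multiplication identities, and whose morphisms are coherent analytic morphisms compatible with $\alpha$. The functor $q^*$ keeps the underlying sheaf and sends an action $\beta$ to $\alpha_g=\beta_{q(g)}$. *)

theory Defs
  imports "HOL-Analysis.Analysis" "HOL-Algebra.Module"
begin

section \<open>Smooth and holomorphic functions on coordinate spaces\<close>

text \<open>
  Points of \<open>\<real>\<^sup>m\<close> and \<open>\<complex>\<^sup>n\<close> are functions on \<^typ>\<open>nat\<close> vanishing from \<open>m\<close> (resp. \<open>n\<close>) on, as in
  \<^const>\<open>Euclidean_space\<close>; this allows the dimensions to be zero.
\<close>

definition Complex_space :: "nat \<Rightarrow> (nat \<Rightarrow> complex) topology" where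
  "Complex_space n =
     subtopology (product_topology (\<lambda>_. euclidean) UNIV) {z. \<forall>j\<ge>n. z j = 0}"

definition pdiff :: "nat \<Rightarrow> ((nat \<Rightarrow> real) \<Rightarrow> 'a::real_normed_vector) \<Rightarrow> (nat \<Rightarrow> real) \<Rightarrow> 'a" where
  "pdiff i f x = vector_derivative (\<lambda>h. f (x(i := h))) (at (x i))"

primrec Ck_in :: "nat \<Rightarrow> nat \<Rightarrow> (nat \<Rightarrow> real) set \<Rightarrow> ((nat \<Rightarrow> real) \<Rightarrow> 'a::real_normed_vector) \<Rightarrow> bool" where
  "Ck_in 0 m S f \<longleftrightarrow> continuous_map (subtopology (Euclidean_space m) S) euclidean f"
| "Ck_in (Suc k) m S f \<longleftrightarrow>
     continuous_map (subtopology (Euclidean_space m) S) euclidean f \<and>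
     (\<forall>i<m. (\<forall>x\<in>S. (\<lambda>h. f (x(i := h))) differentiable (at (x i))) \<and> Ck_in k m S (pdiff i f))"

text \<open>The sets \<open>S\<close> below are meant to be open in the coordinate space.\<close>

definition smooth_in :: "nat \<Rightarrow> (nat \<Rightarrow> real) set \<Rightarrow> ((nat \<Rightarrow> real) \<Rightarrow> 'a::real_normed_vector) \<Rightarrow> bool" where
  "smooth_in m S f \<longleftrightarrow> (\<forall>k. Ck_in k m S f)"

definition holomorphic_in :: "nat \<Rightarrow> (nat \<Rightarrow> complex) set \<Rightarrow> ((nat \<Rightarrow> complex) \<Rightarrow> complex) \<Rightarrow> bool" where
  "holomorphic_in n S f \<longleftrightarrow>
     continuous_map (subtopology (Complex_space n) S) euclidean f \<and>
     (\<forall>z\<in>S. \<forall>j<n. (\<lambda>w. f (z(j := w))) field_differentiable (at (z j)))"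

definition real_ball :: "nat \<Rightarrow> real \<Rightarrow> (nat \<Rightarrow> real) set" where
  "real_ball d r = {x \<in> topspace (Euclidean_space d). (\<Sum>i<d. (x i)\<^sup>2) < r\<^sup>2}"

definition polydisc :: "nat \<Rightarrow> (nat \<Rightarrow> complex) \<Rightarrow> (nat \<Rightarrow> real) \<Rightarrow> (nat \<Rightarrow> complex) set" where
  "polydisc n c \<rho> = {z \<in> topspace (Complex_space n). \<forall>j<n. cmod (z j - c j) < \<rho> j}"

definition agree_near :: "'p topology \<Rightarrow> 'p \<Rightarrow> ('p \<Rightarrow> 'a) \<Rightarrow> ('p \<Rightarrow> 'a) \<Rightarrow> bool" where
  "agree_near T p f g \<longleftrightarrow> (\<exists>U. openin T U \<and> p \<in> U \<and> (\<forall>y\<in>U. f y = g y))"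


section \<open>Smooth manifolds and complexified tangent vectors\<close>

type_synonym 'x chart = "'x set \<times> ('x \<Rightarrow> nat \<Rightarrow> real)"

record 'x smooth_mfd =
  mtop :: "'x topology"
  mdim :: nat
  matlas :: "'x chart set"

definition chart_on :: "'x topology \<Rightarrow> nat \<Rightarrow> 'x chart \<Rightarrow> bool" where
  "chart_on X m = (\<lambda>(U, \<phi>).
     openin X U \<and> openin (Euclidean_space m) (\<phi> ` U) \<and>
     homeomorphic_map (subtopology X U) (subtopology (Euclidean_space m) (\<phi> ` U)) \<phi>)"

definition smooth_transition :: "nat \<Rightarrow> 'x chart \<Rightarrow> 'x chart \<Rightarrow> bool" where
  "smooth_transition m = (\<lambda>(U, \<phi>) (U', \<phi>').
     \<forall>i<m. smooth_in m (\<phi> ` (U \<inter> U')) (\<lambda>x. \<phi>' (the_inv_into U \<phi> x) i))"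

text \<open>Membership in the maximal atlas generated by \<^const>\<open>matlas\<close>.\<close>

definition smooth_chart :: "'x smooth_mfd \<Rightarrow> 'x chart \<Rightarrow> bool" where
  "smooth_chart M c \<longleftrightarrow> chart_on (mtop M) (mdim M) c \<and>
     (\<forall>c'\<in>matlas M. smooth_transition (mdim M) c c' \<and> smooth_transition (mdim M) c' c)"

definition smooth_manifold :: "'x smooth_mfd \<Rightarrow> bool" where
  "smooth_manifold M \<longleftrightarrow>
     Hausdorff_space (mtop M) \<and> second_countable (mtop M) \<and>
     (\<forall>c\<in>matlas M. smooth_chart M c) \<and> (\<Union>(U, \<phi>)\<in>matlas M. U) = topspace (mtop M)"

definition smooth_on :: "'x smooth_mfd \<Rightarrow> 'x set \<Rightarrow> ('x \<Rightarrow> complex) \<Rightarrow> bool" where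
  "smooth_on M U f \<longleftrightarrow> openin (mtop M) U \<and>
     (\<forall>(W, \<phi>)\<in>matlas M. smooth_in (mdim M) (\<phi> ` (U \<inter> W)) (\<lambda>x. f (the_inv_into W \<phi> x)))"

definition smooth_at :: "'x smooth_mfd \<Rightarrow> 'x \<Rightarrow> ('x \<Rightarrow> complex) \<Rightarrow> bool" where
  "smooth_at M p f \<longleftrightarrow> (\<exists>U. p \<in> U \<and> smooth_on M U f)"

text \<open>
  A complexified tangent vector at \<open>p\<close> is a complex-linear derivation of the algebra of germs at
  \<open>p\<close> of smooth complex-valued functions.  Derivations are written as functionals on representatives
  and are set to \<open>0\<close> on functions which are not smooth near \<open>p\<close>, so that they are determined by
  their values on germs.
\<close>

type_synonym 'x cvec = "('x \<Rightarrow> complex) \<Rightarrow> complex"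

definition ctangent :: "'x smooth_mfd \<Rightarrow> 'x \<Rightarrow> 'x cvec set" where
  "ctangent M p = {v.
     (\<forall>f g. smooth_at M p f \<longrightarrow> smooth_at M p g \<longrightarrow>
        v (\<lambda>x. f x + g x) = v f + v g \<and> v (\<lambda>x. f x * g x) = v f * g p + f p * v g) \<and>
     (\<forall>c f. smooth_at M p f \<longrightarrow> v (\<lambda>x. c * f x) = c * v f) \<and>
     (\<forall>f g. agree_near (mtop M) p f g \<longrightarrow> v f = v g) \<and>
     (\<forall>f. \<not> smooth_at M p f \<longrightarrow> v f = 0)}"

definition vec_conj :: "'x cvec \<Rightarrow> 'x cvec" where
  "vec_conj v = (\<lambda>f. cnj (v (\<lambda>x. cnj (f x))))"

definition coord_vec :: "'x smooth_mfd \<Rightarrow> 'x chart \<Rightarrow> nat \<Rightarrow> 'x \<Rightarrow> 'x cvec" where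
  "coord_vec M = (\<lambda>(U, \<phi>) i p f.
     if smooth_at M p f then pdiff i (\<lambda>x. f (the_inv_into U \<phi> x)) (\<phi> p) else 0)"

definition smooth_field_on :: "'x smooth_mfd \<Rightarrow> 'x set \<Rightarrow> ('x \<Rightarrow> 'x cvec) \<Rightarrow> bool" where
  "smooth_field_on M U Z \<longleftrightarrow> (\<forall>p\<in>U. Z p \<in> ctangent M p) \<and>
     (\<forall>W f. smooth_on M W f \<longrightarrow> smooth_on M (U \<inter> W) (\<lambda>p. Z p f))"

definition lie_bracket :: "'x smooth_mfd \<Rightarrow> ('x \<Rightarrow> 'x cvec) \<Rightarrow> ('x \<Rightarrow> 'x cvec) \<Rightarrow> 'x \<Rightarrow> 'x cvec" where
  "lie_bracket M Z W p f =
     (if smooth_at M p f then Z p (\<lambda>x. W x f) - W p (\<lambda>x. Z x f) else 0)"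


section \<open>Elliptic involutive structures and their foliations\<close>

definition complex_subbundle :: "'x smooth_mfd \<Rightarrow> nat \<Rightarrow> ('x \<Rightarrow> 'x cvec set) \<Rightarrow> bool" where
  "complex_subbundle M k V \<longleftrightarrow> (\<forall>p\<in>topspace (mtop M). \<exists>U Z.
     openin (mtop M) U \<and> p \<in> U \<and> (\<forall>j<k. smooth_field_on M U (Z j)) \<and>
     (\<forall>x\<in>U. V x = {(\<lambda>f. \<Sum>j<k. a j * Z j x f) | a. True} \<and>
        (\<forall>a. (\<forall>f. (\<Sum>j<k. a j * Z j x f) = 0) \<longrightarrow> (\<forall>j<k. a j = 0))))"

definition global_sections :: "'x smooth_mfd \<Rightarrow> ('x \<Rightarrow> 'x cvec set) \<Rightarrow> ('x \<Rightarrow> 'x cvec) set" where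
  "global_sections M V = {Z. smooth_field_on M (topspace (mtop M)) Z \<and>
     (\<forall>p\<in>topspace (mtop M). Z p \<in> V p)}"

definition elliptic_involutive_structure :: "'x smooth_mfd \<Rightarrow> nat \<Rightarrow> ('x \<Rightarrow> 'x cvec set) \<Rightarrow> bool" where
  "elliptic_involutive_structure M k V \<longleftrightarrow> complex_subbundle M k V \<and>
     (\<forall>Z\<in>global_sections M V. \<forall>W\<in>global_sections M V. lie_bracket M Z W \<in> global_sections M V) \<and>
     (\<forall>p\<in>topspace (mtop M). {(\<lambda>f. v f + vec_conj w f) | v w. v \<in> V p \<and> w \<in> V p} = ctangent M p)"

text \<open>
  The real tangent space sits in the complexified one as the fixed space of conjugation, and
  \<open>D\<^sub>\<real> = TX \<inter> (V \<inter> conj V)\<close>.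
\<close>

definition real_distribution :: "('x \<Rightarrow> 'x cvec set) \<Rightarrow> 'x \<Rightarrow> 'x cvec set" where
  "real_distribution V p = {v \<in> V p \<inter> vec_conj ` V p. vec_conj v = v}"

definition foliated_chart :: "'x smooth_mfd \<Rightarrow> ('x \<Rightarrow> 'x cvec set) \<Rightarrow> nat \<Rightarrow> 'x chart \<Rightarrow> bool" where
  "foliated_chart M D d c \<longleftrightarrow> smooth_chart M c \<and>
     (\<forall>p\<in>fst c. D p = {(\<lambda>f. \<Sum>i<d. of_real (a i) * coord_vec M c i p f) | a. True})"

text \<open>
  The leaf topology on the underlying set of the manifold, generated by the open subsets of
  plaques.  Its path components are the leaves, so paths in it are exactly leafwise paths and
  homotopies in it are leafwise homotopies.
\<close>

definition leaf_topology :: "'x smooth_mfd \<Rightarrow> ('x \<Rightarrow> 'x cvec set) \<Rightarrow> nat \<Rightarrow> 'x topology" where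
  "leaf_topology M D d = topology_generated_by
     {{p \<in> W. \<forall>i\<ge>d. \<phi> p i = b i} | W U \<phi> b.
        foliated_chart M D d (U, \<phi>) \<and> openin (mtop M) W \<and> W \<subseteq> U}"


section \<open>Adapted charts and complete transverse atlases\<close>

record 'x adapted =
  adom :: "'x set"
  tcoord :: "'x \<Rightarrow> nat \<Rightarrow> real"
  zcoord :: "'x \<Rightarrow> nat \<Rightarrow> complex"

text \<open>The real coordinates are ordered \<open>t\<^sub>0, \<dots>, t\<^bsub>d-1\<^esub>, x\<^sub>0, y\<^sub>0, x\<^sub>1, y\<^sub>1, \<dots>\<close> where \<open>z\<^sub>j = x\<^sub>j + \<i> y\<^sub>j\<close>.\<close>

definition real_coords :: "nat \<Rightarrow> nat \<Rightarrow> 'x adapted \<Rightarrow> 'x \<Rightarrow> nat \<Rightarrow> real" where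
  "real_coords d n c p i =
     (if i < d then tcoord c p i
      else if i < d + 2 * n then
        (if even (i - d) then Re (zcoord c p ((i - d) div 2)) else Im (zcoord c p ((i - d) div 2)))
      else 0)"

definition real_chart :: "nat \<Rightarrow> nat \<Rightarrow> 'x adapted \<Rightarrow> 'x chart" where
  "real_chart d n c = (adom c, real_coords d n c)"

definition dbar_vec :: "'x smooth_mfd \<Rightarrow> nat \<Rightarrow> nat \<Rightarrow> 'x adapted \<Rightarrow> nat \<Rightarrow> 'x \<Rightarrow> 'x cvec" where
  "dbar_vec M d n c j p f =
     (coord_vec M (real_chart d n c) (d + 2 * j) p f
      + \<i> * coord_vec M (real_chart d n c) (d + 2 * j + 1) p f) / 2"

definition adapted_chart ::
    "'x smooth_mfd \<Rightarrow> nat \<Rightarrow> nat \<Rightarrow> ('x \<Rightarrow> 'x cvec set) \<Rightarrow> 'x adapted \<Rightarrow> bool" where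
  "adapted_chart M d n V c \<longleftrightarrow> smooth_chart M (real_chart d n c) \<and>
     (\<exists>r w \<rho>. r > 0 \<and> (\<forall>j<n. \<rho> j > 0) \<and>
        (\<lambda>p. (tcoord c p, zcoord c p)) ` adom c = real_ball d r \<times> polydisc n w \<rho>) \<and>
     (\<forall>p\<in>adom c. V p = {(\<lambda>f. (\<Sum>i<d. a i * coord_vec M (real_chart d n c) i p f)
                              + (\<Sum>j<n. b j * dbar_vec M d n c j p f)) | a b. True})"

definition transversal :: "'x adapted \<Rightarrow> 'x set" where
  "transversal c = {p \<in> adom c. tcoord c p = (\<lambda>_. 0)}"

definition complete_transverse_atlas ::
    "'x smooth_mfd \<Rightarrow> nat \<Rightarrow> nat \<Rightarrow> ('x \<Rightarrow> 'x cvec set) \<Rightarrow> 'i set \<Rightarrow> ('i \<Rightarrow> 'x adapted) \<Rightarrow> bool" where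
  "complete_transverse_atlas M d n V I c \<longleftrightarrow> countable I \<and>
     (\<forall>i\<in>I. adapted_chart M d n V (c i)) \<and> (\<Union>i\<in>I. adom (c i)) = topspace (mtop M) \<and>
     (\<forall>p\<in>topspace (mtop M). \<exists>W. openin (mtop M) W \<and> p \<in> W \<and> finite {i\<in>I. adom (c i) \<inter> W \<noteq> {}})"


section \<open>Complex manifolds and germs of holomorphic functions\<close>

record 'p complex_mfd =
  ctop :: "'p topology"
  cdim :: nat
  catlas :: "('p set \<times> ('p \<Rightarrow> nat \<Rightarrow> complex)) set"

definition holo_on :: "'p complex_mfd \<Rightarrow> 'p set \<Rightarrow> ('p \<Rightarrow> complex) \<Rightarrow> bool" where
  "holo_on C U f \<longleftrightarrow> openin (ctop C) U \<and>
     (\<forall>(W, \<psi>)\<in>catlas C. holomorphic_in (cdim C) (\<psi> ` (U \<inter> W)) (\<lambda>z. f (the_inv_into W \<psi> z)))"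

type_synonym 'p germ = "('p \<Rightarrow> complex) set"

definition germ :: "'p complex_mfd \<Rightarrow> 'p \<Rightarrow> ('p \<Rightarrow> complex) \<Rightarrow> 'p germ" where
  "germ C x f = {g. agree_near (ctop C) x f g}"

definition O_stalk :: "'p complex_mfd \<Rightarrow> 'p \<Rightarrow> 'p germ ring" where
  "O_stalk C x =
     \<lparr>carrier = {germ C x f | f U. x \<in> U \<and> holo_on C U f},
      mult = (\<lambda>a b. \<Union>f\<in>a. \<Union>g\<in>b. germ C x (\<lambda>y. f y * g y)),
      one = germ C x (\<lambda>_. 1),
      zero = germ C x (\<lambda>_. 0),
      add = (\<lambda>a b. \<Union>f\<in>a. \<Union>g\<in>b. germ C x (\<lambda>y. f y + g y))\<rparr>"

definition comp_germ :: "'q complex_mfd \<Rightarrow> ('q \<Rightarrow> 'p) \<Rightarrow> 'q \<Rightarrow> 'p germ \<Rightarrow> 'q germ" where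
  "comp_germ C' \<Phi> y a = (\<Union>f\<in>a. germ C' y (\<lambda>u. f (\<Phi> u)))"


section \<open>Coherent analytic sheaves\<close>

text \<open>Sheaves of \<open>\<O>\<close>-modules are given by their etale spaces.\<close>

record ('p, 'e) omod =
  etop :: "'e topology"
  proj :: "'e \<Rightarrow> 'p"
  stalk :: "'p \<Rightarrow> ('p germ, 'e) module"

definition O_module :: "'p complex_mfd \<Rightarrow> ('p, 'e) omod \<Rightarrow> bool" where
  "O_module C F \<longleftrightarrow>
     continuous_map (etop F) (ctop C) (proj F) \<and>
     (\<forall>e\<in>topspace (etop F). \<exists>N. openin (etop F) N \<and> e \<in> N \<and> openin (ctop C) (proj F ` N) \<and>
        homeomorphic_map (subtopology (etop F) N) (subtopology (ctop C) (proj F ` N)) (proj F)) \<and>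
     (\<forall>x\<in>topspace (ctop C).
        carrier (stalk F x) = {e \<in> topspace (etop F). proj F e = x} \<and>
        Module.module (O_stalk C x) (stalk F x)) \<and>
     continuous_map (subtopology (prod_topology (etop F) (etop F)) {(e, e'). proj F e = proj F e'})
       (etop F) (\<lambda>(e, e'). e \<oplus>\<^bsub>stalk F (proj F e)\<^esub> e') \<and>
     (\<forall>U f. holo_on C U f \<longrightarrow>
        continuous_map (subtopology (etop F) {e. proj F e \<in> U}) (etop F)
          (\<lambda>e. germ C (proj F e) f \<odot>\<^bsub>stalk F (proj F e)\<^esub> e))"

definition section_on :: "'p complex_mfd \<Rightarrow> ('p, 'e) omod \<Rightarrow> 'p set \<Rightarrow> ('p \<Rightarrow> 'e) \<Rightarrow> bool" where
  "section_on C F U s \<longleftrightarrow> openin (ctop C) U \<and>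
     continuous_map (subtopology (ctop C) U) (etop F) s \<and> (\<forall>x\<in>U. proj F (s x) = x)"

definition finite_type :: "'p complex_mfd \<Rightarrow> ('p, 'e) omod \<Rightarrow> bool" where
  "finite_type C F \<longleftrightarrow> (\<forall>x\<in>topspace (ctop C). \<exists>U k s.
     x \<in> U \<and> (\<forall>l<k. section_on C F U (s l)) \<and> openin (ctop C) U \<and>
     (\<forall>y\<in>U. \<forall>e\<in>carrier (stalk F y). \<exists>a\<in>{..<k} \<rightarrow> carrier (O_stalk C y).
        e = (\<Oplus>\<^bsub>stalk F y\<^esub>l\<in>{..<k::nat}. a l \<odot>\<^bsub>stalk F y\<^esub> s l y)))"

text \<open>
  The relation sheaf of \<open>s\<^sub>0, \<dots>, s\<^bsub>k-1\<^esub> \<in> F(U)\<close>, that is, the kernel of the induced morphism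
  \<open>\<O>\<^sup>k \<rightarrow> F\<close> over \<open>U\<close>, is of finite type: near each point it is generated by finitely many tuples
  \<open>R j = (R j 0, \<dots>, R j (k-1))\<close> of holomorphic functions.
\<close>

definition relations_finite_type ::
    "'p complex_mfd \<Rightarrow> ('p, 'e) omod \<Rightarrow> 'p set \<Rightarrow> nat \<Rightarrow> (nat \<Rightarrow> 'p \<Rightarrow> 'e) \<Rightarrow> bool" where
  "relations_finite_type C F U k s \<longleftrightarrow> (\<forall>x\<in>U. \<exists>W r R.
     openin (ctop C) W \<and> x \<in> W \<and> W \<subseteq> U \<and>
     (\<forall>j<r. \<forall>l<k. holo_on C W (R j l)) \<and>
     (\<forall>y\<in>W. \<forall>j<r.
        (\<Oplus>\<^bsub>stalk F y\<^esub>l\<in>{..<k}. germ C y (R j l) \<odot>\<^bsub>stalk F y\<^esub> s l y) = \<zero>\<^bsub>stalk F y\<^esub>) \<and>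
     (\<forall>y\<in>W. \<forall>a\<in>{..<k} \<rightarrow> carrier (O_stalk C y).
        (\<Oplus>\<^bsub>stalk F y\<^esub>l\<in>{..<k}. a l \<odot>\<^bsub>stalk F y\<^esub> s l y) = \<zero>\<^bsub>stalk F y\<^esub> \<longrightarrow>
        (\<exists>b\<in>{..<r::nat} \<rightarrow> carrier (O_stalk C y). \<forall>l<k.
           a l = (\<Oplus>\<^bsub>O_stalk C y\<^esub>j\<in>{..<r}. b j \<otimes>\<^bsub>O_stalk C y\<^esub> germ C y (R j l)))))"

definition coherent_sheaf :: "'p complex_mfd \<Rightarrow> ('p, 'e) omod \<Rightarrow> bool" where
  "coherent_sheaf C F \<longleftrightarrow> O_module C F \<and> finite_type C F \<and>
     (\<forall>U k s. openin (ctop C) U \<and> (\<forall>l<k. section_on C F U (s l)) \<longrightarrow>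
        relations_finite_type C F U k s)"

definition omod_hom ::
    "'p complex_mfd \<Rightarrow> ('p, 'e) omod \<Rightarrow> ('p, 'f) omod \<Rightarrow> ('e \<Rightarrow> 'f) set" where
  "omod_hom C F F' = {\<phi> \<in> extensional (topspace (etop F)).
     continuous_map (etop F) (etop F') \<phi> \<and>
     (\<forall>e\<in>topspace (etop F). proj F' (\<phi> e) = proj F e) \<and>
     (\<forall>x\<in>topspace (ctop C).
        (\<forall>e\<in>carrier (stalk F x). \<forall>e'\<in>carrier (stalk F x).
           \<phi> (e \<oplus>\<^bsub>stalk F x\<^esub> e') = \<phi> e \<oplus>\<^bsub>stalk F' x\<^esub> \<phi> e') \<and>
        (\<forall>a\<in>carrier (O_stalk C x). \<forall>e\<in>carrier (stalk F x).
           \<phi> (a \<odot>\<^bsub>stalk F x\<^esub> e) = a \<odot>\<^bsub>stalk F' x\<^esub> \<phi> e))}"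

definition omod_iso ::
    "'p complex_mfd \<Rightarrow> ('p, 'e) omod \<Rightarrow> ('p, 'f) omod \<Rightarrow> ('e \<Rightarrow> 'f) set" where
  "omod_iso C F F' = {\<phi> \<in> omod_hom C F F'. \<exists>\<psi>\<in>omod_hom C F' F.
     (\<forall>e\<in>topspace (etop F). \<psi> (\<phi> e) = e) \<and> (\<forall>e\<in>topspace (etop F'). \<phi> (\<psi> e) = e)}"

text \<open>
  Pullback along a local biholomorphism \<open>\<Phi> : N \<rightarrow> C\<close>.  Since composition with \<open>\<Phi>\<close> is an isomorphism
  \<open>\<O>\<^bsub>C,\<Phi>(y)\<^esub> \<rightarrow> \<O>\<^bsub>N,y\<^esub>\<close> at every point, the base change \<open>\<Phi>\<^sup>-\<^sup>1F \<otimes> \<O>\<^sub>N\<close> over \<open>\<Phi>\<^sup>-\<^sup>1\<O>\<^sub>C\<close> is \<open>\<Phi>\<^sup>-\<^sup>1F\<close> itself,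
  on which \<open>\<O>\<^bsub>N,y\<^esub>\<close> acts through the inverse of that isomorphism.  In particular the stalk at
  \<open>y\<close> is identified with the stalk of \<open>F\<close> at \<open>\<Phi>(y)\<close>.
\<close>

definition pullback ::
    "'q complex_mfd \<Rightarrow> 'p complex_mfd \<Rightarrow> ('q \<Rightarrow> 'p) \<Rightarrow> ('p, 'e) omod \<Rightarrow> ('q, 'q \<times> 'e) omod" where
  "pullback N C \<Phi> F =
     \<lparr>etop = subtopology (prod_topology (ctop N) (etop F)) {(y, e). \<Phi> y = proj F e},
      proj = fst,
      stalk = (\<lambda>y. let S = stalk F (\<Phi> y) in
        \<lparr>carrier = {y} \<times> carrier S,
         mult = (\<lambda>u v. (y, snd u \<otimes>\<^bsub>S\<^esub> snd v)),
         one = (y, \<one>\<^bsub>S\<^esub>),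
         zero = (y, \<zero>\<^bsub>S\<^esub>),
         add = (\<lambda>u v. (y, snd u \<oplus>\<^bsub>S\<^esub> snd v)),
         smult = (\<lambda>a u. (y, inv_into (carrier (O_stalk C (\<Phi> y))) (comp_germ N \<Phi> y) a \<odot>\<^bsub>S\<^esub> snd u))\<rparr>)\<rparr>"


section \<open>Categories, functors and equivalences\<close>

text \<open>
  The domain and codomain are passed to composition and to the action of a functor on morphisms,
  because morphisms are bare functions.
\<close>

record ('o, 'm) category =
  cobj :: "'o set"
  chom :: "'o \<Rightarrow> 'o \<Rightarrow> 'm set"
  cid :: "'o \<Rightarrow> 'm"
  ccomp :: "'o \<Rightarrow> 'o \<Rightarrow> 'o \<Rightarrow> 'm \<Rightarrow> 'm \<Rightarrow> 'm"

definition is_category :: "('o, 'm) category \<Rightarrow> bool" where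
  "is_category C \<longleftrightarrow>
     (\<forall>a\<in>cobj C. cid C a \<in> chom C a a) \<and>
     (\<forall>a\<in>cobj C. \<forall>b\<in>cobj C. \<forall>c\<in>cobj C. \<forall>f\<in>chom C a b. \<forall>g\<in>chom C b c.
        ccomp C a b c g f \<in> chom C a c) \<and>
     (\<forall>a\<in>cobj C. \<forall>b\<in>cobj C. \<forall>f\<in>chom C a b.
        ccomp C a b b (cid C b) f = f \<and> ccomp C a a b f (cid C a) = f) \<and>
     (\<forall>a\<in>cobj C. \<forall>b\<in>cobj C. \<forall>c\<in>cobj C. \<forall>d\<in>cobj C.
        \<forall>f\<in>chom C a b. \<forall>g\<in>chom C b c. \<forall>h\<in>chom C c d.
        ccomp C a c d h (ccomp C a b c g f) = ccomp C a b d (ccomp C b c d h g) f)"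

definition full_subcategory :: "('o, 'm) category \<Rightarrow> ('o \<Rightarrow> bool) \<Rightarrow> ('o, 'm) category" where
  "full_subcategory C P = C\<lparr>cobj := {a \<in> cobj C. P a}\<rparr>"

record ('o, 'm, 'o2, 'm2) functr =
  fobj :: "'o \<Rightarrow> 'o2"
  fmor :: "'o \<Rightarrow> 'o \<Rightarrow> 'm \<Rightarrow> 'm2"

definition is_functor ::
    "('o, 'm) category \<Rightarrow> ('o2, 'm2) category \<Rightarrow> ('o, 'm, 'o2, 'm2) functr \<Rightarrow> bool" where
  "is_functor C D F \<longleftrightarrow> is_category C \<and> is_category D \<and>
     (\<forall>a\<in>cobj C. fobj F a \<in> cobj D \<and> fmor F a a (cid C a) = cid D (fobj F a)) \<and>
     (\<forall>a\<in>cobj C. \<forall>b\<in>cobj C. \<forall>f\<in>chom C a b. fmor F a b f \<in> chom D (fobj F a) (fobj F b)) \<and>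
     (\<forall>a\<in>cobj C. \<forall>b\<in>cobj C. \<forall>c\<in>cobj C. \<forall>f\<in>chom C a b. \<forall>g\<in>chom C b c.
        fmor F a c (ccomp C a b c g f) =
        ccomp D (fobj F a) (fobj F b) (fobj F c) (fmor F b c g) (fmor F a b f))"

definition fully_faithful ::
    "('o, 'm) category \<Rightarrow> ('o2, 'm2) category \<Rightarrow> ('o, 'm, 'o2, 'm2) functr \<Rightarrow> bool" where
  "fully_faithful C D F \<longleftrightarrow> is_functor C D F \<and>
     (\<forall>a\<in>cobj C. \<forall>b\<in>cobj C.
        bij_betw (fmor F a b) (chom C a b) (chom D (fobj F a) (fobj F b)))"

definition id_functor :: "('o, 'm, 'o, 'm) functr" where
  "id_functor = \<lparr>fobj = (\<lambda>a. a), fmor = (\<lambda>a b f. f)\<rparr>"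

definition comp_functor ::
    "('o2, 'm2, 'o3, 'm3) functr \<Rightarrow> ('o, 'm, 'o2, 'm2) functr \<Rightarrow> ('o, 'm, 'o3, 'm3) functr" where
  "comp_functor G F = \<lparr>fobj = (\<lambda>a. fobj G (fobj F a)),
     fmor = (\<lambda>a b f. fmor G (fobj F a) (fobj F b) (fmor F a b f))\<rparr>"

definition cat_iso :: "('o, 'm) category \<Rightarrow> 'o \<Rightarrow> 'o \<Rightarrow> 'm set" where
  "cat_iso C a b = {f \<in> chom C a b. \<exists>g\<in>chom C b a.
     ccomp C a b a g f = cid C a \<and> ccomp C b a b f g = cid C b}"

definition natural_iso ::
    "('o, 'm) category \<Rightarrow> ('o2, 'm2) category \<Rightarrow> ('o, 'm, 'o2, 'm2) functr \<Rightarrow>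
     ('o, 'm, 'o2, 'm2) functr \<Rightarrow> ('o \<Rightarrow> 'm2) \<Rightarrow> bool" where
  "natural_iso C D F G \<eta> \<longleftrightarrow>
     (\<forall>a\<in>cobj C. \<eta> a \<in> cat_iso D (fobj F a) (fobj G a)) \<and>
     (\<forall>a\<in>cobj C. \<forall>b\<in>cobj C. \<forall>f\<in>chom C a b.
        ccomp D (fobj F a) (fobj F b) (fobj G b) (\<eta> b) (fmor F a b f) =
        ccomp D (fobj F a) (fobj G a) (fobj G b) (fmor G a b f) (\<eta> a))"

definition equivalence_functor ::
    "('o, 'm) category \<Rightarrow> ('o2, 'm2) category \<Rightarrow> ('o, 'm, 'o2, 'm2) functr \<Rightarrow> bool" where
  "equivalence_functor C D F \<longleftrightarrow> is_functor C D F \<and>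
     (\<exists>G \<eta> \<epsilon>. is_functor D C G \<and>
        natural_iso C C id_functor (comp_functor G F) \<eta> \<and>
        natural_iso D D (comp_functor F G) id_functor \<epsilon>)"


section \<open>Equivariant coherent sheaves on complex etale groupoids\<close>

record ('o, 'g) cgroupoid =
  gobj :: "'o complex_mfd"
  garr :: "'g complex_mfd"
  gsrc :: "'g \<Rightarrow> 'o"
  gtgt :: "'g \<Rightarrow> 'o"
  gunit :: "'o \<Rightarrow> 'g"
  gmult :: "'g \<Rightarrow> 'g \<Rightarrow> 'g"
  ginv :: "'g \<Rightarrow> 'g"

abbreviation arrows :: "('o, 'g) cgroupoid \<Rightarrow> 'g set" where
  "arrows G \<equiv> topspace (ctop (garr G))"

abbreviation src_pullback :: "('o, 'g) cgroupoid \<Rightarrow> ('o, 'e) omod \<Rightarrow> ('g, 'g \<times> 'e) omod" where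
  "src_pullback G F \<equiv> pullback (garr G) (gobj G) (gsrc G) F"

abbreviation tgt_pullback :: "('o, 'g) cgroupoid \<Rightarrow> ('o, 'e) omod \<Rightarrow> ('g, 'g \<times> 'e) omod" where
  "tgt_pullback G F \<equiv> pullback (garr G) (gobj G) (gtgt G) F"

type_synonym ('o, 'g, 'e) eq_sheaf = "('o, 'e) omod \<times> ('g \<times> 'e \<Rightarrow> 'g \<times> 'e)"

text \<open>The map \<open>\<alpha>\<^sub>g\<close> from the stalk at \<open>s(g)\<close> to the stalk at \<open>t(g)\<close>.\<close>

definition act :: "('g \<times> 'e \<Rightarrow> 'g \<times> 'e) \<Rightarrow> 'g \<Rightarrow> 'e \<Rightarrow> 'e" where
  "act \<alpha> g e = snd (\<alpha> (g, e))"

definition equivariant_coherent :: "('o, 'g) cgroupoid \<Rightarrow> ('o, 'g, 'e) eq_sheaf \<Rightarrow> bool" where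
  "equivariant_coherent G = (\<lambda>(F, \<alpha>). coherent_sheaf (gobj G) F \<and>
     \<alpha> \<in> omod_iso (garr G) (src_pullback G F) (tgt_pullback G F) \<and>
     (\<forall>x\<in>topspace (ctop (gobj G)). \<forall>e\<in>carrier (stalk F x). act \<alpha> (gunit G x) e = e) \<and>
     (\<forall>g\<in>arrows G. \<forall>h\<in>arrows G. gsrc G g = gtgt G h \<longrightarrow>
        (\<forall>e\<in>carrier (stalk F (gsrc G h)). act \<alpha> (gmult G g h) e = act \<alpha> g (act \<alpha> h e))))"

definition equivariant_hom ::
    "('o, 'g) cgroupoid \<Rightarrow> ('o, 'g, 'e) eq_sheaf \<Rightarrow> ('o, 'g, 'e) eq_sheaf \<Rightarrow> ('e \<Rightarrow> 'e) set" where
  "equivariant_hom G = (\<lambda>(F, \<alpha>) (F', \<alpha>'). {\<phi> \<in> omod_hom (gobj G) F F'.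
     \<forall>g\<in>arrows G. \<forall>e\<in>carrier (stalk F (gsrc G g)). \<phi> (act \<alpha> g e) = act \<alpha>' g (\<phi> e)})"

text \<open>The type \<open>'e\<close> is the universe in which the etale spaces of the sheaves live.\<close>

definition Coh_an :: "('o, 'g) cgroupoid \<Rightarrow> (('o, 'g, 'e) eq_sheaf, 'e \<Rightarrow> 'e) category" where
  "Coh_an G =
     \<lparr>cobj = {A. equivariant_coherent G A},
      chom = equivariant_hom G,
      cid = (\<lambda>A. restrict (\<lambda>e. e) (topspace (etop (fst A)))),
      ccomp = (\<lambda>A B C g f. compose (topspace (etop (fst A))) g f)\<rparr>"

definition pullback_functor ::
    "('o, 'g) cgroupoid \<Rightarrow> ('g \<Rightarrow> 'h) \<Rightarrow>
     (('o, 'h, 'e) eq_sheaf, 'e \<Rightarrow> 'e, ('o, 'g, 'e) eq_sheaf, 'e \<Rightarrow> 'e) functr" where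
  "pullback_functor G q =
     \<lparr>fobj = (\<lambda>(F, \<beta>). (F, restrict (\<lambda>(g, e). (g, act \<beta> (q g) e)) (topspace (etop (src_pullback G F))))),
      fmor = (\<lambda>A B \<phi>. \<phi>)\<rparr>"

definition kernel_subgroupoid :: "('o, 'g) cgroupoid \<Rightarrow> ('o, 'h) cgroupoid \<Rightarrow> ('g \<Rightarrow> 'h) \<Rightarrow> 'g set" where
  "kernel_subgroupoid G H q = {k \<in> arrows G. gsrc G k = gtgt G k \<and> q k = gunit H (gsrc G k)}"

definition acts_as_identity ::
    "('o, 'g) cgroupoid \<Rightarrow> 'g set \<Rightarrow> ('o, 'g, 'e) eq_sheaf \<Rightarrow> bool" where
  "acts_as_identity G K = (\<lambda>(F, \<alpha>).
     \<forall>k\<in>K. \<forall>e\<in>carrier (stalk F (gsrc G k)). act \<alpha> k e = e)"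


section \<open>Monodromy and holonomy groupoids over a transverse atlas\<close>

abbreviation unit_interval :: "real topology" where
  "unit_interval \<equiv> top_of_set {0..1}"

text \<open>
  A continuous family of leafwise paths from the transversal \<open>S\<close> to the transversal \<open>S'\<close>,
  parametrised by their starting points in an open subset \<open>W\<close> of \<open>S\<close>; here \<open>L\<close> is the leaf
  topology on \<open>X\<close>.
\<close>

definition leafwise_family ::
    "'x topology \<Rightarrow> 'x topology \<Rightarrow> 'x set \<Rightarrow> 'x set \<Rightarrow> 'x set \<Rightarrow> ('x \<Rightarrow> real \<Rightarrow> 'x) \<Rightarrow> bool" where
  "leafwise_family X L S S' W H \<longleftrightarrow> openin (subtopology X S) W \<and>
     continuous_map (prod_topology (subtopology X W) unit_interval) X (\<lambda>(w, r). H w r) \<and>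
     (\<forall>w\<in>W. pathin L (H w) \<and> H w 0 = w \<and> H w 1 \<in> S')"

text \<open>
  The holonomy germ of a leafwise path \<open>\<gamma>\<close> from \<open>S\<close> to \<open>S'\<close>: deform \<open>\<gamma>\<close> to leafwise paths starting
  at nearby points of \<open>S\<close> and ending in \<open>S'\<close>, and send initial points to end points.  The set
  below consists of all functions which represent this germ at \<open>\<gamma> 0\<close>.
\<close>

definition hol_germ ::
    "'x topology \<Rightarrow> 'x topology \<Rightarrow> 'x set \<Rightarrow> 'x set \<Rightarrow> (real \<Rightarrow> 'x) \<Rightarrow> ('x \<Rightarrow> 'x) set" where
  "hol_germ X L S S' \<gamma> = {h. \<exists>W H. leafwise_family X L S S' W H \<and> \<gamma> 0 \<in> W \<and>
     (\<forall>r\<in>{0..1}. H (\<gamma> 0) r = \<gamma> r) \<and> (\<forall>w\<in>W. h w = H w 1)}"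

definition hol_class ::
    "'x topology \<Rightarrow> 'x topology \<Rightarrow> 'x set \<Rightarrow> 'x set \<Rightarrow> (real \<Rightarrow> 'x) \<Rightarrow> (real \<Rightarrow> 'x) set" where
  "hol_class X L S S' \<gamma> = {\<delta>. pathin L \<delta> \<and> \<delta> 0 = \<gamma> 0 \<and> \<delta> 1 = \<gamma> 1 \<and>
     hol_germ X L S S' \<delta> = hol_germ X L S S' \<gamma>}"

definition mon_class :: "'x topology \<Rightarrow> (real \<Rightarrow> 'x) \<Rightarrow> (real \<Rightarrow> 'x) set" where
  "mon_class L \<gamma> =
     {\<delta>. homotopic_with (\<lambda>\<eta>. \<eta> 0 = \<gamma> 0 \<and> \<eta> 1 = \<gamma> 1) unit_interval L \<gamma> \<delta>}"

definition path_join :: "(real \<Rightarrow> 'x) \<Rightarrow> (real \<Rightarrow> 'x) \<Rightarrow> real \<Rightarrow> 'x" where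
  "path_join \<gamma> \<delta> = (\<lambda>r. if r \<le> 1/2 then \<gamma> (2 * r) else \<delta> (2 * r - 1))"

text \<open>
  The disjoint union of the transversals; its points are pairs of an index and a point of the
  corresponding transversal.
\<close>

definition transverse_mfd :: "'x topology \<Rightarrow> nat \<Rightarrow> 'i set \<Rightarrow> ('i \<Rightarrow> 'x adapted) \<Rightarrow> ('i \<times> 'x) complex_mfd" where
  "transverse_mfd X n I c =
     \<lparr>ctop = sum_topology (\<lambda>i. subtopology X (transversal (c i))) I,
      cdim = n,
      catlas = {({i} \<times> transversal (c i), \<lambda>p. zcoord (c i) (snd p)) | i. i \<in> I}\<rparr>"

text \<open>
  Groupoid of leafwise paths between points of the transverse atlas modulo an equivalence
  relation, given by the function \<open>cls i j\<close> which sends a path from the \<open>i\<close>-th to the \<open>j\<close>-th transversal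
  to its class.  An arrow is a triple of source, class and target.  The arrow space
  has as basic open sets the images of continuous families of leafwise paths, and the
  complex structure for which the source map is a local biholomorphism.
\<close>

type_synonym ('i, 'x) parrow = "('i \<times> 'x) \<times> (real \<Rightarrow> 'x) set \<times> ('i \<times> 'x)"

definition path_arrows ::
    "'x topology \<Rightarrow> 'i set \<Rightarrow> ('i \<Rightarrow> 'x adapted) \<Rightarrow>
     ('i \<Rightarrow> 'i \<Rightarrow> (real \<Rightarrow> 'x) \<Rightarrow> (real \<Rightarrow> 'x) set) \<Rightarrow> ('i, 'x) parrow set" where
  "path_arrows L I c cls = {((i, \<gamma> 0), cls i j \<gamma>, (j, \<gamma> 1)) | i j \<gamma>.
     i \<in> I \<and> j \<in> I \<and> pathin L \<gamma> \<and> \<gamma> 0 \<in> transversal (c i) \<and> \<gamma> 1 \<in> transversal (c j)}"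

definition family_arrows ::
    "('i \<Rightarrow> 'i \<Rightarrow> (real \<Rightarrow> 'x) \<Rightarrow> (real \<Rightarrow> 'x) set) \<Rightarrow> 'i \<Rightarrow> 'i \<Rightarrow> 'x set \<Rightarrow> ('x \<Rightarrow> real \<Rightarrow> 'x) \<Rightarrow>
     ('i, 'x) parrow set" where
  "family_arrows cls i j W H = {((i, w), cls i j (H w), (j, H w 1)) | w. w \<in> W}"

definition arrow_mfd ::
    "'x topology \<Rightarrow> 'x topology \<Rightarrow> nat \<Rightarrow> 'i set \<Rightarrow> ('i \<Rightarrow> 'x adapted) \<Rightarrow>
     ('i \<Rightarrow> 'i \<Rightarrow> (real \<Rightarrow> 'x) \<Rightarrow> (real \<Rightarrow> 'x) set) \<Rightarrow> ('i, 'x) parrow complex_mfd" where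
  "arrow_mfd X L n I c cls =
     \<lparr>ctop = topology_generated_by (insert (path_arrows L I c cls)
        {family_arrows cls i j W H | i j W H. i \<in> I \<and> j \<in> I \<and>
           leafwise_family X L (transversal (c i)) (transversal (c j)) W H}),
      cdim = n,
      catlas = {(family_arrows cls i j W H, \<lambda>g. zcoord (c i) (snd (fst g))) | i j W H. i \<in> I \<and> j \<in> I \<and>
           leafwise_family X L (transversal (c i)) (transversal (c j)) W H}\<rparr>"

definition path_groupoid ::
    "'x topology \<Rightarrow> 'x topology \<Rightarrow> nat \<Rightarrow> 'i set \<Rightarrow> ('i \<Rightarrow> 'x adapted) \<Rightarrow>
     ('i \<Rightarrow> 'i \<Rightarrow> (real \<Rightarrow> 'x) \<Rightarrow> (real \<Rightarrow> 'x) set) \<Rightarrow> ('i \<times> 'x, ('i, 'x) parrow) cgroupoid" where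
  "path_groupoid X L n I c cls =
     \<lparr>gobj = transverse_mfd X n I c,
      garr = arrow_mfd X L n I c cls,
      gsrc = (\<lambda>(a, \<Gamma>, b). a),
      gtgt = (\<lambda>(a, \<Gamma>, b). b),
      gunit = (\<lambda>a. (a, cls (fst a) (fst a) (\<lambda>_. snd a), a)),
      gmult = (\<lambda>(b', \<Delta>, e) (a, \<Gamma>, b). (a, \<Union>\<gamma>\<in>\<Gamma>. \<Union>\<delta>\<in>\<Delta>. cls (fst a) (fst e) (path_join \<gamma> \<delta>), e)),
      ginv = (\<lambda>(a, \<Gamma>, b). (b, \<Union>\<gamma>\<in>\<Gamma>. cls (fst b) (fst a) (\<lambda>r. \<gamma> (1 - r)), a))\<rparr>"

definition Mon :: "'x smooth_mfd \<Rightarrow> ('x \<Rightarrow> 'x cvec set) \<Rightarrow> nat \<Rightarrow> nat \<Rightarrow> 'i set \<Rightarrow> ('i \<Rightarrow> 'x adapted) \<Rightarrow>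
    ('i \<times> 'x, ('i, 'x) parrow) cgroupoid" where
  "Mon M D d n I c = path_groupoid (mtop M) (leaf_topology M D d) n I c
     (\<lambda>i j. mon_class (leaf_topology M D d))"

definition Hol :: "'x smooth_mfd \<Rightarrow> ('x \<Rightarrow> 'x cvec set) \<Rightarrow> nat \<Rightarrow> nat \<Rightarrow> 'i set \<Rightarrow> ('i \<Rightarrow> 'x adapted) \<Rightarrow>
    ('i \<times> 'x, ('i, 'x) parrow) cgroupoid" where
  "Hol M D d n I c = path_groupoid (mtop M) (leaf_topology M D d) n I c
     (\<lambda>i j. hol_class (mtop M) (leaf_topology M D d) (transversal (c i)) (transversal (c j)))"

definition mon_to_hol :: "'x smooth_mfd \<Rightarrow> ('x \<Rightarrow> 'x cvec set) \<Rightarrow> nat \<Rightarrow> ('i \<Rightarrow> 'x adapted) \<Rightarrow>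
    ('i, 'x) parrow \<Rightarrow> ('i, 'x) parrow" where
  "mon_to_hol M D d c = (\<lambda>(a, \<Gamma>, b). (a,
     \<Union>\<gamma>\<in>\<Gamma>. hol_class (mtop M) (leaf_topology M D d) (transversal (c (fst a))) (transversal (c (fst b))) \<gamma>,
     b))"

end

theory Submission
  imports Defs "HOL-Complex_Analysis.Cauchy_Integral_Formula"
begin

text \<open>
  The groupoids \<open>G\<^sub>m\<^sub>o\<^sub>n\<close> and \<open>G\<^sub>h\<^sub>o\<^sub>l\<close> have the same objects, and \<open>q\<close> is compatible with sources and
  targets. Both directions of the equivalence therefore keep the underlying sheaf, and the question is
  which actions \<open>\<alpha>\<close> of \<open>G\<^sub>m\<^sub>o\<^sub>n\<close> on a coherent sheaf have the form \<open>\<alpha>\<^sub>g = \<beta>\<^bsub>q(g)\<^esub>\<close>. Three properties of \<open>q\<close> answer it.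

  First, \<open>q\<close> is a surjective local biholomorphism of arrow spaces. The pullback of \<open>\<beta>\<close> is then
  again a morphism of sheaves of modules, and a morphism upstairs which is constant along the fibres
  of \<open>q\<close> descends to a continuous and linear one (\<open>pull_hom\<close>, \<open>descend_hom\<close>).

  Second, two arrows \<open>g\<close>, \<open>g'\<close> with \<open>q(g) = q(g')\<close> satisfy \<open>g = g' k\<close> for some \<open>k\<close> in the kernel: if
  they are represented by paths \<open>\<gamma>\<close> and \<open>\<gamma>'\<close>, then \<open>k\<close> is the loop which follows \<open>\<gamma>\<close> and returns along
  \<open>\<gamma>'\<close> (\<open>quotient_fibre\<close>). So \<open>\<alpha>\<close> is constant along the fibres of \<open>q\<close> if the kernel acts trivially,
  and an action pulled back from \<open>G\<^sub>h\<^sub>o\<^sub>l\<close> is trivial on the kernel because \<open>\<beta>\<close> is trivial on units.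

  Third, \<open>q\<close> is onto, so a morphism of sheaves is equivariant for \<open>\<beta>\<close> exactly if it is equivariant for
  \<open>q\<^sup>*\<beta>\<close>; this gives full faithfulness. Pullback and descent are strictly inverse to each other on
  objects. The locale \<open>groupoid_quotient\<close> collects these properties and derives the equivalence
  from them (\<open>pullback_equivalence\<close>).

  The remaining work is to establish the properties from the definition of the arrow spaces, whose
  topology and complex structure are given by families of leafwise paths over open subsets of a transversal.
  Every leafwise path extends to such a family, and two families whose paths at one point are
  leafwise homotopic have leafwise homotopic paths at all nearby points
  (\<open>leafwise_family_exists\<close>, \<open>leafwise_families_homotopic_near\<close>). Hence homotopic paths have the
  same holonomy germ, so that \<open>q\<close> is well defined, and in both groupoids a family is a chart, with the
  transverse coordinate of the source as coordinate. As \<open>q\<close> maps the chart of a family to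
  the chart of the same family by the identity in these coordinates, it is a local biholomorphism.

  The scalar multiplication of the pullbacks along source and target presupposes that every germ of a
  holomorphic function on the arrow space is pulled back from the transversal. For the source
  map this is clear in the coordinates above; for the target map it says that holonomy
  is holomorphic (\<open>holonomy_holomorphic\<close>). The reason is that a leafwise path keeps its transverse
  coordinates as long as it stays in one adapted chart, and that the transverse coordinates of two
  adapted charts are related holomorphically, since \<open>V\<close> contains the vectors \<open>\<partial>/\<partial>cnj z\<close> of both.
\<close>

section \<open>Homotopy classes of paths in a topology\<close>

lemma continuous_map_reparam_snd:
  fixes \<phi> :: "real \<Rightarrow> real"
  assumes "continuous_on S \<phi>" "\<phi> ` S \<subseteq> R"
  shows "continuous_map (prod_topology T (top_of_set S)) (prod_topology T (top_of_set R)) (\<lambda>(x, r). (x, \<phi> r))"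
proof -
  have "continuous_map (top_of_set S) (top_of_set R) \<phi>"
    using assms by (auto simp: continuous_map_in_subtopology)
  then have "continuous_map (prod_topology T (top_of_set S)) (top_of_set R) (\<phi> \<circ> snd)"
    using continuous_map_compose continuous_map_snd by blast
  then show ?thesis
    using continuous_map_fst[of T "top_of_set S"]
    by (simp add: continuous_map_pairwise case_prod_unfold o_def)
qed

lemma continuous_map_glue:
  fixes a b e :: real
  assumes f: "continuous_map (prod_topology T (top_of_set {a..b})) Y f"
    and g: "continuous_map (prod_topology T (top_of_set {b..e})) Y g"
    and eq: "\<And>x. x \<in> topspace T \<Longrightarrow> f (x, b) = g (x, b)" and "a \<le> b" "b \<le> e"
  shows "continuous_map (prod_topology T (top_of_set {a..e})) Y (\<lambda>(x, r). if r \<le> b then f (x, r) else g (x, r))"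
proof -
  let ?P = "prod_topology T (top_of_set {a..e})"
  have snd: "continuous_map ?P euclideanreal snd"
    using continuous_map_snd[of T "top_of_set {a..e}"] by (simp add: continuous_map_in_subtopology)
  have "continuous_map ?P Y (\<lambda>x. if snd x \<le> b then f x else g x)"
  proof (rule continuous_map_cases_le[OF snd])
    have "subtopology ?P {x \<in> topspace ?P. snd x \<le> b} = prod_topology T (top_of_set {a..b})"
    proof -
      have "{x \<in> topspace ?P. snd x \<le> b} = topspace T \<times> {a..b}" using \<open>b \<le> e\<close> by auto
      moreover have "{a..e} \<inter> {a..b} = {a..b}" using \<open>b \<le> e\<close> by auto
      ultimately show ?thesis
        using assms(4,5) by (simp add: subtopology_Times subtopology_subtopology min_absorb2 max_absorb2)
    qed
    then show "continuous_map (subtopology ?P {x \<in> topspace ?P. snd x \<le> b}) Y f" using f by simp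
    have "subtopology ?P {x \<in> topspace ?P. b \<le> snd x} = prod_topology T (top_of_set {b..e})"
    proof -
      have "{x \<in> topspace ?P. b \<le> snd x} = topspace T \<times> {b..e}" using \<open>a \<le> b\<close> by auto
      moreover have "{a..e} \<inter> {b..e} = {b..e}" using \<open>a \<le> b\<close> by auto
      ultimately show ?thesis
        using assms(4,5) by (simp add: subtopology_Times subtopology_subtopology min_absorb2 max_absorb2)
    qed
    then show "continuous_map (subtopology ?P {x \<in> topspace ?P. b \<le> snd x}) Y g" using g by simp
  qed (use eq in auto)
  moreover have "(\<lambda>x. if snd x \<le> b then f x else g x) = (\<lambda>(x, r). if r \<le> b then f (x, r) else g (x, r))"
    by (rule ext) (simp add: case_prod_unfold)
  ultimately show ?thesis by simp
qed

lemma continuous_map_path_join: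
  assumes f: "continuous_map (prod_topology T unit_interval) Y (\<lambda>(x, r). F x r)"
    and g: "continuous_map (prod_topology T unit_interval) Y (\<lambda>(x, r). G x r)"
    and eq: "\<And>x. x \<in> topspace T \<Longrightarrow> F x 1 = G x 0"
  shows "continuous_map (prod_topology T unit_interval) Y (\<lambda>(x, r). path_join (F x) (G x) r)"
proof -
  have "continuous_map (prod_topology T (top_of_set {0..1/2})) Y ((\<lambda>(x, r). F x r) \<circ> (\<lambda>(x, r). (x, 2 * r)))"
    by (rule continuous_map_compose[OF continuous_map_reparam_snd f]) (auto intro!: continuous_intros)
  moreover have "continuous_map (prod_topology T (top_of_set {1/2..1})) Y
      ((\<lambda>(x, r). G x r) \<circ> (\<lambda>(x, r). (x, 2 * r - 1)))"
    by (rule continuous_map_compose[OF continuous_map_reparam_snd g]) (auto intro!: continuous_intros)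
  ultimately have "continuous_map (prod_topology T unit_interval) Y
     (\<lambda>(x, r). if r \<le> 1/2 then ((\<lambda>(x, r). F x r) \<circ> (\<lambda>(x, r). (x, 2 * r))) (x, r)
        else ((\<lambda>(x, r). G x r) \<circ> (\<lambda>(x, r). (x, 2 * r - 1))) (x, r))"
    by (rule continuous_map_glue) (use eq in auto)
  moreover have "(\<lambda>(x, r). if r \<le> 1/2 then ((\<lambda>(x, r). F x r) \<circ> (\<lambda>(x, r). (x, 2 * r))) (x, r)
        else ((\<lambda>(x, r). G x r) \<circ> (\<lambda>(x, r). (x, 2 * r - 1))) (x, r)) = (\<lambda>(x, r). path_join (F x) (G x) r)"
    by (rule ext) (simp add: path_join_def case_prod_unfold)
  ultimately show ?thesis by simp
qed

lemma continuous_map_slice: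
  assumes "continuous_map (prod_topology T S) Y (\<lambda>(x, r). F x r)" "x \<in> topspace T"
  shows "continuous_map S Y (F x)"
proof -
  have "continuous_map S (prod_topology T S) (\<lambda>r. (x, r))"
    using assms(2) by (simp add: continuous_map_pairwise o_def)
  from continuous_map_compose[OF this assms(1)] show ?thesis by (simp add: o_def)
qed

lemma continuous_map_const_family:
  assumes "continuous_map S Y \<gamma>"
  shows "continuous_map (prod_topology T S) Y (\<lambda>(x, r). \<gamma> r)"
  using continuous_map_compose[OF continuous_map_snd assms] by (simp add: o_def case_prod_unfold)

lemma pathin_path_join:
  assumes "pathin L \<gamma>" "pathin L \<delta>" "\<gamma> 1 = \<delta> 0"
  shows "pathin L (path_join \<gamma> \<delta>)"
proof -
  let ?T = "discrete_topology {()}"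
  have "continuous_map (prod_topology ?T unit_interval) L (\<lambda>(x, r). path_join \<gamma> \<delta> r)"
    by (rule continuous_map_path_join[where F="\<lambda>_. \<gamma>" and G="\<lambda>_. \<delta>"])
      (use assms continuous_map_const_family in \<open>auto simp: pathin_def\<close>)
  from continuous_map_slice[OF this, of "()"] show ?thesis by (simp add: pathin_def)
qed

lemma pathin_reparam:
  assumes "continuous_map (top_of_set {a..b}) L \<gamma>" "continuous_on {0..1} f" "f ` {0..1} \<subseteq> {a..b::real}"
  shows "pathin L (\<lambda>r. \<gamma> (f r))"
  using continuous_map_compose[of unit_interval "top_of_set {a..b}" f L \<gamma>] assms
  by (auto simp: pathin_def o_def continuous_map_in_subtopology)

lemma path_join_ends [simp]: "path_join \<gamma> \<delta> 0 = \<gamma> 0" "path_join \<gamma> \<delta> 1 = \<delta> 1"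
  by (simp_all add: path_join_def)

definition path_homotopic :: "'x topology \<Rightarrow> (real \<Rightarrow> 'x) \<Rightarrow> (real \<Rightarrow> 'x) \<Rightarrow> bool" where
  "path_homotopic L \<gamma> \<delta> \<longleftrightarrow>
     homotopic_with (\<lambda>\<eta>. \<eta> 0 = \<gamma> 0 \<and> \<eta> 1 = \<gamma> 1) unit_interval L \<gamma> \<delta>"

lemma mem_mon_class: "\<delta> \<in> mon_class L \<gamma> \<longleftrightarrow> path_homotopic L \<gamma> \<delta>"
  by (simp add: mon_class_def path_homotopic_def)

lemma path_homotopic_iff:
  "path_homotopic L \<gamma> \<delta> \<longleftrightarrow> (\<exists>h. continuous_map (prod_topology unit_interval unit_interval) L (\<lambda>(s, r). h s r) \<and>
     (\<forall>r\<in>{0..1}. h 0 r = \<gamma> r \<and> h 1 r = \<delta> r) \<and> (\<forall>s\<in>{0..1}. h s 0 = \<gamma> 0 \<and> h s 1 = \<gamma> 1))"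
  (is "_ \<longleftrightarrow> ?R")
proof -
  have "path_homotopic L \<gamma> \<delta> \<longleftrightarrow> (\<exists>h. continuous_map (prod_topology unit_interval unit_interval) L h \<and>
       (\<forall>x\<in>{0..1}. h (0, x) = \<gamma> x) \<and> (\<forall>x\<in>{0..1}. h (1, x) = \<delta> x) \<and>
       (\<forall>t\<in>{0..1}. h (t, 0) = \<gamma> 0 \<and> h (t, 1) = \<gamma> 1))"
    unfolding path_homotopic_def by (subst homotopic_with) auto
  also have "\<dots> \<longleftrightarrow> ?R" (is "(\<exists>h. ?P h) \<longleftrightarrow> _")
  proof
    assume "\<exists>h. ?P h"
    then obtain h where "?P h" ..
    then show ?R by (intro exI[of _ "\<lambda>s r. h (s, r)"]) auto
  next
    assume ?R
    then obtain h where "continuous_map (prod_topology unit_interval unit_interval) L (\<lambda>(s, r). h s r)"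
      "(\<forall>r\<in>{0..1}. h 0 r = \<gamma> r \<and> h 1 r = \<delta> r) \<and> (\<forall>s\<in>{0..1}. h s 0 = \<gamma> 0 \<and> h s 1 = \<gamma> 1)" by blast
    then show "\<exists>h. ?P h" by (intro exI[of _ "\<lambda>(s, r). h s r"]) auto
  qed
  finally show ?thesis .
qed

lemma path_homotopic_ends:
  assumes "path_homotopic L \<gamma> \<delta>" shows "\<delta> 0 = \<gamma> 0" "\<delta> 1 = \<gamma> 1"
proof -
  obtain h where "continuous_map (prod_topology unit_interval unit_interval) L (\<lambda>(s, r). h s r)"
    and h: "\<forall>r\<in>{0..1}. h 0 r = \<gamma> r \<and> h 1 r = \<delta> r" "\<forall>s\<in>{0..1}. h s 0 = \<gamma> 0 \<and> h s 1 = \<gamma> 1"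
    using assms unfolding path_homotopic_iff by blast
  from h(1)[rule_format, of 0] h(1)[rule_format, of 1] h(2)[rule_format, of 1]
  show "\<delta> 0 = \<gamma> 0" "\<delta> 1 = \<gamma> 1" by auto
qed

lemma path_homotopic_pathin:
  assumes "path_homotopic L \<gamma> \<delta>" shows "pathin L \<gamma>" "pathin L \<delta>"
  using homotopic_with_imp_continuous_maps[OF assms[unfolded path_homotopic_def]] by (auto simp: pathin_def)

lemma path_homotopic_refl: "pathin L \<gamma> \<Longrightarrow> path_homotopic L \<gamma> \<gamma>"
  by (simp add: path_homotopic_def pathin_def)

lemma path_homotopic_sym: "path_homotopic L \<gamma> \<delta> \<Longrightarrow> path_homotopic L \<delta> \<gamma>"
  using path_homotopic_ends[of L \<gamma> \<delta>] by (simp add: path_homotopic_def homotopic_with_sym)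

lemma path_homotopic_trans [trans]:
  "path_homotopic L \<gamma> \<delta> \<Longrightarrow> path_homotopic L \<delta> \<eta> \<Longrightarrow> path_homotopic L \<gamma> \<eta>"
  using path_homotopic_ends[of L \<gamma> \<delta>] by (auto simp: path_homotopic_def intro: homotopic_with_trans)

lemma path_homotopic_cong:
  assumes "pathin L \<gamma>" "\<And>r. r \<in> {0..1} \<Longrightarrow> \<gamma> r = \<delta> r"
  shows "path_homotopic L \<gamma> \<delta>"
proof -
  have "continuous_map (prod_topology unit_interval unit_interval) L (\<lambda>(s, r). \<gamma> r)"
    using assms(1) unfolding pathin_def by (rule continuous_map_const_family)
  then show ?thesis
    unfolding path_homotopic_iff by (intro exI[of _ "\<lambda>s. \<gamma>"]) (use assms(2) in auto)
qed

lemma mon_class_eq_iff: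
  assumes "pathin L \<gamma>"
  shows "mon_class L \<gamma> = mon_class L \<delta> \<longleftrightarrow> path_homotopic L \<gamma> \<delta>"
proof
  assume "mon_class L \<gamma> = mon_class L \<delta>"
  then have "\<gamma> \<in> mon_class L \<delta>" using path_homotopic_refl[OF assms] by (auto simp: mem_mon_class)
  then show "path_homotopic L \<gamma> \<delta>" by (simp add: mem_mon_class path_homotopic_sym)
next
  assume "path_homotopic L \<gamma> \<delta>"
  then show "mon_class L \<gamma> = mon_class L \<delta>"
    using path_homotopic_trans path_homotopic_sym by (simp add: set_eq_iff mem_mon_class) blast
qed

lemma path_homotopic_join:
  assumes "path_homotopic L \<gamma> \<gamma>'" "path_homotopic L \<delta> \<delta>'" "\<gamma> 1 = \<delta> 0"
  shows "path_homotopic L (path_join \<gamma> \<delta>) (path_join \<gamma>' \<delta>')"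
proof -
  obtain h where h: "continuous_map (prod_topology unit_interval unit_interval) L (\<lambda>(s, r). h s r)"
     "\<And>r. r\<in>{0..1} \<Longrightarrow> h 0 r = \<gamma> r \<and> h 1 r = \<gamma>' r" "\<And>s. s\<in>{0..1} \<Longrightarrow> h s 0 = \<gamma> 0 \<and> h s 1 = \<gamma> 1"
    using assms(1) unfolding path_homotopic_iff by blast
  obtain k where k: "continuous_map (prod_topology unit_interval unit_interval) L (\<lambda>(s, r). k s r)"
     "\<And>r. r\<in>{0..1} \<Longrightarrow> k 0 r = \<delta> r \<and> k 1 r = \<delta>' r" "\<And>s. s\<in>{0..1} \<Longrightarrow> k s 0 = \<delta> 0 \<and> k s 1 = \<delta> 1"
    using assms(2) unfolding path_homotopic_iff by blast
  have "continuous_map (prod_topology unit_interval unit_interval) L (\<lambda>(s, r). path_join (h s) (k s) r)"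
    by (rule continuous_map_path_join[OF h(1) k(1)]) (use h(3) k(3) assms(3) in auto)
  then show ?thesis
    unfolding path_homotopic_iff
    by (intro exI[of _ "\<lambda>s. path_join (h s) (k s)"]) (use h k in \<open>auto simp: path_join_def\<close>)
qed

text \<open>
  Every identity of the fundamental groupoid below is an instance of this one: both sides run
  through the same path, and two parametrisations \<open>f\<close>, \<open>g\<close> with equal endpoints are joined by
  the straight-line homotopy inside the parameter interval.
\<close>

lemma path_homotopic_reparam:
  fixes f g :: "real \<Rightarrow> real"
  assumes \<gamma>: "continuous_map (top_of_set {a..b}) L \<gamma>"
    and f: "continuous_on {0..1} f" "f ` {0..1} \<subseteq> {a..b}" and g: "continuous_on {0..1} g" "g ` {0..1} \<subseteq> {a..b}"
    and "f 0 = g 0" "f 1 = g 1"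
  shows "path_homotopic L (\<lambda>r. \<gamma> (f r)) (\<lambda>r. \<gamma> (g r))"
proof -
  let ?m = "\<lambda>(s, r). (1 - s) * f r + s * g r"
  have "continuous_on ({0..1} \<times> {0..1}) ?m"
    unfolding case_prod_unfold
    by (intro continuous_intros continuous_on_compose2[OF f(1)] continuous_on_compose2[OF g(1)]) auto
  moreover have "?m ` ({0..1} \<times> {0..1}) \<subseteq> {a..b}"
  proof clarify
    fix s r :: real assume sr: "s \<in> {0..1}" "r \<in> {0..1}"
    then have *: "f r \<in> {a..b}" "g r \<in> {a..b}" using f(2) g(2) by blast+
    show "(1 - s) * f r + s * g r \<in> {a..b}"
      using convexD_alt[OF convex_real_interval(5) *, of s] sr by simp
  qed
  ultimately have "continuous_map (prod_topology unit_interval unit_interval) (top_of_set {a..b}) ?m"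
    by (auto simp: continuous_map_in_subtopology)
  from continuous_map_compose[OF this \<gamma>] show ?thesis
    unfolding path_homotopic_iff
    by (intro exI[of _ "\<lambda>s r. \<gamma> ((1 - s) * f r + s * g r)"]) (use assms(6,7) in \<open>auto simp: o_def case_prod_unfold algebra_simps\<close>)
qed

lemma path_homotopic_assoc:
  assumes "pathin L \<alpha>" "pathin L \<beta>" "pathin L \<gamma>" "\<alpha> 1 = \<beta> 0" "\<beta> 1 = \<gamma> 0"
  shows "path_homotopic L (path_join (path_join \<alpha> \<beta>) \<gamma>) (path_join \<alpha> (path_join \<beta> \<gamma>))"
proof -
  let ?P = "path_join \<alpha> (path_join \<beta> \<gamma>)"
  let ?f = "\<lambda>r::real. min (2 * r) (min (r + 1/4) ((r + 1) / 2))"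
  have P: "pathin L ?P" using assms by (intro pathin_path_join) auto
  have "path_homotopic L (\<lambda>r. ?P (?f r)) (\<lambda>r. ?P r)"
  proof (rule path_homotopic_reparam[OF P[unfolded pathin_def]])
    show "?f ` {0..1} \<subseteq> {0..1}" by (auto simp: min_def)
  qed (auto intro!: continuous_intros)
  moreover have "?P (?f r) = path_join (path_join \<alpha> \<beta>) \<gamma> r" if "r \<in> {0..1}" for r
  proof -
    consider "r \<le> 1/4" | "1/4 < r" "r \<le> 1/2" | "1/2 < r" by linarith
    then show ?thesis
    proof cases
      case 1 then show ?thesis by (auto simp: path_join_def min_def)
    next
      case 2
      then have *: "?f r = r + 1/4" by (auto simp: min_def)
      show ?thesis unfolding * using 2 by (auto simp: path_join_def algebra_simps)
    next
      case 3
      then have *: "?f r = (r + 1) / 2" by (auto simp: min_def)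
      show ?thesis unfolding * using 3 assms(5) by (auto simp: path_join_def field_simps)
    qed
  qed
  ultimately show ?thesis
    by (meson path_homotopic_cong path_homotopic_pathin path_homotopic_sym path_homotopic_trans)
qed

lemma path_homotopic_unit:
  assumes "pathin L \<gamma>"
  shows "path_homotopic L (path_join \<gamma> (\<lambda>_. \<gamma> 1)) \<gamma>" "path_homotopic L (path_join (\<lambda>_. \<gamma> 0) \<gamma>) \<gamma>"
proof -
  have "path_homotopic L (\<lambda>r. \<gamma> (min (2 * r) 1)) (\<lambda>r. \<gamma> r)"
    by (rule path_homotopic_reparam[OF assms[unfolded pathin_def]]) (auto intro!: continuous_intros)
  moreover have "(\<lambda>r. \<gamma> (min (2 * r) 1)) = path_join \<gamma> (\<lambda>_. \<gamma> 1)"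
    by (auto simp: path_join_def min_def fun_eq_iff)
  ultimately show "path_homotopic L (path_join \<gamma> (\<lambda>_. \<gamma> 1)) \<gamma>" by simp
  have "path_homotopic L (\<lambda>r. \<gamma> (max (2 * r - 1) 0)) (\<lambda>r. \<gamma> r)"
    by (rule path_homotopic_reparam[OF assms[unfolded pathin_def]]) (auto intro!: continuous_intros)
  moreover have "(\<lambda>r. \<gamma> (max (2 * r - 1) 0)) = path_join (\<lambda>_. \<gamma> 0) \<gamma>"
    by (auto simp: path_join_def max_def fun_eq_iff)
  ultimately show "path_homotopic L (path_join (\<lambda>_. \<gamma> 0) \<gamma>) \<gamma>" by simp
qed

lemma pathin_reverse: "pathin L \<gamma> \<Longrightarrow> pathin L (\<lambda>r. \<gamma> (1 - r))"
  unfolding pathin_def[of L \<gamma>] by (rule pathin_reparam) (auto intro!: continuous_intros)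

lemma path_homotopic_inverse:
  assumes "pathin L \<gamma>"
  shows "path_homotopic L (path_join (\<lambda>r. \<gamma> (1 - r)) \<gamma>) (\<lambda>_. \<gamma> 1)"
proof -
  have "path_homotopic L (\<lambda>r. \<gamma> \<bar>2 * r - 1\<bar>) (\<lambda>r. \<gamma> 1)"
    by (rule path_homotopic_reparam[OF assms[unfolded pathin_def]]) (auto intro!: continuous_intros)
  moreover have "(\<lambda>r. \<gamma> \<bar>2 * r - 1\<bar>) = path_join (\<lambda>r. \<gamma> (1 - r)) \<gamma>"
    by (auto simp: path_join_def fun_eq_iff)
  ultimately show ?thesis by simp
qed

definition subpath_on :: "(real \<Rightarrow> 'x) \<Rightarrow> real \<Rightarrow> real \<Rightarrow> real \<Rightarrow> 'x" where
  "subpath_on \<gamma> a b = (\<lambda>r. \<gamma> (a + (b - a) * r))"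

lemma subpath_on_ends [simp]: "subpath_on \<gamma> a b 0 = \<gamma> a" "subpath_on \<gamma> a b 1 = \<gamma> b"
  by (simp_all add: subpath_on_def)

lemma affine_interval:
  assumes "a \<le> b" "r \<in> {0..1::real}" shows "a + (b - a) * r \<in> {a..b}"
proof -
  have "(b - a) * r \<le> (b - a) * 1" using assms by (intro mult_left_mono) auto
  moreover have "0 \<le> (b - a) * r" using assms by auto
  ultimately show ?thesis by auto
qed

lemma pathin_subpath:
  assumes "pathin L \<gamma>" "0 \<le> a" "a \<le> b" "b \<le> 1"
  shows "pathin L (subpath_on \<gamma> a b)"
  unfolding subpath_on_def
  by (rule pathin_reparam[OF assms(1)[unfolded pathin_def]])
    (use affine_interval[of a b] assms in \<open>force intro!: continuous_intros\<close>)+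

lemma subpath_homotopic_join:
  assumes "pathin L \<gamma>" "0 \<le> a" "a \<le> b" "b \<le> e" "e \<le> 1"
  shows "path_homotopic L (path_join (subpath_on \<gamma> a b) (subpath_on \<gamma> b e)) (subpath_on \<gamma> a e)"
proof -
  let ?f = "\<lambda>r. if r \<le> 1/2 then a + (b - a) * (2 * r) else b + (e - b) * (2 * r - 1)"
  have r1: "?f r \<in> {a..e}" if "r \<in> {0..1}" for r
    using affine_interval[of a b "2 * r"] affine_interval[of b e "2 * r - 1"] assms that
    by (auto intro: order_trans)
  have c: "continuous_on {0..1} ?f"
  proof -
    have "continuous_on ({0..1/2} \<union> {1/2..1}) ?f"
      by (rule continuous_on_cases_le[where h="\<lambda>r. r", unfolded mem_Collect_eq])
        (auto intro!: continuous_intros simp: algebra_simps)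
    moreover have "{0..1/2} \<union> {1/2..1} = {0..1::real}" by auto
    ultimately show ?thesis by simp
  qed
  have "path_homotopic L (\<lambda>r. \<gamma> (?f r)) (\<lambda>r. \<gamma> (a + (e - a) * r))"
    by (rule path_homotopic_reparam[OF assms(1)[unfolded pathin_def]])
      (use c r1 affine_interval[of a e] assms in \<open>force intro!: continuous_intros\<close>)+
  moreover have "(\<lambda>r. \<gamma> (?f r)) = path_join (subpath_on \<gamma> a b) (subpath_on \<gamma> b e)"
    by (auto simp: path_join_def subpath_on_def fun_eq_iff)
  ultimately show ?thesis by (simp add: subpath_on_def)
qed

section \<open>Foliated spaces: extending leafwise paths and homotopies to nearby leaves\<close>

lemma continuous_map_into_fun:
  "(\<And>k. continuous_map T euclideanreal (\<lambda>x. F x k)) \<Longrightarrow> continuous_map T euclidean (F :: 'a \<Rightarrow> nat \<Rightarrow> real)"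
  unfolding euclidean_product_topology[symmetric] by (simp add: continuous_map_componentwise_UNIV)

lemma continuous_map_fun_component:
  "continuous_map T euclidean (F :: 'a \<Rightarrow> nat \<Rightarrow> real) \<Longrightarrow> continuous_map T euclideanreal (\<lambda>x. F x k)"
  unfolding euclidean_product_topology[symmetric] by (simp add: continuous_map_componentwise_UNIV)

lemma tube_near_slice:
  assumes "continuous_map (prod_topology T (top_of_set K)) X (\<lambda>(w, r). H w r)" "compact K"
    and "p \<in> topspace T" "openin X N" "\<And>r. r \<in> K \<Longrightarrow> H p r \<in> N"
  shows "\<exists>W. openin T W \<and> p \<in> W \<and> (\<forall>w\<in>W. \<forall>r\<in>K. H w r \<in> N)"
proof -
  have o: "openin (prod_topology T (top_of_set K)) {x \<in> topspace T \<times> K. (\<lambda>(w, r). H w r) x \<in> N}"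
    using openin_continuous_map_preimage[OF assms(1,4)] by simp
  have c: "compactin (top_of_set K) K" using assms(2) by (simp add: compactin_subtopology)
  have "{p} \<times> K \<subseteq> {x \<in> topspace T \<times> K. (\<lambda>(w, r). H w r) x \<in> N}"
    using assms(3,5) by auto
  from tube_lemma_right[OF o c assms(3) this]
  obtain U V where "openin T U" "p \<in> U" "K \<subseteq> V" "U \<times> V \<subseteq> {x \<in> topspace T \<times> K. (\<lambda>(w, r). H w r) x \<in> N}"
    by blast
  then show ?thesis by (intro exI[of _ U]) fastforce
qed

lemma openin_unit_interval_ball:
  assumes "openin unit_interval V" "s0 \<in> V"
  obtains \<epsilon> where "\<epsilon> > 0" "\<And>s. s \<in> {0..1} \<Longrightarrow> \<bar>s - s0\<bar> < \<epsilon> \<Longrightarrow> s \<in> V"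
  using assms unfolding openin_euclidean_subtopology_iff dist_real_def by metis

lemma openin_subtopology_trans:
  assumes "openin (subtopology X S) W" "openin (subtopology X W) W'"
  shows "openin (subtopology X S) W'"
proof -
  obtain A A' where "openin X A" "W = A \<inter> S" "openin X A'" "W' = A' \<inter> W"
    using assms by (auto simp: openin_subtopology)
  then show ?thesis unfolding openin_subtopology by (intro exI[of _ "A' \<inter> A"]) auto
qed

lemma open_contains_convex_box:
  fixes O' :: "(nat \<Rightarrow> real) set"
  assumes "open O'" "x \<in> O'"
  obtains C where "open C" "x \<in> C" "C \<subseteq> O'"
    "\<And>y y' s. y \<in> C \<Longrightarrow> y' \<in> C \<Longrightarrow> s \<in> {0..1} \<Longrightarrow> (\<lambda>k. (1 - s) * y k + s * y' k) \<in> C"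
proof -
  have "openin (product_topology (\<lambda>_. euclidean) UNIV) O'"
    using assms(1) by (simp add: euclidean_product_topology)
  from product_topology_open_contains_basis[OF this assms(2)]
  obtain Y where Y: "x \<in> (\<Pi>\<^sub>E i\<in>UNIV. Y i)" "\<And>i. openin euclidean (Y i)" "finite {i. Y i \<noteq> topspace euclidean}"
    "(\<Pi>\<^sub>E i\<in>UNIV. Y i) \<subseteq> O'" by blast
  have "\<exists>e>0. ball (x i) e \<subseteq> Y i" for i
    using Y(1) Y(2)[of i] by (auto simp: PiE_iff open_contains_ball)
  then obtain e where e: "\<And>i. e i > 0" "\<And>i. ball (x i) (e i) \<subseteq> Y i" by metis
  define Q where "Q i = (if Y i = UNIV then UNIV else ball (x i) (e i))" for i
  have "openin (product_topology (\<lambda>_. euclidean) UNIV) (\<Pi>\<^sub>E i\<in>UNIV. Q i)"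
    by (rule product_topology_basis) (use Y(3) in \<open>auto simp: Q_def elim!: finite_subset[rotated]\<close>)
  then have "open (\<Pi>\<^sub>E i\<in>UNIV. Q i)" by (simp add: euclidean_product_topology)
  moreover have "x \<in> (\<Pi>\<^sub>E i\<in>UNIV. Q i)" using e(1) by (auto simp: Q_def)
  moreover have "(\<Pi>\<^sub>E i\<in>UNIV. Q i) \<subseteq> O'"
  proof (rule order_trans[OF _ Y(4)], rule PiE_mono)
    show "Q i \<subseteq> Y i" for i using e(2)[of i] by (auto simp: Q_def)
  qed
  moreover have "(\<lambda>k. (1 - s) * y k + s * y' k) \<in> (\<Pi>\<^sub>E i\<in>UNIV. Q i)"
    if "y \<in> (\<Pi>\<^sub>E i\<in>UNIV. Q i)" "y' \<in> (\<Pi>\<^sub>E i\<in>UNIV. Q i)" "s \<in> {0..1}" for y y' s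
  proof (rule PiE_I)
    fix i :: nat
    have "convex (Q i)" by (simp add: Q_def)
    then show "(1 - s) * y i + s * y' i \<in> Q i"
      using convexD_alt[of "Q i" "y i" "y' i" s] that by (auto simp: PiE_iff)
  qed simp
  ultimately show ?thesis by (rule that)
qed

text \<open>
  The topological side of a foliation. The assumptions on \<open>L\<close> say that, locally, it is the sum of
  the plaques \<open>z i = const\<close>. Each plaque is convex in the coordinates \<open>t i\<close>; this is the source of
  all homotopies below.
\<close>

locale foliated_space =
  fixes X L :: "'x topology" and I :: "'i set" and U :: "'i \<Rightarrow> 'x set" and d :: nat
    and t :: "'i \<Rightarrow> 'x \<Rightarrow> nat \<Rightarrow> real" and z :: "'i \<Rightarrow> 'x \<Rightarrow> 'z::topological_space"
    and B :: "'i \<Rightarrow> (nat \<Rightarrow> real) set" and Z :: "'i \<Rightarrow> 'z set"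
  assumes chart_open: "i \<in> I \<Longrightarrow> openin X (U i)"
    and chart_cover: "topspace X = (\<Union>i\<in>I. U i)"
    and chart_homeo: "i \<in> I \<Longrightarrow>
      homeomorphic_map (subtopology X (U i)) (top_of_set (B i \<times> Z i)) (\<lambda>x. (t i x, z i x))"
    and ball_convex: "i \<in> I \<Longrightarrow> \<tau> \<in> B i \<Longrightarrow> \<tau>' \<in> B i \<Longrightarrow> s \<in> {0..1} \<Longrightarrow>
      (\<lambda>k. (1 - s) * \<tau> k + s * \<tau>' k) \<in> B i"
    and ball_open: "i \<in> I \<Longrightarrow> \<exists>O'. open O' \<and> B i = {\<tau> \<in> O'. \<forall>k\<ge>d. \<tau> k = 0}"
    and ball_zero: "i \<in> I \<Longrightarrow> (\<lambda>_. 0) \<in> B i"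
    and leaf_topspace: "topspace L = topspace X"
    and plaque_open: "i \<in> I \<Longrightarrow> openin X N \<Longrightarrow> openin L {y \<in> N \<inter> U i. z i y = \<zeta>}"
    and leaf_open: "openin L P \<Longrightarrow> x \<in> P \<Longrightarrow> i \<in> I \<Longrightarrow> x \<in> U i \<Longrightarrow>
      \<exists>N. openin X N \<and> x \<in> N \<and> {y \<in> N \<inter> U i. z i y = z i x} \<subseteq> P"
begin

definition transv :: "'i \<Rightarrow> 'x set" where
  "transv i = {x \<in> U i. t i x = (\<lambda>_. 0)}"

definition point :: "'i \<Rightarrow> (nat \<Rightarrow> real) \<Rightarrow> 'z \<Rightarrow> 'x" where
  "point i \<tau> \<zeta> = inv_into (U i) (\<lambda>x. (t i x, z i x)) (\<tau>, \<zeta>)"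

lemma chart_subset: "i \<in> I \<Longrightarrow> U i \<subseteq> topspace X"
  using chart_open openin_subset by blast

lemma chart_bij: "i \<in> I \<Longrightarrow> bij_betw (\<lambda>x. (t i x, z i x)) (U i) (B i \<times> Z i)"
  using chart_homeo[of i] chart_subset[of i]
  by (auto simp: homeomorphic_map_def bij_betw_def quotient_map_def inf_absorb2 dest: homeomorphic_imp_surjective_map homeomorphic_imp_injective_map)

lemma coords_in: "i \<in> I \<Longrightarrow> x \<in> U i \<Longrightarrow> t i x \<in> B i" "i \<in> I \<Longrightarrow> x \<in> U i \<Longrightarrow> z i x \<in> Z i"
  using chart_bij[of i] by (auto simp: bij_betw_def)

lemma coords_inj: "i \<in> I \<Longrightarrow> x \<in> U i \<Longrightarrow> y \<in> U i \<Longrightarrow> t i x = t i y \<Longrightarrow> z i x = z i y \<Longrightarrow> x = y"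
  using chart_bij[of i] by (auto simp: bij_betw_def inj_on_def)

lemma point_in:
  assumes "i \<in> I" "\<tau> \<in> B i" "\<zeta> \<in> Z i"
  shows "point i \<tau> \<zeta> \<in> U i" "t i (point i \<tau> \<zeta>) = \<tau>" "z i (point i \<tau> \<zeta>) = \<zeta>"
proof -
  have *: "(\<tau>, \<zeta>) \<in> (\<lambda>x. (t i x, z i x)) ` U i"
    using chart_bij[OF assms(1)] assms(2,3) by (simp add: bij_betw_def)
  show "point i \<tau> \<zeta> \<in> U i" "t i (point i \<tau> \<zeta>) = \<tau>" "z i (point i \<tau> \<zeta>) = \<zeta>"
    using inv_into_into[OF *] f_inv_into_f[OF *] by (auto simp: point_def)
qed

lemma point_coords: "i \<in> I \<Longrightarrow> x \<in> U i \<Longrightarrow> point i (t i x) (z i x) = x"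
  using point_in[of i "t i x" "z i x"] coords_in coords_inj by metis

lemma chart_continuous:
  assumes "i \<in> I"
  shows "continuous_map (subtopology X (U i)) euclidean (t i)" "continuous_map (subtopology X (U i)) euclidean (z i)"
proof -
  have "continuous_map (subtopology X (U i)) euclidean (\<lambda>x. (t i x, z i x))"
    using homeomorphic_imp_continuous_map[OF chart_homeo[OF assms]] by (simp add: continuous_map_in_subtopology)
  then show "continuous_map (subtopology X (U i)) euclidean (t i)" "continuous_map (subtopology X (U i)) euclidean (z i)"
    by (auto simp: euclidean_product_topology simp flip: prod_topology_euclidean simp: continuous_map_pairwise o_def)
qed

lemma coords_continuous:
  assumes "i \<in> I" "continuous_map T X f" "\<And>x. x \<in> topspace T \<Longrightarrow> f x \<in> U i"
  shows "continuous_map T euclidean (\<lambda>x. t i (f x))" "continuous_map T euclidean (\<lambda>x. z i (f x))"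
proof -
  have "continuous_map T (subtopology X (U i)) f"
    using assms(2,3) by (auto simp: continuous_map_in_subtopology)
  then show "continuous_map T euclidean (\<lambda>x. t i (f x))" "continuous_map T euclidean (\<lambda>x. z i (f x))"
    using continuous_map_compose chart_continuous[OF assms(1)] by (auto simp: o_def)
qed

lemma point_continuous:
  assumes "i \<in> I" "continuous_map T euclidean f" "continuous_map T euclidean g"
    and "\<And>x. x \<in> topspace T \<Longrightarrow> f x \<in> B i" "\<And>x. x \<in> topspace T \<Longrightarrow> g x \<in> Z i"
  shows "continuous_map T X (\<lambda>x. point i (f x) (g x))"
proof -
  obtain h where h: "homeomorphic_maps (subtopology X (U i)) (top_of_set (B i \<times> Z i)) (\<lambda>x. (t i x, z i x)) h"
    using chart_homeo[OF assms(1)] homeomorphic_map_maps by blast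
  then have "continuous_map (top_of_set (B i \<times> Z i)) (subtopology X (U i)) h"
    and h1: "\<And>\<tau> \<zeta>. \<tau> \<in> B i \<Longrightarrow> \<zeta> \<in> Z i \<Longrightarrow> h (\<tau>, \<zeta>) \<in> U i \<and> t i (h (\<tau>, \<zeta>)) = \<tau> \<and> z i (h (\<tau>, \<zeta>)) = \<zeta>"
    by (auto simp: homeomorphic_maps_def continuous_map_in_subtopology image_subset_iff)
  then have c: "continuous_map (top_of_set (B i \<times> Z i)) X h" by (simp add: continuous_map_in_subtopology)
  have "continuous_map T (top_of_set (B i \<times> Z i)) (\<lambda>x. (f x, g x))"
    using assms(2-5) by (auto simp: continuous_map_in_subtopology continuous_map_pairwise o_def simp flip: prod_topology_euclidean)
  from continuous_map_compose[OF this c] have "continuous_map T X (\<lambda>x. h (f x, g x))" by (simp add: o_def)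
  then show ?thesis
    by (rule continuous_map_eq) (metis assms(1,4,5) h1 point_coords)
qed

lemma leaf_finer:
  assumes N: "openin X N" shows "openin L N"
proof (subst openin_subopen, intro ballI)
  fix x assume x: "x \<in> N"
  then obtain i where i: "i \<in> I" "x \<in> U i" using openin_subset[OF N] chart_cover by auto
  show "\<exists>T. openin L T \<and> x \<in> T \<and> T \<subseteq> N"
    using plaque_open[OF i(1) N, of "z i x"] x i(2) by (intro exI[of _ "{y \<in> N \<inter> U i. z i y = z i x}"]) auto
qed

lemma leaf_continuous_imp: "continuous_map T L f \<Longrightarrow> continuous_map T X f"
  using leaf_finer leaf_topspace by (auto simp: continuous_map_def)

text \<open>
  Every leaf neighbourhood of a point contains the trace of a neighbourhood in \<open>X\<close> on the plaque of
  this point, so on a single plaque both topologies agree.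
\<close>

lemma continuous_map_leafI:
  assumes "i \<in> I" "continuous_map T X f" "\<And>x. x \<in> topspace T \<Longrightarrow> f x \<in> U i \<and> z i (f x) = \<zeta>"
  shows "continuous_map T L f"
  unfolding continuous_map_def leaf_topspace
proof (intro conjI allI impI)
  show "f \<in> topspace T \<rightarrow> topspace X" using assms(3) chart_subset[OF assms(1)] by auto
  fix P assume P: "openin L P"
  show "openin T {x \<in> topspace T. f x \<in> P}"
  proof (subst openin_subopen, clarify)
    fix x assume x: "x \<in> topspace T" "f x \<in> P"
    obtain N where N: "openin X N" "f x \<in> N" "{y \<in> N \<inter> U i. z i y = z i (f x)} \<subseteq> P"
      using leaf_open[OF P x(2) assms(1)] assms(3)[OF x(1)] by blast
    show "\<exists>A. openin T A \<and> x \<in> A \<and> A \<subseteq> {x \<in> topspace T. f x \<in> P}"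
      using openin_continuous_map_preimage[OF assms(2) N(1)] N(2,3) x assms(3)
      by (intro exI[of _ "{x \<in> topspace T. f x \<in> N}"]) auto
  qed
qed

lemma transverse_coord_constant:
  assumes "continuous_map (top_of_set {a..b}) L c" "i \<in> I" "\<And>r. r \<in> {a..b} \<Longrightarrow> c r \<in> U i"
    and "r \<in> {a..b}" "r' \<in> {a..b::real}"
  shows "z i (c r) = z i (c r')"
proof -
  have "(\<lambda>r. z i (c r)) constant_on {a..b}"
  proof (rule locally_constant_imp_constant)
    fix r assume r: "r \<in> {a..b}"
    have "openin (top_of_set {a..b}) {x \<in> topspace (top_of_set {a..b}). c x \<in> {y \<in> topspace X \<inter> U i. z i y = z i (c r)}}"
      by (rule openin_continuous_map_preimage[OF assms(1) plaque_open[OF assms(2)]]) simp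
    then show "\<exists>T. openin (top_of_set {a..b}) T \<and> r \<in> T \<and> (\<forall>x\<in>T. z i (c x) = z i (c r))"
      using r assms(3)[OF r] chart_subset[OF assms(2)] by (intro exI conjI) auto
  qed simp
  then show ?thesis using assms(4,5) by (auto simp: constant_on_def)
qed

lemma pathin_transverse_coord:
  assumes "pathin L c" "i \<in> I" "\<And>r. r \<in> {0..1} \<Longrightarrow> c r \<in> U i"
  shows "z i (c 0) = z i (c 1)"
  by (rule transverse_coord_constant[OF assms(1)[unfolded pathin_def] assms(2,3)]) auto

definition segment :: "'i \<Rightarrow> 'x \<Rightarrow> 'x \<Rightarrow> real \<Rightarrow> 'x" where
  "segment i x y s = point i (\<lambda>k. (1 - s) * t i x k + s * t i y k) (z i x)"

lemma segment:
  assumes "i \<in> I" "x \<in> U i" "y \<in> U i" "z i x = z i y"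
  shows "segment i x y 0 = x" "segment i x y 1 = y"
    and "s \<in> {0..1} \<Longrightarrow> segment i x y s \<in> U i"
    and "s \<in> {0..1} \<Longrightarrow> t i (segment i x y s) = (\<lambda>k. (1 - s) * t i x k + s * t i y k)"
    and "s \<in> {0..1} \<Longrightarrow> z i (segment i x y s) = z i x"
  using point_in[OF assms(1) ball_convex[OF assms(1) coords_in(1)[OF assms(1,2)] coords_in(1)[OF assms(1,3)]] coords_in(2)[OF assms(1,2)], of s]
    point_coords[OF assms(1,2)] point_coords[OF assms(1,3)] assms(4)
  by (simp_all add: segment_def)

lemma segment_continuous:
  assumes "i \<in> I" "continuous_map T X f" "continuous_map T X g" "continuous_map T euclideanreal s"
    and x: "\<And>x. x \<in> topspace T \<Longrightarrow> f x \<in> U i \<and> g x \<in> U i \<and> z i (f x) = z i (g x) \<and> s x \<in> {0..1}"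
  shows "continuous_map T X (\<lambda>x. segment i (f x) (g x) (s x))"
  unfolding segment_def
proof (rule point_continuous[OF assms(1)])
  have "continuous_map T euclideanreal (\<lambda>x. t i (f x) k)" "continuous_map T euclideanreal (\<lambda>x. t i (g x) k)" for k
    using coords_continuous(1)[OF assms(1,2)] coords_continuous(1)[OF assms(1,3)] x
    by (auto intro: continuous_map_fun_component)
  then show "continuous_map T euclidean (\<lambda>x k. (1 - s x) * t i (f x) k + s x * t i (g x) k)"
    by (intro continuous_map_into_fun continuous_map_add continuous_map_real_mult continuous_map_diff assms(4))
      auto
  show "continuous_map T euclidean (\<lambda>x. z i (f x))"
    using coords_continuous(2)[OF assms(1,2)] x by blast
qed (use x ball_convex coords_in assms(1) in auto)

lemma pathin_segment:
  assumes "i \<in> I" "x \<in> U i" "y \<in> U i" "z i x = z i y"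
  shows "pathin L (segment i x y)"
  unfolding pathin_def
proof (rule continuous_map_leafI[OF assms(1)])
  show "continuous_map unit_interval X (segment i x y)"
    by (rule segment_continuous[OF assms(1), where f="\<lambda>_. x" and g="\<lambda>_. y" and s="\<lambda>r. r"])
      (use assms chart_subset[OF assms(1)] in auto)
qed (use segment[OF assms] in auto)

text \<open>
  Plaques are convex: the homotopy is the straight line between corresponding points.
\<close>

lemma plaque_paths_homotopic:
  assumes "i \<in> I" "pathin L \<gamma>" "pathin L \<delta>" "\<gamma> 0 = \<delta> 0" "\<gamma> 1 = \<delta> 1"
    and U: "\<And>r. r \<in> {0..1} \<Longrightarrow> \<gamma> r \<in> U i" "\<And>r. r \<in> {0..1} \<Longrightarrow> \<delta> r \<in> U i"
  shows "path_homotopic L \<gamma> \<delta>"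
proof -
  let ?P = "prod_topology unit_interval unit_interval"
  have zc: "z i (\<gamma> r) = z i (\<gamma> 0)" "z i (\<delta> r) = z i (\<gamma> 0)" if "r \<in> {0..1}" for r
    using transverse_coord_constant[OF assms(2)[unfolded pathin_def] assms(1) U(1) that, of 0]
      transverse_coord_constant[OF assms(3)[unfolded pathin_def] assms(1) U(2) that, of 0] assms(4) by auto
  have X: "continuous_map unit_interval X \<gamma>" "continuous_map unit_interval X \<delta>"
    using assms(2,3) leaf_continuous_imp by (auto simp: pathin_def)
  have "continuous_map ?P X (\<lambda>x. \<gamma> (snd x))" "continuous_map ?P X (\<lambda>x. \<delta> (snd x))"
    using X[THEN continuous_map_compose[OF continuous_map_snd]] unfolding o_def by blast+
  moreover have "continuous_map ?P euclideanreal fst"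
    using continuous_map_fst[of unit_interval unit_interval] unfolding continuous_map_in_subtopology by blast
  moreover have seg: "\<gamma> r \<in> U i \<and> \<delta> r \<in> U i \<and> z i (\<gamma> r) = z i (\<delta> r) \<and> s \<in> {0..1}"
    if "(s, r) \<in> topspace ?P" for s r using that U zc[of r] by simp
  ultimately have "continuous_map ?P X (\<lambda>x. segment i (\<gamma> (snd x)) (\<delta> (snd x)) (fst x))"
    by (intro segment_continuous[OF assms(1)]) auto
  then have "continuous_map ?P L (\<lambda>x. segment i (\<gamma> (snd x)) (\<delta> (snd x)) (fst x))"
  proof (rule continuous_map_leafI[OF assms(1), where \<zeta>="z i (\<gamma> 0)"])
    fix x assume "x \<in> topspace ?P"
    then show "segment i (\<gamma> (snd x)) (\<delta> (snd x)) (fst x) \<in> U i \<and>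
        z i (segment i (\<gamma> (snd x)) (\<delta> (snd x)) (fst x)) = z i (\<gamma> 0)"
      using segment(3,5)[OF assms(1), of "\<gamma> (snd x)" "\<delta> (snd x)" "fst x"] seg[of "fst x" "snd x"] zc[of "snd x"]
      by (cases x) simp
  qed
  then have c: "continuous_map ?P L (\<lambda>(s, r). segment i (\<gamma> r) (\<delta> r) s)" by (simp add: case_prod_unfold)
  have "segment i (\<gamma> r) (\<delta> r) 0 = \<gamma> r" "segment i (\<gamma> r) (\<delta> r) 1 = \<delta> r" if "r \<in> {0..1}" for r
    using segment(1,2)[OF assms(1) U(1)[OF that] U(2)[OF that]] zc(1)[OF that] zc(2)[OF that] by metis+
  moreover have "segment i x x s = x" if "x \<in> U i" for x s
    using point_coords[OF assms(1) that] by (simp add: segment_def algebra_simps)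
  then have "segment i (\<gamma> 0) (\<delta> 0) s = \<gamma> 0" "segment i (\<gamma> 1) (\<delta> 1) s = \<gamma> 1" for s
    using U assms(4,5) by auto
  ultimately show ?thesis
    unfolding path_homotopic_iff using c by (intro exI[of _ "\<lambda>s r. segment i (\<gamma> r) (\<delta> r) s"]) auto
qed

text \<open>
  Homotopies inside a plaque must be kept inside a prescribed neighbourhood; a product
  neighbourhood with a convex factor in the leaf direction does this.
\<close>

lemma plaque_convex_nbhd:
  assumes "i \<in> I" "openin X N" "y \<in> N" "y \<in> U i"
  obtains Q where "openin X Q" "y \<in> Q" "Q \<subseteq> N \<inter> U i"
    "\<And>x x' s. x \<in> Q \<Longrightarrow> x' \<in> Q \<Longrightarrow> z i x = z i x' \<Longrightarrow> s \<in> {0..1} \<Longrightarrow> segment i x x' s \<in> Q"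
proof -
  let ?\<phi> = "\<lambda>x. (t i x, z i x)"
  have "openin (subtopology X (U i)) (N \<inter> U i)" using assms(2) by (auto simp: openin_subtopology)
  then have "openin (top_of_set (B i \<times> Z i)) (?\<phi> ` (N \<inter> U i))"
    using homeomorphic_imp_open_map[OF chart_homeo[OF assms(1)]] by (simp add: open_map_def)
  then obtain A where A: "open A" "?\<phi> ` (N \<inter> U i) = A \<inter> (B i \<times> Z i)"
    by (auto simp: openin_subtopology)
  then obtain A1 A2 where A12: "open A1" "open A2" "t i y \<in> A1" "z i y \<in> A2" "A1 \<times> A2 \<subseteq> A"
  proof -
    have "(t i y, z i y) \<in> A" using A(2) assms(3,4) by blast
    from open_prod_elim[OF A(1) this] show ?thesis using that by (metis mem_Sigma_iff)
  qed
  obtain C where C: "open C" "t i y \<in> C" "C \<subseteq> A1"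
    "\<And>y y' s. y \<in> C \<Longrightarrow> y' \<in> C \<Longrightarrow> s \<in> {0..1} \<Longrightarrow> (\<lambda>k. (1 - s) * y k + s * y' k) \<in> C"
    by (rule open_contains_convex_box[OF A12(1,3)]) (rule that)
  define Q where "Q = {x \<in> U i. t i x \<in> C \<and> z i x \<in> A2}"
  have "openin (subtopology X (U i)) Q"
  proof -
    have "Q = {x \<in> topspace (subtopology X (U i)). t i x \<in> C} \<inter> {x \<in> topspace (subtopology X (U i)). z i x \<in> A2}"
      using chart_subset[OF assms(1)] by (auto simp: Q_def)
    then show ?thesis
      using openin_continuous_map_preimage[OF chart_continuous(1)[OF assms(1)], of C]
        openin_continuous_map_preimage[OF chart_continuous(2)[OF assms(1)], of A2] C(1) A12(2) by auto
  qed
  then have "openin X Q" using chart_open[OF assms(1)] openin_trans_full by blast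
  moreover have "y \<in> Q" using assms(4) C(2) A12(4) by (simp add: Q_def)
  moreover have "Q \<subseteq> N \<inter> U i"
  proof
    fix x assume x: "x \<in> Q"
    then have "?\<phi> x \<in> A \<inter> (B i \<times> Z i)" using A12(5) C(3) coords_in[OF assms(1)] by (auto simp: Q_def)
    then obtain x' where x': "x' \<in> N \<inter> U i" "?\<phi> x = ?\<phi> x'" unfolding A(2)[symmetric] by auto
    then have "x = x'" using coords_inj[OF assms(1)] x by (auto simp: Q_def)
    then show "x \<in> N \<inter> U i" using x'(1) by simp
  qed
  moreover have "segment i x x' s \<in> Q" if "x \<in> Q" "x' \<in> Q" "z i x = z i x'" "s \<in> {0..1}" for x x' s
    using segment[OF assms(1), of x x'] that C(4) by (auto simp: Q_def)
  ultimately show ?thesis by (rule that)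
qed


subsection \<open>Extending a leafwise path\<close>

definition partial_family :: "'x set \<Rightarrow> (real \<Rightarrow> 'x) \<Rightarrow> real \<Rightarrow> 'x set \<Rightarrow> ('x \<Rightarrow> real \<Rightarrow> 'x) \<Rightarrow> bool" where
  "partial_family S \<gamma> b W H \<longleftrightarrow> openin (subtopology X S) W \<and> \<gamma> 0 \<in> W \<and>
     continuous_map (prod_topology (subtopology X W) (top_of_set {0..b})) X (\<lambda>(w, r). H w r) \<and>
     (\<forall>w\<in>W. continuous_map (top_of_set {0..b}) L (H w) \<and> H w 0 = w) \<and> (\<forall>r\<in>{0..b}. H (\<gamma> 0) r = \<gamma> r)"

lemma continuous_map_glue_path:
  fixes a b e :: real
  assumes "continuous_map (top_of_set {a..b}) Y f" "continuous_map (top_of_set {b..e}) Y g"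
    and "f b = g b" "a \<le> b" "b \<le> e"
  shows "continuous_map (top_of_set {a..e}) Y (\<lambda>r. if r \<le> b then f r else g r)"
proof -
  have "continuous_map (prod_topology (discrete_topology {()}) (top_of_set {a..e})) Y
     (\<lambda>(x, r). if r \<le> b then (\<lambda>(x, r). f r) (x, r) else (\<lambda>(x, r). g r) (x, r))"
    by (rule continuous_map_glue[OF continuous_map_const_family continuous_map_const_family]) (use assms in auto)
  from continuous_map_slice[OF this[unfolded prod.case], of "()"] show ?thesis by simp
qed

text \<open>
  Inside one chart a family is prolonged by keeping the transverse coordinate and following
  \<open>t \<circ> \<gamma>\<close>, displaced by an error which decreases linearly from its value at time \<open>a\<close> to \<open>0\<close>.  The
  prolonged paths thus end on the slice \<open>t = t (\<gamma> b)\<close>; in the last chart this slice is the transversal.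
\<close>

lemma partial_family_step:
  assumes \<gamma>: "pathin L \<gamma>" and "0 \<le> a" "a < b" "b \<le> 1" and j: "j \<in> I"
    and U: "\<And>r. r \<in> {a..b} \<Longrightarrow> \<gamma> r \<in> U j" and S: "S \<subseteq> topspace X" and pf: "partial_family S \<gamma> a W H"
  obtains W' H' where "partial_family S \<gamma> b W' H'" "\<And>w. w \<in> W' \<Longrightarrow> H' w b \<in> U j \<and> t j (H' w b) = t j (\<gamma> b)"
proof -
  let ?p = "\<gamma> 0"
  have W: "openin (subtopology X S) W" "?p \<in> W"
    and Hc: "continuous_map (prod_topology (subtopology X W) (top_of_set {0..a})) X (\<lambda>(w, r). H w r)"
    and HL: "\<And>w. w \<in> W \<Longrightarrow> continuous_map (top_of_set {0..a}) L (H w)" "\<And>w. w \<in> W \<Longrightarrow> H w 0 = w"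
    and Hp: "\<And>r. r \<in> {0..a} \<Longrightarrow> H ?p r = \<gamma> r"
    using pf by (auto simp: partial_family_def)
  have WX: "W \<subseteq> topspace X" using openin_subset[OF W(1)] S by auto
  have "continuous_map (prod_topology (subtopology X W) (top_of_set {a})) X (\<lambda>(w, r). H w r)"
    using continuous_map_from_subtopology[OF Hc, of "UNIV \<times> {a}"] assms(2)
    by (simp add: subtopology_Times subtopology_subtopology)
  from tube_near_slice[OF this _ _ chart_open[OF j], of ?p] obtain W1 where
    W1: "openin (subtopology X W) W1" "?p \<in> W1" "\<And>w. w \<in> W1 \<Longrightarrow> H w a \<in> U j"
    using W(2) WX Hp[of a] U[of a] assms(2,3) by auto
  have W1W: "W1 \<subseteq> W" using openin_subset[OF W1(1)] by auto
  have W1o: "openin (subtopology X S) W1" using openin_subtopology_trans[OF W(1) W1(1)] .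
  let ?T = "subtopology X W1"
  have tT: "topspace ?T = W1" using W1W WX by auto
  have Ha: "continuous_map ?T X (\<lambda>w. H w a)"
  proof -
    have "continuous_map ?T (prod_topology (subtopology X W) (top_of_set {0..a})) (\<lambda>w. (w, a))"
      using W1W assms(2) by (auto simp: continuous_map_pairwise o_def continuous_map_in_subtopology)
    from continuous_map_compose[OF this Hc] show ?thesis by (simp add: o_def)
  qed
  define u where "u w r k = t j (\<gamma> r) k + (b - r) / (b - a) * (t j (H w a) k - t j (\<gamma> a) k)" for w r k
  let ?P = "prod_topology ?T (top_of_set {a..b})"
  have \<gamma>X: "continuous_map (top_of_set {a..b}) X \<gamma>"
    using continuous_map_from_subtopology[OF leaf_continuous_imp[OF \<gamma>[unfolded pathin_def]], of "{a..b}"] assms(2-4)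
    by (simp add: subtopology_subtopology min_absorb2 max_absorb2)
  have fst: "continuous_map ?P ?T fst" and snd: "continuous_map ?P (top_of_set {a..b}) snd"
    by (rule continuous_map_fst continuous_map_snd)+
  have tc: "continuous_map ?P euclideanreal (\<lambda>x. t j (\<gamma> (snd x)) k)"
    "continuous_map ?P euclideanreal (\<lambda>x. t j (H (fst x) a) k)" for k
  proof -
    have "continuous_map (top_of_set {a..b}) euclideanreal (\<lambda>r. t j (\<gamma> r) k)"
      by (rule continuous_map_fun_component[OF coords_continuous(1)[OF j \<gamma>X]]) (use U in auto)
    from continuous_map_compose[OF snd this]
    show "continuous_map ?P euclideanreal (\<lambda>x. t j (\<gamma> (snd x)) k)" by (simp add: o_def)
    have "continuous_map ?T euclideanreal (\<lambda>w. t j (H w a) k)"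
      by (rule continuous_map_fun_component[OF coords_continuous(1)[OF j Ha]]) (use W1 tT in auto)
    from continuous_map_compose[OF fst this]
    show "continuous_map ?P euclideanreal (\<lambda>x. t j (H (fst x) a) k)" by (simp add: o_def)
  qed
  have uc: "continuous_map ?P euclidean (\<lambda>(w, r). u w r)"
  proof -
    have "continuous_map ?P euclideanreal snd"
      using snd unfolding continuous_map_in_subtopology by blast
    then have "continuous_map ?P euclidean (\<lambda>x. u (fst x) (snd x))"
      unfolding u_def using assms(3)
      by (intro continuous_map_into_fun continuous_map_add continuous_map_real_mult continuous_map_diff
          continuous_map_real_divide tc continuous_map_canonical_const) auto
    then show ?thesis by (simp add: case_prod_unfold)
  qed
  obtain O' where O': "open O'" "B j = {\<tau> \<in> O'. \<forall>k\<ge>d. \<tau> k = 0}" using ball_open[OF j] by blast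
  have up: "u ?p r = t j (\<gamma> r)" if "r \<in> {a..b}" for r
    using Hp[of a] assms(2) by (simp add: u_def fun_eq_iff)
  have "\<exists>W2. openin ?T W2 \<and> ?p \<in> W2 \<and> (\<forall>w\<in>W2. \<forall>r\<in>{a..b}. u w r \<in> O')"
  proof (rule tube_near_slice[OF uc])
    show "?p \<in> topspace ?T" using W1(2) tT by simp
    show "u ?p r \<in> O'" if "r \<in> {a..b}" for r
      using up[OF that] coords_in(1)[OF j U[OF that]] O'(2) by simp
  qed (use O'(1) in auto)
  then obtain W2 where W2: "openin ?T W2" "?p \<in> W2" "\<And>w r. w \<in> W2 \<Longrightarrow> r \<in> {a..b} \<Longrightarrow> u w r \<in> O'"
    by blast
  have W2o: "openin (subtopology X S) W2" using openin_subtopology_trans[OF W1o W2(1)] .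
  have W2W: "W2 \<subseteq> W1" using openin_subset[OF W2(1)] by auto
  have Ht: "t j (H w a) \<in> B j" "z j (H w a) \<in> Z j" if "w \<in> W1" for w using coords_in[OF j W1(3)[OF that]] .
  have uB: "u w r \<in> B j" if "w \<in> W2" "r \<in> {a..b}" for w r
  proof -
    have "u w r k = 0" if k: "k \<ge> d" for k
      using coords_in(1)[OF j U[OF \<open>r \<in> {a..b}\<close>]] coords_in(1)[OF j U[of a]] Ht(1)[of w] assms(3) k W2W \<open>w \<in> W2\<close>
      by (auto simp: u_def O'(2))
    then show ?thesis using W2(3)[OF that] O'(2) by auto
  qed
  define G where "G w r = point j (u w r) (z j (H w a))" for w r
  define H' where "H' w r = (if r \<le> a then H w r else G w r)" for w r
  have G: "G w r \<in> U j" "t j (G w r) = u w r" "z j (G w r) = z j (H w a)" if "w \<in> W2" "r \<in> {a..b}" for w r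
    using point_in[OF j uB[OF that] Ht(2)[of w]] W2W that(1) by (auto simp: G_def)
  have Ga: "G w a = H w a" if "w \<in> W2" for w
  proof -
    have "u w a = t j (H w a)" using assms(3) by (auto simp: u_def)
    then show ?thesis using point_coords[OF j W1(3)] that W2W by (auto simp: G_def)
  qed
  let ?T2 = "subtopology X W2"
  have T2: "topspace ?T2 = W2" using W2W tT by auto
  have Gc: "continuous_map (prod_topology ?T2 (top_of_set {a..b})) X (\<lambda>(w, r). G w r)"
  proof -
    have *: "subtopology ?P (W2 \<times> UNIV) = prod_topology ?T2 (top_of_set {a..b})"
      using W2W by (simp add: subtopology_Times subtopology_subtopology inf_absorb2)
    have "continuous_map ?P euclidean (\<lambda>x. z j (H (fst x) a))"
      using continuous_map_compose[OF fst coords_continuous(2)[OF j Ha]] W1(3) tT by (simp add: o_def)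
    from continuous_map_from_subtopology[OF this, of "W2 \<times> UNIV"] continuous_map_from_subtopology[OF uc, of "W2 \<times> UNIV"]
    have "continuous_map (prod_topology ?T2 (top_of_set {a..b})) X (\<lambda>x. point j ((\<lambda>(w, r). u w r) x) (z j (H (fst x) a)))"
      unfolding * by (intro point_continuous[OF j]) (use T2 uB Ht(2) W2W in auto)
    then show ?thesis by (simp add: G_def case_prod_unfold)
  qed
  have "partial_family S \<gamma> b W2 H'"
    unfolding partial_family_def
  proof (intro conjI ballI)
    show "openin (subtopology X S) W2" "\<gamma> 0 \<in> W2" by fact+
    have "continuous_map (prod_topology ?T2 (top_of_set {0..a})) X (\<lambda>(w, r). H w r)"
      using continuous_map_from_subtopology[OF Hc, of "W2 \<times> UNIV"] W2W W1W
      by (simp add: subtopology_Times subtopology_subtopology inf_absorb2)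
    from continuous_map_glue[OF this Gc] Ga T2 assms(2,3)
    have "continuous_map (prod_topology ?T2 (top_of_set {0..b})) X (\<lambda>(w, r). if r \<le> a then H w r else G w r)"
      by auto
    then show "continuous_map (prod_topology ?T2 (top_of_set {0..b})) X (\<lambda>(w, r). H' w r)"
      by (simp add: H'_def)
  next
    fix w assume w: "w \<in> W2"
    then have wW: "w \<in> W" using W2W W1W by auto
    have "continuous_map (top_of_set {a..b}) L (G w)"
      by (rule continuous_map_leafI[OF j continuous_map_slice[OF Gc], where \<zeta>="z j (H w a)"]) (use w T2 G in auto)
    from continuous_map_glue_path[OF HL(1)[OF wW] this Ga[OF w, symmetric]] assms(2,3)
    show "continuous_map (top_of_set {0..b}) L (H' w)" by (simp add: H'_def[abs_def])
    show "H' w 0 = w" using HL(2)[OF wW] assms(2) by (simp add: H'_def)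
  next
    fix r assume r: "r \<in> {0..b}"
    show "H' (\<gamma> 0) r = \<gamma> r"
    proof (cases "r \<le> a")
      case True
      then show ?thesis using Hp r by (simp add: H'_def)
    next
      case False
      then have r': "r \<in> {a..b}" using r by simp
      have "continuous_map (top_of_set {a..b}) L \<gamma>"
        using continuous_map_from_subtopology[OF \<gamma>[unfolded pathin_def], of "{a..b}"] assms(2-4)
        by (simp add: subtopology_subtopology min_absorb2 max_absorb2)
      from transverse_coord_constant[OF this j U, of a r] r'
      have "z j (\<gamma> a) = z j (\<gamma> r)" by auto
      then have "G (\<gamma> 0) r = \<gamma> r"
        using up[OF r'] Hp[of a] assms(2) point_coords[OF j U[OF r']] by (simp add: G_def)
      then show ?thesis using False by (simp add: H'_def)
    qed
  qed
  moreover have "H' w b \<in> U j \<and> t j (H' w b) = t j (\<gamma> b)" if "w \<in> W2" for w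
    using G[OF that, of b] assms(3) by (auto simp: H'_def u_def)
  ultimately show ?thesis by (rule that)
qed

lemma path_stays_in_chart:
  assumes "pathin L \<gamma>" "x \<in> {0..1}"
  obtains i e where "i \<in> I" "e > 0" "\<And>r. r \<in> {0..1} \<Longrightarrow> \<bar>r - x\<bar> < e \<Longrightarrow> \<gamma> r \<in> U i"
proof -
  have c: "continuous_map unit_interval X \<gamma>" using assms(1) leaf_continuous_imp by (simp add: pathin_def)
  then have "\<gamma> x \<in> topspace X" using assms(2) by (auto simp: continuous_map_def)
  then obtain i where i: "i \<in> I" "\<gamma> x \<in> U i" using chart_cover by auto
  have "openin unit_interval {r \<in> topspace unit_interval. \<gamma> r \<in> U i}"
    by (rule openin_continuous_map_preimage[OF c chart_open[OF i(1)]])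
  then obtain e where "e > 0" "\<And>r. r \<in> {0..1} \<Longrightarrow> \<bar>r - x\<bar> < e \<Longrightarrow> r \<in> {r \<in> topspace unit_interval. \<gamma> r \<in> U i}"
    by (rule openin_unit_interval_ball[of _ x]) (use i assms(2) in auto)
  with that[OF i(1)] show ?thesis by auto
qed

text \<open>
  A family is prolonged over every interval on which \<open>\<gamma>\<close> stays in one chart; since such intervals
  surround every point of \<open>[0, 1]\<close>, finitely many of them suffice.
\<close>

lemma partial_family_exists:
  assumes \<gamma>: "pathin L \<gamma>" and S: "\<gamma> 0 \<in> S" "S \<subseteq> topspace X" and "0 \<le> b" "b \<le> 1"
  shows "\<exists>W H. partial_family S \<gamma> b W H"
proof -
  let ?Q = "\<lambda>b. \<exists>W H. partial_family S \<gamma> b W H"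
  have "partial_family S \<gamma> 0 S (\<lambda>w r. w)"
    unfolding partial_family_def
  proof (intro conjI ballI)
    show "openin (subtopology X S) S" using openin_topspace[of "subtopology X S"] S(2) by (simp add: inf_absorb2)
    have "continuous_map (prod_topology (subtopology X S) (top_of_set {0..0::real})) X fst"
      using continuous_map_fst[of "subtopology X S" "top_of_set {0..0::real}"] unfolding continuous_map_in_subtopology by blast
    then show "continuous_map (prod_topology (subtopology X S) (top_of_set {0..0::real})) X (\<lambda>(w, r). w)"
      by (simp add: case_prod_unfold)
  qed (use S leaf_topspace in auto)
  then have "?Q 0" by blast
  moreover have "(0::real) \<le> 0 \<longrightarrow> b \<le> 1 \<longrightarrow> ?Q 0 \<longrightarrow> ?Q b"
  proof (rule Bolzano[where P="\<lambda>a b. 0 \<le> a \<longrightarrow> b \<le> 1 \<longrightarrow> ?Q a \<longrightarrow> ?Q b", OF \<open>0 \<le> b\<close>])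
    fix x assume "0 \<le> x" "x \<le> b"
    then have "x \<in> {0..1}" using \<open>b \<le> 1\<close> by auto
    then obtain i e where
      e: "i \<in> I" "e > 0" "\<And>r. r \<in> {0..1} \<Longrightarrow> \<bar>r - x\<bar> < e \<Longrightarrow> \<gamma> r \<in> U i"
      using path_stays_in_chart[OF \<gamma>] by metis
    show "\<exists>d>0. \<forall>a b. a \<le> x \<and> x \<le> b \<and> b - a < d \<longrightarrow> 0 \<le> a \<longrightarrow> b \<le> 1 \<longrightarrow> ?Q a \<longrightarrow> ?Q b"
    proof (intro exI[of _ e] conjI allI impI)
      fix a b assume ab: "a \<le> x \<and> x \<le> b \<and> b - a < e" "0 \<le> a" "b \<le> 1" and "?Q a"
      then obtain W H where WH: "partial_family S \<gamma> a W H" by blast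
      show "?Q b"
      proof (cases "a = b")
        case True then show ?thesis using \<open>?Q a\<close> by simp
      next
        case False
        then have "a < b" using ab(1) by simp
        moreover have "\<gamma> r \<in> U i" if "r \<in> {a..b}" for r using e(3)[of r] ab that by auto
        ultimately obtain W' H' where "partial_family S \<gamma> b W' H'"
          by (rule partial_family_step[OF \<gamma> ab(2) _ ab(3) e(1) _ S(2) WH])
        then show ?thesis by blast
      qed
    qed (rule e(2))
  qed auto
  ultimately show ?thesis using assms(5) by simp
qed

text \<open>
  The last prolongation takes place in the chart of the target transversal, which moves all end
  points onto this transversal.
\<close>

theorem leafwise_family_exists:
  assumes \<gamma>: "pathin L \<gamma>" and S: "\<gamma> 0 \<in> S" "S \<subseteq> topspace X" and j: "j \<in> I" "\<gamma> 1 \<in> transv j"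
  obtains W H where "leafwise_family X L S (transv j) W H" "\<gamma> 0 \<in> W" "\<And>r. r \<in> {0..1} \<Longrightarrow> H (\<gamma> 0) r = \<gamma> r"
proof -
  have c: "continuous_map unit_interval X \<gamma>" using \<gamma> leaf_continuous_imp by (simp add: pathin_def)
  have "openin unit_interval {r \<in> topspace unit_interval. \<gamma> r \<in> U j}"
    by (rule openin_continuous_map_preimage[OF c chart_open[OF j(1)]])
  then obtain e where e: "e > 0" "\<And>r. r \<in> {0..1} \<Longrightarrow> \<bar>r - 1\<bar> < e \<Longrightarrow> r \<in> {r \<in> topspace unit_interval. \<gamma> r \<in> U j}"
    by (rule openin_unit_interval_ball[of _ 1]) (use j in \<open>auto simp: transv_def\<close>)
  define a where "a = max 0 (1 - e / 2)"
  have a: "0 \<le> a" "a < 1" "1 - a < e" using e(1) by (auto simp: a_def)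
  obtain W H where "partial_family S \<gamma> a W H" using partial_family_exists[OF \<gamma> S a(1)] a(2) by auto
  moreover have "\<gamma> r \<in> U j" if "r \<in> {a..1}" for r using e(2)[of r] a that by auto
  ultimately obtain W H where *: "partial_family S \<gamma> 1 W H" "\<And>w. w \<in> W \<Longrightarrow> H w 1 \<in> U j \<and> t j (H w 1) = t j (\<gamma> 1)"
    using partial_family_step[OF \<gamma> a(1,2) order_refl j(1) _ S(2)] by metis
  then have "leafwise_family X L S (transv j) W H"
    using j(2) by (auto simp: leafwise_family_def partial_family_def pathin_def transv_def)
  then show ?thesis using that *(1) by (auto simp: partial_family_def)
qed


subsection \<open>Extending a leafwise homotopy\<close>

definition family_through :: "'x set \<Rightarrow> 'i \<Rightarrow> (real \<Rightarrow> 'x) \<Rightarrow> 'x set \<Rightarrow> ('x \<Rightarrow> real \<Rightarrow> 'x) \<Rightarrow> bool" where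
  "family_through S j \<gamma> W H \<longleftrightarrow> leafwise_family X L S (transv j) W H \<and> \<gamma> 0 \<in> W \<and> (\<forall>r\<in>{0..1}. H (\<gamma> 0) r = \<gamma> r)"

lemma family_throughD:
  assumes "family_through S j \<gamma> W H" "S \<subseteq> topspace X"
  shows "openin (subtopology X S) W" "\<gamma> 0 \<in> W" "W \<subseteq> topspace X"
    and "continuous_map (prod_topology (subtopology X W) unit_interval) X (\<lambda>(w, r). H w r)"
    and "w \<in> W \<Longrightarrow> pathin L (H w)" "w \<in> W \<Longrightarrow> H w 0 = w" "w \<in> W \<Longrightarrow> H w 1 \<in> transv j"
    and "r \<in> {0..1} \<Longrightarrow> H (\<gamma> 0) r = \<gamma> r"
  using assms openin_subset[of "subtopology X S" W] by (auto simp: family_through_def leafwise_family_def)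

lemma family_tube:
  assumes "family_through S j \<gamma> W H" "S \<subseteq> topspace X" "openin X N" "0 \<le> a" "b \<le> 1"
    and "\<And>r. r \<in> {a..b} \<Longrightarrow> \<gamma> r \<in> N"
  obtains W' where "openin (subtopology X S) W'" "\<gamma> 0 \<in> W'" "W' \<subseteq> W" "\<And>w r. w \<in> W' \<Longrightarrow> r \<in> {a..b} \<Longrightarrow> H w r \<in> N"
proof -
  note F = family_throughD[OF assms(1,2)]
  have "continuous_map (prod_topology (subtopology X W) (top_of_set {a..b})) X (\<lambda>(w, r). H w r)"
    using continuous_map_from_subtopology[OF F(4), of "UNIV \<times> {a..b}"] assms(4,5)
    by (simp add: subtopology_Times subtopology_subtopology min_absorb2 max_absorb2)
  then have "\<exists>W'. openin (subtopology X W) W' \<and> \<gamma> 0 \<in> W' \<and> (\<forall>w\<in>W'. \<forall>r\<in>{a..b}. H w r \<in> N)"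
    by (rule tube_near_slice[OF _ _ _ assms(3)]) (use F(2,3) F(8) assms(4-6) in auto)
  then obtain W' where W': "openin (subtopology X W) W'" "\<gamma> 0 \<in> W'" "\<And>w r. w \<in> W' \<Longrightarrow> r \<in> {a..b} \<Longrightarrow> H w r \<in> N"
    by blast
  show ?thesis
    using that[OF openin_subtopology_trans[OF F(1) W'(1)] W'(2) _ W'(3)] openin_subset[OF W'(1)] by auto
qed

text \<open>
  At time \<open>r\<close> the families \<open>H\<close> and \<open>H'\<close> agree up to homotopy along a leafwise path inside \<open>N\<close>.
  For the induction over \<open>r\<close> it matters that \<open>N\<close> can be taken arbitrarily small: this lets
  the connecting path be seen in two consecutive charts.
\<close>

definition connected_within :: "'x set \<Rightarrow> real \<Rightarrow> 'x \<Rightarrow> ('x \<Rightarrow> real \<Rightarrow> 'x) \<Rightarrow> ('x \<Rightarrow> real \<Rightarrow> 'x) \<Rightarrow> bool" where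
  "connected_within N r w H H' \<longleftrightarrow> (\<exists>c. pathin L c \<and> c ` {0..1} \<subseteq> N \<and> c 0 = H w r \<and> c 1 = H' w r \<and>
     path_homotopic L (path_join (subpath_on (H w) 0 r) c) (subpath_on (H' w) 0 r))"

definition close_at :: "'x set \<Rightarrow> 'i \<Rightarrow> (real \<Rightarrow> real \<Rightarrow> 'x) \<Rightarrow> real \<Rightarrow> real \<Rightarrow> bool" where
  "close_at S j K s0 r \<longleftrightarrow> (\<forall>N. openin X N \<longrightarrow> K s0 r \<in> N \<longrightarrow>
     (\<exists>\<epsilon>>0. \<forall>s\<in>{0..1}. \<bar>s - s0\<bar> < \<epsilon> \<longrightarrow> (\<forall>W H W' H'.
        family_through S j (K s0) W H \<longrightarrow> family_through S j (K s) W' H' \<longrightarrow>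
        (\<exists>W0. openin (subtopology X S) W0 \<and> K s0 0 \<in> W0 \<and> W0 \<subseteq> W \<inter> W' \<and>
           (\<forall>w\<in>W0. connected_within N r w H H')))))"

text \<open>
  Between the times \<open>a\<close> and \<open>b\<close> the two paths run in one chart. Together with the connecting path at
  time \<open>a\<close> and the segment at time \<open>b\<close> they bound a square inside one plaque, which can be filled.
\<close>

lemma connected_within_step:
  assumes i: "i \<in> I" and ab: "0 \<le> a" "a \<le> b" "b \<le> 1" and H: "pathin L (H w)" "pathin L (H' w)"
    and U: "\<And>r. r \<in> {a..b} \<Longrightarrow> H w r \<in> U i" "\<And>r. r \<in> {a..b} \<Longrightarrow> H' w r \<in> U i"
    and Q: "H w b \<in> Q" "H' w b \<in> Q" "Q \<subseteq> N"
      "\<And>x x' s. x \<in> Q \<Longrightarrow> x' \<in> Q \<Longrightarrow> z i x = z i x' \<Longrightarrow> s \<in> {0..1} \<Longrightarrow> segment i x x' s \<in> Q"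
    and con: "connected_within (U i) a w H H'"
  shows "connected_within N b w H H'"
proof -
  obtain c where c: "pathin L c" "c ` {0..1} \<subseteq> U i" "c 0 = H w a" "c 1 = H' w a"
    "path_homotopic L (path_join (subpath_on (H w) 0 a) c) (subpath_on (H' w) 0 a)"
    using con by (auto simp: connected_within_def)
  let ?A = "subpath_on (H w) 0 a" and ?A' = "subpath_on (H' w) 0 a"
  let ?B = "subpath_on (H w) a b" and ?B' = "subpath_on (H' w) a b"
  let ?c = "segment i (H w b) (H' w b)"
  have p: "pathin L ?A" "pathin L ?A'" "pathin L ?B" "pathin L ?B'"
    using pathin_subpath[OF H(1)] pathin_subpath[OF H(2)] ab by auto
  have inU: "?B r \<in> U i" "?B' r \<in> U i" if "r \<in> {0..1}" for r
    using U affine_interval[OF ab(2) that] by (auto simp: subpath_on_def)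
  have "z i (H w b) = z i (H w a)" "z i (H' w a) = z i (H' w b)"
    using pathin_transverse_coord[OF p(3) i inU(1)] pathin_transverse_coord[OF p(4) i inU(2)] by simp_all
  moreover have "z i (c 0) = z i (c 1)"
    using pathin_transverse_coord[OF c(1) i] c(2) by blast
  ultimately have zb: "z i (H w b) = z i (H' w b)" using c(3,4) by simp
  have bU: "H w b \<in> U i" "H' w b \<in> U i" using U ab(2) by auto
  note seg = segment[OF i bU zb]
  have pc: "pathin L ?c" using pathin_segment[OF i bU zb] .
  have "path_homotopic L (path_join ?B ?c) (path_join c ?B')"
  proof (rule plaque_paths_homotopic[OF i])
    show "pathin L (path_join ?B ?c)" using p(3) pc seg(1) by (intro pathin_path_join) auto
    show "pathin L (path_join c ?B')" using p(4) c(1,4) by (intro pathin_path_join) auto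
    fix r :: real assume r: "r \<in> {0..1}"
    show "path_join ?B ?c r \<in> U i"
      using r inU(1)[of "2 * r"] seg(3)[of "2 * r - 1"] by (auto simp: path_join_def)
    show "path_join c ?B' r \<in> U i"
      using r c(2) inU(2)[of "2 * r - 1"] by (auto simp: path_join_def)
  qed (use c(3,4) seg in auto)
  note sq = this
  have e: "?A 1 = ?B 0" "?A' 1 = ?B' 0" "?B 1 = ?c 0" "?A 1 = c 0" "c 1 = ?B' 0" using c(3,4) seg(1) by auto
  have "path_homotopic L (path_join (subpath_on (H w) 0 b) ?c) (path_join (path_join ?A ?B) ?c)"
    using path_homotopic_sym[OF subpath_homotopic_join[OF H(1) order_refl ab]] path_homotopic_refl[OF pc] seg(1)
    by (intro path_homotopic_join) auto
  also have "path_homotopic L \<dots> (path_join ?A (path_join ?B ?c))"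
    using e p pc by (intro path_homotopic_assoc) auto
  also have "path_homotopic L \<dots> (path_join ?A (path_join c ?B'))"
    using e by (intro path_homotopic_join[OF path_homotopic_refl[OF p(1)] sq]) auto
  also have "path_homotopic L \<dots> (path_join (path_join ?A c) ?B')"
    using e p c(1) by (intro path_homotopic_sym[OF path_homotopic_assoc]) auto
  also have "path_homotopic L \<dots> (path_join ?A' ?B')"
    using e by (intro path_homotopic_join[OF c(5) path_homotopic_refl[OF p(4)]]) auto
  also have "path_homotopic L \<dots> (subpath_on (H' w) 0 b)"
    by (rule subpath_homotopic_join[OF H(2) order_refl ab])
  finally have "path_homotopic L (path_join (subpath_on (H w) 0 b) ?c) (subpath_on (H' w) 0 b)" .
  moreover have "?c ` {0..1} \<subseteq> N" using Q(3) Q(4)[OF Q(1,2) zb] by auto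
  ultimately show ?thesis
    unfolding connected_within_def using pc seg(1,2) by (intro exI[of _ ?c]) auto
qed

text \<open>
  Here \<open>K\<close> is a leafwise homotopy with fixed starting point \<open>p\<close>: the families through the paths \<open>K s\<close>
  and \<open>K s'\<close> consist of homotopic paths near \<open>p\<close>.
\<close>

definition ends_homotopic ::
    "'x set \<Rightarrow> 'i \<Rightarrow> (real \<Rightarrow> real \<Rightarrow> 'x) \<Rightarrow> 'x \<Rightarrow> real \<Rightarrow> real \<Rightarrow> bool" where
  "ends_homotopic S j K p s s' \<longleftrightarrow> (\<forall>W H W' H'. family_through S j (K s) W H \<longrightarrow> family_through S j (K s') W' H' \<longrightarrow>
     (\<exists>W0. openin (subtopology X S) W0 \<and> p \<in> W0 \<and> W0 \<subseteq> W \<inter> W' \<and> (\<forall>w\<in>W0. path_homotopic L (H w) (H' w))))"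

context
  fixes S :: "'x set" and j :: 'i and K :: "real \<Rightarrow> real \<Rightarrow> 'x" and p :: 'x
  assumes S: "S \<subseteq> topspace X" and j: "j \<in> I"
    and K: "continuous_map (prod_topology unit_interval unit_interval) L (\<lambda>(s, r). K s r)"
    and K0: "\<And>s. s \<in> {0..1} \<Longrightarrow> K s 0 = p" and p: "p \<in> S"
begin

lemma K_near:
  assumes "s0 \<in> {0..1}" "openin X N" "0 \<le> a" "b \<le> 1" "\<And>r. r \<in> {a..b} \<Longrightarrow> K s0 r \<in> N"
  obtains \<epsilon> where "\<epsilon> > 0" "\<And>s r. s \<in> {0..1} \<Longrightarrow> \<bar>s - s0\<bar> < \<epsilon> \<Longrightarrow> r \<in> {a..b} \<Longrightarrow> K s r \<in> N"
proof -
  have "continuous_map (prod_topology unit_interval (top_of_set {a..b})) X (\<lambda>(s, r). K s r)"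
    using continuous_map_from_subtopology[OF leaf_continuous_imp[OF K], of "UNIV \<times> {a..b}"] assms(3,4)
    by (simp only: subtopology_Times subtopology_subtopology subtopology_UNIV) (simp add: min_absorb2 max_absorb2)
  from tube_near_slice[OF this compact_Icc _ assms(2), of s0] assms(1,5)
  obtain V where V: "openin unit_interval V" "s0 \<in> V" "\<And>s r. s \<in> V \<Longrightarrow> r \<in> {a..b} \<Longrightarrow> K s r \<in> N" by auto
  show ?thesis
    by (rule openin_unit_interval_ball[OF V(1,2)]) (use that V(3) in metis)
qed

lemma close_at_0:
  assumes "s0 \<in> {0..1}" shows "close_at S j K s0 0"
  unfolding close_at_def
proof (intro allI impI exI[of _ "1::real"] conjI ballI)
  fix N s W H W' H'
  assume N: "openin X N" "K s0 0 \<in> N" and s: "s \<in> {0..1}"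
    and F: "family_through S j (K s0) W H" "family_through S j (K s) W' H'"
  note F1 = family_throughD[OF F(1) S] and F2 = family_throughD[OF F(2) S]
  show "\<exists>W0. openin (subtopology X S) W0 \<and> K s0 0 \<in> W0 \<and> W0 \<subseteq> W \<inter> W' \<and> (\<forall>w\<in>W0. connected_within N 0 w H H')"
  proof (intro exI conjI ballI)
    show "openin (subtopology X S) (W \<inter> W' \<inter> (S \<inter> N))"
      using F1(1) F2(1) N(1) by (auto intro: openin_subtopology_Int2)
    show "K s0 0 \<in> W \<inter> W' \<inter> (S \<inter> N)" using F1(2) F2(2) N(2) K0 s assms p by auto
    fix w assume w: "w \<in> W \<inter> W' \<inter> (S \<inter> N)"
    then have eq: "H w 0 = w" "H' w 0 = w" using F1(6) F2(6) by auto
    have "subpath_on (H w) 0 0 = (\<lambda>_. w)" "subpath_on (H' w) 0 0 = (\<lambda>_. w)"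
      using eq by (auto simp: subpath_on_def)
    moreover have "pathin L (\<lambda>_. w)" using w F1(3) leaf_topspace by (auto simp: pathin_def)
    ultimately show "connected_within N 0 w H H'"
      unfolding connected_within_def using w eq path_homotopic_unit(1)[of L "\<lambda>_. w"]
      by (intro exI[of _ "\<lambda>_. w"]) auto
  qed auto
qed auto

lemma close_at_step:
  assumes s0: "s0 \<in> {0..1}" and i: "i \<in> I" and ab: "0 \<le> a" "a \<le> b" "b \<le> 1"
    and U: "\<And>r. r \<in> {a..b} \<Longrightarrow> K s0 r \<in> U i" and cl: "close_at S j K s0 a"
  shows "close_at S j K s0 b"
  unfolding close_at_def
proof (intro allI impI)
  fix N assume N: "openin X N" "K s0 b \<in> N"
  obtain Q where Q: "openin X Q" "K s0 b \<in> Q" "Q \<subseteq> N \<inter> U i"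
    "\<And>x x' s. x \<in> Q \<Longrightarrow> x' \<in> Q \<Longrightarrow> z i x = z i x' \<Longrightarrow> s \<in> {0..1} \<Longrightarrow> segment i x x' s \<in> Q"
    using plaque_convex_nbhd[OF i N U[of b]] ab(2) by auto
  obtain e1 where e1: "e1 > 0" "\<And>s W H W' H'. s \<in> {0..1} \<Longrightarrow> \<bar>s - s0\<bar> < e1 \<Longrightarrow>
      family_through S j (K s0) W H \<Longrightarrow> family_through S j (K s) W' H' \<Longrightarrow>
        \<exists>W0. openin (subtopology X S) W0 \<and> K s0 0 \<in> W0 \<and> W0 \<subseteq> W \<inter> W' \<and> (\<forall>w\<in>W0. connected_within (U i) a w H H')"
    using cl[unfolded close_at_def, rule_format, OF chart_open[OF i] U[of a]] ab(2) by auto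
  obtain e2 where e2: "e2 > 0" "\<And>s r. s \<in> {0..1} \<Longrightarrow> \<bar>s - s0\<bar> < e2 \<Longrightarrow> r \<in> {a..b} \<Longrightarrow> K s r \<in> U i"
    using K_near[OF s0 chart_open[OF i] ab(1,3) U] by blast
  obtain e3 where e3: "e3 > 0" "\<And>s r. s \<in> {0..1} \<Longrightarrow> \<bar>s - s0\<bar> < e3 \<Longrightarrow> r \<in> {b..b} \<Longrightarrow> K s r \<in> Q"
    using K_near[OF s0 Q(1), of b b] ab Q(2) by auto
  show "\<exists>\<epsilon>>0. \<forall>s\<in>{0..1}. \<bar>s - s0\<bar> < \<epsilon> \<longrightarrow> (\<forall>W H W' H'.
        family_through S j (K s0) W H \<longrightarrow> family_through S j (K s) W' H' \<longrightarrow>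
        (\<exists>W0. openin (subtopology X S) W0 \<and> K s0 0 \<in> W0 \<and> W0 \<subseteq> W \<inter> W' \<and> (\<forall>w\<in>W0. connected_within N b w H H')))"
  proof (intro exI[of _ "min e1 (min e2 e3)"] conjI ballI impI allI)
    fix s W H W' H' assume s: "s \<in> {0..1}" "\<bar>s - s0\<bar> < min e1 (min e2 e3)"
      and F: "family_through S j (K s0) W H" "family_through S j (K s) W' H'"
    note F1 = family_throughD[OF F(1) S] and F2 = family_throughD[OF F(2) S]
    have Ks: "K s 0 = K s0 0" using K0 s(1) s0 by simp
    have b: "0 \<le> b" using ab by simp
    obtain W0 where W0: "openin (subtopology X S) W0" "K s0 0 \<in> W0" "W0 \<subseteq> W \<inter> W'"
      "\<And>w. w \<in> W0 \<Longrightarrow> connected_within (U i) a w H H'" using e1(2)[OF s(1) _ F] s(2) by auto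
    obtain W1 where W1: "openin (subtopology X S) W1" "K s0 0 \<in> W1" "\<And>w r. w \<in> W1 \<Longrightarrow> r \<in> {a..b} \<Longrightarrow> H w r \<in> U i"
      using family_tube[OF F(1) S chart_open[OF i] ab(1,3) U] by metis
    obtain W2 where W2: "openin (subtopology X S) W2" "K s 0 \<in> W2" "\<And>w r. w \<in> W2 \<Longrightarrow> r \<in> {a..b} \<Longrightarrow> H' w r \<in> U i"
      using family_tube[OF F(2) S chart_open[OF i] ab(1,3) e2(2)[OF s(1)]] s(2) by (metis min_less_iff_conj)
    have "\<And>r. r \<in> {b..b} \<Longrightarrow> K s0 r \<in> Q" using Q(2) by simp
    from family_tube[OF F(1) S Q(1) b ab(3) this] obtain W3 where
      W3: "openin (subtopology X S) W3" "K s0 0 \<in> W3" "\<And>w r. w \<in> W3 \<Longrightarrow> r \<in> {b..b} \<Longrightarrow> H w r \<in> Q" by metis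
    obtain W4 where W4: "openin (subtopology X S) W4" "K s 0 \<in> W4" "\<And>w r. w \<in> W4 \<Longrightarrow> r \<in> {b..b} \<Longrightarrow> H' w r \<in> Q"
      using family_tube[OF F(2) S Q(1) b ab(3) e3(2)[OF s(1)]] s(2) by (metis min_less_iff_conj)
    show "\<exists>W0. openin (subtopology X S) W0 \<and> K s0 0 \<in> W0 \<and> W0 \<subseteq> W \<inter> W' \<and> (\<forall>w\<in>W0. connected_within N b w H H')"
    proof (intro exI[of _ "W0 \<inter> W1 \<inter> W2 \<inter> W3 \<inter> W4"] conjI ballI)
      show "openin (subtopology X S) (W0 \<inter> W1 \<inter> W2 \<inter> W3 \<inter> W4)"
        using W0 W1 W2 W3 W4 by auto
      show "K s0 0 \<in> W0 \<inter> W1 \<inter> W2 \<inter> W3 \<inter> W4" using W0(2) W1(2) W2(2) W3(2) W4(2) Ks by auto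
      fix w assume w: "w \<in> W0 \<inter> W1 \<inter> W2 \<inter> W3 \<inter> W4"
      show "connected_within N b w H H'"
      proof (rule connected_within_step[OF i ab])
        show "pathin L (H w)" "pathin L (H' w)" using F1(5) F2(5) w W0(3) by auto
        show "connected_within (U i) a w H H'" using W0(4) w by auto
        show "H w b \<in> Q" "H' w b \<in> Q" using W3(3)[of w b] W4(3)[of w b] w by auto
      qed (use W1(3) W2(3) w Q(3,4) in auto)
    qed (use W0 in auto)
  qed (use e1(1) e2(1) e3(1) in auto)
qed

lemma K_path: "s \<in> {0..1} \<Longrightarrow> pathin L (K s)"
  unfolding pathin_def using continuous_map_slice[OF K] by auto

lemma close_at_1:
  assumes s0: "s0 \<in> {0..1}" shows "close_at S j K s0 1"
proof -
  have "(0::real) \<le> 0 \<longrightarrow> (1::real) \<le> 1 \<longrightarrow> close_at S j K s0 0 \<longrightarrow> close_at S j K s0 1"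
  proof (rule Bolzano[where P="\<lambda>a b. 0 \<le> a \<longrightarrow> b \<le> 1 \<longrightarrow> close_at S j K s0 a \<longrightarrow> close_at S j K s0 b"])
    fix x :: real assume "0 \<le> x" "x \<le> 1"
    then have x: "x \<in> {0..1}" by simp
    obtain i e where e: "i \<in> I" "e > 0" "\<And>r. r \<in> {0..1} \<Longrightarrow> \<bar>r - x\<bar> < e \<Longrightarrow> K s0 r \<in> U i"
      using path_stays_in_chart[OF K_path[OF s0] x] by metis
    show "\<exists>d>0. \<forall>a b. a \<le> x \<and> x \<le> b \<and> b - a < d \<longrightarrow> 0 \<le> a \<longrightarrow> b \<le> 1 \<longrightarrow> close_at S j K s0 a \<longrightarrow> close_at S j K s0 b"
    proof (intro exI[of _ e] conjI allI impI)
      fix a b assume ab: "a \<le> x \<and> x \<le> b \<and> b - a < e" "0 \<le> a" "b \<le> 1" and cl: "close_at S j K s0 a"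
      have "K s0 r \<in> U i" if "r \<in> {a..b}" for r using e(3)[of r] ab that by auto
      then show "close_at S j K s0 b" using close_at_step[OF s0 e(1) ab(2) _ ab(3) _ cl] ab(1) by auto
    qed (rule e(2))
  qed auto
  then show ?thesis using close_at_0[OF s0] by simp
qed

text \<open>
  At time \<open>1\<close> the connecting path lies in a plaque of the target chart, and both of its ends lie on
  the transversal. A plaque meets the transversal at most once, so this path is a contractible loop.
\<close>

lemma ends_homotopic_near:
  assumes s0: "s0 \<in> {0..1}" and K1: "K s0 1 \<in> transv j"
  shows "\<exists>\<epsilon>>0. \<forall>s\<in>{0..1}. \<bar>s - s0\<bar> < \<epsilon> \<longrightarrow> ends_homotopic S j K p s0 s"
proof -
  have "K s0 1 \<in> U j" using K1 by (simp add: transv_def)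
  then obtain e where e: "e > 0" "\<And>s W H W' H'. s \<in> {0..1} \<Longrightarrow> \<bar>s - s0\<bar> < e \<Longrightarrow>
      family_through S j (K s0) W H \<Longrightarrow> family_through S j (K s) W' H' \<Longrightarrow>
        \<exists>W0. openin (subtopology X S) W0 \<and> K s0 0 \<in> W0 \<and> W0 \<subseteq> W \<inter> W' \<and> (\<forall>w\<in>W0. connected_within (U j) 1 w H H')"
    using close_at_1[OF s0, unfolded close_at_def, rule_format, OF chart_open[OF j]] by auto
  have "ends_homotopic S j K p s0 s" if s: "s \<in> {0..1}" "\<bar>s - s0\<bar> < e" for s
    unfolding ends_homotopic_def
  proof (intro allI impI)
    fix W H W' H' assume F: "family_through S j (K s0) W H" "family_through S j (K s) W' H'"
    note F1 = family_throughD[OF F(1) S] and F2 = family_throughD[OF F(2) S]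
    obtain W0 where W0: "openin (subtopology X S) W0" "K s0 0 \<in> W0" "W0 \<subseteq> W \<inter> W'"
      "\<And>w. w \<in> W0 \<Longrightarrow> connected_within (U j) 1 w H H'" using e(2)[OF s F] by blast
    have "path_homotopic L (H w) (H' w)" if w: "w \<in> W0" for w
    proof -
      have wW: "w \<in> W" "w \<in> W'" using w W0(3) by auto
      obtain c where c: "pathin L c" "c ` {0..1} \<subseteq> U j" "c 0 = H w 1" "c 1 = H' w 1"
        "path_homotopic L (path_join (H w) c) (H' w)"
        using W0(4)[OF w] by (auto simp: connected_within_def subpath_on_def)
      have "z j (c 0) = z j (c 1)" using pathin_transverse_coord[OF c(1) j] c(2) by blast
      then have eq: "H w 1 = H' w 1"
        using coords_inj[OF j, of "H w 1" "H' w 1"] F1(7)[OF wW(1)] F2(7)[OF wW(2)] c(3,4) by (auto simp: transv_def)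
      have "path_homotopic L (\<lambda>_. H w 1) c"
      proof (rule plaque_paths_homotopic[OF j _ c(1)])
        show "pathin L (\<lambda>_. H w 1)" using F1(7)[OF wW(1)] chart_subset[OF j] leaf_topspace
          by (auto simp: pathin_def transv_def)
      qed (use c eq F1(7)[OF wW(1)] in \<open>auto simp: transv_def\<close>)
      then have "path_homotopic L (path_join (H w) (\<lambda>_. H w 1)) (path_join (H w) c)"
        using path_homotopic_refl[OF F1(5)[OF wW(1)]] by (intro path_homotopic_join) auto
      then show ?thesis
        using path_homotopic_unit(1)[OF F1(5)[OF wW(1)]] c(5) path_homotopic_sym path_homotopic_trans by blast
    qed
    then show "\<exists>W0. openin (subtopology X S) W0 \<and> p \<in> W0 \<and> W0 \<subseteq> W \<inter> W' \<and> (\<forall>w\<in>W0. path_homotopic L (H w) (H' w))"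
      using W0 K0[OF s0] by (intro exI[of _ W0]) auto
  qed
  then show ?thesis using e(1) by blast
qed

lemma ends_homotopic_sym: "ends_homotopic S j K p s s' \<Longrightarrow> ends_homotopic S j K p s' s"
  unfolding ends_homotopic_def
proof (intro allI impI)
  fix W H W' H'
  assume *: "\<forall>W H W' H'. family_through S j (K s) W H \<longrightarrow> family_through S j (K s') W' H' \<longrightarrow>
     (\<exists>W0. openin (subtopology X S) W0 \<and> p \<in> W0 \<and> W0 \<subseteq> W \<inter> W' \<and> (\<forall>w\<in>W0. path_homotopic L (H w) (H' w)))"
    and F: "family_through S j (K s') W H" "family_through S j (K s) W' H'"
  obtain W0 where "openin (subtopology X S) W0 \<and> p \<in> W0 \<and> W0 \<subseteq> W' \<inter> W \<and> (\<forall>w\<in>W0. path_homotopic L (H' w) (H w))"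
    using *[rule_format, OF F(2,1)] by (elim exE) (rule that)
  then show "\<exists>W0. openin (subtopology X S) W0 \<and> p \<in> W0 \<and> W0 \<subseteq> W \<inter> W' \<and> (\<forall>w\<in>W0. path_homotopic L (H w) (H' w))"
    by (intro exI[of _ W0]) (auto intro: path_homotopic_sym)
qed

text \<open>
  A family through the intermediate path \<open>K s\<close> is compared with both given ones; this is
  where the existence of families is used.
\<close>

lemma ends_homotopic_trans:
  assumes s: "s \<in> {0..1}" "K s 1 \<in> transv j" and 1: "ends_homotopic S j K p r s" and 2: "ends_homotopic S j K p s r'"
  shows "ends_homotopic S j K p r r'"
  unfolding ends_homotopic_def
proof (intro allI impI)
  fix W H W' H' assume F: "family_through S j (K r) W H" "family_through S j (K r') W' H'"
  have "K s 0 \<in> S" using K0[OF s(1)] p by simp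
  from leafwise_family_exists[OF K_path[OF s(1)] this S j s(2)]
  obtain W1 H1 where F1: "family_through S j (K s) W1 H1" by (metis family_through_def)
  obtain A where A: "openin (subtopology X S) A" "p \<in> A" "A \<subseteq> W \<inter> W1" "\<forall>w\<in>A. path_homotopic L (H w) (H1 w)"
    using 1[unfolded ends_homotopic_def, rule_format, OF F(1) F1] by auto
  obtain A' where A': "openin (subtopology X S) A'" "p \<in> A'" "A' \<subseteq> W1 \<inter> W'" "\<forall>w\<in>A'. path_homotopic L (H1 w) (H' w)"
    using 2[unfolded ends_homotopic_def, rule_format, OF F1 F(2)] by auto
  show "\<exists>W0. openin (subtopology X S) W0 \<and> p \<in> W0 \<and> W0 \<subseteq> W \<inter> W' \<and> (\<forall>w\<in>W0. path_homotopic L (H w) (H' w))"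
    using A A' by (intro exI[of _ "A \<inter> A'"]) (auto intro: path_homotopic_trans)
qed

lemma ends_homotopic_0_1:
  assumes K1: "\<And>s. s \<in> {0..1} \<Longrightarrow> K s 1 \<in> transv j" shows "ends_homotopic S j K p 0 1"
proof -
  have "(0::real) \<le> 0 \<longrightarrow> (1::real) \<le> 1 \<longrightarrow> ends_homotopic S j K p 0 1"
  proof (rule Bolzano[where P="\<lambda>a b. 0 \<le> a \<longrightarrow> b \<le> 1 \<longrightarrow> ends_homotopic S j K p a b"])
    fix a b c :: real
    assume "0 \<le> a \<longrightarrow> b \<le> 1 \<longrightarrow> ends_homotopic S j K p a b" "0 \<le> b \<longrightarrow> c \<le> 1 \<longrightarrow> ends_homotopic S j K p b c" "a \<le> b" "b \<le> c"
    then show "0 \<le> a \<longrightarrow> c \<le> 1 \<longrightarrow> ends_homotopic S j K p a c" using ends_homotopic_trans[of b a c] K1[of b] by auto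
  next
    fix x :: real assume "0 \<le> x" "x \<le> 1"
    then have x: "x \<in> {0..1}" by simp
    obtain e where e: "e > 0" "\<And>s. s \<in> {0..1} \<Longrightarrow> \<bar>s - x\<bar> < e \<Longrightarrow> ends_homotopic S j K p x s"
      using ends_homotopic_near[OF x K1[OF x]] by blast
    have "ends_homotopic S j K p a b" if "a \<le> x \<and> x \<le> b \<and> b - a < e" "0 \<le> a" "b \<le> 1" for a b
      by (rule ends_homotopic_trans[OF x K1[OF x] ends_homotopic_sym[OF e(2)] e(2)]) (use that in auto)
    then show "\<exists>d>0. \<forall>a b. a \<le> x \<and> x \<le> b \<and> b - a < d \<longrightarrow> 0 \<le> a \<longrightarrow> b \<le> 1 \<longrightarrow> ends_homotopic S j K p a b"
      using e(1) by blast
  qed simp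
  then show ?thesis by simp
qed

end

text \<open>
  Along a homotopy from \<open>H p\<close> to \<open>H' p\<close>, families through paths with close parameters are compared
  chart by chart; finitely many such comparisons lead from \<open>H\<close> to \<open>H'\<close>.
\<close>

theorem leafwise_families_homotopic_near:
  assumes F: "leafwise_family X L S (transv j) W H" "leafwise_family X L S (transv j) W' H'"
    and S: "S \<subseteq> topspace X" and j: "j \<in> I" and p: "p \<in> W" "p \<in> W'" and hom: "path_homotopic L (H p) (H' p)"
  obtains W0 where "openin (subtopology X S) W0" "p \<in> W0" "W0 \<subseteq> W \<inter> W'" "\<And>w. w \<in> W0 \<Longrightarrow> path_homotopic L (H w) (H' w)"
proof -
  obtain K where K: "continuous_map (prod_topology unit_interval unit_interval) L (\<lambda>(s, r). K s r)"
    "\<forall>r\<in>{0..1}. K 0 r = H p r \<and> K 1 r = H' p r" "\<forall>s\<in>{0..1}. K s 0 = H p 0 \<and> K s 1 = H p 1"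
    using hom unfolding path_homotopic_iff by blast
  have H: "H p 0 = p" "H' p 0 = p" "H p 1 \<in> transv j" using F p by (auto simp: leafwise_family_def)
  have pS: "p \<in> S" using F(1) p(1) openin_subset by (fastforce simp: leafwise_family_def)
  have K0: "\<And>s. s \<in> {0..1} \<Longrightarrow> K s 0 = p" using K(3) H(1) by auto
  have "ends_homotopic S j K p 0 1"
    by (rule ends_homotopic_0_1[OF S j K(1) K0 pS]) (use K(3) H(3) in auto)
  moreover have "family_through S j (K 0) W H" "family_through S j (K 1) W' H'"
    using F p K0 K(2) by (auto simp: family_through_def)
  ultimately have "\<exists>W0. openin (subtopology X S) W0 \<and> p \<in> W0 \<and> W0 \<subseteq> W \<inter> W' \<and>
      (\<forall>w\<in>W0. path_homotopic L (H w) (H' w))"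
    unfolding ends_homotopic_def by blast
  then show ?thesis using that by blast
qed

end

section \<open>Differential calculus in coordinates\<close>

definition coord_space :: "nat \<Rightarrow> (nat \<Rightarrow> 'k::real_normed_field) set" where
  "coord_space m = {x. \<forall>i\<ge>m. x i = 0}"

lemma Euclidean_space_eq: "Euclidean_space m = top_of_set (coord_space m)"
  by (simp add: Euclidean_space_def coord_space_def euclidean_product_topology)

lemma Complex_space_eq: "Complex_space n = top_of_set (coord_space n)"
  by (simp add: Complex_space_def coord_space_def euclidean_product_topology)

lemma coord_space_upd: "x \<in> coord_space m \<Longrightarrow> i < m \<Longrightarrow> x(i := h) \<in> coord_space m"
  by (auto simp: coord_space_def)

lemma open_coordinate_box:
  fixes S :: "(nat \<Rightarrow> 'k::real_normed_field) set"
  assumes "openin (top_of_set (coord_space m)) S" "x \<in> S"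
  obtains \<delta> where "\<delta> > 0" "\<And>y. y \<in> coord_space m \<Longrightarrow> (\<And>i. i < m \<Longrightarrow> dist (y i) (x i) < \<delta>) \<Longrightarrow> y \<in> S"
proof -
  obtain T where T: "open T" "S = coord_space m \<inter> T" using assms(1) by (auto simp: openin_open)
  have "openin (product_topology (\<lambda>_. euclidean) UNIV) T"
    using T(1) by (simp add: euclidean_product_topology)
  from product_topology_open_contains_basis[OF this, of x]
  obtain Y where Y: "x \<in> (\<Pi>\<^sub>E i\<in>UNIV. Y i)" "\<And>i. openin euclidean (Y i)" "(\<Pi>\<^sub>E i\<in>UNIV. Y i) \<subseteq> T"
    using assms(2) T(2) by blast
  have "\<exists>e>0. ball (x i) e \<subseteq> Y i" for i
    using Y(1) Y(2)[of i] by (auto simp: PiE_iff open_contains_ball)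
  then obtain e where e: "\<And>i. e i > 0" "\<And>i. ball (x i) (e i) \<subseteq> Y i" by metis
  define \<delta> where "\<delta> = Min (insert 1 (e ` {..<m}))"
  have \<delta>: "\<delta> > 0" "\<And>i. i < m \<Longrightarrow> \<delta> \<le> e i"
    using e(1) by (auto simp: \<delta>_def)
  show ?thesis
  proof (rule that[OF \<delta>(1)])
    fix y :: "nat \<Rightarrow> 'k" assume y: "y \<in> coord_space m" "\<And>i. i < m \<Longrightarrow> dist (y i) (x i) < \<delta>"
    have "y i \<in> Y i" for i
    proof (cases "i < m")
      case True
      then have "y i \<in> ball (x i) (e i)" using y(2)[OF True] \<delta>(2)[OF True] by (auto simp: dist_commute)
      then show ?thesis using e(2) by blast
    next
      case False
      then have "y i = x i" using y(1) assms(2) T(2) by (simp add: coord_space_def)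
      then show ?thesis using Y(1) by (auto simp: PiE_iff)
    qed
    then show "y \<in> S" using Y(3) y(1) T(2) by (auto simp: PiE_iff)
  qed
qed

lemma continuous_coordinate_box:
  fixes S :: "(nat \<Rightarrow> 'k::real_normed_field) set" and g :: "_ \<Rightarrow> 'b::metric_space"
  assumes S: "openin (top_of_set (coord_space m)) S" and g: "continuous_on S g" and "x \<in> S" "\<epsilon> > 0"
  obtains \<delta> where "\<delta> > 0" "\<And>y. y \<in> coord_space m \<Longrightarrow> (\<And>i. i < m \<Longrightarrow> dist (y i) (x i) < \<delta>) \<Longrightarrow> y \<in> S \<and> dist (g y) (g x) < \<epsilon>"
proof -
  have "openin (top_of_set S) (S \<inter> g -` ball (g x) \<epsilon>)"
    by (rule continuous_openin_preimage_gen[OF g]) simp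
  then have "openin (top_of_set (coord_space m)) (S \<inter> g -` ball (g x) \<epsilon>)" using S openin_trans by blast
  then obtain \<delta> where "\<delta> > 0" "\<And>y. y \<in> coord_space m \<Longrightarrow> (\<And>i. i < m \<Longrightarrow> dist (y i) (x i) < \<delta>) \<Longrightarrow> y \<in> S \<inter> g -` ball (g x) \<epsilon>"
    by (rule open_coordinate_box[of m _ x]) (use assms in auto)
  then show ?thesis using that[of \<delta>] by (auto simp: dist_commute)
qed

lemma subtopology_coord_space:
  "openin (top_of_set (coord_space m)) S \<Longrightarrow> subtopology (top_of_set (coord_space m)) S = top_of_set S"
  by (metis inf.absorb2 openin_subset subtopology_subtopology topspace_euclidean_subtopology)

text \<open>
  The coordinates are changed one at a time; the mean value inequality applies to each change
  because the partial derivatives are continuous.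
\<close>

lemma chain_rule_coordinates:
  fixes F :: "(nat \<Rightarrow> 'k::real_normed_field) \<Rightarrow> 'k" and u :: "'a::real_normed_vector \<Rightarrow> nat \<Rightarrow> 'k"
  assumes S: "openin (top_of_set (coord_space m)) S"
    and F: "\<And>x k. x \<in> S \<Longrightarrow> k < m \<Longrightarrow> ((\<lambda>h. F (x(k := h))) has_field_derivative F' k x) (at (x k))"
    and F': "\<And>k. k < m \<Longrightarrow> continuous_on S (F' k)"
    and u: "\<And>k. k < m \<Longrightarrow> ((\<lambda>a. u a k) has_derivative u' k) (at a0)"
    and u0: "u a0 \<in> S" and near: "eventually (\<lambda>a. u a \<in> coord_space m) (nhds a0)"
  shows "((\<lambda>a. F (u a)) has_derivative (\<lambda>v. \<Sum>k<m. F' k (u a0) * u' k v)) (at a0)"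
proof -
  let ?x = "u a0"
  define mix where "mix j a = (\<lambda>l. if l < j then u a l else ?x l)" for j a
  have x: "?x \<in> coord_space m" using S u0 openin_subset by fastforce
  have step: "((\<lambda>a. F (mix (Suc j) a) - F (mix j a)) has_derivative (\<lambda>v. F' j ?x * u' j v)) (at a0)" if j: "j < m" for j
  proof -
    let ?D = "F' j ?x"
    have "((\<lambda>a. F (mix (Suc j) a) - F (mix j a) - ?D * (u a j - ?x j)) has_derivative (\<lambda>v. 0)) (at a0)"
      unfolding has_derivative_at_alt
    proof (intro conjI allI impI)
      fix e :: real assume e: "e > 0"
      obtain C where C: "C > 0" "eventually (\<lambda>a. norm (u a j - ?x j) \<le> C * norm (a - a0)) (nhds a0)"
      proof -
        obtain B where B: "B > 0" "\<And>v. norm (u' j v) \<le> norm v * B"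
          using bounded_linear.pos_bounded[OF has_derivative_bounded_linear[OF u[OF j]]] by blast
        obtain d where d: "d > 0" "\<And>y. norm (y - a0) < d \<Longrightarrow> norm (u y j - ?x j - u' j (y - a0)) \<le> 1 * norm (y - a0)"
          using u[OF j] unfolding has_derivative_at_alt by (metis zero_less_one)
        have "norm (u a j - ?x j) \<le> (B + 1) * norm (a - a0)" if "norm (a - a0) < d" for a
          using d(2)[OF that] B(2)[of "a - a0"] norm_triangle_sub[of "u a j - ?x j" "u' j (a - a0)"]
          by (simp add: algebra_simps)
        then have "eventually (\<lambda>a. norm (u a j - ?x j) \<le> (B + 1) * norm (a - a0)) (nhds a0)"
          unfolding eventually_nhds_metric using d(1) by (auto simp: dist_norm)
        then show ?thesis using that[of "B + 1"] B(1) by simp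
      qed
      define \<eta> where "\<eta> = e / C"
      have \<eta>: "\<eta> > 0" using e C(1) by (simp add: \<eta>_def)
      obtain \<delta> where \<delta>: "\<delta> > 0" "\<And>y. y \<in> coord_space m \<Longrightarrow> (\<And>i. i < m \<Longrightarrow> dist (y i) (?x i) < \<delta>) \<Longrightarrow> y \<in> S \<and> dist (F' j y) ?D < \<eta>"
        using continuous_coordinate_box[OF S F'[OF j] u0 \<eta>] by blast
      have "eventually (\<lambda>a. dist (u a k) (?x k) < \<delta>) (nhds a0)" if "k < m" for k
      proof -
        have "((\<lambda>a. u a k) \<longlongrightarrow> ?x k) (nhds a0)"
          using has_derivative_continuous[OF u[OF that]] by (simp add: isCont_def tendsto_nhds_iff)
        from tendstoD[OF this \<delta>(1)] show ?thesis .
      qed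
      then have "eventually (\<lambda>a. \<forall>k\<in>{..<m}. dist (u a k) (?x k) < \<delta>) (nhds a0)"
        by (intro eventually_ball_finite) auto
      then have "eventually (\<lambda>a. norm (F (mix (Suc j) a) - F (mix j a) - ?D * (u a j - ?x j)) \<le> e * norm (a - a0)) (nhds a0)"
        using near C(2)
      proof eventually_elim
        case (elim a)
        let ?B = "ball (?x j) \<delta>" and ?G = "\<lambda>h. F ((mix j a)(j := h)) - ?D * h"
        have in_S: "(mix j a)(j := h) \<in> S \<and> dist (F' j ((mix j a)(j := h))) ?D < \<eta>" if h: "h \<in> ?B" for h
        proof (rule \<delta>(2))
          show "(mix j a)(j := h) \<in> coord_space m"
            using elim(2) x j by (auto simp: coord_space_def mix_def)
          show "dist (((mix j a)(j := h)) i) (?x i) < \<delta>" if "i < m" for i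
            using elim(1) that h \<delta>(1) by (auto simp: mix_def dist_commute)
        qed
        have "norm (?G (u a j) - ?G (?x j)) \<le> \<eta> * norm (u a j - ?x j)"
        proof (rule field_differentiable_bound[OF convex_ball])
          fix h assume h: "h \<in> ?B"
          have "((\<lambda>h'. F (((mix j a)(j := h))(j := h'))) has_field_derivative F' j ((mix j a)(j := h))) (at h)"
            using F[OF conjunct1[OF in_S[OF h]] j] by simp
          then have "((\<lambda>h'. F ((mix j a)(j := h'))) has_field_derivative F' j ((mix j a)(j := h))) (at h within ?B)"
            by (simp add: has_field_derivative_at_within)
          then show "(?G has_field_derivative (F' j ((mix j a)(j := h)) - ?D)) (at h within ?B)"
            by (auto intro!: derivative_eq_intros)
          show "norm (F' j ((mix j a)(j := h)) - ?D) \<le> \<eta>" using in_S[OF h] by (simp add: dist_norm)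
        qed (use elim(1) j \<delta>(1) in \<open>auto simp: dist_commute\<close>)
        moreover have "(mix j a)(j := u a j) = mix (Suc j) a" "(mix j a)(j := ?x j) = mix j a"
          by (auto simp: mix_def fun_eq_iff less_Suc_eq)
        ultimately have "norm (F (mix (Suc j) a) - F (mix j a) - ?D * (u a j - ?x j)) \<le> \<eta> * norm (u a j - ?x j)"
          by (simp add: algebra_simps)
        also have "\<dots> \<le> \<eta> * (C * norm (a - a0))" using elim(3) \<eta> by (intro mult_left_mono) auto
        also have "\<dots> = e * norm (a - a0)" using C(1) by (simp add: \<eta>_def)
        finally show ?case .
      qed
      then show "\<exists>d>0. \<forall>y. norm (y - a0) < d \<longrightarrow>
          norm (F (mix (Suc j) y) - F (mix j y) - ?D * (u y j - ?x j) - (F (mix (Suc j) a0) - F (mix j a0) - ?D * (u a0 j - ?x j)) - 0)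
            \<le> e * norm (y - a0)"
        unfolding eventually_nhds_metric by (simp add: mix_def dist_norm cong: if_cong)
    qed simp
    moreover have "((\<lambda>a. ?D * (u a j - ?x j)) has_derivative (\<lambda>v. ?D * u' j v)) (at a0)"
      by (auto intro!: derivative_eq_intros u[OF j])
    ultimately have "((\<lambda>a. (F (mix (Suc j) a) - F (mix j a) - ?D * (u a j - ?x j)) + ?D * (u a j - ?x j)) has_derivative (\<lambda>v. 0 + ?D * u' j v)) (at a0)"
      by (rule has_derivative_add)
    then show ?thesis by simp
  qed
  have "j \<le> m \<Longrightarrow> ((\<lambda>a. F (mix j a)) has_derivative (\<lambda>v. \<Sum>k<j. F' k ?x * u' k v)) (at a0)" for j
  proof (induction j)
    case 0
    have "mix 0 a = ?x" for a by (simp add: mix_def)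
    then show ?case by simp
  next
    case (Suc j)
    then have "((\<lambda>a. F (mix j a) + (F (mix (Suc j) a) - F (mix j a))) has_derivative
        (\<lambda>v. (\<Sum>k<j. F' k ?x * u' k v) + F' j ?x * u' j v)) (at a0)"
      by (intro has_derivative_add step) auto
    then show ?case by simp
  qed
  then have d: "((\<lambda>a. F (mix m a)) has_derivative (\<lambda>v. \<Sum>k<m. F' k ?x * u' k v)) (at a0)" by simp
  have ev: "eventually (\<lambda>a. F (mix m a) = F (u a)) (nhds a0)"
    using near
  proof eventually_elim
    case (elim a)
    have "mix m a = u a" using elim x by (auto simp: mix_def coord_space_def fun_eq_iff)
    then show ?case by simp
  qed
  have "eventually (\<lambda>a. F (mix m a) = F (u a)) (at a0)"
    using ev by (simp add: eventually_nhds_conv_at)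
  from has_derivative_transform_eventually[OF d this eventually_nhds_x_imp_x[OF ev] UNIV_I]
  show ?thesis .
qed

subsection \<open>Holomorphic functions of several variables\<close>

lemma holomorphic_inD:
  assumes "openin (top_of_set (coord_space n)) S" "holomorphic_in n S f"
  shows "continuous_on S f" "z \<in> S \<Longrightarrow> j < n \<Longrightarrow> (\<lambda>w. f (z(j := w))) field_differentiable at (z j)"
  using assms subtopology_coord_space[OF assms(1)] by (auto simp: holomorphic_in_def Complex_space_eq)

lemma holomorphic_inI:
  assumes "openin (top_of_set (coord_space n)) S" "continuous_on S f"
    "\<And>z j. z \<in> S \<Longrightarrow> j < n \<Longrightarrow> (\<lambda>w. f (z(j := w))) field_differentiable at (z j)"
  shows "holomorphic_in n S f"
  using assms subtopology_coord_space[OF assms(1)] by (auto simp: holomorphic_in_def Complex_space_eq)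

lemma eventually_upd_in_open:
  fixes S :: "(nat \<Rightarrow> 'k::real_normed_field) set"
  assumes "openin (top_of_set (coord_space n)) S" "z \<in> S" "j < n"
  shows "eventually (\<lambda>w. z(j := w) \<in> S) (nhds (z j))"
proof -
  obtain \<delta> where "\<delta> > 0" "\<And>y. y \<in> coord_space n \<Longrightarrow> (\<And>i. i < n \<Longrightarrow> dist (y i) (z i) < \<delta>) \<Longrightarrow> y \<in> S"
    using open_coordinate_box[OF assms(1,2)] by metis
  moreover have "z \<in> coord_space n" using assms(1,2) openin_subset by fastforce
  ultimately show ?thesis
    unfolding eventually_nhds_metric using assms(3) coord_space_upd[of z n j] by (intro exI[of _ \<delta>]) auto
qed

lemma holomorphic_in_cong:
  assumes "openin (top_of_set (coord_space n)) S'" "openin (top_of_set (coord_space n)) S" "S' \<subseteq> S"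
    and "holomorphic_in n S f" "\<And>z. z \<in> S' \<Longrightarrow> g z = f z"
  shows "holomorphic_in n S' g"
proof (rule holomorphic_inI[OF assms(1)])
  show "continuous_on S' g"
    using continuous_on_subset[OF holomorphic_inD(1)[OF assms(2,4)] assms(3)] assms(5) by (simp cong: continuous_on_cong)
  fix z j assume z: "z \<in> S'" "j < n"
  have "(\<lambda>w. f (z(j := w))) field_differentiable at (z j)"
    using holomorphic_inD(2)[OF assms(2,4)] z assms(3) by blast
  moreover have "eventually (\<lambda>w. g (z(j := w)) = f (z(j := w))) (nhds (z j))"
    using eventually_upd_in_open[OF assms(1) z] assms(5) by (auto elim: eventually_mono)
  ultimately show "(\<lambda>w. g (z(j := w))) field_differentiable at (z j)"
    unfolding field_differentiable_def using DERIV_cong_ev[OF refl _ refl] by metis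
qed

text \<open>
  This is Osgood's lemma: by Cauchy's inequality, slices of \<open>f\<close> which are uniformly close on a disc
  have close derivatives at its centre.
\<close>

lemma partial_derivative_continuous:
  assumes S: "openin (top_of_set (coord_space n)) S" and f: "holomorphic_in n S f" and j: "j < n"
  shows "continuous_on S (\<lambda>z. deriv (\<lambda>w. f (z(j := w))) (z j))"
  unfolding continuous_on_topological
proof (intro ballI allI impI)
  let ?D = "\<lambda>z. deriv (\<lambda>w. f (z(j := w))) (z j)"
  fix z0 A assume z0: "z0 \<in> S" and A: "open A" "?D z0 \<in> A"
  note f' = holomorphic_inD[OF S f]
  obtain e where e: "e > 0" "ball (?D z0) e \<subseteq> A" using A by (auto simp: open_contains_ball)
  obtain r where r: "r > 0" "\<And>y. y \<in> coord_space n \<Longrightarrow> (\<And>i. i < n \<Longrightarrow> dist (y i) (z0 i) < r) \<Longrightarrow> y \<in> S"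
    using open_coordinate_box[OF S z0] by metis
  define \<rho> where "\<rho> = r / 4"
  define T where "T = {z \<in> coord_space n. \<forall>i<n. dist (z i) (z0 i) < r}"
  have z0V: "z0 \<in> coord_space n" using S z0 openin_subset by fastforce
  have TS: "z(j := w) \<in> S" if "z \<in> T" "dist w (z0 j) < r" for z w
    using that r(2)[of "z(j := w)"] coord_space_upd[OF _ j, of z w] by (auto simp: T_def)
  have To: "openin (top_of_set (coord_space n)) T"
  proof -
    have "open {z::nat \<Rightarrow> complex. \<forall>i\<in>{..<n}. dist (z i) (z0 i) < r}"
      unfolding Collect_ball_eq
      by (intro open_INT finite_lessThan ballI open_Collect_less continuous_intros continuous_on_product_coordinates)
    then show ?thesis by (auto simp: openin_open T_def)
  qed
  have hol: "(\<lambda>w. f (z(j := w))) holomorphic_on ball (z0 j) r" if "z \<in> T" for z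
  proof -
    have "(\<lambda>w. f (z(j := w))) field_differentiable at w" if w: "w \<in> ball (z0 j) r" for w
      using f'(2)[OF TS[OF \<open>z \<in> T\<close>, of w] j] w by (simp add: dist_commute)
    then show ?thesis by (simp add: holomorphic_on_def field_differentiable_at_within)
  qed
  let ?K = "cball (z0 j) (2 * \<rho>)"
  have K: "w \<in> ball (z0 j) r" if "w \<in> ?K" for w using that r(1) by (auto simp: \<rho>_def)
  define g where "g z w = f (z(j := w)) - f (z0(j := w))" for z w
  have z0T: "z0 \<in> T" using z0V r(1) by (simp add: T_def)
  have g: "continuous_on (T \<times> ?K) (\<lambda>(z, w). g z w)"
  proof -
    have "continuous_on (T \<times> ?K) (\<lambda>x. (fst x)(j := snd x) :: nat \<Rightarrow> complex)"
    proof (rule continuous_on_coordinatewise_then_product)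
      fix i
      show "continuous_on (T \<times> ?K) (\<lambda>x. ((fst x)(j := snd x)) i)"
        using continuous_on_product_then_coordinatewise[OF continuous_on_fst[OF continuous_on_id], of "T \<times> ?K" i]
          continuous_on_snd[OF continuous_on_id, of "T \<times> ?K"]
        by (cases "i = j") simp_all
    qed
    moreover have "continuous_on (T \<times> ?K) (\<lambda>x. z0(j := snd x) :: nat \<Rightarrow> complex)"
    proof (rule continuous_on_coordinatewise_then_product)
      fix i
      show "continuous_on (T \<times> ?K) (\<lambda>x. (z0(j := snd x)) i)"
        using continuous_on_snd[OF continuous_on_id, of "T \<times> ?K"] by (cases "i = j") simp_all
    qed
    ultimately show ?thesis
      unfolding g_def case_prod_unfold
      by (intro continuous_on_diff continuous_on_compose2[OF f'(1)])
        (use TS z0T K in \<open>auto simp: dist_commute\<close>)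
  qed
  define \<eta> where "\<eta> = e * \<rho> / 2"
  have \<rho>: "\<rho> > 0" "\<eta> > 0" using r(1) e(1) by (auto simp: \<rho>_def \<eta>_def)
  have "\<exists>W. openin (top_of_set T) W \<and> z0 \<in> W \<and> (\<forall>z\<in>W. \<forall>w\<in>?K. g z w \<in> ball 0 \<eta>)"
    by (rule tube_near_slice[where X=euclidean]) (use g z0T \<rho> in \<open>auto simp: g_def\<close>)
  then obtain W where W: "openin (top_of_set T) W" "z0 \<in> W" "\<And>z w. z \<in> W \<Longrightarrow> w \<in> ?K \<Longrightarrow> norm (g z w) < \<eta>" by auto
  have "(deriv (\<lambda>w. f (z0(j := w)))) holomorphic_on ball (z0 j) r"
    by (rule holomorphic_deriv[OF hol[OF z0T] open_ball])
  then have "continuous_on (ball (z0 j) r) (deriv (\<lambda>w. f (z0(j := w))))" by (rule holomorphic_on_imp_continuous_on)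
  then have "continuous (at (z0 j)) (deriv (\<lambda>w. f (z0(j := w))))" using r(1) by (simp add: continuous_on_eq_continuous_at)
  then obtain d where d: "d > 0" "\<And>w. dist w (z0 j) < d \<Longrightarrow> dist (deriv (\<lambda>w. f (z0(j := w))) w) (?D z0) < e / 2"
    unfolding continuous_at_eps_delta using e(1) by (metis half_gt_zero)
  have WT: "W \<subseteq> T" using openin_subset[OF W(1)] by simp
  have close: "?D z \<in> A" if z: "z \<in> W" "dist (z j) (z0 j) < min d \<rho>" for z
  proof -
    have zT: "z \<in> T" using WT z by auto
    have cb: "cball (z j) \<rho> \<subseteq> ?K"
    proof
      fix w assume "w \<in> cball (z j) \<rho>"
      then show "w \<in> ?K" using z(2) dist_triangle[of "z0 j" w "z j"] by (simp add: dist_commute)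
    qed
    have sub: "cball (z j) \<rho> \<subseteq> ball (z0 j) r" using cb K by blast
    have gh: "g z holomorphic_on ball (z0 j) r" unfolding g_def by (intro holomorphic_intros hol zT z0T)
    have "norm ((deriv ^^ 1) (g z) (z j)) \<le> fact 1 * \<eta> / \<rho> ^ 1"
    proof (rule Cauchy_inequality[OF _ _ \<rho>(1)])
      show "g z holomorphic_on ball (z j) \<rho>" using gh sub by (meson ball_subset_cball holomorphic_on_subset order_trans)
      show "continuous_on (cball (z j) \<rho>) (g z)"
        using holomorphic_on_imp_continuous_on[OF gh] sub continuous_on_subset by blast
      show "norm (g z w) \<le> \<eta>" if "norm (z j - w) = \<rho>" for w
        using W(3)[OF z(1), of w] cb that by (force simp: dist_norm)
    qed
    then have 1: "norm (deriv (g z) (z j)) \<le> e / 2" using \<rho>(1) by (simp add: \<eta>_def)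
    have zj: "z j \<in> ball (z0 j) r" by (rule subsetD[OF sub]) (use \<rho>(1) in simp)
    have "deriv (g z) (z j) = ?D z - deriv (\<lambda>w. f (z0(j := w))) (z j)"
      unfolding g_def using hol[OF zT] hol[OF z0T] zj
      by (intro deriv_diff) (auto simp: holomorphic_on_open field_differentiable_def)
    then have "norm (?D z - ?D z0) \<le> norm (deriv (g z) (z j)) + norm (deriv (\<lambda>w. f (z0(j := w))) (z j) - ?D z0)"
      using norm_triangle_ineq[of "?D z - deriv (\<lambda>w. f (z0(j := w))) (z j)" "deriv (\<lambda>w. f (z0(j := w))) (z j) - ?D z0"] by simp
    also have "\<dots> < e / 2 + e / 2" using 1 d(2)[of "z j"] z(2) by (intro add_le_less_mono) (auto simp: dist_norm)
    finally have "?D z \<in> ball (?D z0) e" by (simp add: dist_norm norm_minus_commute)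
    then show ?thesis using e(2) by blast
  qed
  let ?N = "{z::nat \<Rightarrow> complex. dist (z j) (z0 j) < min d \<rho>}"
  obtain W' where W': "open W'" "W = T \<inter> W'" using W(1) by (auto simp: openin_open)
  obtain T' where T': "open T'" "T = coord_space n \<inter> T'" using To by (auto simp: openin_open)
  have "open ?N" by (intro open_Collect_less continuous_intros continuous_on_product_coordinates)
  then show "\<exists>B. open B \<and> z0 \<in> B \<and> (\<forall>z\<in>S. z \<in> B \<longrightarrow> ?D z \<in> A)"
    using W' T' W(2) z0T d(1) \<rho>(1) close S openin_subset[OF S]
    by (intro exI[of _ "?N \<inter> W' \<inter> T'"]) auto
qed

text \<open>
  Holomorphy is defined by continuity and separate complex differentiability, which do not pass
  through a composition by themselves; the continuity of the partial derivatives makes the chain rule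
  applicable.
\<close>

lemma holomorphic_in_compose:
  assumes S: "openin (top_of_set (coord_space n)) S" and S': "openin (top_of_set (coord_space n)) S'"
    and f: "holomorphic_in n S' f" and \<Theta>: "\<And>l. l < n \<Longrightarrow> holomorphic_in n S (\<lambda>z. \<Theta> z l)"
    and maps: "\<And>z. z \<in> S \<Longrightarrow> \<Theta> z \<in> S'"
  shows "holomorphic_in n S (\<lambda>z. f (\<Theta> z))"
proof (rule holomorphic_inI[OF S])
  have \<Theta>V: "\<Theta> z l = 0" if "z \<in> S" "l \<ge> n" for z l
    using maps[OF that(1)] openin_subset[OF S'] that(2) by (auto simp: coord_space_def)
  have "continuous_on S \<Theta>"
  proof (rule continuous_on_coordinatewise_then_product)
    fix l
    show "continuous_on S (\<lambda>z. \<Theta> z l)"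
    proof (cases "l < n")
      case True
      then show ?thesis using holomorphic_inD(1)[OF S \<Theta>] by simp
    next
      case False
      then show ?thesis using \<Theta>V by (auto simp: continuous_on_cong[OF refl, where g="\<lambda>_. 0"])
    qed
  qed
  then show "continuous_on S (\<lambda>z. f (\<Theta> z))"
    using continuous_on_compose2[OF holomorphic_inD(1)[OF S' f]] maps by blast
  fix z j assume z: "z \<in> S" "j < n"
  let ?u = "\<lambda>w. \<Theta> (z(j := w))"
  have "\<exists>D. ((\<lambda>w. ?u w l) has_field_derivative D) (at (z j))" if "l < n" for l
    using holomorphic_inD(2)[OF S \<Theta>[OF that] z] by (simp add: field_differentiable_def)
  then obtain D where D: "\<And>l. l < n \<Longrightarrow> ((\<lambda>w. ?u w l) has_field_derivative D l) (at (z j))" by metis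
  have "((\<lambda>w. f (?u w)) has_derivative (\<lambda>v. \<Sum>k<n. deriv (\<lambda>w. f ((?u (z j))(k := w))) (?u (z j) k) * (D k * v))) (at (z j))"
  proof (rule chain_rule_coordinates[OF S', where F'="\<lambda>k x. deriv (\<lambda>w. f (x(k := w))) (x k)"])
    show "((\<lambda>h. f (x(k := h))) has_field_derivative deriv (\<lambda>w. f (x(k := w))) (x k)) (at (x k))" if "x \<in> S'" "k < n" for x k
      using holomorphic_inD(2)[OF S' f that] by (simp add: field_differentiable_derivI)
    show "continuous_on S' (\<lambda>x. deriv (\<lambda>w. f (x(k := w))) (x k))" if "k < n" for k
      by (rule partial_derivative_continuous[OF S' f that])
    show "((\<lambda>w. ?u w k) has_derivative (*) (D k)) (at (z j))" if "k < n" for k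
      using D[OF that] by (simp add: has_field_derivative_def)
    show "?u (z j) \<in> S'" using maps z(1) by simp
    show "eventually (\<lambda>w. ?u w \<in> coord_space n) (nhds (z j))"
      using eventually_upd_in_open[OF S z] maps openin_subset[OF S'] by (auto elim!: eventually_mono)
  qed
  also have "(\<lambda>v. \<Sum>k<n. deriv (\<lambda>w. f ((?u (z j))(k := w))) (?u (z j) k) * (D k * v))
      = (*) (\<Sum>k<n. deriv (\<lambda>w. f ((?u (z j))(k := w))) (?u (z j) k) * D k)"
    by (auto simp: fun_eq_iff sum_distrib_right mult.assoc)
  finally show "(\<lambda>w. f (\<Theta> (z(j := w)))) field_differentiable at (z j)"
    unfolding field_differentiable_def has_field_derivative_def by (rule exI)
qed

section \<open>Germs and pullbacks along local biholomorphisms\<close>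

lemma agree_near_refl: "p \<in> topspace T \<Longrightarrow> agree_near T p f f"
  unfolding agree_near_def by (intro exI[of _ "topspace T"]) auto

lemma agree_near_sym: "agree_near T p f g \<Longrightarrow> agree_near T p g f"
  unfolding agree_near_def by metis

lemma agree_near_trans: "agree_near T p f g \<Longrightarrow> agree_near T p g h \<Longrightarrow> agree_near T p f h"
  unfolding agree_near_def by (metis (full_types) IntE IntI openin_Int)

lemma agree_near_compose:
  assumes "continuous_map T' T q" "y \<in> topspace T'" "agree_near T (q y) f g"
  shows "agree_near T' y (\<lambda>u. f (q u)) (\<lambda>u. g (q u))"
proof -
  obtain U where U: "openin T U" "q y \<in> U" "\<forall>x\<in>U. f x = g x" using assms(3) by (auto simp: agree_near_def)
  then show ?thesis
    unfolding agree_near_def using openin_continuous_map_preimage[OF assms(1) U(1)] assms(2)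
    by (intro exI[of _ "{x \<in> topspace T'. q x \<in> U}"]) auto
qed

lemma mem_germ: "g \<in> germ C x f \<longleftrightarrow> agree_near (ctop C) x f g"
  by (simp add: germ_def)

lemma mem_comp_germ: "k \<in> comp_germ N \<Phi> y a \<longleftrightarrow> (\<exists>f\<in>a. agree_near (ctop N) y (\<lambda>u. f (\<Phi> u)) k)"
  by (auto simp: comp_germ_def mem_germ)

lemma comp_germ_compose:
  assumes "continuous_map (ctop N') (ctop N) q" "y \<in> topspace (ctop N')"
  shows "comp_germ N' (\<Phi> \<circ> q) y a = comp_germ N' q y (comp_germ N \<Phi> (q y) a)"
proof (rule Set.set_eqI)
  fix k
  have qy: "q y \<in> topspace (ctop N)" using assms by (auto simp: continuous_map_def)
  show "k \<in> comp_germ N' (\<Phi> \<circ> q) y a \<longleftrightarrow> k \<in> comp_germ N' q y (comp_germ N \<Phi> (q y) a)"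
  proof
    assume "k \<in> comp_germ N' (\<Phi> \<circ> q) y a"
    then obtain f where "f \<in> a" "agree_near (ctop N') y (\<lambda>u. f (\<Phi> (q u))) k" by (auto simp: mem_comp_germ)
    then show "k \<in> comp_germ N' q y (comp_germ N \<Phi> (q y) a)"
      unfolding mem_comp_germ using agree_near_refl[OF qy]
      by (intro bexI[of _ "\<lambda>u. f (\<Phi> u)"]) (auto simp: mem_comp_germ)
  next
    assume "k \<in> comp_germ N' q y (comp_germ N \<Phi> (q y) a)"
    then obtain f l where "f \<in> a" "agree_near (ctop N) (q y) (\<lambda>u. f (\<Phi> u)) l" "agree_near (ctop N') y (\<lambda>u. l (q u)) k"
      by (auto simp: mem_comp_germ)
    then show "k \<in> comp_germ N' (\<Phi> \<circ> q) y a"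
      unfolding mem_comp_germ using agree_near_trans[OF agree_near_compose[OF assms]] by auto
  qed
qed

definition germ_closed :: "'p complex_mfd \<Rightarrow> 'p \<Rightarrow> 'p germ \<Rightarrow> bool" where
  "germ_closed C x a \<longleftrightarrow> (\<forall>f\<in>a. \<forall>g. agree_near (ctop C) x f g \<longrightarrow> g \<in> a)"

lemma germ_closed_carrier: "a \<in> carrier (O_stalk C x) \<Longrightarrow> germ_closed C x a"
  by (auto simp: O_stalk_def germ_closed_def mem_germ intro: agree_near_trans)

lemma germ_closed_comp: "germ_closed N y (comp_germ N \<Phi> y a)"
  by (auto simp: germ_closed_def mem_comp_germ) (blast intro: agree_near_trans)

text \<open>
  Two germs with the same pullback agree on \<open>q ` U\<close> for some neighbourhood \<open>U\<close> of \<open>y\<close>, and this set is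
  open.
\<close>

lemma comp_germ_inj:
  assumes "continuous_map (ctop N') (ctop N) q" "open_map (ctop N') (ctop N) q" "y \<in> topspace (ctop N')"
    and "germ_closed N (q y) a" "germ_closed N (q y) b" "comp_germ N' q y a = comp_germ N' q y b"
  shows "a = b"
proof -
  have sub: "k \<in> b" if ab: "germ_closed N (q y) b" "comp_germ N' q y a = comp_germ N' q y b" and k: "k \<in> a" for a b k
  proof -
    have "(\<lambda>u. k (q u)) \<in> comp_germ N' q y a"
      unfolding mem_comp_germ using k agree_near_refl[OF assms(3)] by (intro bexI[of _ k]) auto
    then obtain l where l: "l \<in> b" "agree_near (ctop N') y (\<lambda>u. l (q u)) (\<lambda>u. k (q u))"
      unfolding ab(2) by (auto simp: mem_comp_germ)
    then obtain U where "openin (ctop N') U" "y \<in> U" "\<forall>u\<in>U. l (q u) = k (q u)" by (auto simp: agree_near_def)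
    then have "agree_near (ctop N) (q y) l k"
      unfolding agree_near_def using assms(2) by (intro exI[of _ "q ` U"]) (auto simp: open_map_def)
    then show ?thesis using ab(1) l(1) by (auto simp: germ_closed_def)
  qed
  show ?thesis using sub[OF assms(5,6)] sub[OF assms(4) assms(6)[symmetric]] by blast
qed

text \<open>
  Biholomorphy is expressed by germs: pullback along \<open>q\<close> reaches exactly the holomorphic germs
  upstairs, and openness makes it injective on germs.
\<close>

definition local_biholo_onto :: "'q complex_mfd \<Rightarrow> 'p complex_mfd \<Rightarrow> ('q \<Rightarrow> 'p) \<Rightarrow> bool" where
  "local_biholo_onto N' N q \<longleftrightarrow> continuous_map (ctop N') (ctop N) q \<and> open_map (ctop N') (ctop N) q \<and>
     q ` topspace (ctop N') = topspace (ctop N) \<and>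
     (\<forall>y\<in>topspace (ctop N'). comp_germ N' q y ` carrier (O_stalk N (q y)) = carrier (O_stalk N' y))"

lemma local_biholo_ontoD:
  assumes "local_biholo_onto N' N q"
  shows "continuous_map (ctop N') (ctop N) q" "open_map (ctop N') (ctop N) q"
    "q ` topspace (ctop N') = topspace (ctop N)"
    "y \<in> topspace (ctop N') \<Longrightarrow> comp_germ N' q y ` carrier (O_stalk N (q y)) = carrier (O_stalk N' y)"
    "y \<in> topspace (ctop N') \<Longrightarrow> q y \<in> topspace (ctop N)"
  using assms by (auto simp: local_biholo_onto_def)

text \<open>
  In the pullback of a module along \<open>\<Phi>\<close>, a germ on \<open>N\<close> acts through a germ on \<open>C\<close> of which it is the
  pullback; the latter has to exist.
\<close>

definition pulls_all_germs :: "'q complex_mfd \<Rightarrow> 'p complex_mfd \<Rightarrow> ('q \<Rightarrow> 'p) \<Rightarrow> bool" where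
  "pulls_all_germs N C \<Phi> \<longleftrightarrow> (\<forall>y\<in>topspace (ctop N). \<Phi> y \<in> topspace (ctop C) \<and>
     carrier (O_stalk N y) \<subseteq> comp_germ N \<Phi> y ` carrier (O_stalk C (\<Phi> y)))"

lemma pulls_all_germs_inv:
  assumes "pulls_all_germs N C \<Phi>" "y \<in> topspace (ctop N)" "a \<in> carrier (O_stalk N y)"
  shows "inv_into (carrier (O_stalk C (\<Phi> y))) (comp_germ N \<Phi> y) a \<in> carrier (O_stalk C (\<Phi> y))"
  using assms by (auto simp: pulls_all_germs_def intro!: inv_into_into)

text \<open>
  The scalars of \<open>(\<Phi> \<circ> q)\<^sup>*F\<close> and of \<open>q\<^sup>*(\<Phi>\<^sup>*F)\<close> agree: a germ on the base pulls back to \<open>q\<^sup>*b\<close> along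
  \<open>\<Phi> \<circ> q\<close> exactly if it pulls back to \<open>b\<close> along \<open>\<Phi>\<close>.
\<close>

lemma inv_comp_germ_compose:
  assumes "local_biholo_onto N' N q" "y \<in> topspace (ctop N')" "b \<in> carrier (O_stalk N (q y))"
  shows "inv_into A (comp_germ N' (\<Phi> \<circ> q) y) (comp_germ N' q y b) = inv_into A (comp_germ N \<Phi> (q y)) b"
proof -
  note q = local_biholo_ontoD[OF assms(1)]
  have "comp_germ N' (\<Phi> \<circ> q) y x = comp_germ N' q y b \<longleftrightarrow> comp_germ N \<Phi> (q y) x = b" for x
    unfolding comp_germ_compose[OF q(1) assms(2)]
    using comp_germ_inj[OF q(1,2) assms(2) germ_closed_comp germ_closed_carrier[OF assms(3)]] by blast
  then show ?thesis by (simp add: inv_into_def)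
qed

lemma etop_pullback: "etop (pullback N C \<Phi> F) = subtopology (prod_topology (ctop N) (etop F)) {(y, e). \<Phi> y = proj F e}"
  by (simp add: pullback_def)

lemma topspace_pullback:
  "topspace (etop (pullback N C \<Phi> F)) = {(y, e). y \<in> topspace (ctop N) \<and> e \<in> topspace (etop F) \<and> \<Phi> y = proj F e}"
  by (auto simp: etop_pullback)

lemma proj_pullback: "proj (pullback N C \<Phi> F) = fst"
  by (simp add: pullback_def)

lemma stalk_pullback:
  "carrier (stalk (pullback N C \<Phi> F) y) = {y} \<times> carrier (stalk F (\<Phi> y))"
  "u \<oplus>\<^bsub>stalk (pullback N C \<Phi> F) y\<^esub> v = (y, snd u \<oplus>\<^bsub>stalk F (\<Phi> y)\<^esub> snd v)"
  "a \<odot>\<^bsub>stalk (pullback N C \<Phi> F) y\<^esub> u =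
     (y, inv_into (carrier (O_stalk C (\<Phi> y))) (comp_germ N \<Phi> y) a \<odot>\<^bsub>stalk F (\<Phi> y)\<^esub> snd u)"
  by (simp_all add: pullback_def Let_def)

lemma O_moduleD:
  assumes "O_module C F" "x \<in> topspace (ctop C)"
  shows "carrier (stalk F x) = {e \<in> topspace (etop F). proj F e = x}" "Module.module (O_stalk C x) (stalk F x)"
  using assms by (auto simp: O_module_def)

lemma O_module_closed:
  assumes "O_module C F" "x \<in> topspace (ctop C)" "e \<in> carrier (stalk F x)"
  shows "e' \<in> carrier (stalk F x) \<Longrightarrow> e \<oplus>\<^bsub>stalk F x\<^esub> e' \<in> carrier (stalk F x)"
    and "a \<in> carrier (O_stalk C x) \<Longrightarrow> a \<odot>\<^bsub>stalk F x\<^esub> e \<in> carrier (stalk F x)"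
proof -
  interpret Module.module "O_stalk C x" "stalk F x" by (rule O_moduleD(2)[OF assms(1,2)])
  show "e' \<in> carrier (stalk F x) \<Longrightarrow> e \<oplus>\<^bsub>stalk F x\<^esub> e' \<in> carrier (stalk F x)"
    "a \<in> carrier (O_stalk C x) \<Longrightarrow> a \<odot>\<^bsub>stalk F x\<^esub> e \<in> carrier (stalk F x)"
    using assms(3) by auto
qed

lemma omod_homD:
  assumes "\<phi> \<in> omod_hom C F F'"
  shows "\<phi> \<in> extensional (topspace (etop F))" "continuous_map (etop F) (etop F') \<phi>"
    "e \<in> topspace (etop F) \<Longrightarrow> proj F' (\<phi> e) = proj F e"
    "e \<in> topspace (etop F) \<Longrightarrow> \<phi> e \<in> topspace (etop F')"
    "x \<in> topspace (ctop C) \<Longrightarrow> u \<in> carrier (stalk F x) \<Longrightarrow> v \<in> carrier (stalk F x) \<Longrightarrow>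
       \<phi> (u \<oplus>\<^bsub>stalk F x\<^esub> v) = \<phi> u \<oplus>\<^bsub>stalk F' x\<^esub> \<phi> v"
    "x \<in> topspace (ctop C) \<Longrightarrow> a \<in> carrier (O_stalk C x) \<Longrightarrow> u \<in> carrier (stalk F x) \<Longrightarrow>
       \<phi> (a \<odot>\<^bsub>stalk F x\<^esub> u) = a \<odot>\<^bsub>stalk F' x\<^esub> \<phi> u"
  using assms by (auto simp: omod_hom_def continuous_map_def)

lemma pullback_hom_fiber:
  assumes "\<phi> \<in> omod_hom N (pullback N C \<Phi> F) (pullback N C \<Psi> F')" "y \<in> topspace (ctop N)" "e \<in> topspace (etop F)" "\<Phi> y = proj F e"
  shows "\<phi> (y, e) = (y, snd (\<phi> (y, e)))" "snd (\<phi> (y, e)) \<in> topspace (etop F')" "proj F' (snd (\<phi> (y, e))) = \<Psi> y"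
  using omod_homD(3,4)[OF assms(1), of "(y, e)"] assms(2-4)
  by (auto simp: topspace_pullback proj_pullback prod_eq_iff)

definition pull_hom :: "'q complex_mfd \<Rightarrow> ('q \<Rightarrow> 'p) \<Rightarrow> ('q, 'q \<times> 'e) omod \<Rightarrow> ('p \<times> 'e \<Rightarrow> 'p \<times> 'f) \<Rightarrow> 'q \<times> 'e \<Rightarrow> 'q \<times> 'f" where
  "pull_hom N' q F \<beta> = restrict (\<lambda>(g, e). (g, snd (\<beta> (q g, e)))) (topspace (etop F))"

text \<open>
  The pulled-back morphism is linear because upstairs every scalar is a pullback under \<open>q\<close>.
\<close>

lemma pull_hom:
  assumes q: "local_biholo_onto N' N q" and \<Phi>: "pulls_all_germs N' C (\<Phi> \<circ> q)" and F: "O_module C F"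
    and \<beta>: "\<beta> \<in> omod_hom N (pullback N C \<Phi> F) (pullback N C \<Psi> F')"
  shows "pull_hom N' q (pullback N' C (\<Phi> \<circ> q) F) \<beta> \<in> omod_hom N' (pullback N' C (\<Phi> \<circ> q) F) (pullback N' C (\<Psi> \<circ> q) F')"
proof -
  let ?P = "pullback N' C (\<Phi> \<circ> q) F" and ?P' = "pullback N' C (\<Psi> \<circ> q) F'"
  let ?\<alpha> = "pull_hom N' q ?P \<beta>"
  note q' = local_biholo_ontoD[OF q]
  have val: "?\<alpha> (g, e) = (g, snd (\<beta> (q g, e)))" if "(g, e) \<in> topspace (etop ?P)" for g e
    using that by (simp add: pull_hom_def)
  have carr: "carrier (stalk F (\<Phi> (q g))) = {e. (g, e) \<in> topspace (etop ?P)}" if "g \<in> topspace (ctop N')" for g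
    using O_moduleD(1)[OF F, of "\<Phi> (q g)"] \<Phi> that by (auto simp: pulls_all_germs_def topspace_pullback)
  have base: "\<Phi> (q g) \<in> topspace (ctop C)" if "g \<in> topspace (ctop N')" for g
    using \<Phi> that by (auto simp: pulls_all_germs_def)
  have carr': "(q g, e) \<in> carrier (stalk (pullback N C \<Phi> F) (q g))" if "e \<in> carrier (stalk F (\<Phi> (q g)))" for g e
    using that by (simp add: stalk_pullback)
  have "continuous_map (etop ?P) (etop ?P') ?\<alpha>"
  proof -
    have c1: "continuous_map (etop ?P) (ctop N') fst"
      unfolding etop_pullback by (intro continuous_map_from_subtopology continuous_map_fst)
    have c2: "continuous_map (etop ?P) (etop F) snd"
      unfolding etop_pullback by (intro continuous_map_from_subtopology continuous_map_snd)
    have "continuous_map (etop ?P) (etop (pullback N C \<Phi> F)) (\<lambda>x. (q (fst x), snd x))"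
      unfolding etop_pullback[of N]
      using continuous_map_compose[OF c1 q'(1)] c2
      by (auto simp: continuous_map_in_subtopology continuous_map_pairwise o_def topspace_pullback)
    from continuous_map_compose[OF this omod_homD(2)[OF \<beta>]]
    have "continuous_map (etop ?P) (etop F') (\<lambda>x. snd (\<beta> (q (fst x), snd x)))"
      unfolding etop_pullback[of N] by (auto simp: continuous_map_in_subtopology continuous_map_pairwise o_def)
    with c1 have "continuous_map (etop ?P) (etop ?P') (\<lambda>x. (fst x, snd (\<beta> (q (fst x), snd x))))"
      unfolding etop_pullback[of N' C "\<Psi> \<circ> q"]
      using pullback_hom_fiber(3)[OF \<beta>] q'(5)
      by (auto simp: continuous_map_in_subtopology continuous_map_pairwise o_def topspace_pullback)
    then show ?thesis by (rule continuous_map_eq) (auto simp: val)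
  qed
  moreover have "?\<alpha> (u \<oplus>\<^bsub>stalk ?P g\<^esub> v) = ?\<alpha> u \<oplus>\<^bsub>stalk ?P' g\<^esub> ?\<alpha> v"
    if g: "g \<in> topspace (ctop N')" and uv: "u \<in> carrier (stalk ?P g)" "v \<in> carrier (stalk ?P g)" for g u v
  proof -
    obtain e e' where e: "u = (g, e)" "v = (g, e')" "e \<in> carrier (stalk F (\<Phi> (q g)))" "e' \<in> carrier (stalk F (\<Phi> (q g)))"
      using uv by (auto simp: stalk_pullback)
    have "e \<oplus>\<^bsub>stalk F (\<Phi> (q g))\<^esub> e' \<in> carrier (stalk F (\<Phi> (q g)))"
      using O_module_closed(1)[OF F base[OF g]] e by auto
    then show ?thesis
      using omod_homD(5)[OF \<beta> q'(5)[OF g] carr'[OF e(3)] carr'[OF e(4)]] e g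
      by (auto simp: stalk_pullback carr val)
  qed
  moreover have "?\<alpha> (a \<odot>\<^bsub>stalk ?P g\<^esub> u) = a \<odot>\<^bsub>stalk ?P' g\<^esub> ?\<alpha> u"
    if g: "g \<in> topspace (ctop N')" and a: "a \<in> carrier (O_stalk N' g)" and u: "u \<in> carrier (stalk ?P g)" for g a u
  proof -
    obtain e where e: "u = (g, e)" "e \<in> carrier (stalk F (\<Phi> (q g)))"
      using u by (auto simp: stalk_pullback)
    obtain b where b: "b \<in> carrier (O_stalk N (q g))" "a = comp_germ N' q g b" using q'(4)[OF g] a by blast
    note inv = inv_comp_germ_compose[OF q g b(1)]
    let ?i = "inv_into (carrier (O_stalk C (\<Phi> (q g)))) (comp_germ N \<Phi> (q g)) b"
    have "?i \<in> carrier (O_stalk C (\<Phi> (q g)))"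
      using pulls_all_germs_inv[OF \<Phi> g a] by (simp add: b(2) inv)
    then have "?i \<odot>\<^bsub>stalk F (\<Phi> (q g))\<^esub> e \<in> carrier (stalk F (\<Phi> (q g)))"
      using O_module_closed(2)[OF F base[OF g]] e by auto
    then show ?thesis
      using omod_homD(6)[OF \<beta> q'(5)[OF g] b(1) carr'[OF e(2)]] e g
      by (auto simp: stalk_pullback carr val b(2) inv)
  qed
  moreover have "proj ?P' (?\<alpha> x) = proj ?P x" if "x \<in> topspace (etop ?P)" for x
    using val that by (cases x) (auto simp: proj_pullback)
  ultimately show ?thesis by (auto simp: omod_hom_def pull_hom_def)
qed

text \<open>
  The value over \<open>h\<close> is computed at some point of the fibre \<open>q -` {h}\<close>, so this is meaningful for
  morphisms which are constant along the fibres of \<open>q\<close>.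
\<close>

definition descend_hom :: "'q complex_mfd \<Rightarrow> ('q \<Rightarrow> 'p) \<Rightarrow> ('p, 'p \<times> 'e) omod \<Rightarrow> ('q \<times> 'e \<Rightarrow> 'q \<times> 'f) \<Rightarrow> 'p \<times> 'e \<Rightarrow> 'p \<times> 'f" where
  "descend_hom N' q F \<alpha> = restrict (\<lambda>(h, e). (h, snd (\<alpha> (inv_into (topspace (ctop N')) q h, e)))) (topspace (etop F))"

text \<open>
  The descended morphism is continuous because \<open>q\<close> is open and onto, and linear because every
  scalar below pulls back to one upstairs.
\<close>

lemma descend_hom:
  assumes q: "local_biholo_onto N' N q" and \<Phi>: "pulls_all_germs N' C (\<Phi> \<circ> q)" and F: "O_module C F"
    and \<alpha>: "\<alpha> \<in> omod_hom N' (pullback N' C (\<Phi> \<circ> q) F) (pullback N' C (\<Psi> \<circ> q) F')"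
    and fib: "\<And>g g' e. g \<in> topspace (ctop N') \<Longrightarrow> g' \<in> topspace (ctop N') \<Longrightarrow> q g = q g' \<Longrightarrow>
        e \<in> carrier (stalk F (\<Phi> (q g))) \<Longrightarrow> snd (\<alpha> (g, e)) = snd (\<alpha> (g', e))"
  shows "descend_hom N' q (pullback N C \<Phi> F) \<alpha> \<in> omod_hom N (pullback N C \<Phi> F) (pullback N C \<Psi> F')" (is "?\<beta> \<in> _")
    and "g \<in> topspace (ctop N') \<Longrightarrow> e \<in> carrier (stalk F (\<Phi> (q g))) \<Longrightarrow>
      descend_hom N' q (pullback N C \<Phi> F) \<alpha> (q g, e) = (q g, snd (\<alpha> (g, e)))"
proof -
  let ?P = "pullback N C \<Phi> F" and ?P' = "pullback N C \<Psi> F'"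
  let ?Q = "pullback N' C (\<Phi> \<circ> q) F" and ?Q' = "pullback N' C (\<Psi> \<circ> q) F'"
  note q' = local_biholo_ontoD[OF q]
  have base: "\<Phi> (q g) \<in> topspace (ctop C)" if "g \<in> topspace (ctop N')" for g
    using \<Phi> that by (auto simp: pulls_all_germs_def)
  have carr: "carrier (stalk F (\<Phi> (q g))) = {e. (q g, e) \<in> topspace (etop ?P)}" if "g \<in> topspace (ctop N')" for g
    unfolding O_moduleD(1)[OF F base[OF that]] topspace_pullback using q'(5)[OF that] by auto
  have carrQ: "carrier (stalk F (\<Phi> (q g))) = {e. (g, e) \<in> topspace (etop ?Q)}" if "g \<in> topspace (ctop N')" for g
    unfolding O_moduleD(1)[OF F base[OF that]] topspace_pullback using that by auto
  show val: "?\<beta> (q g, e) = (q g, snd (\<alpha> (g, e)))" if "g \<in> topspace (ctop N')" "e \<in> carrier (stalk F (\<Phi> (q g)))" for g e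
  proof -
    have "q g \<in> q ` topspace (ctop N')" using that by blast
    then have "inv_into (topspace (ctop N')) q (q g) \<in> topspace (ctop N')" "q (inv_into (topspace (ctop N')) q (q g)) = q g"
      by (auto intro: inv_into_into f_inv_into_f)
    then have "snd (\<alpha> (inv_into (topspace (ctop N')) q (q g), e)) = snd (\<alpha> (g, e))"
      by (intro fib) (use that in auto)
    then show ?thesis using carr[OF that(1)] that(2) by (simp add: descend_hom_def)
  qed
  have lift: "\<exists>g e. g \<in> topspace (ctop N') \<and> e \<in> carrier (stalk F (\<Phi> (q g))) \<and> x = (q g, e)"
    if "x \<in> topspace (etop ?P)" for x
  proof -
    obtain h e where x: "x = (h, e)" by (cases x)
    then have "h \<in> topspace (ctop N)" using that by (simp add: topspace_pullback)
    then obtain g where g: "g \<in> topspace (ctop N')" "h = q g" using q'(3) by blast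
    then show ?thesis using carr[OF g(1)] that x by auto
  qed
  have carr': "(g, e) \<in> carrier (stalk ?Q g)" if "e \<in> carrier (stalk F (\<Phi> (q g)))" for g e
    using that by (simp add: stalk_pullback)
  have fibre: "\<alpha> (g, e) = (g, snd (\<alpha> (g, e)))" "snd (\<alpha> (g, e)) \<in> topspace (etop F')" "proj F' (snd (\<alpha> (g, e))) = \<Psi> (q g)"
    if "g \<in> topspace (ctop N')" "e \<in> carrier (stalk F (\<Phi> (q g)))" for g e
    using pullback_hom_fiber[OF \<alpha> that(1), of e] that carrQ[OF that(1)] by (auto simp: topspace_pullback)
  have "continuous_map (etop ?P) (etop ?P') ?\<beta>"
    unfolding continuous_map_def
  proof (intro conjI allI impI funcsetI)
    show "?\<beta> x \<in> topspace (etop ?P')" if "x \<in> topspace (etop ?P)" for x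
      using lift[OF that] val fibre q'(5) by (auto simp: topspace_pullback)
    fix A assume A: "openin (etop ?P') A"
    define M where "M = {x \<in> topspace (etop ?Q). (q (fst (\<alpha> x)), snd (\<alpha> x)) \<in> A}"
    have "openin (etop ?Q) M"
    proof -
      have c1: "continuous_map (etop ?Q') (ctop N') fst"
        unfolding etop_pullback by (intro continuous_map_from_subtopology continuous_map_fst)
      have c2: "continuous_map (etop ?Q') (etop F') snd"
        unfolding etop_pullback by (intro continuous_map_from_subtopology continuous_map_snd)
      have "continuous_map (etop ?Q') (etop ?P') (\<lambda>x. (q (fst x), snd x))"
        unfolding etop_pullback[of N]
        using continuous_map_compose[OF c1 q'(1)] c2
        by (auto simp: continuous_map_in_subtopology continuous_map_pairwise o_def topspace_pullback)
      from openin_continuous_map_preimage[OF continuous_map_compose[OF omod_homD(2)[OF \<alpha>] this] A]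
      show ?thesis by (simp add: M_def o_def)
    qed
    then obtain T where T: "openin (prod_topology (ctop N') (etop F)) T" "M = T \<inter> {(y, e). (\<Phi> \<circ> q) y = proj F e}"
      by (auto simp: etop_pullback openin_subtopology)
    show "openin (etop ?P) {x \<in> topspace (etop ?P). ?\<beta> x \<in> A}"
    proof (subst openin_subopen, intro ballI)
      fix x assume x: "x \<in> {x \<in> topspace (etop ?P). ?\<beta> x \<in> A}"
      then obtain g e where g: "g \<in> topspace (ctop N')" "e \<in> carrier (stalk F (\<Phi> (q g)))" "x = (q g, e)"
        using lift by blast
      have "(g, e) \<in> M"
        using x g val[OF g(1,2)] fibre(1)[OF g(1,2)] carrQ[OF g(1)] by (auto simp: M_def) (metis fst_conv)
      then have "(g, e) \<in> T" using T(2) by blast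
      then obtain D E where DE: "openin (ctop N') D" "openin (etop F) E" "g \<in> D" "e \<in> E" "D \<times> E \<subseteq> T"
        using T(1) unfolding openin_prod_topology_alt by metis
      let ?R = "(q ` D \<times> E) \<inter> {(y, e). \<Phi> y = proj F e}"
      have "openin (etop ?P) ?R"
      proof -
        have "openin (ctop N) (q ` D)" using q'(2) DE(1) by (auto simp: open_map_def)
        then have "openin (prod_topology (ctop N) (etop F)) (q ` D \<times> E)" using DE(2) by (simp add: openin_prod_Times_iff)
        then show ?thesis unfolding etop_pullback by (auto simp: openin_subtopology)
      qed
      moreover have "x \<in> ?R" using g DE x by (auto simp: topspace_pullback)
      moreover have "?R \<subseteq> {x \<in> topspace (etop ?P). ?\<beta> x \<in> A}"
      proof
        fix y assume y: "y \<in> ?R"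
        then obtain g' e' where g': "g' \<in> D" "e' \<in> E" "y = (q g', e')" "\<Phi> (q g') = proj F e'" by auto
        have g't: "g' \<in> topspace (ctop N')" using g'(1) openin_subset[OF DE(1)] by auto
        have "(g', e') \<in> M" using T(2) DE(5) g' by auto
        then have *: "(g', e') \<in> topspace (etop ?Q)" "(q (fst (\<alpha> (g', e'))), snd (\<alpha> (g', e'))) \<in> A" by (auto simp: M_def)
        then have e': "e' \<in> carrier (stalk F (\<Phi> (q g')))" using carrQ[OF g't] by auto
        have "?\<beta> y \<in> A" using val[OF g't e'] *(2) fibre(1)[OF g't e'] g'(3) by (metis fst_conv)
        then show "y \<in> {x \<in> topspace (etop ?P). ?\<beta> x \<in> A}" using carr[OF g't] e' g'(3) by auto
      qed
      ultimately show "\<exists>S. openin (etop ?P) S \<and> x \<in> S \<and> S \<subseteq> {x \<in> topspace (etop ?P). ?\<beta> x \<in> A}" by blast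
    qed
  qed
  moreover have "?\<beta> (u \<oplus>\<^bsub>stalk ?P h\<^esub> v) = ?\<beta> u \<oplus>\<^bsub>stalk ?P' h\<^esub> ?\<beta> v"
    if h: "h \<in> topspace (ctop N)" and uv: "u \<in> carrier (stalk ?P h)" "v \<in> carrier (stalk ?P h)" for h u v
  proof -
    obtain g where g: "g \<in> topspace (ctop N')" "h = q g" using h q'(3) by blast
    obtain e e' where e: "u = (q g, e)" "v = (q g, e')" "e \<in> carrier (stalk F (\<Phi> (q g)))" "e' \<in> carrier (stalk F (\<Phi> (q g)))"
      using uv g by (auto simp: stalk_pullback)
    have "e \<oplus>\<^bsub>stalk F (\<Phi> (q g))\<^esub> e' \<in> carrier (stalk F (\<Phi> (q g)))"
      using O_module_closed(1)[OF F base[OF g(1)]] e by auto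
    then show ?thesis
      using omod_homD(5)[OF \<alpha> g(1) carr'[OF e(3)] carr'[OF e(4)]] e g
      by (auto simp: stalk_pullback val)
  qed
  moreover have "?\<beta> (b \<odot>\<^bsub>stalk ?P h\<^esub> u) = b \<odot>\<^bsub>stalk ?P' h\<^esub> ?\<beta> u"
    if h: "h \<in> topspace (ctop N)" and b: "b \<in> carrier (O_stalk N h)" and u: "u \<in> carrier (stalk ?P h)" for h b u
  proof -
    obtain g where g: "g \<in> topspace (ctop N')" "h = q g" using h q'(3) by blast
    obtain e where e: "u = (q g, e)" "e \<in> carrier (stalk F (\<Phi> (q g)))"
      using u g by (auto simp: stalk_pullback)
    let ?a = "comp_germ N' q g b"
    have b': "b \<in> carrier (O_stalk N (q g))" using b g by simp
    have a: "?a \<in> carrier (O_stalk N' g)" using q'(4)[OF g(1)] b' by blast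
    note inv = inv_comp_germ_compose[OF q g(1) b']
    let ?i = "inv_into (carrier (O_stalk C (\<Phi> (q g)))) (comp_germ N \<Phi> (q g)) b"
    have "?i \<in> carrier (O_stalk C (\<Phi> (q g)))"
      using pulls_all_germs_inv[OF \<Phi> g(1) a] by (simp add: inv)
    then have "?i \<odot>\<^bsub>stalk F (\<Phi> (q g))\<^esub> e \<in> carrier (stalk F (\<Phi> (q g)))"
      using O_module_closed(2)[OF F base[OF g(1)]] e by auto
    then show ?thesis
      using omod_homD(6)[OF \<alpha> g(1) a carr'[OF e(2)]] e g
      by (auto simp: stalk_pullback val inv)
  qed
  moreover have "proj ?P' (?\<beta> x) = proj ?P x" if "x \<in> topspace (etop ?P)" for x
    using lift[OF that] val by (auto simp: proj_pullback)
  ultimately show "?\<beta> \<in> omod_hom N ?P ?P'" by (auto simp: omod_hom_def descend_hom_def)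
qed


section \<open>Descent of equivariant sheaves\<close>

lemma equivariant_coherentD:
  assumes "equivariant_coherent G (F, \<alpha>)"
  shows "coherent_sheaf (gobj G) F" "O_module (gobj G) F"
    "\<alpha> \<in> omod_iso (garr G) (src_pullback G F) (tgt_pullback G F)"
    "\<alpha> \<in> omod_hom (garr G) (src_pullback G F) (tgt_pullback G F)"
    "x \<in> topspace (ctop (gobj G)) \<Longrightarrow> e \<in> carrier (stalk F x) \<Longrightarrow> act \<alpha> (gunit G x) e = e"
    "g \<in> arrows G \<Longrightarrow> h \<in> arrows G \<Longrightarrow> gsrc G g = gtgt G h \<Longrightarrow> e \<in> carrier (stalk F (gsrc G h)) \<Longrightarrow>
       act \<alpha> (gmult G g h) e = act \<alpha> g (act \<alpha> h e)"
  using assms by (auto simp: equivariant_coherent_def coherent_sheaf_def omod_iso_def)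

text \<open>
  This keeps actions inside the stalks, so that equivariant morphisms can be composed.
\<close>

definition arrows_over_objects :: "('o, 'g) cgroupoid \<Rightarrow> bool" where
  "arrows_over_objects G \<longleftrightarrow> (\<forall>g\<in>arrows G. gsrc G g \<in> topspace (ctop (gobj G)) \<and> gtgt G g \<in> topspace (ctop (gobj G)))"

lemma act_in_stalk:
  assumes "arrows_over_objects G" "equivariant_coherent G (F, \<alpha>)" "g \<in> arrows G" "e \<in> carrier (stalk F (gsrc G g))"
  shows "\<alpha> (g, e) = (g, act \<alpha> g e)" "act \<alpha> g e \<in> carrier (stalk F (gtgt G g))"
proof -
  have o: "gsrc G g \<in> topspace (ctop (gobj G))" "gtgt G g \<in> topspace (ctop (gobj G))"
    using assms(1,3) by (auto simp: arrows_over_objects_def)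
  note F = equivariant_coherentD(2,4)[OF assms(2)]
  have e: "e \<in> topspace (etop F)" "gsrc G g = proj F e" using O_moduleD(1)[OF F(1) o(1)] assms(4) by auto
  from pullback_hom_fiber[OF F(2) assms(3) e]
  show "\<alpha> (g, e) = (g, act \<alpha> g e)" "act \<alpha> g e \<in> carrier (stalk F (gtgt G g))"
    using O_moduleD(1)[OF F(1) o(2)] by (auto simp: act_def)
qed

lemma omod_hom_in_stalk:
  assumes "\<phi> \<in> omod_hom C F F'" "O_module C F" "O_module C F'" "x \<in> topspace (ctop C)" "e \<in> carrier (stalk F x)"
  shows "\<phi> e \<in> carrier (stalk F' x)"
  using omod_homD(3,4)[OF assms(1), of e] O_moduleD(1)[OF assms(2,4)] O_moduleD(1)[OF assms(3,4)] assms(5) by auto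

lemma stalk_subset: "O_module C F \<Longrightarrow> x \<in> topspace (ctop C) \<Longrightarrow> carrier (stalk F x) \<subseteq> topspace (etop F)"
  using O_moduleD(1) by fastforce

lemma omod_hom_id:
  assumes "O_module C F" shows "restrict (\<lambda>e. e) (topspace (etop F)) \<in> omod_hom C F F"
proof -
  have "continuous_map (etop F) (etop F) (restrict (\<lambda>e. e) (topspace (etop F)))"
    by (rule continuous_map_eq[OF continuous_map_id]) auto
  then show ?thesis
    using O_module_closed[OF assms] stalk_subset[OF assms] by (auto simp: omod_hom_def subset_iff)
qed

lemma omod_hom_compose:
  assumes f: "f \<in> omod_hom C F F'" and g: "g \<in> omod_hom C F' F''" and "O_module C F" "O_module C F'"
  shows "compose (topspace (etop F)) g f \<in> omod_hom C F F''"
proof -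
  have "continuous_map (etop F) (etop F'') (compose (topspace (etop F)) g f)"
    by (rule continuous_map_eq[OF continuous_map_compose[OF omod_homD(2)[OF f] omod_homD(2)[OF g]]])
      (auto simp: compose_def)
  moreover have "compose (topspace (etop F)) g f e = g (f e)" if "x \<in> topspace (ctop C)" "e \<in> carrier (stalk F x)" for x e
    using that stalk_subset[OF assms(3)] by (auto simp: compose_def)
  ultimately show ?thesis
    using omod_hom_in_stalk[OF f assms(3,4)] O_module_closed[OF assms(3)] omod_homD(3,4)[OF f] omod_homD(3)[OF g]
      omod_homD(5,6)[OF f] omod_homD(5,6)[OF g]
    by (auto simp: omod_hom_def compose_def)
qed

lemma is_category_Coh_an:
  fixes G :: "('o, 'g) cgroupoid"
  assumes G: "arrows_over_objects G"
  shows "is_category (Coh_an G :: (('o, 'g, 'e) eq_sheaf, 'e \<Rightarrow> 'e) category)"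
proof -
  have o: "gsrc G g \<in> topspace (ctop (gobj G))" if "g \<in> arrows G" for g
    using G that by (auto simp: arrows_over_objects_def)
  have o': "gtgt G g \<in> topspace (ctop (gobj G))" if "g \<in> arrows G" for g
    using G that by (auto simp: arrows_over_objects_def)
  have id: "restrict (\<lambda>e. e) (topspace (etop F)) \<in> equivariant_hom G (F, \<alpha>) (F, \<alpha>)"
    if A: "equivariant_coherent G (F, \<alpha>)" for F and \<alpha> :: "'g \<times> 'e \<Rightarrow> 'g \<times> 'e"
  proof -
    note F = equivariant_coherentD(2)[OF A]
    have "e \<in> topspace (etop F)" "act \<alpha> g e \<in> topspace (etop F)"
      if g: "g \<in> arrows G" and e: "e \<in> carrier (stalk F (gsrc G g))" for g e
      using act_in_stalk(2)[OF G A g e] e stalk_subset[OF F o[OF g]] stalk_subset[OF F o'[OF g]] by blast+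
    then show ?thesis using omod_hom_id[OF F] by (simp add: equivariant_hom_def)
  qed
  have comp: "compose (topspace (etop F1)) g f \<in> equivariant_hom G (F1, \<alpha>1) (F3, \<alpha>3)"
    if f: "f \<in> equivariant_hom G (F1, \<alpha>1) (F2, \<alpha>2)" and g: "g \<in> equivariant_hom G (F2, \<alpha>2) (F3, \<alpha>3)"
      and A: "equivariant_coherent G (F1, \<alpha>1)" "equivariant_coherent G (F2, \<alpha>2)"
    for F1 F2 F3 f g and \<alpha>1 \<alpha>2 \<alpha>3 :: "'g \<times> 'e \<Rightarrow> 'g \<times> 'e"
  proof -
    have fg: "f \<in> omod_hom (gobj G) F1 F2" "g \<in> omod_hom (gobj G) F2 F3" using f g by (auto simp: equivariant_hom_def)
    have "compose (topspace (etop F1)) g f (act \<alpha>1 k e) = act \<alpha>3 k (compose (topspace (etop F1)) g f e)"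
      if k: "k \<in> arrows G" and e: "e \<in> carrier (stalk F1 (gsrc G k))" for k e
    proof -
      have "e \<in> topspace (etop F1)" "act \<alpha>1 k e \<in> topspace (etop F1)"
        using act_in_stalk(2)[OF G A(1) k e] e stalk_subset[OF equivariant_coherentD(2)[OF A(1)]] o[OF k] o'[OF k] by blast+
      moreover have "f e \<in> carrier (stalk F2 (gsrc G k))"
        using omod_hom_in_stalk[OF fg(1) equivariant_coherentD(2)[OF A(1)] equivariant_coherentD(2)[OF A(2)] o[OF k] e] .
      ultimately show ?thesis using f g k e by (auto simp: equivariant_hom_def compose_def)
    qed
    then show ?thesis
      using omod_hom_compose[OF fg equivariant_coherentD(2)[OF A(1)] equivariant_coherentD(2)[OF A(2)]]
      by (auto simp: equivariant_hom_def)
  qed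
  have ext: "f \<in> extensional (topspace (etop F1))" "\<And>e. e \<in> topspace (etop F1) \<Longrightarrow> f e \<in> topspace (etop F2)"
    if "f \<in> equivariant_hom G (F1, \<alpha>1) (F2, \<alpha>2)" for f F1 F2 and \<alpha>1 \<alpha>2 :: "'g \<times> 'e \<Rightarrow> 'g \<times> 'e"
    using that omod_homD(1,4)[of f "gobj G" F1 F2] by (auto simp: equivariant_hom_def)
  have idl: "compose (topspace (etop F1)) (restrict (\<lambda>e. e) (topspace (etop F2))) f = f"
    and idr: "compose (topspace (etop F1)) f (restrict (\<lambda>e. e) (topspace (etop F1))) = f"
    if "f \<in> equivariant_hom G (F1, \<alpha>1) (F2, \<alpha>2)" for f F1 F2 and \<alpha>1 \<alpha>2 :: "'g \<times> 'e \<Rightarrow> 'g \<times> 'e"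
    using ext[OF that] by (auto simp: compose_def fun_eq_iff extensional_def)
  have assoc: "compose (topspace (etop F1)) h (compose (topspace (etop F1)) g f)
      = compose (topspace (etop F1)) (compose (topspace (etop F2)) h g) f"
    if "f \<in> equivariant_hom G (F1, \<alpha>1) (F2, \<alpha>2)" for f g h F1 F2 and \<alpha>1 \<alpha>2 :: "'g \<times> 'e \<Rightarrow> 'g \<times> 'e"
    using ext[OF that] by (auto simp: compose_def fun_eq_iff)
  show ?thesis
    unfolding is_category_def Coh_an_def
    by (simp only: category.simps split_paired_all mem_Collect_eq Ball_def split_paired_All fst_conv)
      (intro conjI allI impI; (rule id comp idl idr assoc; assumption))
qed

lemma is_category_full_subcategory: "is_category C \<Longrightarrow> is_category (full_subcategory C P)"
  unfolding is_category_def full_subcategory_def by simp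

text \<open>
  The natural isomorphisms are identities because the inverse is strict.
\<close>

lemma equivalence_functorI:
  assumes F: "is_functor C D F" and G: "is_functor D C G"
    and FG: "\<And>a. a \<in> cobj C \<Longrightarrow> fobj G (fobj F a) = a" "\<And>b. b \<in> cobj D \<Longrightarrow> fobj F (fobj G b) = b"
    and mor: "\<And>a b f. fmor F a b f = f" "\<And>a b f. fmor G a b f = f"
  shows "equivalence_functor C D F"
proof -
  have C: "is_category C" "is_category D" using F by (auto simp: is_functor_def)
  have iso: "cid C a \<in> cat_iso C a a" if "is_category C" "a \<in> cobj C" for C :: "('z, 'm) category" and a
    using that unfolding is_category_def cat_iso_def by blast
  have nat: "ccomp C a b b (cid C b) f = ccomp C a a b f (cid C a)"
    if "is_category C" "a \<in> cobj C" "b \<in> cobj C" "f \<in> chom C a b" for C :: "('z, 'm) category" and a b f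
    using that unfolding is_category_def by metis
  have "natural_iso C C id_functor (comp_functor G F) (cid C)"
    unfolding natural_iso_def id_functor_def comp_functor_def using iso[OF C(1)] nat[OF C(1)] FG mor by simp
  moreover have "natural_iso D D (comp_functor F G) id_functor (cid D)"
    unfolding natural_iso_def id_functor_def comp_functor_def using iso[OF C(2)] nat[OF C(2)] FG mor by simp
  ultimately show ?thesis unfolding equivalence_functor_def using F G by blast
qed

text \<open>
  What descent along \<open>q\<close> relies on. The last assumption says that the fibres of \<open>q\<close> are orbits under
  composition with kernel elements at the source.
\<close>

locale groupoid_quotient =
  fixes G :: "('o, 'g) cgroupoid" and H :: "('o, 'h) cgroupoid" and q :: "'g \<Rightarrow> 'h"
  assumes obj: "gobj H = gobj G"
    and src: "gsrc G = gsrc H \<circ> q" and tgt: "gtgt G = gtgt H \<circ> q"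
    and q: "local_biholo_onto (garr G) (garr H) q"
    and germs: "pulls_all_germs (garr G) (gobj G) (gsrc G)" "pulls_all_germs (garr G) (gobj G) (gtgt G)"
    and unit: "x \<in> topspace (ctop (gobj G)) \<Longrightarrow> gunit G x \<in> arrows G \<and> gsrc G (gunit G x) = x \<and> q (gunit G x) = gunit H x"
    and mult: "g \<in> arrows G \<Longrightarrow> h \<in> arrows G \<Longrightarrow> gsrc G g = gtgt G h \<Longrightarrow>
      gmult G g h \<in> arrows G \<and> gsrc G (gmult G g h) = gsrc G h \<and> q (gmult G g h) = gmult H (q g) (q h)"
    and fibre: "g \<in> arrows G \<Longrightarrow> g' \<in> arrows G \<Longrightarrow> q g = q g' \<Longrightarrow>
      \<exists>k\<in>kernel_subgroupoid G H q. gsrc G g' = gtgt G k \<and> gsrc G k = gsrc G g \<and> gmult G g' k = g"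
begin

lemmas q_props = local_biholo_ontoD[OF q]

lemma over: "arrows_over_objects G" "arrows_over_objects H"
proof -
  show 1: "arrows_over_objects G"
    using germs by (auto simp: arrows_over_objects_def pulls_all_germs_def)
  have "gsrc H h \<in> topspace (ctop (gobj H)) \<and> gtgt H h \<in> topspace (ctop (gobj H))" if h: "h \<in> arrows H" for h
  proof -
    obtain g where "g \<in> arrows G" "h = q g" using h q_props(3) by blast
    then show ?thesis using 1 src tgt obj by (auto simp: arrows_over_objects_def)
  qed
  then show "arrows_over_objects H" by (auto simp: arrows_over_objects_def)
qed

lemma germs': "pulls_all_germs (garr G) (gobj G) (gsrc H \<circ> q)" "pulls_all_germs (garr G) (gobj G) (gtgt H \<circ> q)"
  using germs src tgt by auto

definition pull_obj :: "('o, 'h, 'e) eq_sheaf \<Rightarrow> ('o, 'g, 'e) eq_sheaf" where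
  "pull_obj = (\<lambda>(F, \<beta>). (F, pull_hom (garr G) q (src_pullback G F) \<beta>))"

lemma fobj_pullback_functor: "fobj (pullback_functor G q) = pull_obj"
  by (auto simp: pullback_functor_def pull_obj_def pull_hom_def act_def fun_eq_iff)

definition descend_obj :: "('o, 'g, 'e) eq_sheaf \<Rightarrow> ('o, 'h, 'e) eq_sheaf" where
  "descend_obj = (\<lambda>(F, \<alpha>). (F, descend_hom (garr G) q (src_pullback H F) \<alpha>))"

lemma act_pull:
  assumes "O_module (gobj G) F" "g \<in> arrows G" "e \<in> carrier (stalk F (gsrc G g))"
  shows "act (pull_hom (garr G) q (src_pullback G F) \<beta>) g e = act \<beta> (q g) e"
  using assms over(1) O_moduleD(1)[OF assms(1), of "gsrc G g"]
  by (auto simp: act_def pull_hom_def topspace_pullback arrows_over_objects_def)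

lemma pull_iso:
  assumes F: "O_module (gobj G) F" and \<beta>: "\<beta> \<in> omod_iso (garr H) (src_pullback H F) (tgt_pullback H F)"
  shows "pull_hom (garr G) q (src_pullback G F) \<beta> \<in> omod_iso (garr G) (src_pullback G F) (tgt_pullback G F)"
proof -
  obtain \<psi> where \<psi>: "\<psi> \<in> omod_hom (garr H) (tgt_pullback H F) (src_pullback H F)"
    "\<And>x. x \<in> topspace (etop (src_pullback H F)) \<Longrightarrow> \<psi> (\<beta> x) = x" "\<And>x. x \<in> topspace (etop (tgt_pullback H F)) \<Longrightarrow> \<beta> (\<psi> x) = x"
    and \<beta>h: "\<beta> \<in> omod_hom (garr H) (src_pullback H F) (tgt_pullback H F)"
    using \<beta> by (auto simp: omod_iso_def)
  have 1: "pull_hom (garr G) q (src_pullback G F) \<beta> \<in> omod_hom (garr G) (src_pullback G F) (tgt_pullback G F)"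
    using pull_hom[OF q germs'(1) F \<beta>h[unfolded obj]] by (simp add: src tgt)
  have 2: "pull_hom (garr G) q (tgt_pullback G F) \<psi> \<in> omod_hom (garr G) (tgt_pullback G F) (src_pullback G F)"
    using pull_hom[OF q germs'(2) F \<psi>(1)[unfolded obj]] by (simp add: src tgt)
  have "pull_hom (garr G) q (tgt_pullback G F) \<psi> (pull_hom (garr G) q (src_pullback G F) \<beta> x) = x"
    if x: "x \<in> topspace (etop (src_pullback G F))" for x
  proof -
    obtain g e where ge: "x = (g, e)" "g \<in> arrows G" "e \<in> topspace (etop F)" "gsrc H (q g) = proj F e"
      using x by (auto simp: topspace_pullback src)
    note f = pullback_hom_fiber[OF \<beta>h q_props(5)[OF ge(2)] ge(3,4)]
    have "\<psi> (q g, snd (\<beta> (q g, e))) = (q g, e)"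
      using \<psi>(2)[of "(q g, e)"] f(1) ge q_props(5) by (auto simp: topspace_pullback)
    then show ?thesis using f ge by (auto simp: pull_hom_def topspace_pullback src tgt)
  qed
  moreover have "pull_hom (garr G) q (src_pullback G F) \<beta> (pull_hom (garr G) q (tgt_pullback G F) \<psi> x) = x"
    if x: "x \<in> topspace (etop (tgt_pullback G F))" for x
  proof -
    obtain g e where ge: "x = (g, e)" "g \<in> arrows G" "e \<in> topspace (etop F)" "gtgt H (q g) = proj F e"
      using x by (auto simp: topspace_pullback tgt)
    note f = pullback_hom_fiber[OF \<psi>(1) q_props(5)[OF ge(2)] ge(3,4)]
    have "\<beta> (q g, snd (\<psi> (q g, e))) = (q g, e)"
      using \<psi>(3)[of "(q g, e)"] f(1) ge q_props(5) by (auto simp: topspace_pullback)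
    then show ?thesis using f ge by (auto simp: pull_hom_def topspace_pullback src tgt)
  qed
  ultimately show ?thesis using 1 2 unfolding omod_iso_def mem_Collect_eq by blast
qed

lemma pull_equivariant:
  assumes A: "equivariant_coherent H (F, \<beta>)"
  shows "equivariant_coherent G (pull_obj (F, \<beta>))"
    and "acts_as_identity G (kernel_subgroupoid G H q) (pull_obj (F, \<beta>))"
proof -
  note F = equivariant_coherentD[OF A, unfolded obj]
  let ?\<alpha> = "pull_hom (garr G) q (src_pullback G F) \<beta>"
  have o: "gsrc G g \<in> topspace (ctop (gobj G))" if "g \<in> arrows G" for g
    using over(1) that by (auto simp: arrows_over_objects_def)
  show "equivariant_coherent G (pull_obj (F, \<beta>))"
    unfolding equivariant_coherent_def pull_obj_def prod.case
  proof (intro conjI ballI impI)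
    show "coherent_sheaf (gobj G) F" by (rule F(1))
    show "?\<alpha> \<in> omod_iso (garr G) (src_pullback G F) (tgt_pullback G F)"
      by (rule pull_iso[OF F(2)]) (use F(3) obj in simp)
    show "act ?\<alpha> (gunit G x) e = e" if "x \<in> topspace (ctop (gobj G))" "e \<in> carrier (stalk F x)" for x e
      using act_pull[OF F(2), of "gunit G x" e] unit[OF that(1)] F(5)[OF that] that(2) by simp
    fix g h e assume gh: "g \<in> arrows G" "h \<in> arrows G" "gsrc G g = gtgt G h" and e: "e \<in> carrier (stalk F (gsrc G h))"
    have e': "e \<in> carrier (stalk F (gsrc H (q h)))" using e by (simp add: src)
    have "act \<beta> (q h) e \<in> carrier (stalk F (gtgt H (q h)))"
      using act_in_stalk(2)[OF over(2) A q_props(5)[OF gh(2)] e'] .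
    then have "act \<beta> (q h) e \<in> carrier (stalk F (gsrc G g))" using gh(3) by (simp add: tgt)
    then have "act ?\<alpha> g (act ?\<alpha> h e) = act \<beta> (q g) (act \<beta> (q h) e)"
      using act_pull[OF F(2) gh(1), of "act \<beta> (q h) e"] act_pull[OF F(2) gh(2) e] by metis
    also have "\<dots> = act \<beta> (gmult H (q g) (q h)) e"
      using F(6)[OF q_props(5)[OF gh(1)] q_props(5)[OF gh(2)] _ e'] gh(3) by (simp add: src tgt)
    also have "\<dots> = act ?\<alpha> (gmult G g h) e"
      using act_pull[OF F(2), of "gmult G g h" e] mult[OF gh] e by metis
    finally show "act ?\<alpha> (gmult G g h) e = act ?\<alpha> g (act ?\<alpha> h e)" by simp
  qed
  have "act ?\<alpha> k e = e" if k: "k \<in> kernel_subgroupoid G H q" and e: "e \<in> carrier (stalk F (gsrc G k))" for k e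
  proof -
    have k': "k \<in> arrows G" "q k = gunit H (gsrc G k)" using k by (auto simp: kernel_subgroupoid_def)
    then show ?thesis using act_pull[OF F(2) k'(1) e] F(5)[OF o[OF k'(1)] e] by simp
  qed
  then show "acts_as_identity G (kernel_subgroupoid G H q) (pull_obj (F, \<beta>))"
    by (auto simp: acts_as_identity_def pull_obj_def)
qed

text \<open>Two arrows in one fibre of \<open>q\<close> differ by an element of the kernel, so they act alike.\<close>

lemma act_constant_on_fibres:
  assumes A: "equivariant_coherent G (F, \<alpha>)" and K: "acts_as_identity G (kernel_subgroupoid G H q) (F, \<alpha>)"
    and g: "g \<in> arrows G" "g' \<in> arrows G" "q g = q g'" and e: "e \<in> carrier (stalk F (gsrc G g))"
  shows "act \<alpha> g e = act \<alpha> g' e"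
proof -
  obtain k where k: "k \<in> kernel_subgroupoid G H q" "gsrc G g' = gtgt G k" "gsrc G k = gsrc G g" "gmult G g' k = g"
    using fibre[OF g] by blast
  have "k \<in> arrows G" using k(1) by (auto simp: kernel_subgroupoid_def)
  then have "act \<alpha> g e = act \<alpha> g' (act \<alpha> k e)"
    using equivariant_coherentD(6)[OF A g(2) _ k(2), of e] k(3,4) e by simp
  also have "act \<alpha> k e = e" using K k(1,3) e by (auto simp: acts_as_identity_def)
  finally show ?thesis .
qed

text \<open>
  The identities for the descended action are verified at preimages under \<open>q\<close>; composable arrows
  have composable preimages because \<open>q\<close> preserves sources and targets.
\<close>

lemma descend_equivariant:
  assumes A: "equivariant_coherent G (F, \<alpha>)" and K: "acts_as_identity G (kernel_subgroupoid G H q) (F, \<alpha>)"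
  shows "equivariant_coherent H (descend_obj (F, \<alpha>))"
    and "g \<in> arrows G \<Longrightarrow> e \<in> carrier (stalk F (gsrc G g)) \<Longrightarrow> act (snd (descend_obj (F, \<alpha>))) (q g) e = act \<alpha> g e"
proof -
  note F = equivariant_coherentD[OF A]
  let ?\<beta> = "descend_hom (garr G) q (src_pullback H F) \<alpha>"
  obtain \<psi> where \<psi>: "\<psi> \<in> omod_hom (garr G) (tgt_pullback G F) (src_pullback G F)"
    "\<And>x. x \<in> topspace (etop (src_pullback G F)) \<Longrightarrow> \<psi> (\<alpha> x) = x" "\<And>x. x \<in> topspace (etop (tgt_pullback G F)) \<Longrightarrow> \<alpha> (\<psi> x) = x"
    using F(3) by (auto simp: omod_iso_def)
  have carrS: "(g, e) \<in> topspace (etop (src_pullback G F)) \<longleftrightarrow> e \<in> carrier (stalk F (gsrc H (q g)))"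
    and carrT: "(g, e) \<in> topspace (etop (tgt_pullback G F)) \<longleftrightarrow> e \<in> carrier (stalk F (gtgt H (q g)))"
    if "g \<in> arrows G" for g e
    using O_moduleD(1)[OF F(2), of "gsrc H (q g)"] O_moduleD(1)[OF F(2), of "gtgt H (q g)"] over(1) that
    by (auto simp: topspace_pullback arrows_over_objects_def src tgt)
  have fibS: "snd (\<alpha> (g, e)) = snd (\<alpha> (g', e))"
    if "g \<in> arrows G" "g' \<in> arrows G" "q g = q g'" "e \<in> carrier (stalk F (gsrc H (q g)))" for g g' e
    using act_constant_on_fibres[OF A K that(1-3), of e] that(4) by (simp add: act_def src)
  have S: "\<psi> (g, snd (\<alpha> (g, e))) = (g, e)" "\<alpha> (g, e) = (g, snd (\<alpha> (g, e)))" "snd (\<alpha> (g, e)) \<in> carrier (stalk F (gtgt H (q g)))"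
    if "g \<in> arrows G" "e \<in> carrier (stalk F (gsrc H (q g)))" for g e
    using act_in_stalk[OF over(1) A that(1), of e] that carrS[OF that(1)] \<psi>(2)[of "(g, e)"] by (auto simp: act_def src tgt)
  have T: "\<alpha> (g, snd (\<psi> (g, e))) = (g, e)" "snd (\<psi> (g, e)) \<in> carrier (stalk F (gsrc H (q g)))" "\<psi> (g, e) = (g, snd (\<psi> (g, e)))"
    if "g \<in> arrows G" "e \<in> carrier (stalk F (gtgt H (q g)))" for g e
  proof -
    have ge: "(g, e) \<in> topspace (etop (tgt_pullback G F))" using carrT that by simp
    have "fst (\<psi> (g, e)) = g" using omod_homD(3)[OF \<psi>(1) ge] by (simp add: proj_pullback)
    then obtain e1 where e1: "\<psi> (g, e) = (g, e1)" by (metis prod.collapse)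
    moreover have "(g, e1) \<in> topspace (etop (src_pullback G F))" "\<alpha> (g, e1) = (g, e)"
      using omod_homD(4)[OF \<psi>(1) ge] \<psi>(3)[OF ge] by (simp_all add: e1)
    ultimately show "\<alpha> (g, snd (\<psi> (g, e))) = (g, e)" "snd (\<psi> (g, e)) \<in> carrier (stalk F (gsrc H (q g)))" "\<psi> (g, e) = (g, snd (\<psi> (g, e)))"
      using carrS[OF that(1)] by simp_all
  qed
  have fibT: "snd (\<psi> (g, e)) = snd (\<psi> (g', e))"
    if "g \<in> arrows G" "g' \<in> arrows G" "q g = q g'" "e \<in> carrier (stalk F (gtgt H (q g)))" for g g' e
  proof -
    define e1 where "e1 = snd (\<psi> (g, e))"
    have e1: "\<alpha> (g, e1) = (g, e)" "e1 \<in> carrier (stalk F (gsrc H (q g)))" "e1 \<in> carrier (stalk F (gsrc H (q g')))"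
      using T(1,2)[OF that(1,4)] that(3) by (simp_all add: e1_def)
    have "snd (\<alpha> (g', e1)) = e" using fibS[OF that(1-3) e1(2)] e1(1) by simp
    then have "\<psi> (g', e) = (g', e1)" using S(1)[OF that(2) e1(3)] by simp
    then show ?thesis by (simp add: e1_def)
  qed
  have \<alpha>': "\<alpha> \<in> omod_hom (garr G) (pullback (garr G) (gobj G) (gsrc H \<circ> q) F) (pullback (garr G) (gobj G) (gtgt H \<circ> q) F)"
    using F(4) by (simp add: src tgt)
  have \<psi>': "\<psi> \<in> omod_hom (garr G) (pullback (garr G) (gobj G) (gtgt H \<circ> q) F) (pullback (garr G) (gobj G) (gsrc H \<circ> q) F)"
    using \<psi>(1) by (simp add: src tgt)
  have d\<alpha>: "?\<beta> \<in> omod_hom (garr H) (src_pullback H F) (tgt_pullback H F)"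
    "g \<in> arrows G \<Longrightarrow> e \<in> carrier (stalk F (gsrc H (q g))) \<Longrightarrow> ?\<beta> (q g, e) = (q g, snd (\<alpha> (g, e)))" for g e
    unfolding obj by (rule descend_hom[OF q germs'(1) F(2) \<alpha>']; use fibS in blast)+
  have d\<psi>: "descend_hom (garr G) q (tgt_pullback H F) \<psi> \<in> omod_hom (garr H) (tgt_pullback H F) (src_pullback H F)"
    "g \<in> arrows G \<Longrightarrow> e \<in> carrier (stalk F (gtgt H (q g))) \<Longrightarrow>
      descend_hom (garr G) q (tgt_pullback H F) \<psi> (q g, e) = (q g, snd (\<psi> (g, e)))" for g e
    unfolding obj by (rule descend_hom[OF q germs'(2) F(2) \<psi>']; use fibT in blast)+
  have "descend_hom (garr G) q (tgt_pullback H F) \<psi> (?\<beta> x) = x" if x: "x \<in> topspace (etop (src_pullback H F))" for x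
  proof -
    obtain h e where h: "x = (h, e)" "h \<in> arrows H" using x by (auto simp: topspace_pullback)
    then obtain g where g: "g \<in> arrows G" "h = q g" using q_props(3) by blast
    have e: "e \<in> carrier (stalk F (gsrc H (q g)))"
      using x carrS[OF g(1)] h g by (auto simp: topspace_pullback src)
    show ?thesis using d\<alpha>(2)[OF g(1) e] d\<psi>(2)[OF g(1) S(3)[OF g(1) e]] S(1)[OF g(1) e] h g by simp
  qed
  moreover have "?\<beta> (descend_hom (garr G) q (tgt_pullback H F) \<psi> x) = x" if x: "x \<in> topspace (etop (tgt_pullback H F))" for x
  proof -
    obtain h e where h: "x = (h, e)" "h \<in> arrows H" using x by (auto simp: topspace_pullback)
    then obtain g where g: "g \<in> arrows G" "h = q g" using q_props(3) by blast
    have e: "e \<in> carrier (stalk F (gtgt H (q g)))"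
      using x carrT[OF g(1)] h g by (auto simp: topspace_pullback tgt)
    show ?thesis using d\<psi>(2)[OF g(1) e] d\<alpha>(2)[OF g(1) T(2)[OF g(1) e]] T(1)[OF g(1) e] h g by simp
  qed
  ultimately have iso: "?\<beta> \<in> omod_iso (garr H) (src_pullback H F) (tgt_pullback H F)"
    using d\<alpha>(1) d\<psi>(1) unfolding omod_iso_def mem_Collect_eq by blast
  have act: "act ?\<beta> (q g) e = act \<alpha> g e" if "g \<in> arrows G" "e \<in> carrier (stalk F (gsrc G g))" for g e
    using d\<alpha>(2)[OF that(1), of e] that(2) by (simp add: act_def src)
  then show "g \<in> arrows G \<Longrightarrow> e \<in> carrier (stalk F (gsrc G g)) \<Longrightarrow> act (snd (descend_obj (F, \<alpha>))) (q g) e = act \<alpha> g e"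
    by (simp add: descend_obj_def)
  show "equivariant_coherent H (descend_obj (F, \<alpha>))"
    unfolding equivariant_coherent_def descend_obj_def prod.case obj
  proof (intro conjI ballI impI)
    show "coherent_sheaf (gobj G) F" by (rule F(1))
    show "descend_hom (garr G) q (pullback (garr H) (gobj G) (gsrc H) F) \<alpha>
      \<in> omod_iso (garr H) (pullback (garr H) (gobj G) (gsrc H) F) (pullback (garr H) (gobj G) (gtgt H) F)"
      using iso by (simp add: obj)
    show "act (descend_hom (garr G) q (pullback (garr H) (gobj G) (gsrc H) F) \<alpha>) (gunit H x) e = e"
      if "x \<in> topspace (ctop (gobj G))" "e \<in> carrier (stalk F x)" for x e
      using act[of "gunit G x" e] unit[OF that(1)] that(2) F(5)[OF that] by (simp add: obj)
    fix h1 h2 e assume h: "h1 \<in> arrows H" "h2 \<in> arrows H" "gsrc H h1 = gtgt H h2" and e: "e \<in> carrier (stalk F (gsrc H h2))"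
    obtain g1 g2 where g: "g1 \<in> arrows G" "g2 \<in> arrows G" "h1 = q g1" "h2 = q g2" using h q_props(3) by blast
    have gs: "gsrc G g1 = gtgt G g2" "e \<in> carrier (stalk F (gsrc G g2))" using h(3) e g by (auto simp: src tgt)
    have "act \<alpha> g2 e \<in> carrier (stalk F (gsrc G g1))" using act_in_stalk(2)[OF over(1) A g(2) gs(2)] gs(1) by simp
    then show "act (descend_hom (garr G) q (pullback (garr H) (gobj G) (gsrc H) F) \<alpha>) (gmult H h1 h2) e =
       act (descend_hom (garr G) q (pullback (garr H) (gobj G) (gsrc H) F) \<alpha>) h1
         (act (descend_hom (garr G) q (pullback (garr H) (gobj G) (gsrc H) F) \<alpha>) h2 e)"
      using act[OF g(2) gs(2)] act[OF g(1)] act[of "gmult G g1 g2" e] mult[OF g(1,2) gs(1)] F(6)[OF g(1,2) gs] gs g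
      by (simp add: obj)
  qed
qed

lemma descend_pull:
  assumes A: "equivariant_coherent H (F, \<beta>)"
  shows "descend_obj (pull_obj (F, \<beta>)) = (F, \<beta>)"
proof -
  note F = equivariant_coherentD[OF A, unfolded obj]
  let ?\<alpha> = "pull_hom (garr G) q (src_pullback G F) \<beta>"
  have P: "equivariant_coherent G (F, ?\<alpha>)" "acts_as_identity G (kernel_subgroupoid G H q) (F, ?\<alpha>)"
    using pull_equivariant[OF A] by (simp_all add: pull_obj_def)
  let ?\<gamma> = "descend_hom (garr G) q (src_pullback H F) ?\<alpha>"
  have D: "equivariant_coherent H (F, ?\<gamma>)" using descend_equivariant(1)[OF P] by (simp add: descend_obj_def)
  have "?\<gamma> x = \<beta> x" for x
  proof (cases "x \<in> topspace (etop (src_pullback H F))")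
    case True
    obtain h e where h: "x = (h, e)" "h \<in> arrows H" using True by (auto simp: topspace_pullback)
    then obtain g where g: "g \<in> arrows G" "h = q g" using q_props(3) by blast
    have e: "e \<in> carrier (stalk F (gsrc H h))"
      using True O_moduleD(1)[OF F(2), of "gsrc H h"] over(2) h by (auto simp: topspace_pullback arrows_over_objects_def obj)
    have e': "e \<in> carrier (stalk F (gsrc G g))" using e g by (simp add: src)
    have "act ?\<gamma> h e = act \<beta> h e"
      using descend_equivariant(2)[OF P g(1) e'] act_pull[OF F(2) g(1) e'] g by (simp add: descend_obj_def)
    then show ?thesis
      using act_in_stalk(1)[OF over(2) A h(2) e] act_in_stalk(1)[OF over(2) D h(2) e] h by simp
  next
    case False
    have "\<beta> \<in> extensional (topspace (etop (src_pullback H F)))"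
      using omod_homD(1)[OF F(4)] by (simp add: obj)
    then show ?thesis using False by (cases x) (simp add: descend_hom_def extensional_def)
  qed
  then show ?thesis by (auto simp: pull_obj_def descend_obj_def)
qed

lemma pull_descend:
  assumes A: "equivariant_coherent G (F, \<alpha>)" and K: "acts_as_identity G (kernel_subgroupoid G H q) (F, \<alpha>)"
  shows "pull_obj (descend_obj (F, \<alpha>)) = (F, \<alpha>)"
proof -
  note F = equivariant_coherentD[OF A]
  have "pull_hom (garr G) q (src_pullback G F) (snd (descend_obj (F, \<alpha>))) x = \<alpha> x" for x
  proof (cases "x \<in> topspace (etop (src_pullback G F))")
    case True
    then obtain g e where g: "x = (g, e)" "g \<in> arrows G" by (auto simp: topspace_pullback)
    have e: "e \<in> carrier (stalk F (gsrc G g))"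
      using True O_moduleD(1)[OF F(2), of "gsrc G g"] over(1) g by (auto simp: topspace_pullback arrows_over_objects_def)
    have "pull_hom (garr G) q (src_pullback G F) (snd (descend_obj (F, \<alpha>))) x = (g, act (snd (descend_obj (F, \<alpha>))) (q g) e)"
      using True g by (simp add: pull_hom_def act_def)
    then show ?thesis
      using descend_equivariant(2)[OF A K g(2) e] act_in_stalk(1)[OF over(1) A g(2) e] g(1) by metis
  next
    case False
    then show ?thesis using omod_homD(1)[OF F(4)] by (cases x) (simp add: pull_hom_def extensional_def)
  qed
  then show ?thesis by (auto simp: pull_obj_def descend_obj_def)
qed

text \<open>Because \<open>q\<close> is onto, the two equivariance conditions on a morphism of sheaves are the same.\<close>

lemma equivariant_hom_pull:
  assumes A: "equivariant_coherent H A" "equivariant_coherent H A'"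
  shows "equivariant_hom G (pull_obj A) (pull_obj A') = equivariant_hom H A A'"
proof -
  obtain F \<beta> F' \<beta>' where eq: "A = (F, \<beta>)" "A' = (F', \<beta>')" by (cases A, cases A')
  have O: "O_module (gobj G) F" "O_module (gobj G) F'"
    using equivariant_coherentD(2)[OF A(1)[unfolded eq]] equivariant_coherentD(2)[OF A(2)[unfolded eq]] obj by auto
  have "(\<forall>g\<in>arrows G. \<forall>e\<in>carrier (stalk F (gsrc G g)).
        \<phi> (act (pull_hom (garr G) q (src_pullback G F) \<beta>) g e) = act (pull_hom (garr G) q (src_pullback G F') \<beta>') g (\<phi> e)) \<longleftrightarrow>
     (\<forall>h\<in>arrows H. \<forall>e\<in>carrier (stalk F (gsrc H h)). \<phi> (act \<beta> h e) = act \<beta>' h (\<phi> e))"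
    if \<phi>: "\<phi> \<in> omod_hom (gobj G) F F'" for \<phi>
  proof -
    have "\<phi> (act (pull_hom (garr G) q (src_pullback G F) \<beta>) g e) = \<phi> (act \<beta> (q g) e)"
      "act (pull_hom (garr G) q (src_pullback G F') \<beta>') g (\<phi> e) = act \<beta>' (q g) (\<phi> e)"
      if "g \<in> arrows G" "e \<in> carrier (stalk F (gsrc G g))" for g e
      using act_pull[OF O(1) that] act_pull[OF O(2) that(1) omod_hom_in_stalk[OF \<phi> O _ that(2)]] over(1) that(1)
      by (auto simp: arrows_over_objects_def)
    then have "(\<forall>g\<in>arrows G. \<forall>e\<in>carrier (stalk F (gsrc G g)).
        \<phi> (act (pull_hom (garr G) q (src_pullback G F) \<beta>) g e) = act (pull_hom (garr G) q (src_pullback G F') \<beta>') g (\<phi> e)) \<longleftrightarrow>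
      (\<forall>g\<in>arrows G. \<forall>e\<in>carrier (stalk F (gsrc H (q g))). \<phi> (act \<beta> (q g) e) = act \<beta>' (q g) (\<phi> e))"
      by (simp add: src)
    also have "\<dots> \<longleftrightarrow> (\<forall>h\<in>q ` arrows G. \<forall>e\<in>carrier (stalk F (gsrc H h)). \<phi> (act \<beta> h e) = act \<beta>' h (\<phi> e))"
      by simp
    finally show ?thesis unfolding q_props(3) .
  qed
  then show ?thesis unfolding eq by (auto simp: equivariant_hom_def pull_obj_def obj)
qed

text \<open>
  Pulling back and descending are mutually inverse on objects and do not change the morphisms.
\<close>

theorem pullback_equivalence:
  defines "CG \<equiv> (Coh_an G :: (('o, 'g, 'e) eq_sheaf, 'e \<Rightarrow> 'e) category)"
    and "CH \<equiv> (Coh_an H :: (('o, 'h, 'e) eq_sheaf, 'e \<Rightarrow> 'e) category)"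
  shows "fully_faithful CH CG (pullback_functor G q)"
    and "equivalence_functor CH (full_subcategory CG (acts_as_identity G (kernel_subgroupoid G H q))) (pullback_functor G q)"
proof -
  let ?K = "acts_as_identity G (kernel_subgroupoid G H q)" 
    and ?Q = "pullback_functor G q :: (('o, 'h, 'e) eq_sheaf, 'e \<Rightarrow> 'e, ('o, 'g, 'e) eq_sheaf, 'e \<Rightarrow> 'e) functr"
  let ?D = "full_subcategory CG ?K"
  have cat: "is_category CG" "is_category CH" "is_category ?D"
    using is_category_Coh_an[OF over(1)] is_category_Coh_an[OF over(2)] is_category_full_subcategory
    unfolding CG_def CH_def by blast+
  have fst: "fst (pull_obj A) = fst A" for A :: "('o, 'h, 'e) eq_sheaf" by (cases A) (simp add: pull_obj_def)
  have fst': "fst (descend_obj A) = fst A" for A :: "('o, 'g, 'e) eq_sheaf" by (cases A) (simp add: descend_obj_def)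
  have ob: "pull_obj A \<in> cobj ?D" if "A \<in> cobj CH" for A
    using that pull_equivariant[of "fst A" "snd A"] by (simp add: CH_def CG_def Coh_an_def full_subcategory_def)
  have hom: "chom CG (pull_obj A) (pull_obj B) = chom CH A B" if "A \<in> cobj CH" "B \<in> cobj CH" for A B
    using equivariant_hom_pull[of A B] that by (simp add: CH_def CG_def Coh_an_def)
  have mor: "fmor ?Q A B f = f" for A B and f :: "'e \<Rightarrow> 'e" by (simp add: pullback_functor_def)
  have mor_id: "fmor ?Q A B = (\<lambda>f. f)" for A B by (rule ext) (rule mor)
  have fun_D: "is_functor CH ?D ?Q"
    unfolding is_functor_def fobj_pullback_functor mor
    using cat ob hom fst by (simp add: full_subcategory_def) (simp add: CH_def CG_def Coh_an_def)
  have fun_G: "is_functor CH CG ?Q"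
    using fun_D cat(1) by (simp add: is_functor_def full_subcategory_def)
  show "fully_faithful CH CG ?Q"
    using fun_G hom by (simp add: fully_faithful_def fobj_pullback_functor mor_id bij_betw_def)
  define R :: "(('o, 'g, 'e) eq_sheaf, 'e \<Rightarrow> 'e, ('o, 'h, 'e) eq_sheaf, 'e \<Rightarrow> 'e) functr"
    where "R = \<lparr>fobj = descend_obj, fmor = (\<lambda>A B f. f)\<rparr>"
  have obR: "descend_obj A \<in> cobj CH" "pull_obj (descend_obj A) = A" if "A \<in> cobj ?D" for A
    using that descend_equivariant(1)[of "fst A" "snd A"] pull_descend[of "fst A" "snd A"]
    by (simp_all add: CH_def CG_def Coh_an_def full_subcategory_def)
  have homR: "chom CH (descend_obj A) (descend_obj B) = chom CG A B" if "A \<in> cobj ?D" "B \<in> cobj ?D" for A B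
    using hom[OF obR(1)[OF that(1)] obR(1)[OF that(2)]] obR(2)[OF that(1)] obR(2)[OF that(2)] by simp
  have fun_R: "is_functor ?D CH R"
    unfolding is_functor_def R_def functr.simps
    using cat obR(1) homR fst' by (simp add: full_subcategory_def) (simp add: CH_def CG_def Coh_an_def)
  show "equivalence_functor CH ?D ?Q"
  proof (rule equivalence_functorI[OF fun_D fun_R])
    show "fobj R (fobj ?Q A) = A" if "A \<in> cobj CH" for A
      using that descend_pull[of "fst A" "snd A"] by (simp add: R_def fobj_pullback_functor CH_def Coh_an_def)
    show "fobj ?Q (fobj R A) = A" if "A \<in> cobj ?D" for A
      using obR(2)[OF that] by (simp add: R_def fobj_pullback_functor)
  qed (simp_all add: mor R_def)
qed

end

section \<open>Smooth charts\<close>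

lemma topspace_subtopology_Euclidean:
  "openin (Euclidean_space m) S \<Longrightarrow> topspace (subtopology (Euclidean_space m) S) = S"
  using openin_subset by fastforce

lemma subtopology_Euclidean:
  "openin (Euclidean_space m) S \<Longrightarrow> subtopology (Euclidean_space m) S = top_of_set S"
  using subtopology_coord_space[of m S] by (simp add: Euclidean_space_eq)

lemma eventually_upd_in_Euclidean:
  assumes "openin (Euclidean_space m) S" "x \<in> S" "i < m"
  shows "eventually (\<lambda>h. x(i := h) \<in> S) (nhds (x i))"
  using eventually_upd_in_open[of m S x i] assms by (simp add: Euclidean_space_eq)

lemma differentiable_eq_near:
  fixes f g :: "real \<Rightarrow> 'a::real_normed_vector"
  assumes "f differentiable (at a)" "eventually (\<lambda>h. f h = g h) (nhds a)"
  shows "g differentiable (at a)"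
proof -
  obtain D where "(f has_derivative D) (at a)" using assms(1) by (auto simp: differentiable_def)
  moreover have "eventually (\<lambda>h. f h = g h) (at a)" using assms(2) by (simp add: eventually_nhds_conv_at)
  ultimately have "(g has_derivative D) (at a)"
    by (rule has_derivative_transform_eventually) (use eventually_nhds_x_imp_x[OF assms(2)] in auto)
  then show ?thesis by (auto simp: differentiable_def)
qed

lemma pdiff_cong:
  assumes S: "openin (Euclidean_space m) S" and "x \<in> S" "i < m" and eq: "\<And>y. y \<in> S \<Longrightarrow> f y = g y"
  shows "pdiff i f x = pdiff i g x"
  unfolding pdiff_def
proof (rule vector_derivative_cong_eq)
  show "eventually (\<lambda>h. h \<in> UNIV \<longrightarrow> f (x(i := h)) = g (x(i := h))) (nhds (x i))"
    using eventually_upd_in_Euclidean[OF assms(1-3)] eq by (auto elim: eventually_mono)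
qed auto

lemma Ck_in_cong:
  assumes S: "openin (Euclidean_space m) S"
  shows "(\<And>y. y \<in> S \<Longrightarrow> f y = g y) \<Longrightarrow> Ck_in k m S f \<Longrightarrow> Ck_in k m S g"
proof (induction k arbitrary: f g)
  case 0
  then show ?case
    using topspace_subtopology_Euclidean[OF S] by (auto intro: continuous_map_eq)
next
  case (Suc k)
  have c: "continuous_map (subtopology (Euclidean_space m) S) euclidean g"
    using Suc.prems topspace_subtopology_Euclidean[OF S] by (auto intro: continuous_map_eq)
  have d: "(\<lambda>h. g (x(i := h))) differentiable (at (x i))" if "i < m" "x \<in> S" for i x
  proof (rule differentiable_eq_near[of "\<lambda>h. f (x(i := h))"])
    show "eventually (\<lambda>h. f (x(i := h)) = g (x(i := h))) (nhds (x i))"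
      using eventually_upd_in_Euclidean[OF S that(2,1)] by eventually_elim (rule Suc.prems(1))
  qed (use Suc.prems(2) that in simp)
  have "Ck_in k m S (pdiff i g)" if i: "i < m" for i
  proof (rule Suc.IH)
    show "Ck_in k m S (pdiff i f)" using Suc.prems(2) i by simp
    show "pdiff i f y = pdiff i g y" if "y \<in> S" for y
      by (rule pdiff_cong[OF S that i Suc.prems(1)])
  qed
  with c d show ?case by simp
qed

lemma Ck_in_bounded_linear:
  assumes S: "openin (Euclidean_space m) S" and T: "bounded_linear T"
  shows "Ck_in k m S f \<Longrightarrow> Ck_in k m S (\<lambda>x. T (f x))"
proof (induction k arbitrary: f)
  case 0
  then show ?case
    using continuous_on_compose2[OF linear_continuous_on[OF T, of UNIV]] by (auto simp: subtopology_Euclidean[OF S])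
next
  case (Suc k)
  have c: "continuous_map (subtopology (Euclidean_space m) S) euclidean (\<lambda>x. T (f x))"
    using Suc.prems continuous_on_compose2[OF linear_continuous_on[OF T, of UNIV]] by (auto simp: subtopology_Euclidean[OF S])
  have vd: "((\<lambda>h. T (f (x(i := h)))) has_vector_derivative T (pdiff i f x)) (at (x i))" if "i < m" "x \<in> S" for i x
  proof -
    have "((\<lambda>h. f (x(i := h))) has_vector_derivative pdiff i f x) (at (x i))"
      using Suc.prems that by (simp add: pdiff_def vector_derivative_works)
    then show ?thesis by (rule bounded_linear.has_vector_derivative[OF T])
  qed
  have "Ck_in k m S (pdiff i (\<lambda>x. T (f x)))" if i: "i < m" for i
  proof (rule Ck_in_cong[OF S])
    show "Ck_in k m S (\<lambda>x. T (pdiff i f x))" using Suc.IH Suc.prems i by simp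
    show "T (pdiff i f y) = pdiff i (\<lambda>x. T (f x)) y" if "y \<in> S" for y
      using vector_derivative_at[OF vd[OF i that]] by (simp add: pdiff_def)
  qed
  with c vd show ?case by (auto intro: differentiableI_vector)
qed

lemma chart_onD:
  assumes "chart_on X m (U, \<phi>)"
  shows "openin X U" "U \<subseteq> topspace X" "inj_on \<phi> U" "openin X N \<Longrightarrow> openin (Euclidean_space m) (\<phi> ` (U \<inter> N))"
    "x \<in> U \<Longrightarrow> the_inv_into U \<phi> (\<phi> x) = x"
    "continuous_map (subtopology X U) euclidean \<phi>" "x \<in> U \<Longrightarrow> \<phi> x \<in> coord_space m"
    "continuous_map (top_of_set (\<phi> ` U)) X (the_inv_into U \<phi>)"
proof -
  have *: "openin X U" "openin (Euclidean_space m) (\<phi> ` U)"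
    "homeomorphic_map (subtopology X U) (subtopology (Euclidean_space m) (\<phi> ` U)) \<phi>"
    using assms by (auto simp: chart_on_def)
  show "openin X U" "U \<subseteq> topspace X" using *(1) openin_subset by auto
  then have tU: "topspace (subtopology X U) = U" by auto
  show inj: "inj_on \<phi> U" using homeomorphic_imp_injective_map[OF *(3)] tU by simp
  show inv: "x \<in> U \<Longrightarrow> the_inv_into U \<phi> (\<phi> x) = x" for x using the_inv_into_f_f[OF inj] .
  show "openin (Euclidean_space m) (\<phi> ` (U \<inter> N))" if "openin X N"
  proof -
    have "openin (subtopology X U) (U \<inter> N)" using that by (auto simp: openin_subtopology)
    then have "openin (subtopology (Euclidean_space m) (\<phi> ` U)) (\<phi> ` (U \<inter> N))"
      using homeomorphic_imp_open_map[OF *(3)] by (auto simp: open_map_def)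
    then show ?thesis using *(2) openin_trans_full by blast
  qed
  have "continuous_map (subtopology X U) (top_of_set (\<phi> ` U)) \<phi>"
    using homeomorphic_imp_continuous_map[OF *(3)] subtopology_Euclidean[OF *(2)] by simp
  then show "continuous_map (subtopology X U) euclidean \<phi>" by (simp add: continuous_map_in_subtopology)
  show "x \<in> U \<Longrightarrow> \<phi> x \<in> coord_space m" using openin_subset[OF *(2)] by (auto simp: Euclidean_space_eq)
  obtain g where g: "homeomorphic_maps (subtopology X U) (top_of_set (\<phi> ` U)) \<phi> g"
    using *(3) subtopology_Euclidean[OF *(2)] homeomorphic_map_maps by metis
  then have "continuous_map (top_of_set (\<phi> ` U)) X g"
    by (auto simp: homeomorphic_maps_def continuous_map_in_subtopology)
  moreover have "g y = the_inv_into U \<phi> y" if "y \<in> \<phi> ` U" for y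
  proof -
    obtain x where "x \<in> U" "y = \<phi> x" using \<open>y \<in> \<phi> ` U\<close> by blast
    then show ?thesis using g inv tU by (auto simp: homeomorphic_maps_def)
  qed
  ultimately show "continuous_map (top_of_set (\<phi> ` U)) X (the_inv_into U \<phi>)"
    by (auto intro: continuous_map_eq)
qed

lemma eventually_in_open_coords:
  fixes u :: "'a::real_normed_vector \<Rightarrow> nat \<Rightarrow> real"
  assumes S: "openin (Euclidean_space m) S" "u a0 \<in> S"
    and u: "\<And>k. k < m \<Longrightarrow> ((\<lambda>a. u a k) has_derivative u' k) (at a0)"
    and near: "eventually (\<lambda>a. u a \<in> coord_space m) (nhds a0)"
  shows "eventually (\<lambda>a. u a \<in> S) (nhds a0)"
proof -
  obtain \<delta> where \<delta>: "\<delta> > 0" "\<And>y. y \<in> coord_space m \<Longrightarrow> (\<And>i. i < m \<Longrightarrow> dist (y i) (u a0 i) < \<delta>) \<Longrightarrow> y \<in> S"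
    using open_coordinate_box[of m S "u a0"] S by (auto simp: Euclidean_space_eq)
  have "eventually (\<lambda>a. dist (u a k) (u a0 k) < \<delta>) (nhds a0)" if "k < m" for k
  proof -
    have "((\<lambda>a. u a k) \<longlongrightarrow> u a0 k) (nhds a0)"
      using has_derivative_continuous[OF u[OF that]] by (simp add: isCont_def tendsto_nhds_iff)
    from tendstoD[OF this \<delta>(1)] show ?thesis .
  qed
  then have "eventually (\<lambda>a. \<forall>k\<in>{..<m}. dist (u a k) (u a0 k) < \<delta>) (nhds a0)"
    by (intro eventually_ball_finite) auto
  then show ?thesis using near by eventually_elim (use \<delta>(2) in auto)
qed

lemma C1_chain_rule:
  fixes F :: "(nat \<Rightarrow> real) \<Rightarrow> real" and u :: "'a::real_normed_vector \<Rightarrow> nat \<Rightarrow> real"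
  assumes S: "openin (Euclidean_space m) S" and F: "Ck_in (Suc 0) m S F"
    and u: "\<And>k. k < m \<Longrightarrow> ((\<lambda>a. u a k) has_derivative u' k) (at a0)"
    and u0: "u a0 \<in> S" and near: "eventually (\<lambda>a. u a \<in> coord_space m) (nhds a0)"
  shows "((\<lambda>a. F (u a)) has_derivative (\<lambda>v. \<Sum>k<m. pdiff k F (u a0) * u' k v)) (at a0)"
proof (rule chain_rule_coordinates[where F'="\<lambda>k. pdiff k F", OF S[unfolded Euclidean_space_eq] _ _ u u0 near])
  show "((\<lambda>h. F (x(k := h))) has_real_derivative pdiff k F x) (at (x k))" if "x \<in> S" "k < m" for x k
    using F that by (simp add: pdiff_def has_real_derivative_iff_has_vector_derivative vector_derivative_works)
  show "continuous_on S (pdiff k F)" if "k < m" for k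
    using F that by (simp add: subtopology_Euclidean[OF S])
qed

text \<open>
  Real and imaginary parts of smooth functions, and coordinate functions, satisfy this; it is what
  the chain rule in a chart requires.
\<close>

definition C1_near :: "'x smooth_mfd \<Rightarrow> 'x \<Rightarrow> ('x \<Rightarrow> real) \<Rightarrow> bool" where
  "C1_near M p f \<longleftrightarrow> (\<exists>U. openin (mtop M) U \<and> p \<in> U \<and>
     (\<forall>(W, \<psi>)\<in>matlas M. Ck_in (Suc 0) (mdim M) (\<psi> ` (U \<inter> W)) (\<lambda>x. f (the_inv_into W \<psi> x))))"

context
  fixes M :: "'x smooth_mfd"
  assumes M: "smooth_manifold M"
begin

lemma smooth_chart_on: "smooth_chart M (U, \<phi>) \<Longrightarrow> chart_on (mtop M) (mdim M) (U, \<phi>)"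
  by (simp add: smooth_chart_def)

lemma atlas_chart: "c \<in> matlas M \<Longrightarrow> smooth_chart M c"
  using M by (auto simp: smooth_manifold_def)

lemma atlas_cover: "p \<in> topspace (mtop M) \<Longrightarrow> \<exists>W \<psi>. (W, \<psi>) \<in> matlas M \<and> p \<in> W"
proof -
  assume "p \<in> topspace (mtop M)"
  then have "p \<in> (\<Union>(U, \<phi>)\<in>matlas M. U)" using M by (simp add: smooth_manifold_def)
  then show ?thesis by auto
qed

lemma atlas_image_open:
  "(W, \<psi>) \<in> matlas M \<Longrightarrow> openin (mtop M) U \<Longrightarrow> openin (Euclidean_space (mdim M)) (\<psi> ` (U \<inter> W))"
  using chart_onD(4)[OF smooth_chart_on[OF atlas_chart]] by (metis Int_commute)

lemma smooth_onI:
  assumes "openin (mtop M) U" "\<And>W \<psi> k. (W, \<psi>) \<in> matlas M \<Longrightarrow> Ck_in k (mdim M) (\<psi> ` (U \<inter> W)) (\<lambda>x. f (the_inv_into W \<psi> x))"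
  shows "smooth_on M U f"
  using assms unfolding smooth_on_def smooth_in_def by blast

lemma smooth_onD:
  assumes "smooth_on M U f"
  shows "openin (mtop M) U" "(W, \<psi>) \<in> matlas M \<Longrightarrow> Ck_in k (mdim M) (\<psi> ` (U \<inter> W)) (\<lambda>x. f (the_inv_into W \<psi> x))"
  using assms unfolding smooth_on_def smooth_in_def by blast+

lemma C1_nearI:
  assumes "openin (mtop M) U" "p \<in> U"
    "\<And>W \<psi>. (W, \<psi>) \<in> matlas M \<Longrightarrow> Ck_in (Suc 0) (mdim M) (\<psi> ` (U \<inter> W)) (\<lambda>x. f (the_inv_into W \<psi> x))"
  shows "C1_near M p f"
  unfolding C1_near_def by (intro exI[of _ U] conjI assms(1,2)) (use assms(3) in blast)

lemma smooth_at_bounded_linear: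
  assumes "bounded_linear T" "smooth_at M p f"
  shows "smooth_at M p (\<lambda>x. T (f x))"
proof -
  obtain U where U: "p \<in> U" "smooth_on M U f" using assms(2) by (auto simp: smooth_at_def)
  have "smooth_on M U (\<lambda>x. T (f x))"
    by (rule smooth_onI[OF smooth_onD(1)[OF U(2)]])
      (rule Ck_in_bounded_linear[OF atlas_image_open[OF _ smooth_onD(1)[OF U(2)]] assms(1) smooth_onD(2)[OF U(2)]])
  then show ?thesis using U(1) unfolding smooth_at_def by blast
qed

lemma C1_near_Re_Im:
  assumes "smooth_at M p f" shows "C1_near M p (\<lambda>x. Re (f x))" "C1_near M p (\<lambda>x. Im (f x))"
proof -
  obtain U where U: "p \<in> U" "smooth_on M U f" using assms by (auto simp: smooth_at_def)
  have "C1_near M p (\<lambda>x. T (f x))" if T: "bounded_linear (T :: complex \<Rightarrow> real)" for T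
    by (rule C1_nearI[OF smooth_onD(1)[OF U(2)] U(1)])
      (rule Ck_in_bounded_linear[OF atlas_image_open[OF _ smooth_onD(1)[OF U(2)]] T smooth_onD(2)[OF U(2)]])
  then show "C1_near M p (\<lambda>x. Re (f x))" "C1_near M p (\<lambda>x. Im (f x))"
    using bounded_linear_Re bounded_linear_Im by blast+
qed

lemma smooth_transitionD:
  assumes "smooth_chart M (U, \<phi>)" "(W, \<psi>) \<in> matlas M" "k < mdim M"
  shows "smooth_in (mdim M) (\<phi> ` (U \<inter> W)) (\<lambda>x. \<psi> (the_inv_into U \<phi> x) k)"
    "smooth_in (mdim M) (\<psi> ` (U \<inter> W)) (\<lambda>x. \<phi> (the_inv_into W \<psi> x) k)"
proof -
  have "smooth_transition (mdim M) (U, \<phi>) (W, \<psi>)" "smooth_transition (mdim M) (W, \<psi>) (U, \<phi>)"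
    using assms(1,2) unfolding smooth_chart_def by blast+
  then show "smooth_in (mdim M) (\<phi> ` (U \<inter> W)) (\<lambda>x. \<psi> (the_inv_into U \<phi> x) k)"
    "smooth_in (mdim M) (\<psi> ` (U \<inter> W)) (\<lambda>x. \<phi> (the_inv_into W \<psi> x) k)"
    using assms(3) by (simp_all add: smooth_transition_def Int_commute)
qed

lemma chart_coordinate_smooth:
  assumes c: "smooth_chart M (U, \<phi>)" and "k < mdim M" "p \<in> U"
  shows "smooth_at M p (\<lambda>x. of_real (\<phi> x k))" "C1_near M p (\<lambda>x. \<phi> x k)"
proof -
  have U: "openin (mtop M) U" using chart_onD(1)[OF smooth_chart_on[OF c]] .
  have s: "Ck_in l (mdim M) (\<psi> ` (U \<inter> W)) (\<lambda>x. \<phi> (the_inv_into W \<psi> x) k)" if "(W, \<psi>) \<in> matlas M" for W \<psi> l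
    using smooth_transitionD(2)[OF c that assms(2)] by (simp add: smooth_in_def)
  show "C1_near M p (\<lambda>x. \<phi> x k)" by (rule C1_nearI[OF U assms(3) s])
  have "smooth_on M U (\<lambda>x. complex_of_real (\<phi> x k))"
    by (rule smooth_onI[OF U]) (rule Ck_in_bounded_linear[OF atlas_image_open[OF _ U] bounded_linear_of_real s])
  then show "smooth_at M p (\<lambda>x. of_real (\<phi> x k))" using assms(3) unfolding smooth_at_def by blast
qed

text \<open>
  Only the transitions to the given atlas are known to be smooth, so a function is differentiated
  in a chart of the maximal atlas by passing through a chart of the given one.
\<close>

lemma chart_chain_rule_aux:
  fixes x :: "'a::real_normed_vector \<Rightarrow> nat \<Rightarrow> real"
  assumes c: "smooth_chart M (U, \<phi>)" and f: "\<And>W \<psi>. (W, \<psi>) \<in> matlas M \<Longrightarrow>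
      Ck_in (Suc 0) (mdim M) (\<psi> ` (U0 \<inter> W)) (\<lambda>x. f (the_inv_into W \<psi> x))"
    and U0: "openin (mtop M) U0" "p \<in> U0" and W: "(W, \<psi>) \<in> matlas M" "p \<in> W" and p: "p \<in> U"
    and x: "x a0 = \<phi> p" "\<And>k. k < mdim M \<Longrightarrow> ((\<lambda>a. x a k) has_derivative x' k) (at a0)"
      "eventually (\<lambda>a. x a \<in> coord_space (mdim M)) (nhds a0)"
  shows "((\<lambda>a. f (the_inv_into U \<phi> (x a))) has_derivative
     (\<lambda>v. \<Sum>k<mdim M. (\<Sum>l<mdim M. pdiff l (\<lambda>y. f (the_inv_into W \<psi> y)) (\<psi> p) *
        pdiff k (\<lambda>y. \<psi> (the_inv_into U \<phi> y) l) (\<phi> p)) * x' k v)) (at a0)"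
proof -
  let ?m = "mdim M"
  let ?G = "\<lambda>l y. \<psi> (the_inv_into U \<phi> y) l" and ?F = "\<lambda>y. f (the_inv_into W \<psi> y)"
  note cc = chart_onD[OF smooth_chart_on[OF c]] and cW = chart_onD[OF smooth_chart_on[OF atlas_chart[OF W(1)]]]
  let ?S1 = "\<phi> ` (U \<inter> W)" and ?S2 = "\<psi> ` (U0 \<inter> W)"
  have S1: "openin (Euclidean_space ?m) ?S1" by (rule cc(4)[OF cW(1)])
  have S2: "openin (Euclidean_space ?m) ?S2" by (rule atlas_image_open[OF W(1) U0(1)])
  have x0: "x a0 \<in> ?S1" using x(1) p W(2) by auto
  have ev: "eventually (\<lambda>a. x a \<in> ?S1) (nhds a0)"
    by (rule eventually_in_open_coords[where u=x and u'=x', OF S1 x0]) (use x in auto)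
  let ?u = "\<lambda>a. \<psi> (the_inv_into U \<phi> (x a))"
  have G: "((\<lambda>a. ?u a l) has_derivative (\<lambda>v. \<Sum>k<?m. pdiff k (?G l) (\<phi> p) * x' k v)) (at a0)" if l: "l < ?m" for l
  proof -
    have "Ck_in (Suc 0) ?m ?S1 (?G l)"
      using smooth_transitionD(1)[OF c W(1) l] unfolding smooth_in_def by blast
    from C1_chain_rule[where u=x, OF S1 this x(2) x0 x(3)] show ?thesis by (simp add: x(1))
  qed
  have u0: "?u a0 = \<psi> p" using x(1) cc(5)[OF p] by simp
  have "((\<lambda>a. ?F (?u a)) has_derivative (\<lambda>v. \<Sum>l<?m. pdiff l ?F (?u a0) * (\<Sum>k<?m. pdiff k (?G l) (\<phi> p) * x' k v))) (at a0)"
  proof (rule C1_chain_rule[where u="?u", OF S2 f[OF W(1)] G])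
    show "?u a0 \<in> ?S2" using u0 U0(2) W(2) by auto
    show "eventually (\<lambda>a. ?u a \<in> coord_space ?m) (nhds a0)"
      using ev by eventually_elim (use cc(5) cW(7) in auto)
  qed
  moreover have "(\<lambda>v. \<Sum>l<?m. pdiff l ?F (?u a0) * (\<Sum>k<?m. pdiff k (?G l) (\<phi> p) * x' k v))
     = (\<lambda>v. \<Sum>k<?m. (\<Sum>l<?m. pdiff l ?F (\<psi> p) * pdiff k (?G l) (\<phi> p)) * x' k v)"
  proof
    fix v
    have "(\<Sum>l<?m. pdiff l ?F (\<psi> p) * (\<Sum>k<?m. pdiff k (?G l) (\<phi> p) * x' k v))
      = (\<Sum>l<?m. \<Sum>k<?m. pdiff l ?F (\<psi> p) * pdiff k (?G l) (\<phi> p) * x' k v)"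
      by (simp add: sum_distrib_left mult.assoc)
    also have "\<dots> = (\<Sum>k<?m. \<Sum>l<?m. pdiff l ?F (\<psi> p) * pdiff k (?G l) (\<phi> p) * x' k v)" by (rule sum.swap)
    finally show "(\<Sum>l<?m. pdiff l ?F (?u a0) * (\<Sum>k<?m. pdiff k (?G l) (\<phi> p) * x' k v))
      = (\<Sum>k<?m. (\<Sum>l<?m. pdiff l ?F (\<psi> p) * pdiff k (?G l) (\<phi> p)) * x' k v)"
      by (simp add: u0 sum_distrib_right)
  qed
  ultimately have d: "((\<lambda>a. ?F (?u a)) has_derivative
      (\<lambda>v. \<Sum>k<?m. (\<Sum>l<?m. pdiff l ?F (\<psi> p) * pdiff k (?G l) (\<phi> p)) * x' k v)) (at a0)" by simp
  have e: "eventually (\<lambda>a. ?F (?u a) = f (the_inv_into U \<phi> (x a))) (nhds a0)"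
    using ev by eventually_elim (use cc(5) cW(5) in auto)
  have "eventually (\<lambda>a. ?F (?u a) = f (the_inv_into U \<phi> (x a))) (at a0)"
    using e by (simp add: eventually_nhds_conv_at)
  from has_derivative_transform_eventually[OF d this eventually_nhds_x_imp_x[OF e] UNIV_I] show ?thesis .
qed

lemma chart_partial_derivative:
  assumes c: "smooth_chart M (U, \<phi>)" and f: "C1_near M p f" and p: "p \<in> U" and k: "k < mdim M"
  shows "((\<lambda>h. f (the_inv_into U \<phi> ((\<phi> p)(k := h)))) has_real_derivative pdiff k (\<lambda>y. f (the_inv_into U \<phi> y)) (\<phi> p)) (at (\<phi> p k))"
    and "(W, \<psi>) \<in> matlas M \<Longrightarrow> p \<in> W \<Longrightarrow> pdiff k (\<lambda>y. f (the_inv_into U \<phi> y)) (\<phi> p) =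
      (\<Sum>l<mdim M. pdiff l (\<lambda>y. f (the_inv_into W \<psi> y)) (\<psi> p) * pdiff k (\<lambda>y. \<psi> (the_inv_into U \<phi> y) l) (\<phi> p))"
proof -
  let ?x = "\<lambda>h. (\<phi> p)(k := h)" and ?m = "mdim M"
  obtain U0 where U0: "openin (mtop M) U0" "p \<in> U0"
    "\<And>W \<psi>. (W, \<psi>) \<in> matlas M \<Longrightarrow> Ck_in (Suc 0) ?m (\<psi> ` (U0 \<inter> W)) (\<lambda>x. f (the_inv_into W \<psi> x))"
    using f unfolding C1_near_def by blast
  have pV: "\<phi> p \<in> coord_space ?m" using chart_onD(7)[OF smooth_chart_on[OF c] p] .
  have d: "((\<lambda>h. f (the_inv_into U \<phi> (?x h))) has_real_derivative
      (\<Sum>l<?m. pdiff l (\<lambda>y. f (the_inv_into W \<psi> y)) (\<psi> p) * pdiff k (\<lambda>y. \<psi> (the_inv_into U \<phi> y) l) (\<phi> p))) (at (\<phi> p k))"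
    if W: "(W, \<psi>) \<in> matlas M" "p \<in> W" for W \<psi>
  proof -
    have "((\<lambda>h. f (the_inv_into U \<phi> (?x h))) has_derivative
     (\<lambda>v. \<Sum>j<?m. (\<Sum>l<?m. pdiff l (\<lambda>y. f (the_inv_into W \<psi> y)) (\<psi> p) *
        pdiff j (\<lambda>y. \<psi> (the_inv_into U \<phi> y) l) (\<phi> p)) * (if j = k then v else 0))) (at (\<phi> p k))"
    proof (rule chart_chain_rule_aux[OF c U0(3) U0(1,2) W p])
      show "((\<lambda>h. ?x h j) has_derivative (\<lambda>v. if j = k then v else 0)) (at (\<phi> p k))" for j
        by (cases "j = k") auto
      show "eventually (\<lambda>h. ?x h \<in> coord_space ?m) (nhds (\<phi> p k))"
        using coord_space_upd[OF pV k] by simp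
    qed auto
    moreover have "(\<Sum>j<?m. A j * (if j = k then v else 0)) = A k * v" for A and v :: real
      using k by (simp add: sum.delta if_distrib cong: if_cong)
    ultimately show ?thesis by (simp add: has_field_derivative_def)
  qed
  show eq: "pdiff k (\<lambda>y. f (the_inv_into U \<phi> y)) (\<phi> p) =
      (\<Sum>l<?m. pdiff l (\<lambda>y. f (the_inv_into W \<psi> y)) (\<psi> p) * pdiff k (\<lambda>y. \<psi> (the_inv_into U \<phi> y) l) (\<phi> p))"
    if W: "(W, \<psi>) \<in> matlas M" "p \<in> W" for W \<psi>
    unfolding pdiff_def[of k] using vector_derivative_at[OF d[OF W, unfolded has_real_derivative_iff_has_vector_derivative]]
    by (simp add: pdiff_def)
  have "p \<in> topspace (mtop M)" using chart_onD(2)[OF smooth_chart_on[OF c]] p by auto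
  then obtain W \<psi> where W: "(W, \<psi>) \<in> matlas M" "p \<in> W" using atlas_cover by blast
  show "((\<lambda>h. f (the_inv_into U \<phi> (?x h))) has_real_derivative pdiff k (\<lambda>y. f (the_inv_into U \<phi> y)) (\<phi> p)) (at (\<phi> p k))"
    using d[OF W] eq[OF W] by simp
qed

lemma chart_chain_rule:
  fixes x :: "'a::real_normed_vector \<Rightarrow> nat \<Rightarrow> real"
  assumes c: "smooth_chart M (U, \<phi>)" and f: "C1_near M p f" and p: "p \<in> U"
    and x: "x a0 = \<phi> p" "\<And>k. k < mdim M \<Longrightarrow> ((\<lambda>a. x a k) has_derivative x' k) (at a0)"
      "eventually (\<lambda>a. x a \<in> coord_space (mdim M)) (nhds a0)"
  shows "((\<lambda>a. f (the_inv_into U \<phi> (x a))) has_derivative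
     (\<lambda>v. \<Sum>k<mdim M. pdiff k (\<lambda>y. f (the_inv_into U \<phi> y)) (\<phi> p) * x' k v)) (at a0)"
proof -
  have "p \<in> topspace (mtop M)" using chart_onD(2)[OF smooth_chart_on[OF c]] p by auto
  then obtain W \<psi> where W: "(W, \<psi>) \<in> matlas M" "p \<in> W" using atlas_cover by blast
  obtain U0 where U0: "openin (mtop M) U0" "p \<in> U0"
    "\<And>W \<psi>. (W, \<psi>) \<in> matlas M \<Longrightarrow> Ck_in (Suc 0) (mdim M) (\<psi> ` (U0 \<inter> W)) (\<lambda>x. f (the_inv_into W \<psi> x))"
    using f unfolding C1_near_def by blast
  have "(\<Sum>k<mdim M. (\<Sum>l<mdim M. pdiff l (\<lambda>y. f (the_inv_into W \<psi> y)) (\<psi> p) *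
        pdiff k (\<lambda>y. \<psi> (the_inv_into U \<phi> y) l) (\<phi> p)) * x' k v) =
      (\<Sum>k<mdim M. pdiff k (\<lambda>y. f (the_inv_into U \<phi> y)) (\<phi> p) * x' k v)" for v
    by (rule sum.cong) (use chart_partial_derivative(2)[OF c f p _ W] in auto)
  then show ?thesis using chart_chain_rule_aux[OF c U0(3) U0(1,2) W p x] by simp
qed

lemma chart_own_partial:
  assumes c: "smooth_chart M (U, \<phi>)" and p: "p \<in> U" and k: "k < mdim M"
  shows "pdiff k (\<lambda>y. \<phi> (the_inv_into U \<phi> y) l) (\<phi> p) = (if k = l then 1 else 0)"
proof -
  note cc = chart_onD[OF smooth_chart_on[OF c]]
  have "openin (Euclidean_space (mdim M)) (\<phi> ` U)" using cc(4)[OF cc(1)] by simp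
  then have "pdiff k (\<lambda>y. \<phi> (the_inv_into U \<phi> y) l) (\<phi> p) = pdiff k (\<lambda>y. y l) (\<phi> p)"
    by (rule pdiff_cong) (use p k cc(5) in auto)
  also have "\<dots> = (if k = l then 1 else 0)"
  proof (cases "k = l")
    case True
    then show ?thesis using vector_derivative_at[OF has_vector_derivative_id] by (simp add: pdiff_def)
  next
    case False
    then show ?thesis by (simp add: pdiff_def)
  qed
  finally show ?thesis .
qed

lemma coord_vec_eq:
  assumes c: "smooth_chart M (U, \<phi>)" and f: "smooth_at M p f" and p: "p \<in> U" and k: "k < mdim M"
  shows "coord_vec M (U, \<phi>) k p f = Complex (pdiff k (\<lambda>y. Re (f (the_inv_into U \<phi> y))) (\<phi> p))
     (pdiff k (\<lambda>y. Im (f (the_inv_into U \<phi> y))) (\<phi> p))"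
proof -
  let ?g = "\<lambda>h. f (the_inv_into U \<phi> ((\<phi> p)(k := h)))"
  let ?a = "pdiff k (\<lambda>y. Re (f (the_inv_into U \<phi> y))) (\<phi> p)" and ?b = "pdiff k (\<lambda>y. Im (f (the_inv_into U \<phi> y))) (\<phi> p)"
  have "((\<lambda>h. Re (?g h)) has_real_derivative ?a) (at (\<phi> p k))" "((\<lambda>h. Im (?g h)) has_real_derivative ?b) (at (\<phi> p k))"
    using chart_partial_derivative(1)[OF c C1_near_Re_Im(1)[OF f] p k] chart_partial_derivative(1)[OF c C1_near_Re_Im(2)[OF f] p k]
    by simp_all
  then have "(?g has_vector_derivative Complex ?a ?b) (at (\<phi> p k))"
    by (auto simp: has_vector_derivative_complex_iff)
  then have "pdiff k (\<lambda>y. f (the_inv_into U \<phi> y)) (\<phi> p) = Complex ?a ?b"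
    unfolding pdiff_def by (rule vector_derivative_at)
  then show ?thesis using f by (simp add: coord_vec_def)
qed

lemma coord_vec_of_real:
  assumes c: "smooth_chart M (U, \<phi>)" and f: "smooth_at M p (\<lambda>x. of_real (f x))" and p: "p \<in> U" and k: "k < mdim M"
  shows "coord_vec M (U, \<phi>) k p (\<lambda>x. of_real (f x)) = of_real (pdiff k (\<lambda>y. f (the_inv_into U \<phi> y)) (\<phi> p))"
proof -
  have "pdiff k (\<lambda>y. 0) (\<phi> p) = (0::real)" by (simp add: pdiff_def)
  then show ?thesis using coord_vec_eq[OF c f p k] by (simp add: complex_of_real_def)
qed

lemma coord_vec_own:
  assumes c: "smooth_chart M (U, \<phi>)" and p: "p \<in> U" and k: "k < mdim M" and l: "l < mdim M"
  shows "coord_vec M (U, \<phi>) k p (\<lambda>x. of_real (\<phi> x l)) = (if k = l then 1 else 0)"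
  using coord_vec_of_real[OF c chart_coordinate_smooth(1)[OF c l p] p k] chart_own_partial[OF c p k, of l] by simp

lemma vec_conj_coord_vec:
  assumes c: "smooth_chart M (U, \<phi>)" and p: "p \<in> U" and k: "k < mdim M"
  shows "cnj (coord_vec M (U, \<phi>) k p (\<lambda>x. cnj (f x))) = coord_vec M (U, \<phi>) k p f"
proof (cases "smooth_at M p f")
  case True
  let ?g = "\<lambda>h. Im (f (the_inv_into U \<phi> ((\<phi> p)(k := h))))"
  have f': "smooth_at M p (\<lambda>x. cnj (f x))" by (rule smooth_at_bounded_linear[OF bounded_linear_cnj True])
  have "(?g has_vector_derivative pdiff k (\<lambda>y. Im (f (the_inv_into U \<phi> y))) (\<phi> p)) (at (\<phi> p k))"
    using chart_partial_derivative(1)[OF c C1_near_Re_Im(2)[OF True] p k]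
    by (simp add: has_real_derivative_iff_has_vector_derivative)
  from vector_derivative_at[OF has_vector_derivative_minus[OF this]]
  have "pdiff k (\<lambda>y. - Im (f (the_inv_into U \<phi> y))) (\<phi> p) = - pdiff k (\<lambda>y. Im (f (the_inv_into U \<phi> y))) (\<phi> p)"
    by (simp add: pdiff_def)
  then show ?thesis using coord_vec_eq[OF c True p k] coord_vec_eq[OF c f' p k] by (simp add: complex_eq_iff)
next
  case False
  have "\<not> smooth_at M p (\<lambda>x. cnj (f x))"
    using smooth_at_bounded_linear[OF bounded_linear_cnj, of p "\<lambda>x. cnj (f x)"] False by auto
  then show ?thesis using False by (simp add: coord_vec_def)
qed

end

section \<open>The foliation of an elliptic involutive structure\<close>

text \<open>
  The real coordinates of an adapted chart as a function of its coordinates \<open>(t, z)\<close>: those of \<open>t\<close>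
  first, then the real and imaginary parts of \<open>z\<close> in alternation.
\<close>

definition real_tuple :: "nat \<Rightarrow> nat \<Rightarrow> (nat \<Rightarrow> real) \<Rightarrow> (nat \<Rightarrow> complex) \<Rightarrow> nat \<Rightarrow> real" where
  "real_tuple d n \<tau> \<zeta> i = (if i < d then \<tau> i else if i < d + 2 * n then
     (if even (i - d) then Re (\<zeta> ((i - d) div 2)) else Im (\<zeta> ((i - d) div 2))) else 0)"

lemma real_coords_eq: "real_coords d n c p = real_tuple d n (tcoord c p) (zcoord c p)"
  by (simp add: real_coords_def real_tuple_def fun_eq_iff)

lemma real_tuple_simps:
  "i < d \<Longrightarrow> real_tuple d n \<tau> \<zeta> i = \<tau> i"
  "j < n \<Longrightarrow> real_tuple d n \<tau> \<zeta> (d + 2 * j) = Re (\<zeta> j)"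
  "j < n \<Longrightarrow> real_tuple d n \<tau> \<zeta> (Suc (d + 2 * j)) = Im (\<zeta> j)"
  "i \<ge> d + 2 * n \<Longrightarrow> real_tuple d n \<tau> \<zeta> i = 0"
  by (auto simp: real_tuple_def)

lemma index_cases:
  assumes "i < d + 2 * n"
  obtains "i < d" | j where "j < n" "i = d + 2 * j" | j where "j < n" "i = Suc (d + 2 * j)"
proof (cases "i < d")
  case False
  then obtain k where k: "i = d + k" "k < 2 * n" using assms by (metis add_diff_inverse_nat nat_add_left_cancel_less)
  show ?thesis
  proof (cases "even k")
    case True
    then obtain j where "k = 2 * j" by blast
    then show ?thesis using that(2)[of j] k by auto
  next
    case False
    then obtain j where "k = 2 * j + 1" using oddE by blast
    then show ?thesis using that(3)[of j] k by auto
  qed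
qed (use that in blast)

lemma sum_index_split:
  fixes g :: "nat \<Rightarrow> 'a::comm_monoid_add"
  shows "(\<Sum>i<d + 2 * n. g i) = (\<Sum>i<d. g i) + (\<Sum>j<n. g (d + 2 * j) + g (Suc (d + 2 * j)))"
  by (induction n) (simp_all add: ac_simps)

locale adapted_charts =
  fixes M :: "'x smooth_mfd" and V :: "'x \<Rightarrow> 'x cvec set" and d n :: nat and I :: "'i set" and c :: "'i \<Rightarrow> 'x adapted"
  assumes M: "smooth_manifold M" and dim: "mdim M = d + 2 * n"
    and adapted: "i \<in> I \<Longrightarrow> adapted_chart M d n V (c i)"
    and cover: "(\<Union>i\<in>I. adom (c i)) = topspace (mtop M)"
begin

abbreviation U where "U i \<equiv> adom (c i)"
abbreviation \<phi> where "\<phi> i \<equiv> real_coords d n (c i)"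
abbreviation "D \<equiv> real_distribution V"
abbreviation "L \<equiv> leaf_topology M D d"

lemma real_chart_smooth: "i \<in> I \<Longrightarrow> smooth_chart M (U i, \<phi> i)"
  using adapted by (simp add: adapted_chart_def real_chart_def)

lemmas real_chart = chart_onD[OF smooth_chart_on[OF M real_chart_smooth]]

definition Tball :: "'i \<Rightarrow> (nat \<Rightarrow> real) set" where "Tball i = tcoord (c i) ` U i"
definition Zdisc :: "'i \<Rightarrow> (nat \<Rightarrow> complex) set" where "Zdisc i = zcoord (c i) ` U i"

lemma ball_times_disc:
  assumes "i \<in> I"
  obtains r w \<rho> where "r > 0" "\<And>j. j < n \<Longrightarrow> \<rho> j > 0" "Tball i = real_ball d r" "Zdisc i = polydisc n w \<rho>"
    "(\<lambda>p. (tcoord (c i) p, zcoord (c i) p)) ` U i = Tball i \<times> Zdisc i"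
proof -
  obtain r w \<rho> where *: "r > 0" "\<And>j. j < n \<Longrightarrow> \<rho> j > 0"
    "(\<lambda>p. (tcoord (c i) p, zcoord (c i) p)) ` U i = real_ball d r \<times> polydisc n w \<rho>"
    using adapted[OF assms] unfolding adapted_chart_def by blast
  have "(\<lambda>_. 0) \<in> real_ball d r" using *(1) by (simp add: real_ball_def Euclidean_space_eq coord_space_def)
  moreover have "(\<lambda>j. if j < n then w j else 0) \<in> polydisc n w \<rho>"
    using *(2) by (simp add: polydisc_def Complex_space_eq coord_space_def)
  moreover have "Tball i = fst ` (real_ball d r \<times> polydisc n w \<rho>)" "Zdisc i = snd ` (real_ball d r \<times> polydisc n w \<rho>)"
    unfolding *(3)[symmetric] Tball_def Zdisc_def by (auto simp: image_image)
  ultimately have "Tball i = real_ball d r" "Zdisc i = polydisc n w \<rho>" by (auto simp: fst_image_times snd_image_times)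
  then show ?thesis using that[of r \<rho> w] * by simp
qed

lemma Tball_vanish: "i \<in> I \<Longrightarrow> \<tau> \<in> Tball i \<Longrightarrow> k \<ge> d \<Longrightarrow> \<tau> k = 0"
  by (rule ball_times_disc[of i]) (auto simp: real_ball_def Euclidean_space_eq coord_space_def)

lemma Zdisc_vanish: "i \<in> I \<Longrightarrow> \<zeta> \<in> Zdisc i \<Longrightarrow> k \<ge> n \<Longrightarrow> \<zeta> k = 0"
  by (rule ball_times_disc[of i]) (auto simp: polydisc_def Complex_space_eq coord_space_def)

lemma Zdisc_open: assumes "i \<in> I" shows "openin (top_of_set (coord_space n)) (Zdisc i)"
proof -
  obtain r w \<rho> where "Zdisc i = polydisc n w \<rho>" using ball_times_disc[OF assms] by metis
  moreover have "open {z::nat \<Rightarrow> complex. \<forall>j\<in>{..<n}. cmod (z j - w j) < \<rho> j}"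
    unfolding Collect_ball_eq
    by (intro open_INT finite_lessThan ballI open_Collect_less continuous_on_norm continuous_on_diff
        continuous_on_const continuous_on_product_coordinates)
  ultimately show ?thesis by (auto simp: openin_open polydisc_def Complex_space_eq)
qed

lemma Tball_open: assumes "i \<in> I" shows "\<exists>O'. open O' \<and> Tball i = {\<tau> \<in> O'. \<forall>k\<ge>d. \<tau> k = 0}"
proof -
  obtain r where "Tball i = real_ball d r" using ball_times_disc[OF assms] by metis
  moreover have "open {\<tau>::nat \<Rightarrow> real. (\<Sum>k<d. (\<tau> k)\<^sup>2) < r\<^sup>2}"
    by (intro open_Collect_less continuous_on_sum continuous_on_power continuous_on_const continuous_on_product_coordinates)
  ultimately show ?thesis by (intro exI conjI) (auto simp: real_ball_def Euclidean_space_eq coord_space_def)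
qed

lemma Tball_convex:
  assumes "i \<in> I" "\<tau> \<in> Tball i" "\<tau>' \<in> Tball i" "s \<in> {0..1}"
  shows "(\<lambda>k. (1 - s) * \<tau> k + s * \<tau>' k) \<in> Tball i"
proof -
  obtain r where r: "r > 0" "Tball i = real_ball d r" using ball_times_disc[OF assms(1)] by metis
  have \<tau>: "L2_set \<tau> {..<d} < r" "L2_set \<tau>' {..<d} < r"
    using assms(2,3) r by (auto simp: real_ball_def L2_set_def intro!: real_less_lsqrt sum_nonneg)
  have "L2_set (\<lambda>k. (1 - s) * \<tau> k + s * \<tau>' k) {..<d} \<le> L2_set (\<lambda>k. (1 - s) * \<tau> k) {..<d} + L2_set (\<lambda>k. s * \<tau>' k) {..<d}"
    by (rule L2_set_triangle_ineq)
  also have "\<dots> = (1 - s) * L2_set \<tau> {..<d} + s * L2_set \<tau>' {..<d}"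
    using assms(4) by (simp add: L2_set_right_distrib)
  also have "\<dots> < r"
    using assms(4) \<tau> by (intro convex_bound_lt) auto
  finally have "(\<Sum>k<d. ((1 - s) * \<tau> k + s * \<tau>' k)\<^sup>2) < r\<^sup>2"
    unfolding L2_set_def using r(1) by (metis less_eq_real_def real_sqrt_abs real_sqrt_less_iff abs_of_pos)
  then show ?thesis using assms(2,3) r by (auto simp: real_ball_def Euclidean_space_eq coord_space_def)
qed

lemma tz_inj: "i \<in> I \<Longrightarrow> p \<in> U i \<Longrightarrow> q \<in> U i \<Longrightarrow> tcoord (c i) p = tcoord (c i) q \<Longrightarrow> zcoord (c i) p = zcoord (c i) q \<Longrightarrow> p = q"
  using real_chart(3)[of i] by (auto simp: inj_on_def real_coords_eq)

lemma in_Tball: "i \<in> I \<Longrightarrow> p \<in> U i \<Longrightarrow> tcoord (c i) p \<in> Tball i" and in_Zdisc: "i \<in> I \<Longrightarrow> p \<in> U i \<Longrightarrow> zcoord (c i) p \<in> Zdisc i"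
  by (auto simp: Tball_def Zdisc_def)

lemma tuple_chart:
  assumes "i \<in> I" "\<tau> \<in> Tball i" "\<zeta> \<in> Zdisc i"
  shows "real_tuple d n \<tau> \<zeta> \<in> \<phi> i ` U i"
    and "the_inv_into (U i) (\<phi> i) (real_tuple d n \<tau> \<zeta>) \<in> U i"
    and "tcoord (c i) (the_inv_into (U i) (\<phi> i) (real_tuple d n \<tau> \<zeta>)) = \<tau>"
    and "zcoord (c i) (the_inv_into (U i) (\<phi> i) (real_tuple d n \<tau> \<zeta>)) = \<zeta>"
proof -
  have "(\<tau>, \<zeta>) \<in> (\<lambda>p. (tcoord (c i) p, zcoord (c i) p)) ` U i"
    by (rule ball_times_disc[OF assms(1)]) (use assms in simp)
  then obtain p where p: "p \<in> U i" "tcoord (c i) p = \<tau>" "zcoord (c i) p = \<zeta>" by auto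
  then have "real_tuple d n \<tau> \<zeta> = \<phi> i p" by (simp add: real_coords_eq)
  then show "real_tuple d n \<tau> \<zeta> \<in> \<phi> i ` U i"
    and "the_inv_into (U i) (\<phi> i) (real_tuple d n \<tau> \<zeta>) \<in> U i"
    and "tcoord (c i) (the_inv_into (U i) (\<phi> i) (real_tuple d n \<tau> \<zeta>)) = \<tau>"
    and "zcoord (c i) (the_inv_into (U i) (\<phi> i) (real_tuple d n \<tau> \<zeta>)) = \<zeta>"
    using p real_chart(5)[OF assms(1) p(1)] by auto
qed

lemma zcoord_eq_iff:
  assumes "i \<in> I" "p \<in> U i" "q \<in> U i"
  shows "zcoord (c i) p = zcoord (c i) q \<longleftrightarrow> (\<forall>k\<ge>d. \<phi> i p k = \<phi> i q k)"
proof
  assume "zcoord (c i) p = zcoord (c i) q"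
  then show "\<forall>k\<ge>d. \<phi> i p k = \<phi> i q k" by (auto simp: real_coords_def)
next
  assume eq: "\<forall>k\<ge>d. \<phi> i p k = \<phi> i q k"
  show "zcoord (c i) p = zcoord (c i) q"
  proof
    fix j
    show "zcoord (c i) p j = zcoord (c i) q j"
    proof (cases "j < n")
      case True
      then show ?thesis
        using eq[rule_format, of "d + 2 * j"] eq[rule_format, of "Suc (d + 2 * j)"]
        by (simp add: real_coords_eq real_tuple_simps complex_eq_iff)
    next
      case False
      then show ?thesis using Zdisc_vanish[OF assms(1) in_Zdisc[OF assms(1)]] assms(2,3) by simp
    qed
  qed
qed

lemma chart_homeo:
  assumes i: "i \<in> I"
  shows "homeomorphic_map (subtopology (mtop M) (U i)) (top_of_set (Tball i \<times> Zdisc i)) (\<lambda>p. (tcoord (c i) p, zcoord (c i) p))"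
proof -
  let ?g = "\<lambda>x. the_inv_into (U i) (\<phi> i) (real_tuple d n (fst x) (snd x))"
  let ?S = "subtopology (mtop M) (U i)"
  have tU: "topspace ?S = U i" using real_chart(2)[OF i] by auto
  have \<phi>c: "continuous_map ?S euclideanreal (\<lambda>p. \<phi> i p k)" for k
    using real_chart(6)[OF i] by (rule continuous_map_fun_component)
  have "continuous_map ?S euclidean (tcoord (c i))"
  proof (rule continuous_map_into_fun)
    fix k
    show "continuous_map ?S euclideanreal (\<lambda>p. tcoord (c i) p k)"
    proof (cases "k < d")
      case True
      then show ?thesis using \<phi>c[of k] by (simp add: real_coords_eq real_tuple_simps)
    next
      case False
      then show ?thesis
        using Tball_vanish[OF i in_Tball[OF i]] tU by (auto intro: continuous_map_eq[of ?S _ "\<lambda>_. 0"])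
    qed
  qed
  moreover have "continuous_map ?S euclidean (zcoord (c i))"
  proof -
    have "continuous_map ?S euclidean (\<lambda>p. zcoord (c i) p j)" for j
    proof (cases "j < n")
      case True
      have "continuous_map ?S euclidean (\<lambda>p. complex_of_real (\<phi> i p (d + 2 * j)) + \<i> * complex_of_real (\<phi> i p (Suc (d + 2 * j))))"
      proof -
        have 1: "continuous_map ?S euclidean (\<lambda>p. (\<phi> i p (d + 2 * j), \<phi> i p (Suc (d + 2 * j))))"
          using \<phi>c by (simp add: continuous_map_pairwise o_def flip: prod_topology_euclidean)
        have 2: "continuous_map euclidean euclidean (\<lambda>x. complex_of_real (fst x) + \<i> * complex_of_real (snd x))"
          by (simp add: continuous_intros)
        show ?thesis using continuous_map_compose[OF 1 2] by (simp add: o_def)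
      qed
      moreover have "complex_of_real (\<phi> i p (d + 2 * j)) + \<i> * complex_of_real (\<phi> i p (Suc (d + 2 * j))) = zcoord (c i) p j" for p
        using True by (simp add: real_coords_eq real_tuple_simps complex_eq_iff)
      ultimately show ?thesis by simp
    next
      case False
      then show ?thesis
        using Zdisc_vanish[OF i in_Zdisc[OF i]] tU by (auto intro: continuous_map_eq[of ?S _ "\<lambda>_. 0"])
    qed
    then show ?thesis unfolding euclidean_product_topology[symmetric] by (simp add: continuous_map_componentwise_UNIV)
  qed
  ultimately have c1: "continuous_map ?S (top_of_set (Tball i \<times> Zdisc i)) (\<lambda>p. (tcoord (c i) p, zcoord (c i) p))"
    using in_Tball[OF i] in_Zdisc[OF i] tU
    by (auto simp: continuous_map_in_subtopology continuous_map_pairwise o_def simp flip: prod_topology_euclidean)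
  have "continuous_on (Tball i \<times> Zdisc i) (\<lambda>x. real_tuple d n (fst x) (snd x))"
  proof (rule continuous_on_coordinatewise_then_product)
    fix k
    have "continuous_on (Tball i \<times> Zdisc i) (\<lambda>x. fst x k)" "continuous_on (Tball i \<times> Zdisc i) (\<lambda>x. snd x l)" for l
      using continuous_on_product_then_coordinatewise[OF continuous_on_fst[OF continuous_on_id], of "Tball i \<times> Zdisc i" k]
        continuous_on_product_then_coordinatewise[OF continuous_on_snd[OF continuous_on_id], of "Tball i \<times> Zdisc i" l] by auto
    then show "continuous_on (Tball i \<times> Zdisc i) (\<lambda>x. real_tuple d n (fst x) (snd x) k)"
      unfolding real_tuple_def
      by (cases "k < d"; cases "k < d + 2 * n"; cases "even (k - d)") (simp_all add: continuous_on_Re continuous_on_Im)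
  qed
  then have "continuous_map (top_of_set (Tball i \<times> Zdisc i)) (top_of_set (\<phi> i ` U i)) (\<lambda>x. real_tuple d n (fst x) (snd x))"
    using tuple_chart(1)[OF i] by (auto simp: continuous_map_in_subtopology)
  from continuous_map_compose[OF this real_chart(8)[OF i]]
  have c2: "continuous_map (top_of_set (Tball i \<times> Zdisc i)) ?S ?g"
    using tuple_chart(2)[OF i] by (auto simp: continuous_map_in_subtopology o_def)
  have "homeomorphic_maps ?S (top_of_set (Tball i \<times> Zdisc i)) (\<lambda>p. (tcoord (c i) p, zcoord (c i) p)) ?g"
    unfolding homeomorphic_maps_def using c1 c2 tU real_chart(5)[OF i] tuple_chart(3,4)[OF i]
    by (auto simp: real_coords_eq)
  then show ?thesis using homeomorphic_map_maps by blast
qed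

lemma chart_subspace: "i \<in> I \<Longrightarrow> p \<in> U i \<Longrightarrow>
    V p = {(\<lambda>f. (\<Sum>k<d. a k * coord_vec M (U i, \<phi> i) k p f) + (\<Sum>j<n. b j * dbar_vec M d n (c i) j p f)) | a b. True}"
  using adapted by (simp add: adapted_chart_def real_chart_def)

lemma dbar_vec_eq: "dbar_vec M d n (c i) j p f =
    (coord_vec M (U i, \<phi> i) (d + 2 * j) p f + \<i> * coord_vec M (U i, \<phi> i) (Suc (d + 2 * j)) p f) / 2"
  by (simp add: dbar_vec_def real_chart_def)

text \<open>
  A vector of \<open>V\<close> is real if and only if it has real coefficients along \<open>\<partial>/\<partial>t\<close> and none along
  \<open>\<partial>/\<partial>cnj z\<close>; the coefficients are read off by applying the vector to coordinate functions.
\<close>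

lemma real_chart_foliated:
  assumes i: "i \<in> I" shows "foliated_chart M D d (U i, \<phi> i)"
proof -
  note sc = real_chart_smooth[OF i]
  let ?v = "\<lambda>k p. coord_vec M (U i, \<phi> i) k p"
  have "D p = {(\<lambda>f. \<Sum>k<d. of_real (a k) * ?v k p f) | a. True}" if p: "p \<in> U i" for p
  proof (intro subset_antisym subsetI)
    fix v assume "v \<in> D p"
    then have v: "v \<in> V p" "vec_conj v = v" by (auto simp: real_distribution_def)
    then obtain a b where ab: "v = (\<lambda>f. (\<Sum>k<d. a k * ?v k p f) + (\<Sum>j<n. b j * dbar_vec M d n (c i) j p f))"
      using chart_subspace[OF i p] by auto
    have re: "cnj (v (\<lambda>x. of_real (g x))) = v (\<lambda>x. of_real (g x))" for g
      using v(2) by (metis (no_types, lifting) complex_cnj_complex_of_real ext vec_conj_def)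
    have own: "?v k p (\<lambda>x. of_real (\<phi> i x l)) = (if k = l then 1 else 0)" if "k < d + 2 * n" "l < d + 2 * n" for k l
      using coord_vec_own[OF M sc p] that dim by simp
    have a: "cnj (a k) = a k" if k: "k < d" for k
    proof -
      have "dbar_vec M d n (c i) j p (\<lambda>x. of_real (\<phi> i x k)) = 0" if "j < n" for j
        using that k own[of "d + 2 * j" k] own[of "Suc (d + 2 * j)" k] by (simp add: dbar_vec_eq)
      moreover have "(\<Sum>k'<d. a k' * ?v k' p (\<lambda>x. of_real (\<phi> i x k))) = (\<Sum>k'<d. if k' = k then a k' else 0)"
        by (rule sum.cong) (use own k in auto)
      ultimately have "v (\<lambda>x. of_real (\<phi> i x k)) = a k" using k by (simp add: ab)
      then show ?thesis using re[of "\<lambda>x. \<phi> i x k"] by simp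
    qed
    have b: "b j = 0" if j: "j < n" for j
    proof -
      have val: "v (\<lambda>x. of_real (\<phi> i x l)) = b j * dbar_vec M d n (c i) j p (\<lambda>x. of_real (\<phi> i x l))"
        if l: "l = d + 2 * j \<or> l = Suc (d + 2 * j)" for l
      proof -
        have "?v k p (\<lambda>x. of_real (\<phi> i x l)) = 0" if "k < d" for k using own[of k l] that j l by auto
        moreover have "dbar_vec M d n (c i) j' p (\<lambda>x. of_real (\<phi> i x l)) = 0" if "j' < n" "j' \<noteq> j" for j'
        proof -
          have "d + 2 * j' \<noteq> l" "Suc (d + 2 * j') \<noteq> l" using l that(2) by presburger+
          then show ?thesis using own[of "d + 2 * j'" l] own[of "Suc (d + 2 * j')" l] that j l by (auto simp: dbar_vec_eq)
        qed
        then have "(\<Sum>j'<n. b j' * dbar_vec M d n (c i) j' p (\<lambda>x. of_real (\<phi> i x l)))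
            = (\<Sum>j'<n. if j' = j then b j * dbar_vec M d n (c i) j p (\<lambda>x. of_real (\<phi> i x l)) else 0)"
          by (intro sum.cong) auto
        ultimately show ?thesis using j by (simp add: ab)
      qed
      have "v (\<lambda>x. of_real (\<phi> i x (d + 2 * j))) = b j / 2" "v (\<lambda>x. of_real (\<phi> i x (Suc (d + 2 * j)))) = \<i> * b j / 2"
        using val[of "d + 2 * j"] val[of "Suc (d + 2 * j)"] own[of "d + 2 * j" "d + 2 * j"]
          own[of "d + 2 * j" "Suc (d + 2 * j)"] own[of "Suc (d + 2 * j)" "d + 2 * j"]
          own[of "Suc (d + 2 * j)" "Suc (d + 2 * j)"] j by (simp_all add: dbar_vec_eq)
      then have "cnj (b j / 2) = b j / 2" "cnj (\<i> * b j / 2) = \<i> * b j / 2"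
        using re[of "\<lambda>x. \<phi> i x (d + 2 * j)"] re[of "\<lambda>x. \<phi> i x (Suc (d + 2 * j))"] by metis+
      then show ?thesis by (auto simp: complex_eq_iff)
    qed
    have "a k = of_real (Re (a k))" if "k < d" for k using a[OF that] by (simp add: complex_eq_iff)
    then have "(\<Sum>k<d. a k * ?v k p f) = (\<Sum>k<d. of_real (Re (a k)) * ?v k p f)" for f
      by (intro sum.cong) auto
    then have "v = (\<lambda>f. \<Sum>k<d. of_real (Re (a k)) * ?v k p f)" using b by (simp add: ab)
    then show "v \<in> {(\<lambda>f. \<Sum>k<d. of_real (a k) * ?v k p f) | a. True}"
      by (intro CollectI exI[of _ "\<lambda>k. Re (a k)"] conjI) auto
  next
    fix v assume "v \<in> {(\<lambda>f. \<Sum>k<d. of_real (a k) * ?v k p f) | a. True}"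
    then obtain a where a: "v = (\<lambda>f. \<Sum>k<d. of_real (a k) * ?v k p f)" by blast
    have "v \<in> V p"
      unfolding chart_subspace[OF i p] a by (intro CollectI exI[of _ "\<lambda>k. of_real (a k)"] exI[of _ "\<lambda>_. 0"]) simp
    moreover have conj: "vec_conj v = v"
    proof
      fix f
      have "vec_conj v f = (\<Sum>k<d. of_real (a k) * cnj (?v k p (\<lambda>x. cnj (f x))))"
        by (simp add: vec_conj_def a)
      also have "\<dots> = v f" unfolding a by (rule sum.cong) (use vec_conj_coord_vec[OF M sc p] dim in auto)
      finally show "vec_conj v f = v f" .
    qed
    ultimately show "v \<in> D p" by (auto simp: real_distribution_def intro: image_eqI[of _ _ v])
  qed
  then show ?thesis using sc by (simp add: foliated_chart_def)
qed

text \<open>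
  The first \<open>d\<close> coordinate vectors of either chart span \<open>D\<close>, and those of \<open>\<beta>\<close> annihilate its
  remaining coordinates.
\<close>

lemma foliated_transition_partial:
  assumes 1: "foliated_chart M D d (A, \<alpha>)" and 2: "foliated_chart M D d (B, \<beta>)" and q: "q \<in> A" "q \<in> B"
    and k: "k < d" and l: "d \<le> l" "l < mdim M"
  shows "pdiff k (\<lambda>y. \<beta> (the_inv_into A \<alpha> y) l) (\<alpha> q) = 0"
proof -
  have sc: "smooth_chart M (A, \<alpha>)" "smooth_chart M (B, \<beta>)"
    and D: "D q = {(\<lambda>f. \<Sum>i<d. of_real (a i) * coord_vec M (A, \<alpha>) i q f) | a. True}"
      "D q = {(\<lambda>f. \<Sum>i<d. of_real (a i) * coord_vec M (B, \<beta>) i q f) | a. True}"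
    using 1 2 q unfolding foliated_chart_def fst_conv by blast+
  have km: "k < mdim M" using k dim by simp
  have "coord_vec M (A, \<alpha>) k q = (\<lambda>f. \<Sum>i<d. of_real (if i = k then 1 else 0) * coord_vec M (A, \<alpha>) i q f)"
    using k by (simp add: if_distrib[of of_real] if_distrib[of "\<lambda>x. x * _"] cong: if_cong)
  then have "coord_vec M (A, \<alpha>) k q \<in> D q"
    unfolding D(1) by (intro CollectI exI[of _ "\<lambda>i. if i = k then 1 else 0"] conjI) auto
  then obtain a where a: "coord_vec M (A, \<alpha>) k q = (\<lambda>f. \<Sum>i<d. of_real (a i) * coord_vec M (B, \<beta>) i q f)"
    unfolding D(2) by blast
  have "coord_vec M (A, \<alpha>) k q (\<lambda>x. of_real (\<beta> x l)) = 0"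
    unfolding a by (rule sum.neutral) (use coord_vec_own[OF M sc(2) q(2) _ l(2)] l dim in auto)
  then show ?thesis
    using coord_vec_of_real[OF M sc(1) chart_coordinate_smooth(1)[OF M sc(2) l(2) q(2)] q(1) km] by simp
qed

text \<open>
  Hence, near each point, the transverse coordinates of one foliated chart are constant on the
  plaques of another: move from one point of a coordinate box to another one leaf coordinate at a time.
\<close>

lemma foliated_plaques_match:
  assumes 1: "foliated_chart M D d (A, \<alpha>)" and 2: "foliated_chart M D d (B, \<beta>)" and N: "openin (mtop M) N" "x \<in> N"
    and x: "x \<in> A" "x \<in> B"
  obtains N' where "openin (mtop M) N'" "x \<in> N'" "N' \<subseteq> N \<inter> A \<inter> B"
    "\<And>y. y \<in> N' \<Longrightarrow> (\<And>k. k \<ge> d \<Longrightarrow> \<alpha> y k = \<alpha> x k) \<Longrightarrow> (\<And>k. k \<ge> d \<Longrightarrow> \<beta> y k = \<beta> x k)"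
proof -
  have sc: "smooth_chart M (A, \<alpha>)" "smooth_chart M (B, \<beta>)" using 1 2 by (auto simp: foliated_chart_def)
  note cA = chart_onD[OF smooth_chart_on[OF M sc(1)]] and cB = chart_onD[OF smooth_chart_on[OF M sc(2)]]
  let ?m = "mdim M" and ?S = "\<alpha> ` (A \<inter> (B \<inter> N))"
  have So: "openin (top_of_set (coord_space ?m)) ?S"
    using cA(4)[of "B \<inter> N"] cB(1) N(1) by (auto simp: Euclidean_space_eq)
  obtain \<delta> where \<delta>: "\<delta> > 0" "\<And>y. y \<in> coord_space ?m \<Longrightarrow> (\<And>i. i < ?m \<Longrightarrow> dist (y i) (\<alpha> x i) < \<delta>) \<Longrightarrow> y \<in> ?S"
    using open_coordinate_box[OF So, of "\<alpha> x"] x N(2) by blast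
  define N' where "N' = {y \<in> A. \<forall>i<?m. dist (\<alpha> y i) (\<alpha> x i) < \<delta>}"
  have "openin (subtopology (mtop M) A) N'"
  proof -
    have "open {v::nat \<Rightarrow> real. \<forall>i\<in>{..<?m}. dist (v i) (\<alpha> x i) < \<delta>}"
      unfolding Collect_ball_eq
      by (intro open_INT finite_lessThan ballI open_Collect_less continuous_on_dist continuous_on_const continuous_on_product_coordinates)
    from openin_continuous_map_preimage[OF cA(6), unfolded open_openin[symmetric], OF this]
    show ?thesis using cA(2) by (simp add: N'_def Int_absorb1 inf_absorb2 lessThan_def)
  qed
  then have No: "openin (mtop M) N'" using cA(1) openin_trans_full by blast
  have NS: "N' \<subseteq> N \<inter> A \<inter> B"
  proof
    fix y assume y: "y \<in> N'"
    then have yA: "y \<in> A" by (simp add: N'_def)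
    have "\<alpha> y \<in> ?S" by (rule \<delta>(2)) (use y cA(7)[OF yA] in \<open>auto simp: N'_def\<close>)
    then obtain y' where "y' \<in> A \<inter> (B \<inter> N)" "\<alpha> y = \<alpha> y'" by auto
    then show "y \<in> N \<inter> A \<inter> B" using cA(3) yA by (auto simp: inj_on_def)
  qed
  have xN: "x \<in> N'" using x \<delta>(1) by (simp add: N'_def)
  have const: "\<beta> y l = \<beta> x l" if y: "y \<in> N'" "\<And>k. k \<ge> d \<Longrightarrow> \<alpha> y k = \<alpha> x k" and l: "l \<ge> d" for y l
  proof (cases "l < ?m")
    case False
    moreover have "\<beta> y \<in> coord_space ?m" "\<beta> x \<in> coord_space ?m" using cB(7) NS xN y(1) by blast+
    ultimately show ?thesis by (simp add: coord_space_def)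
  next
    case True
    let ?f = "\<lambda>v. \<beta> (the_inv_into A \<alpha> v) l"
    define mix where "mix j = (\<lambda>k. if k < j then \<alpha> y k else \<alpha> x k)" for j
    have yA: "y \<in> A" using y(1) by (simp add: N'_def)
    have "?f (mix j) = ?f (\<alpha> x)" if "j \<le> d" for j
      using that
    proof (induction j)
      case 0
      then show ?case by (simp add: mix_def)
    next
      case (Suc j)
      then have j: "j < d" "j < ?m" using dim by auto
      let ?I = "ball (\<alpha> x j) \<delta>"
      have in_S: "(mix j)(j := h) \<in> ?S" if "h \<in> ?I" for h
      proof (rule \<delta>(2))
        show "(mix j)(j := h) \<in> coord_space ?m"
          using cA(7)[OF yA] cA(7)[OF x(1)] j by (auto simp: coord_space_def mix_def)
        show "dist (((mix j)(j := h)) i) (\<alpha> x i) < \<delta>" if "i < ?m" for i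
          using y(1) that \<open>h \<in> ?I\<close> \<delta>(1) by (auto simp: mix_def N'_def dist_commute)
      qed
      have "((\<lambda>h. ?f ((mix j)(j := h))) has_real_derivative 0) (at h within ?I)" if h: "h \<in> ?I" for h
      proof -
        obtain q where q: "q \<in> A" "q \<in> B" "(mix j)(j := h) = \<alpha> q" using in_S[OF h] by auto
        have "((\<lambda>h'. ?f ((\<alpha> q)(j := h'))) has_real_derivative pdiff j ?f (\<alpha> q)) (at (\<alpha> q j))"
          using chart_partial_derivative(1)[OF M sc(1) chart_coordinate_smooth(2)[OF M sc(2) True q(2)] q(1) j(2)] .
        moreover have "pdiff j ?f (\<alpha> q) = 0" by (rule foliated_transition_partial[OF 1 2 q(1,2) j(1) l True])
        moreover have "\<alpha> q j = h" "(\<alpha> q)(j := h') = (mix j)(j := h')" for h' using q(3)[symmetric] by auto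
        ultimately have "((\<lambda>h'. ?f ((mix j)(j := h'))) has_real_derivative 0) (at h)" by simp
        then show ?thesis by (rule has_field_derivative_at_within)
      qed
      then have "\<exists>C. \<forall>h\<in>?I. ?f ((mix j)(j := h)) = C"
        by (rule has_field_derivative_zero_constant[OF convex_ball])
      then obtain C where C: "\<And>h. h \<in> ?I \<Longrightarrow> ?f ((mix j)(j := h)) = C" by blast
      have "\<alpha> y j \<in> ?I" "\<alpha> x j \<in> ?I" using y(1) j(2) \<delta>(1) by (auto simp: N'_def dist_commute)
      then have "?f ((mix j)(j := \<alpha> y j)) = ?f ((mix j)(j := \<alpha> x j))" using C by simp
      moreover have "(mix j)(j := \<alpha> y j) = mix (Suc j)" "(mix j)(j := \<alpha> x j) = mix j"
        by (auto simp: mix_def fun_eq_iff less_Suc_eq)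
      ultimately show ?case using Suc by simp
    qed
    moreover have "mix d = \<alpha> y" using y(2) by (auto simp: mix_def fun_eq_iff)
    ultimately show ?thesis using cA(5)[OF yA] cA(5)[OF x(1)] by force
  qed
  show ?thesis by (rule that[OF No xN NS const])
qed

lemma leaf_topspace: "topspace L = topspace (mtop M)"
proof -
  have "x \<in> \<Union> {{p \<in> W. \<forall>i\<ge>d. \<phi> p i = b i} | W U \<phi> b. foliated_chart M D d (U, \<phi>) \<and> openin (mtop M) W \<and> W \<subseteq> U}"
    if x: "x \<in> topspace (mtop M)" for x
  proof -
    obtain i where i: "i \<in> I" "x \<in> U i" using x cover by blast
    then have "{p \<in> U i. \<forall>k\<ge>d. \<phi> i p k = \<phi> i x k} \<in> {{p \<in> W. \<forall>i\<ge>d. \<phi> p i = b i} | W U \<phi> b. foliated_chart M D d (U, \<phi>) \<and> openin (mtop M) W \<and> W \<subseteq> U}"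
      using real_chart_foliated[OF i(1)] real_chart(1)[OF i(1)] by blast
    then show ?thesis using i(2) by blast
  qed
  moreover have "\<Union> {{p \<in> W. \<forall>i\<ge>d. \<phi> p i = b i} | W U \<phi> b. foliated_chart M D d (U, \<phi>) \<and> openin (mtop M) W \<and> W \<subseteq> U} \<subseteq> topspace (mtop M)"
    using openin_subset by fastforce
  ultimately show ?thesis unfolding leaf_topology_def topology_generated_by_topspace by blast
qed

text \<open>
  The leaf topology is generated by the plaques of all foliated charts; each of them contains, near
  \<open>x\<close>, the plaque of the given adapted chart.
\<close>

lemma leaf_open_nbhd:
  assumes "openin L P" "x \<in> P" and i: "i \<in> I" "x \<in> U i"
  shows "\<exists>N. openin (mtop M) N \<and> x \<in> N \<and> {y \<in> N \<inter> U i. zcoord (c i) y = zcoord (c i) x} \<subseteq> P"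
proof -
  have "generate_topology_on {{p \<in> W. \<forall>i\<ge>d. \<phi> p i = b i} | W U \<phi> b. foliated_chart M D d (U, \<phi>) \<and> openin (mtop M) W \<and> W \<subseteq> U} P"
    using assms(1) by (simp add: leaf_topology_def openin_topology_generated_by_iff)
  then show ?thesis using assms(2)
  proof induction
    case Empty
    then show ?case by simp
  next
    case (Int P Q)
    then have "x \<in> P" "x \<in> Q" by auto
    from Int.IH(1)[OF this(1)] obtain N where
      N: "openin (mtop M) N" "x \<in> N" "{y \<in> N \<inter> U i. zcoord (c i) y = zcoord (c i) x} \<subseteq> P" by blast
    from Int.IH(2)[OF \<open>x \<in> Q\<close>] obtain N' where
      N': "openin (mtop M) N'" "x \<in> N'" "{y \<in> N' \<inter> U i. zcoord (c i) y = zcoord (c i) x} \<subseteq> Q" by blast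
    show ?case by (rule exI[of _ "N \<inter> N'"]) (use N N' in auto)
  next
    case (UN \<K>)
    then obtain Q where Q: "Q \<in> \<K>" "x \<in> Q" by blast
    from UN.IH[OF this] obtain N where
      "openin (mtop M) N" "x \<in> N" "{y \<in> N \<inter> U i. zcoord (c i) y = zcoord (c i) x} \<subseteq> Q" by blast
    then show ?case using Q(1) by (intro exI[of _ N]) auto
  next
    case (Basis P)
    then obtain W A \<alpha> b where *: "P = {p \<in> W. \<forall>i\<ge>d. \<alpha> p i = b i}" "foliated_chart M D d (A, \<alpha>)" "openin (mtop M) W" "W \<subseteq> A"
      by blast
    then have x: "x \<in> W" "x \<in> A" "\<And>k. k \<ge> d \<Longrightarrow> \<alpha> x k = b k" using Basis by auto
    show ?case
    proof (rule foliated_plaques_match[OF real_chart_foliated[OF i(1)] *(2,3) x(1) i(2) x(2)])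
      fix N assume N: "openin (mtop M) N" "x \<in> N" "N \<subseteq> W \<inter> U i \<inter> A"
        and const: "\<And>y k. y \<in> N \<Longrightarrow> (\<And>k. k \<ge> d \<Longrightarrow> \<phi> i y k = \<phi> i x k) \<Longrightarrow> k \<ge> d \<Longrightarrow> \<alpha> y k = \<alpha> x k"
      have "y \<in> P" if y: "y \<in> N" "y \<in> U i" "zcoord (c i) y = zcoord (c i) x" for y
      proof -
        have "\<phi> i y k = \<phi> i x k" if "k \<ge> d" for k using zcoord_eq_iff[OF i(1) y(2) i(2)] y(3) that by simp
        from const[OF y(1) this] have "\<alpha> y k = b k" if "k \<ge> d" for k using x(3) that by simp
        then show ?thesis using N(3) y(1) unfolding *(1) by blast
      qed
      then show ?thesis using N(1,2) by (intro exI[of _ N]) blast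
    qed
  qed
qed

lemma plaque_leaf_open:
  assumes i: "i \<in> I" and N: "openin (mtop M) N"
  shows "openin L {y \<in> N \<inter> U i. zcoord (c i) y = \<zeta>}"
proof (cases "\<exists>x \<in> U i. zcoord (c i) x = \<zeta>")
  case True
  then obtain x where x: "x \<in> U i" "zcoord (c i) x = \<zeta>" by blast
  have eq: "{y \<in> N \<inter> U i. zcoord (c i) y = \<zeta>} = {p \<in> N \<inter> U i. \<forall>k\<ge>d. \<phi> i p k = \<phi> i x k}"
    using zcoord_eq_iff[OF i _ x(1)] x(2) by auto
  show ?thesis
    unfolding eq leaf_topology_def
    by (rule topology_generated_by_Basis) (use real_chart_foliated[OF i] real_chart(1)[OF i] N in blast)
next
  case False
  then have empty: "{y \<in> N \<inter> U i. zcoord (c i) y = \<zeta>} = {}" by auto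
  show ?thesis unfolding empty by simp
qed

sublocale foliated_space "mtop M" L I U d "\<lambda>i. tcoord (c i)" "\<lambda>i. zcoord (c i)" Tball Zdisc
proof
  show "(\<lambda>_. 0) \<in> Tball i" if "i \<in> I" for i
    by (rule ball_times_disc[OF that]) (simp add: real_ball_def Euclidean_space_eq coord_space_def)
qed (use real_chart(1) cover chart_homeo Tball_convex Tball_open leaf_topspace plaque_leaf_open leaf_open_nbhd in auto)

lemma point_eq:
  assumes "i \<in> I" "\<tau> \<in> Tball i" "\<zeta> \<in> Zdisc i"
  shows "point i \<tau> \<zeta> = the_inv_into (U i) (\<phi> i) (real_tuple d n \<tau> \<zeta>)"
  using tuple_chart[OF assms] point_in[OF assms] by (intro tz_inj[OF assms(1)]) auto

text \<open>
  \<open>V\<close> annihilates the transverse coordinates of every adapted chart, so in another adapted chart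
  these coordinates satisfy the Cauchy-Riemann equations.
\<close>

lemma transition_holomorphic:
  assumes i: "i \<in> I" and j: "j \<in> I" and \<tau>: "\<tau> \<in> Tball i" and l: "l < n"
  defines "S \<equiv> {\<zeta> \<in> Zdisc i. point i \<tau> \<zeta> \<in> U j}"
  shows "openin (top_of_set (coord_space n)) S" "holomorphic_in n S (\<lambda>\<zeta>. zcoord (c j) (point i \<tau> \<zeta>) l)"
proof -
  have pc: "continuous_map (top_of_set (Zdisc i)) (mtop M) (\<lambda>\<zeta>. point i \<tau> \<zeta>)"
    by (rule point_continuous[OF i]) (use \<tau> in auto)
  have "openin (top_of_set (Zdisc i)) S"
    using openin_continuous_map_preimage[OF pc real_chart(1)[OF j]] by (simp add: S_def)
  then show S: "openin (top_of_set (coord_space n)) S" using Zdisc_open[OF i] openin_trans by blast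
  have "continuous_map (top_of_set S) (mtop M) (\<lambda>\<zeta>. point i \<tau> \<zeta>)"
    using continuous_map_from_subtopology[OF pc, of S] by (simp add: S_def subtopology_subtopology Int_absorb1)
  from coords_continuous(2)[OF j this] have "continuous_map (top_of_set S) euclidean (\<lambda>\<zeta>. zcoord (c j) (point i \<tau> \<zeta>))"
    by (simp add: S_def)
  then have c: "continuous_on S (\<lambda>\<zeta>. zcoord (c j) (point i \<tau> \<zeta>) l)"
    by (auto intro: continuous_on_product_then_coordinatewise)
  show "holomorphic_in n S (\<lambda>\<zeta>. zcoord (c j) (point i \<tau> \<zeta>) l)"
  proof (rule holomorphic_inI[OF S c])
    fix \<zeta> k assume \<zeta>: "\<zeta> \<in> S" and k: "k < n"
    let ?p = "point i \<tau> \<zeta>" and ?m = "d + 2 * n"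
    have p: "?p \<in> U i" "?p \<in> U j" "tcoord (c i) ?p = \<tau>" "zcoord (c i) ?p = \<zeta>"
      using \<zeta> point_in[OF i \<tau>, of \<zeta>] by (auto simp: S_def)
    note sci = real_chart_smooth[OF i] and scj = real_chart_smooth[OF j]
    let ?g = "\<lambda>b x. \<phi> j x (d + 2 * l + b)"
    define P where "P b a = pdiff a (\<lambda>y. ?g b (the_inv_into (U i) (\<phi> i) y)) (\<phi> i ?p)" for b a
    have lm: "d + 2 * l + b < mdim M" if "b < 2" for b using l that dim by simp
    have g: "smooth_at M ?p (\<lambda>x. of_real (?g b x))" "C1_near M ?p (?g b)" if "b < 2" for b
      using chart_coordinate_smooth[OF M scj lm[OF that] p(2)] by auto
    have "dbar_vec M d n (c i) k ?p \<in> V ?p"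
    proof -
      have "dbar_vec M d n (c i) k ?p = (\<lambda>f. (\<Sum>a<d. 0 * coord_vec M (U i, \<phi> i) a ?p f) +
          (\<Sum>j<n. (if j = k then 1 else 0) * dbar_vec M d n (c i) j ?p f))"
        using k by (simp add: if_distrib[of "\<lambda>x. x * _"] cong: if_cong)
      then show ?thesis
        unfolding chart_subspace[OF i p(1)]
        by (intro CollectI exI[of _ "\<lambda>_. 0"] exI[of _ "\<lambda>j. if j = k then 1 else 0"] conjI) auto
    qed
    then obtain a b where ab: "dbar_vec M d n (c i) k ?p = (\<lambda>f. (\<Sum>k<d. a k * coord_vec M (U j, \<phi> j) k ?p f) +
        (\<Sum>j'<n. b j' * dbar_vec M d n (c j) j' ?p f))"
      unfolding chart_subspace[OF j p(2)] by blast
    have own: "coord_vec M (U j, \<phi> j) a ?p (\<lambda>x. of_real (?g b x)) = (if a = d + 2 * l + b then 1 else 0)"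
      if "a < ?m" "b < 2" for a b
      using coord_vec_own[OF M scj p(2) _ lm[OF that(2)]] that(1) dim by simp
    have ann: "dbar_vec M d n (c j) j' ?p (\<lambda>x. of_real (?g 0 x)) + \<i> * dbar_vec M d n (c j) j' ?p (\<lambda>x. of_real (?g 1 x)) = 0" if "j' < n" for j'
    proof -
      have "d + 2 * j' \<noteq> d + 2 * l + 1" "Suc (d + 2 * j') \<noteq> d + 2 * l + 0" by presburger+
      then show ?thesis
        using own[of "d + 2 * j'" 0] own[of "d + 2 * j'" 1] own[of "Suc (d + 2 * j')" 0] own[of "Suc (d + 2 * j')" 1] that
        by (auto simp: dbar_vec_eq)
    qed
    have T: "(\<Sum>j'<n. b j' * dbar_vec M d n (c j) j' ?p (\<lambda>x. of_real (?g 0 x)))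
        + \<i> * (\<Sum>j'<n. b j' * dbar_vec M d n (c j) j' ?p (\<lambda>x. of_real (?g 1 x))) = 0"
      unfolding sum_distrib_left sum.distrib[symmetric]
    proof (rule sum.neutral, intro ballI)
      fix j' assume j': "j' \<in> {..<n}"
      have "u * v + \<i> * (u * w) = u * (v + \<i> * w)" for u v w :: complex by (simp add: algebra_simps)
      from this[of "b j'"]
      show "b j' * dbar_vec M d n (c j) j' ?p (\<lambda>x. of_real (?g 0 x)) + \<i> * (b j' * dbar_vec M d n (c j) j' ?p (\<lambda>x. of_real (?g 1 x))) = 0"
        using ann[of j'] j' by simp
    qed
    have S0: "(\<Sum>k<d. a k * coord_vec M (U j, \<phi> j) k ?p (\<lambda>x. of_real (?g b x))) = 0" if "b < 2" for b
      by (rule sum.neutral) (use own that in auto)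
    have "dbar_vec M d n (c i) k ?p (\<lambda>x. of_real (?g 0 x)) + \<i> * dbar_vec M d n (c i) k ?p (\<lambda>x. of_real (?g 1 x)) = 0"
    proof -
      have "(0::nat) < 2" "(1::nat) < 2" by simp_all
      then show ?thesis unfolding ab S0[OF \<open>0 < 2\<close>] S0[OF \<open>1 < 2\<close>] add_0 by (intro T)
    qed
    note zero = this
    have cv: "coord_vec M (U i, \<phi> i) a ?p (\<lambda>x. of_real (?g b x)) = of_real (P b a)" if "a < ?m" "b < 2" for a b
      using coord_vec_of_real[OF M sci g(1)[OF that(2)] p(1)] that(1) dim by (simp add: P_def)
    have k': "d + 2 * k < ?m" "Suc (d + 2 * k) < ?m" "(0::nat) < 2" "(1::nat) < 2" using k by simp_all
    have "(complex_of_real (P 0 (d + 2 * k)) + \<i> * of_real (P 0 (Suc (d + 2 * k)))) / 2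
        + \<i> * ((of_real (P 1 (d + 2 * k)) + \<i> * of_real (P 1 (Suc (d + 2 * k)))) / 2) = 0"
      using zero unfolding dbar_vec_eq cv[OF k'(1,3)] cv[OF k'(2,3)] cv[OF k'(1,4)] cv[OF k'(2,4)] .
    then have CR: "P 0 (d + 2 * k) = P 1 (Suc (d + 2 * k))" "P 1 (d + 2 * k) = - P 0 (Suc (d + 2 * k))"
      by (simp_all add: complex_eq_iff)
    define x where "x w = real_tuple d n \<tau> (\<zeta>(k := w))" for w
    define x' where "x' a v = (if a = d + 2 * k then Re v else if a = Suc (d + 2 * k) then Im v else 0)" for a and v :: complex
    have x0: "x (\<zeta> k) = \<phi> i ?p" using p by (simp add: x_def real_coords_eq)
    have xd: "((\<lambda>w. x w a) has_derivative x' a) (at (\<zeta> k))" if "a < mdim M" for a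
      using that[unfolded dim]
    proof (cases rule: index_cases)
      case 1
      then have "(\<lambda>w. x w a) = (\<lambda>w. \<tau> a)" "x' a = (\<lambda>v. 0)" by (auto simp: x_def x'_def real_tuple_simps fun_eq_iff)
      then show ?thesis by simp
    next
      case (2 b)
      then have "(\<lambda>w. x w a) = (if b = k then Re else (\<lambda>w. Re (\<zeta> b)))" "x' a = (if b = k then Re else (\<lambda>v. 0))"
        by (auto simp: x_def x'_def real_tuple_simps fun_eq_iff)
      then show ?thesis using bounded_linear_imp_has_derivative[OF bounded_linear_Re] by simp
    next
      case (3 b)
      then have "(\<lambda>w. x w a) = (if b = k then Im else (\<lambda>w. Im (\<zeta> b)))" "x' a = (if b = k then Im else (\<lambda>v. 0))"
        by (auto simp: x_def x'_def real_tuple_simps fun_eq_iff)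
      then show ?thesis using bounded_linear_imp_has_derivative[OF bounded_linear_Im] by simp
    qed
    have xV: "eventually (\<lambda>w. x w \<in> coord_space (mdim M)) (nhds (\<zeta> k))"
      by (simp add: x_def coord_space_def real_tuple_simps dim)
    have gd: "((\<lambda>w. ?g b (the_inv_into (U i) (\<phi> i) (x w))) has_derivative
        (\<lambda>v. P b (d + 2 * k) * Re v + P b (Suc (d + 2 * k)) * Im v)) (at (\<zeta> k))" if "b < 2" for b
    proof -
      have "((\<lambda>w. ?g b (the_inv_into (U i) (\<phi> i) (x w))) has_derivative (\<lambda>v. \<Sum>a<mdim M. P b a * x' a v)) (at (\<zeta> k))"
        unfolding P_def by (rule chart_chain_rule[OF M sci g(2)[OF that] p(1) x0 xd xV])
      moreover have "(\<Sum>a<mdim M. P b a * x' a v) = P b (d + 2 * k) * Re v + P b (Suc (d + 2 * k)) * Im v" for v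
      proof -
        have "(\<Sum>j<n. P b (d + 2 * j) * x' (d + 2 * j) v + P b (Suc (d + 2 * j)) * x' (Suc (d + 2 * j)) v)
          = (\<Sum>j<n. if j = k then P b (d + 2 * k) * Re v + P b (Suc (d + 2 * k)) * Im v else 0)"
        proof (rule sum.cong[OF refl])
          fix j
          have "d + 2 * j \<noteq> Suc (d + 2 * k)" "Suc (d + 2 * j) \<noteq> d + 2 * k" by presburger+
          then show "P b (d + 2 * j) * x' (d + 2 * j) v + P b (Suc (d + 2 * j)) * x' (Suc (d + 2 * j)) v
            = (if j = k then P b (d + 2 * k) * Re v + P b (Suc (d + 2 * k)) * Im v else 0)"
            by (auto simp: x'_def)
        qed
        moreover have "(\<Sum>a<d. P b a * x' a v) = 0" by (rule sum.neutral) (auto simp: x'_def)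
        ultimately show ?thesis using k by (simp add: dim sum_index_split)
      qed
      ultimately show ?thesis by simp
    qed
    let ?G = "\<lambda>w. zcoord (c j) (the_inv_into (U i) (\<phi> i) (x w)) l"
    let ?D = "Complex (P 0 (d + 2 * k)) (P 1 (d + 2 * k))"
    have "(?G has_derivative (*) ?D) (at (\<zeta> k))"
    proof -
      have "((\<lambda>w. complex_of_real (?g 0 (the_inv_into (U i) (\<phi> i) (x w))) + \<i> * complex_of_real (?g 1 (the_inv_into (U i) (\<phi> i) (x w))))
        has_derivative (\<lambda>v. of_real (P 0 (d + 2 * k) * Re v + P 0 (Suc (d + 2 * k)) * Im v)
          + \<i> * of_real (P 1 (d + 2 * k) * Re v + P 1 (Suc (d + 2 * k)) * Im v))) (at (\<zeta> k))"
        using gd[of 0] gd[of 1] by (intro derivative_eq_intros has_derivative_of_real) auto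
      moreover have "complex_of_real (?g 0 y) + \<i> * complex_of_real (?g 1 y) = zcoord (c j) y l" for y
        using l by (simp add: real_coords_eq real_tuple_simps complex_eq_iff)
      moreover have "of_real (P 0 (d + 2 * k) * Re v + P 0 (Suc (d + 2 * k)) * Im v)
          + \<i> * of_real (P 1 (d + 2 * k) * Re v + P 1 (Suc (d + 2 * k)) * Im v) = ?D * v" for v
        using CR by (simp add: complex_eq_iff)
      ultimately show ?thesis by simp
    qed
    then have G: "(?G has_field_derivative ?D) (at (\<zeta> k))" by (simp add: has_field_derivative_def)
    have "eventually (\<lambda>w. ?G w = zcoord (c j) (point i \<tau> (\<zeta>(k := w))) l) (nhds (\<zeta> k))"
      using eventually_upd_in_open[OF S \<zeta> k]
      by eventually_elim (use point_eq[OF i \<tau>] in \<open>auto simp: S_def x_def\<close>)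
    from DERIV_cong_ev[OF refl this refl, THEN iffD1, OF G]
    show "(\<lambda>w. zcoord (c j) (point i \<tau> (\<zeta>(k := w))) l) field_differentiable at (\<zeta> k)"
      unfolding field_differentiable_def by (rule exI)
  qed
qed

end

section \<open>Holonomy is holomorphic\<close>

lemma leafwise_family_restrict:
  assumes "leafwise_family X L S S' W H" "openin (subtopology X S) W0" "W0 \<subseteq> W"
  shows "leafwise_family X L S S' W0 H"
proof -
  have "continuous_map (prod_topology (subtopology X W0) unit_interval) X (\<lambda>(w, r). H w r)"
    using continuous_map_from_subtopology[of "prod_topology (subtopology X W) unit_interval" X _ "W0 \<times> UNIV"] assms
    by (simp add: leafwise_family_def subtopology_Times subtopology_subtopology Int_absorb1)
  then show ?thesis using assms by (auto simp: leafwise_family_def)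
qed

lemma leafwise_family_end_continuous:
  assumes "leafwise_family X L S S' W H"
  shows "continuous_map (subtopology X W) X (\<lambda>w. H w 1)"
proof -
  have "continuous_map (subtopology X W) (prod_topology (subtopology X W) unit_interval) (\<lambda>w. (w, 1))"
    by (simp add: continuous_map_pairwise o_def)
  moreover have "continuous_map (prod_topology (subtopology X W) unit_interval) X (\<lambda>(w, r). H w r)"
    using assms by (simp add: leafwise_family_def)
  ultimately have "continuous_map (subtopology X W) X ((\<lambda>(w, r). H w r) \<circ> (\<lambda>w. (w, 1)))"
    by (rule continuous_map_compose)
  then show ?thesis by (simp add: o_def)
qed

lemma leafwise_family_join:
  assumes 1: "leafwise_family X L S S' W H" and 2: "leafwise_family X L S' S'' W' H'" and S: "S \<subseteq> topspace X"
  defines "W1 \<equiv> {w \<in> W. H w 1 \<in> W'}"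
  shows "leafwise_family X L S S'' W1 (\<lambda>w. path_join (H w) (H' (H w 1)))"
proof -
  have W: "openin (subtopology X S) W" "W \<subseteq> topspace X"
    using 1 openin_subset[of "subtopology X S" W] S by (auto simp: leafwise_family_def)
  have end_c: "continuous_map (subtopology X W) X (\<lambda>w. H w 1)" by (rule leafwise_family_end_continuous[OF 1])
  have W'S: "W' \<subseteq> S'" using 2 openin_subset by (fastforce simp: leafwise_family_def)
  obtain A where A: "openin X A" "W' = A \<inter> S'" using 2 by (auto simp: leafwise_family_def openin_subtopology)
  have "W1 = {w \<in> topspace (subtopology X W). H w 1 \<in> A}"
    using W(2) A(2) 1 by (auto simp: W1_def leafwise_family_def)
  then have W1o: "openin (subtopology X S) W1"
    using openin_subtopology_trans[OF W(1)] openin_continuous_map_preimage[OF end_c A(1)] by simp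
  have W1: "leafwise_family X L S S' W1 H" by (rule leafwise_family_restrict[OF 1 W1o]) (auto simp: W1_def)
  have tW1: "topspace (subtopology X W1) = W1" using W(2) by (auto simp: W1_def)
  let ?P = "prod_topology (subtopology X W1) unit_interval"
  have "continuous_map ?P (prod_topology (subtopology X W') unit_interval) (\<lambda>x. (H (fst x) 1, snd x))"
  proof -
    have "continuous_map ?P X (\<lambda>x. H (fst x) 1)"
      using continuous_map_compose[OF continuous_map_fst leafwise_family_end_continuous[OF W1]] by (simp add: o_def)
    then have "continuous_map ?P (subtopology X W') (\<lambda>x. H (fst x) 1)"
      by (auto simp: continuous_map_in_subtopology W1_def)
    then show ?thesis using continuous_map_snd[of "subtopology X W1" unit_interval]
      by (simp add: continuous_map_pairwise o_def)
  qed
  moreover have "continuous_map (prod_topology (subtopology X W') unit_interval) X (\<lambda>(w, r). H' w r)"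
    using 2 by (simp add: leafwise_family_def)
  ultimately have "continuous_map ?P X ((\<lambda>(w, r). H' w r) \<circ> (\<lambda>x. (H (fst x) 1, snd x)))"
    by (rule continuous_map_compose)
  then have c2: "continuous_map ?P X (\<lambda>(w, r). H' (H w 1) r)" by (simp add: o_def case_prod_unfold)
  have "continuous_map ?P X (\<lambda>(w, r). path_join (H w) (H' (H w 1)) r)"
    by (rule continuous_map_path_join[OF _ c2]) (use W1 2 tW1 in \<open>auto simp: leafwise_family_def W1_def\<close>)
  moreover have "pathin L (path_join (H w) (H' (H w 1)))" if "w \<in> W1" for w
    using that 1 2 by (intro pathin_path_join) (auto simp: leafwise_family_def W1_def)
  ultimately show ?thesis using W1o 1 2 by (auto simp: leafwise_family_def W1_def)
qed

context adapted_charts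
begin

abbreviation "X \<equiv> mtop M"
abbreviation "S \<equiv> transv"
abbreviation fam where "fam i j W H \<equiv> leafwise_family X L (S i) (S j) W H"

lemma transv_eq: "S i = transversal (c i)"
  by (simp add: transv_def transversal_def)

lemma transv_subset: "i \<in> I \<Longrightarrow> S i \<subseteq> topspace X"
  using chart_subset by (auto simp: transv_def)

definition slice :: "'i \<Rightarrow> (nat \<Rightarrow> complex) \<Rightarrow> 'x" where
  "slice i \<zeta> = point i (\<lambda>_. 0) \<zeta>"

lemma slice:
  assumes "i \<in> I" "w \<in> S i" shows "slice i (zcoord (c i) w) = w"
  using point_coords[of i w] assms by (auto simp: slice_def transv_def)

lemma famD:
  assumes "fam i j W H" "i \<in> I"
  shows "openin (subtopology X (S i)) W" "W \<subseteq> S i" "W \<subseteq> topspace X" "w \<in> W \<Longrightarrow> pathin L (H w)"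
    "w \<in> W \<Longrightarrow> H w 0 = w" "w \<in> W \<Longrightarrow> H w 1 \<in> S j" "p \<in> W \<Longrightarrow> family_through (S i) j (H p) W H"
  using assms openin_subset[of "subtopology X (S i)" W]
  by (auto simp: leafwise_family_def family_through_def)

lemma transversal_image_open:
  assumes i: "i \<in> I" and W: "openin (subtopology X (S i)) W"
  shows "openin (top_of_set (coord_space n)) (zcoord (c i) ` W)"
proof -
  obtain A where A: "openin X A" "W = A \<inter> S i" using W by (auto simp: openin_subtopology)
  have pc: "continuous_map (top_of_set (Zdisc i)) X (slice i)"
    unfolding slice_def by (rule point_continuous[OF i]) (use ball_zero[OF i] in auto)
  have "zcoord (c i) ` W = {\<zeta> \<in> topspace (top_of_set (Zdisc i)). slice i \<zeta> \<in> A}"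
  proof (intro subset_antisym subsetI)
    fix \<zeta> assume "\<zeta> \<in> zcoord (c i) ` W"
    then obtain w where w: "w \<in> A" "w \<in> S i" "\<zeta> = zcoord (c i) w" using A(2) by auto
    then show "\<zeta> \<in> {\<zeta> \<in> topspace (top_of_set (Zdisc i)). slice i \<zeta> \<in> A}"
      using slice[OF i w(2)] in_Zdisc[OF i, of w] by (auto simp: transv_def)
  next
    fix \<zeta> assume "\<zeta> \<in> {\<zeta> \<in> topspace (top_of_set (Zdisc i)). slice i \<zeta> \<in> A}"
    then have \<zeta>: "\<zeta> \<in> Zdisc i" "slice i \<zeta> \<in> A" by auto
    have "slice i \<zeta> \<in> S i" "zcoord (c i) (slice i \<zeta>) = \<zeta>"
      using point_in[OF i ball_zero[OF i] \<zeta>(1)] by (auto simp: slice_def transv_def)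
    then show "\<zeta> \<in> zcoord (c i) ` W" using \<zeta>(2) A(2) by force
  qed
  then have "openin (top_of_set (Zdisc i)) (zcoord (c i) ` W)"
    using openin_continuous_map_preimage[OF pc A(1)] by simp
  then show ?thesis using Zdisc_open[OF i] openin_trans by blast
qed

text \<open>
  Close to \<open>p\<close>, moving along plaques of chart \<open>i\<close> does not change the transverse coordinates of chart
  \<open>j\<close>, so these can be computed on the slice of chart \<open>i\<close> through \<open>p\<close>.
\<close>

lemma transition_near:
  assumes i: "i \<in> I" and j: "j \<in> I" and p: "p \<in> U i" "p \<in> U j"
  obtains N where "openin X N" "p \<in> N" "N \<subseteq> U i" "N \<subseteq> U j"
    "\<And>x. x \<in> N \<Longrightarrow> point i (tcoord (c i) p) (zcoord (c i) x) \<in> U j"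
    "\<And>x. x \<in> N \<Longrightarrow> zcoord (c j) x = zcoord (c j) (point i (tcoord (c i) p) (zcoord (c i) x))"
proof -
  obtain Q where Q: "openin X Q" "p \<in> Q" "Q \<subseteq> U j \<inter> U i"
    "\<And>x x' s. x \<in> Q \<Longrightarrow> x' \<in> Q \<Longrightarrow> zcoord (c i) x = zcoord (c i) x' \<Longrightarrow> s \<in> {0..1} \<Longrightarrow> segment i x x' s \<in> Q"
    by (rule plaque_convex_nbhd[OF i chart_open[OF j] p(2,1)]) (rule that)
  let ?\<pi> = "\<lambda>x. point i (tcoord (c i) p) (zcoord (c i) x)"
  have tp: "tcoord (c i) p \<in> Tball i" using in_Tball[OF i p(1)] .
  have QX: "Q \<subseteq> topspace X" using openin_subset[OF Q(1)] .
  have "continuous_map (subtopology X Q) X (\<lambda>x. x)" by (simp add: continuous_map_from_subtopology)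
  from coords_continuous(2)[OF i this] have "continuous_map (subtopology X Q) euclidean (\<lambda>x. zcoord (c i) x)" using Q(3) by auto
  then have "continuous_map (subtopology X Q) X ?\<pi>"
    by (intro point_continuous[OF i]) (use tp in_Zdisc[OF i] Q(3) in auto)
  from openin_continuous_map_preimage[OF this Q(1)]
  have "openin (subtopology X Q) {x \<in> Q. ?\<pi> x \<in> Q}" using QX by (simp add: Int_absorb1)
  then have "openin X {x \<in> Q. ?\<pi> x \<in> Q}" using Q(1) openin_trans_full by blast
  moreover have "?\<pi> p = p" by (rule point_coords[OF i p(1)])
  moreover have "zcoord (c j) x = zcoord (c j) (?\<pi> x)" if x: "x \<in> Q" "?\<pi> x \<in> Q" for x
  proof -
    have z: "zcoord (c i) x = zcoord (c i) (?\<pi> x)" using point_in(3)[OF i tp in_Zdisc[OF i]] Q(3) x(1) by auto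
    have xU: "x \<in> U i" "?\<pi> x \<in> U i" using Q(3) x by auto
    have "zcoord (c j) (segment i x (?\<pi> x) 0) = zcoord (c j) (segment i x (?\<pi> x) 1)"
      by (rule pathin_transverse_coord[OF pathin_segment[OF i xU z] j]) (use Q(3,4) x z in blast)
    then show ?thesis using segment(1,2)[OF i xU z] by simp
  qed
  ultimately show ?thesis using that[of "{x \<in> Q. ?\<pi> x \<in> Q}"] Q(2,3) by auto
qed

text \<open>
  Near \<open>p\<close>, the transverse coordinates in chart \<open>k\<close> of the points reached at time \<open>r\<close> depend
  holomorphically on the starting point.
\<close>

definition holomorphic_at_time :: "'i \<Rightarrow> 'x set \<Rightarrow> ('x \<Rightarrow> real \<Rightarrow> 'x) \<Rightarrow> 'x \<Rightarrow> real \<Rightarrow> 'i \<Rightarrow> bool" where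
  "holomorphic_at_time i W H p r k \<longleftrightarrow> (\<exists>W' \<Theta>. openin (subtopology X (S i)) W' \<and> p \<in> W' \<and> W' \<subseteq> W \<and>
     (\<forall>w\<in>W'. H w r \<in> U k \<and> zcoord (c k) (H w r) = \<Theta> (zcoord (c i) w)) \<and>
     (\<forall>l<n. holomorphic_in n (zcoord (c i) ` W') (\<lambda>\<zeta>. \<Theta> \<zeta> l)))"

lemma holomorphic_at_time_0:
  assumes i: "i \<in> I" and F: "fam i j W H" "p \<in> W" and k: "k \<in> I" "p \<in> U k"
  shows "holomorphic_at_time i W H p 0 k"
proof -
  note F' = famD[OF F(1) i]
  have p: "p \<in> U i" "tcoord (c i) p = (\<lambda>_. 0)" using F'(2) F(2) by (auto simp: transv_def)
  obtain N where N: "openin X N" "p \<in> N" "N \<subseteq> U i" "N \<subseteq> U k"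
    "\<And>x. x \<in> N \<Longrightarrow> point i (tcoord (c i) p) (zcoord (c i) x) \<in> U k"
    "\<And>x. x \<in> N \<Longrightarrow> zcoord (c k) x = zcoord (c k) (point i (tcoord (c i) p) (zcoord (c i) x))"
    by (rule transition_near[OF i k(1) p(1) k(2)]) (rule that)
  have W': "openin (subtopology X (S i)) (W \<inter> N)"
  proof -
    have "openin (subtopology X (S i)) (W \<inter> (S i \<inter> N))" using F'(1) N(1) by (intro openin_Int openin_subtopology_Int2)
    then show ?thesis using F'(2) by (simp add: Int_absorb2 flip: Int_assoc)
  qed
  let ?T = "{\<zeta> \<in> Zdisc i. point i (\<lambda>_. 0) \<zeta> \<in> U k}"
  have "holomorphic_in n (zcoord (c i) ` (W \<inter> N)) (\<lambda>\<zeta>. zcoord (c k) (slice i \<zeta>) l)" if l: "l < n" for l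
  proof (rule holomorphic_in_cong[OF transversal_image_open[OF i W'] transition_holomorphic(1)[OF i k(1) ball_zero[OF i] l] _
        transition_holomorphic(2)[OF i k(1) ball_zero[OF i] l]])
    show "zcoord (c i) ` (W \<inter> N) \<subseteq> ?T" using N(3,5) in_Zdisc[OF i] p(2) by auto
  qed (simp add: slice_def)
  moreover have "zcoord (c k) (H w 0) = zcoord (c k) (slice i (zcoord (c i) w))" "H w 0 \<in> U k" if "w \<in> W \<inter> N" for w
    using that F'(2,5) slice[OF i, of w] N(4) by auto
  ultimately show ?thesis
    unfolding holomorphic_at_time_def using W' F(2) N(2)
    by (intro exI[of _ "W \<inter> N"] exI[of _ "\<lambda>\<zeta>. zcoord (c k) (slice i \<zeta>)"]) auto
qed

lemma holomorphic_at_time_step: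
  assumes i: "i \<in> I" and F: "fam i j W H" "p \<in> W" and ab: "0 \<le> a" "a \<le> b" "b \<le> 1"
    and m: "m \<in> I" "\<And>r. r \<in> {a..b} \<Longrightarrow> H p r \<in> U m" and hol: "holomorphic_at_time i W H p a m"
    and k: "k \<in> I" "H p b \<in> U k"
  shows "holomorphic_at_time i W H p b k"
proof -
  note F' = famD[OF F(1) i]
  have bm: "H p b \<in> U m" using m(2) ab by auto
  obtain W1 \<Theta> where W1: "openin (subtopology X (S i)) W1" "p \<in> W1" "W1 \<subseteq> W"
    "\<And>w. w \<in> W1 \<Longrightarrow> zcoord (c m) (H w a) = \<Theta> (zcoord (c i) w)"
    "\<And>l. l < n \<Longrightarrow> holomorphic_in n (zcoord (c i) ` W1) (\<lambda>\<zeta>. \<Theta> \<zeta> l)"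
    using hol unfolding holomorphic_at_time_def by auto
  obtain N where N: "openin X N" "H p b \<in> N" "N \<subseteq> U m" "N \<subseteq> U k"
    "\<And>x. x \<in> N \<Longrightarrow> point m (tcoord (c m) (H p b)) (zcoord (c m) x) \<in> U k"
    "\<And>x. x \<in> N \<Longrightarrow> zcoord (c k) x = zcoord (c k) (point m (tcoord (c m) (H p b)) (zcoord (c m) x))"
    by (rule transition_near[OF m(1) k(1) bm k(2)]) (rule that)
  have p0: "H p 0 = p" using F'(5) F(2) by simp
  note ft = F'(7)[OF F(2)]
  obtain W2 where W2: "openin (subtopology X (S i)) W2" "p \<in> W2" "\<And>w r. w \<in> W2 \<Longrightarrow> r \<in> {a..b} \<Longrightarrow> H w r \<in> U m"
    using family_tube[OF ft transv_subset[OF i] chart_open[OF m(1)] ab(1,3) m(2)] p0 by metis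
  have "0 \<le> b" using ab by simp
  moreover have "\<And>r. r \<in> {b..b} \<Longrightarrow> H p r \<in> N" using N(2) by simp
  ultimately obtain W3 where W3: "openin (subtopology X (S i)) W3" "p \<in> W3" "\<And>w r. w \<in> W3 \<Longrightarrow> r \<in> {b..b} \<Longrightarrow> H w r \<in> N"
    using family_tube[OF ft transv_subset[OF i] N(1) _ ab(3)] p0 by metis
  let ?W = "W1 \<inter> W2 \<inter> W3" and ?\<tau> = "tcoord (c m) (H p b)"
  have Wo: "openin (subtopology X (S i)) ?W" using W1(1) W2(1) W3(1) by auto
  have \<tau>: "?\<tau> \<in> Tball m" by (rule in_Tball[OF m(1) bm])
  have zb: "zcoord (c m) (H w b) = \<Theta> (zcoord (c i) w)" if w: "w \<in> ?W" for w
  proof -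
    have "pathin L (H w)" using F'(4) W1(3) w by auto
    then have "continuous_map (top_of_set {a..b}) L (H w)"
      using continuous_map_from_subtopology[of unit_interval L "H w" "{a..b}"] ab
      by (simp add: pathin_def subtopology_subtopology min_absorb2 max_absorb2)
    then have "zcoord (c m) (H w b) = zcoord (c m) (H w a)"
      by (rule transverse_coord_constant[OF _ m(1)]) (use W2(3) w ab in auto)
    then show ?thesis using W1(4) w by simp
  qed
  have Nw: "H w b \<in> N" if "w \<in> ?W" for w using W3(3)[of w b] that by simp
  have "holomorphic_in n (zcoord (c i) ` ?W) (\<lambda>\<zeta>. zcoord (c k) (point m ?\<tau> (\<Theta> \<zeta>)) l)" if l: "l < n" for l
  proof (rule holomorphic_in_compose[OF transversal_image_open[OF i Wo] transition_holomorphic[OF m(1) k(1) \<tau> l]])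
    show "holomorphic_in n (zcoord (c i) ` ?W) (\<lambda>z. \<Theta> z l')" if "l' < n" for l'
      by (rule holomorphic_in_cong[OF transversal_image_open[OF i Wo] transversal_image_open[OF i W1(1)] _ W1(5)[OF that]]) auto
    fix \<zeta> assume "\<zeta> \<in> zcoord (c i) ` ?W"
    then obtain w where w: "w \<in> ?W" "\<zeta> = zcoord (c i) w" by auto
    show "\<Theta> \<zeta> \<in> {\<zeta> \<in> Zdisc m. point m ?\<tau> \<zeta> \<in> U k}"
      using zb[OF w(1)] N(3) N(5)[OF Nw[OF w(1)]] Nw[OF w(1)] in_Zdisc[OF m(1), of "H w b"] w(2) by auto
  qed
  moreover have "H w b \<in> U k" "zcoord (c k) (H w b) = zcoord (c k) (point m ?\<tau> (\<Theta> (zcoord (c i) w)))" if w: "w \<in> ?W" for w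
    using N(4) N(6)[OF Nw[OF w]] zb[OF w] Nw[OF w] by auto
  ultimately show ?thesis
    unfolding holomorphic_at_time_def using Wo W1(2,3) W2(2) W3(2)
    by (intro exI[of _ ?W] exI[of _ "\<lambda>\<zeta>. zcoord (c k) (point m ?\<tau> (\<Theta> \<zeta>))"]) auto
qed

text \<open>
  While the paths of a family run in one chart, their transverse coordinates are constant; a change
  of charts applies a holomorphic transition to them.
\<close>

theorem holonomy_holomorphic:
  assumes i: "i \<in> I" and j: "j \<in> I" and F: "fam i j W H" "p \<in> W"
  obtains W' \<Theta> where "openin (subtopology X (S i)) W'" "p \<in> W'" "W' \<subseteq> W"
    "\<And>w. w \<in> W' \<Longrightarrow> zcoord (c j) (H w 1) = \<Theta> (zcoord (c i) w)"
    "\<And>l. l < n \<Longrightarrow> holomorphic_in n (zcoord (c i) ` W') (\<lambda>\<zeta>. \<Theta> \<zeta> l)"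
proof -
  note F' = famD[OF F(1) i]
  let ?Q = "\<lambda>r. \<forall>k\<in>I. H p r \<in> U k \<longrightarrow> holomorphic_at_time i W H p r k"
  have "(0::real) \<le> 0 \<longrightarrow> (1::real) \<le> 1 \<longrightarrow> ?Q 0 \<longrightarrow> ?Q 1"
  proof (rule Bolzano[where P="\<lambda>a b. 0 \<le> a \<longrightarrow> b \<le> 1 \<longrightarrow> ?Q a \<longrightarrow> ?Q b"])
    fix x :: real assume "0 \<le> x" "x \<le> 1"
    then have "x \<in> {0..1}" by simp
    then obtain m e where e: "m \<in> I" "e > 0" "\<And>r. r \<in> {0..1} \<Longrightarrow> \<bar>r - x\<bar> < e \<Longrightarrow> H p r \<in> U m"
      using path_stays_in_chart[OF F'(4)[OF F(2)]] by metis
    show "\<exists>d>0. \<forall>a b. a \<le> x \<and> x \<le> b \<and> b - a < d \<longrightarrow> 0 \<le> a \<longrightarrow> b \<le> 1 \<longrightarrow> ?Q a \<longrightarrow> ?Q b"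
    proof (intro exI[of _ e] conjI allI impI ballI)
      fix a b k assume ab: "a \<le> x \<and> x \<le> b \<and> b - a < e" "0 \<le> a" "b \<le> 1" and Q: "?Q a" and k: "k \<in> I" "H p b \<in> U k"
      have inU: "H p r \<in> U m" if "r \<in> {a..b}" for r using e(3)[of r] ab that by auto
      then have "holomorphic_at_time i W H p a m" using Q e(1) ab by auto
      then show "holomorphic_at_time i W H p b k"
        using holomorphic_at_time_step[OF i F ab(2) _ ab(3) e(1) inU _ k] ab(1) by auto
    qed (rule e(2))
  qed auto
  moreover have "?Q 0" using holomorphic_at_time_0[OF i F] F'(5)[OF F(2)] by simp
  ultimately have "holomorphic_at_time i W H p 1 j" using F'(6)[OF F(2)] j by (auto simp: transv_def)
  then show ?thesis unfolding holomorphic_at_time_def using that by blast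
qed

section \<open>Homotopy classes and holonomy classes\<close>

abbreviation mon :: "'i \<Rightarrow> 'i \<Rightarrow> (real \<Rightarrow> 'x) \<Rightarrow> (real \<Rightarrow> 'x) set" where
  "mon i j \<equiv> mon_class L"
abbreviation hol :: "'i \<Rightarrow> 'i \<Rightarrow> (real \<Rightarrow> 'x) \<Rightarrow> (real \<Rightarrow> 'x) set" where
  "hol i j \<equiv> hol_class X L (transversal (c i)) (transversal (c j))"
abbreviation germ_of :: "'i \<Rightarrow> 'i \<Rightarrow> (real \<Rightarrow> 'x) \<Rightarrow> ('x \<Rightarrow> 'x) set" where
  "germ_of i j \<equiv> hol_germ X L (transversal (c i)) (transversal (c j))"

definition path_between :: "'i \<Rightarrow> 'i \<Rightarrow> (real \<Rightarrow> 'x) \<Rightarrow> bool" where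
  "path_between i j \<gamma> \<longleftrightarrow> pathin L \<gamma> \<and> \<gamma> 0 \<in> S i \<and> \<gamma> 1 \<in> S j"

lemma family_exists:
  assumes "i \<in> I" "j \<in> I" "path_between i j \<gamma>"
  obtains W H where "fam i j W H" "\<gamma> 0 \<in> W" "\<And>r. r \<in> {0..1} \<Longrightarrow> H (\<gamma> 0) r = \<gamma> r"
  using leafwise_family_exists[of \<gamma> "S i" j] assms transv_subset[of i] unfolding path_between_def by metis

lemma families_homotopic_near:
  assumes "i \<in> I" "j \<in> I" "fam i j W H" "fam i j W' H'" "p \<in> W" "p \<in> W'" "path_homotopic L (H p) (H' p)"
  obtains W0 where "openin (subtopology X (S i)) W0" "p \<in> W0" "W0 \<subseteq> W \<inter> W'"
    "\<And>w. w \<in> W0 \<Longrightarrow> path_homotopic L (H w) (H' w)" "\<And>w. w \<in> W0 \<Longrightarrow> H w 1 = H' w 1"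
proof (rule leafwise_families_homotopic_near[OF assms(3,4) transv_subset[OF assms(1)] assms(2,5-7)])
  fix W0 assume "openin (subtopology X (S i)) W0" "p \<in> W0" "W0 \<subseteq> W \<inter> W'" "\<And>w. w \<in> W0 \<Longrightarrow> path_homotopic L (H w) (H' w)"
  then show ?thesis using that[of W0] path_homotopic_ends(2) by metis
qed

text \<open>
  Two families through the same path are compared via the constant homotopy, so each of them
  determines the holonomy germ.
\<close>

lemma mem_germ_of:
  assumes i: "i \<in> I" and j: "j \<in> I" and F: "fam i j W H" and p: "p \<in> W" and \<gamma>: "\<And>r. r \<in> {0..1} \<Longrightarrow> \<gamma> r = H p r"
  shows "h \<in> germ_of i j \<gamma> \<longleftrightarrow>
    (\<exists>W0. openin (subtopology X (S i)) W0 \<and> p \<in> W0 \<and> W0 \<subseteq> W \<and> (\<forall>w\<in>W0. h w = H w 1))"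
proof
  note F' = famD[OF F i]
  have \<gamma>0: "\<gamma> 0 = p" using \<gamma>[of 0] F'(5)[OF p] by simp
  assume "h \<in> germ_of i j \<gamma>"
  then obtain W' H' where H': "fam i j W' H'" "p \<in> W'" "\<forall>r\<in>{0..1}. H' p r = \<gamma> r" "\<forall>w\<in>W'. h w = H' w 1"
    by (auto simp: hol_germ_def transv_eq \<gamma>0)
  have "path_homotopic L (H p) (H' p)"
    by (rule path_homotopic_cong[OF F'(4)[OF p]]) (use \<gamma> H'(3) in auto)
  then obtain W0 where W0: "openin (subtopology X (S i)) W0" "p \<in> W0" "W0 \<subseteq> W \<inter> W'" "\<And>w. w \<in> W0 \<Longrightarrow> H w 1 = H' w 1"
    using families_homotopic_near[OF i j F H'(1) p H'(2)] by metis
  then show "\<exists>W0. openin (subtopology X (S i)) W0 \<and> p \<in> W0 \<and> W0 \<subseteq> W \<and> (\<forall>w\<in>W0. h w = H w 1)"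
    using H'(4) by (intro exI[of _ W0]) auto
next
  assume "\<exists>W0. openin (subtopology X (S i)) W0 \<and> p \<in> W0 \<and> W0 \<subseteq> W \<and> (\<forall>w\<in>W0. h w = H w 1)"
  then obtain W0 where W0: "openin (subtopology X (S i)) W0" "p \<in> W0" "W0 \<subseteq> W" "\<forall>w\<in>W0. h w = H w 1" by blast
  have \<gamma>0: "\<gamma> 0 = p" using \<gamma>[of 0] famD(5)[OF F i p] by simp
  show "h \<in> germ_of i j \<gamma>"
    unfolding hol_germ_def transv_eq[symmetric]
    using leafwise_family_restrict[OF F W0(1,3)] W0(2,4) \<gamma> \<gamma>0 by auto
qed

lemma hol_class_eq_iff:
  assumes "pathin L \<gamma>"
  shows "hol i j \<gamma> = hol i j \<delta> \<longleftrightarrow> \<gamma> 0 = \<delta> 0 \<and> \<gamma> 1 = \<delta> 1 \<and> germ_of i j \<gamma> = germ_of i j \<delta>"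
proof
  assume "hol i j \<gamma> = hol i j \<delta>"
  moreover have "\<gamma> \<in> hol i j \<gamma>" using assms by (simp add: hol_class_def)
  ultimately have "\<gamma> \<in> hol i j \<delta>" by simp
  then show "\<gamma> 0 = \<delta> 0 \<and> \<gamma> 1 = \<delta> 1 \<and> germ_of i j \<gamma> = germ_of i j \<delta>" by (simp add: hol_class_def)
qed (simp add: hol_class_def)

lemma germ_of_eqI:
  assumes i: "i \<in> I" and j: "j \<in> I" and F: "fam i j W H" "fam i j W' H'" and p: "p \<in> W" "p \<in> W'"
    and \<gamma>: "\<And>r. r \<in> {0..1} \<Longrightarrow> \<gamma> r = H p r" "\<And>r. r \<in> {0..1} \<Longrightarrow> \<delta> r = H' p r"
    and N: "openin (subtopology X (S i)) N" "p \<in> N" "\<And>w. w \<in> N \<Longrightarrow> w \<in> W \<Longrightarrow> w \<in> W' \<Longrightarrow> H w 1 = H' w 1"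
  shows "germ_of i j \<gamma> = germ_of i j \<delta>"
proof -
  have W: "openin (subtopology X (S i)) W" "openin (subtopology X (S i)) W'" using famD(1)[OF F(1) i] famD(1)[OF F(2) i] by auto
  have "h \<in> germ_of i j \<gamma> \<longleftrightarrow> h \<in> germ_of i j \<delta>" for h
    unfolding mem_germ_of[OF i j F(1) p(1) \<gamma>(1), simplified] mem_germ_of[OF i j F(2) p(2) \<gamma>(2), simplified]
  proof
    assume "\<exists>W0. openin (subtopology X (S i)) W0 \<and> p \<in> W0 \<and> W0 \<subseteq> W \<and> (\<forall>w\<in>W0. h w = H w 1)"
    then obtain W0 where "openin (subtopology X (S i)) W0" "p \<in> W0" "W0 \<subseteq> W" "\<forall>w\<in>W0. h w = H w 1" by blast
    then show "\<exists>W0. openin (subtopology X (S i)) W0 \<and> p \<in> W0 \<and> W0 \<subseteq> W' \<and> (\<forall>w\<in>W0. h w = H' w 1)"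
      using N W p by (intro exI[of _ "W0 \<inter> N \<inter> W'"]) auto
  next
    assume "\<exists>W0. openin (subtopology X (S i)) W0 \<and> p \<in> W0 \<and> W0 \<subseteq> W' \<and> (\<forall>w\<in>W0. h w = H' w 1)"
    then obtain W0 where "openin (subtopology X (S i)) W0" "p \<in> W0" "W0 \<subseteq> W'" "\<forall>w\<in>W0. h w = H' w 1" by blast
    then show "\<exists>W0. openin (subtopology X (S i)) W0 \<and> p \<in> W0 \<and> W0 \<subseteq> W \<and> (\<forall>w\<in>W0. h w = H w 1)"
      using N W p by (intro exI[of _ "W0 \<inter> N \<inter> W"]) auto
  qed
  then show ?thesis by blast
qed

lemma germ_of_eqD:
  assumes i: "i \<in> I" and j: "j \<in> I" and F: "fam i j W H" "fam i j W' H'" and p: "p \<in> W" "p \<in> W'"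
    and \<gamma>: "\<And>r. r \<in> {0..1} \<Longrightarrow> \<gamma> r = H p r" "\<And>r. r \<in> {0..1} \<Longrightarrow> \<delta> r = H' p r"
    and eq: "germ_of i j \<gamma> = germ_of i j \<delta>"
  obtains W0 where "openin (subtopology X (S i)) W0" "p \<in> W0" "W0 \<subseteq> W \<inter> W'" "\<And>w. w \<in> W0 \<Longrightarrow> H w 1 = H' w 1"
proof -
  have "(\<lambda>w. H w 1) \<in> germ_of i j \<gamma>"
    unfolding mem_germ_of[OF i j F(1) p(1) \<gamma>(1), simplified] using famD(1)[OF F(1) i] p(1) by blast
  then have "(\<lambda>w. H w 1) \<in> germ_of i j \<delta>" using eq by simp
  then obtain W0 where "openin (subtopology X (S i)) W0" "p \<in> W0" "W0 \<subseteq> W'" "\<forall>w\<in>W0. H w 1 = H' w 1"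
    unfolding mem_germ_of[OF i j F(2) p(2) \<gamma>(2), simplified] by blast
  then show ?thesis using that[of "W0 \<inter> W"] famD(1)[OF F(1) i] p(1) by auto
qed

text \<open>
  The families through homotopic paths consist of homotopic paths near the common starting point,
  so their end point maps agree there.
\<close>

lemma homotopic_imp_germ_eq:
  assumes i: "i \<in> I" and j: "j \<in> I" and \<gamma>: "path_between i j \<gamma>" and hom: "path_homotopic L \<gamma> \<delta>"
  shows "germ_of i j \<gamma> = germ_of i j \<delta>"
proof -
  have \<delta>: "path_between i j \<delta>" "\<delta> 0 = \<gamma> 0"
    using \<gamma> path_homotopic_pathin(2)[OF hom] path_homotopic_ends[OF hom] by (auto simp: path_between_def)
  obtain W H where H: "fam i j W H" "\<gamma> 0 \<in> W" "\<And>r. r \<in> {0..1} \<Longrightarrow> H (\<gamma> 0) r = \<gamma> r" using family_exists[OF i j \<gamma>] by metis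
  obtain W' H' where H': "fam i j W' H'" "\<gamma> 0 \<in> W'" "\<And>r. r \<in> {0..1} \<Longrightarrow> H' (\<gamma> 0) r = \<delta> r"
    using family_exists[OF i j \<delta>(1)] \<delta>(2) by metis
  have "path_homotopic L (H (\<gamma> 0)) \<gamma>" "path_homotopic L \<delta> (H' (\<gamma> 0))"
    using path_homotopic_cong[OF famD(4)[OF H(1) i H(2)] H(3)] path_homotopic_cong[of L \<delta> "H' (\<gamma> 0)"] H'(3) \<delta>(1)
    by (auto simp: path_between_def)
  then have "path_homotopic L (H (\<gamma> 0)) (H' (\<gamma> 0))" using hom path_homotopic_trans by blast
  then obtain W0 where "openin (subtopology X (S i)) W0" "\<gamma> 0 \<in> W0" "\<And>w. w \<in> W0 \<Longrightarrow> H w 1 = H' w 1"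
    using families_homotopic_near[OF i j H(1) H'(1) H(2) H'(2)] by metis
  then show ?thesis by (intro germ_of_eqI[OF i j H(1) H'(1) H(2) H'(2)]) (use H(3) H'(3) in auto)
qed

lemma germ_of_join:
  assumes i: "i \<in> I" and j: "j \<in> I" and k: "k \<in> I"
    and \<gamma>: "path_between i j \<gamma>" "path_between i j \<gamma>'" "\<gamma> 0 = \<gamma>' 0" "\<gamma> 1 = \<gamma>' 1" "germ_of i j \<gamma> = germ_of i j \<gamma>'"
    and \<delta>: "path_between j k \<delta>" "path_between j k \<delta>'" "\<delta> 0 = \<delta>' 0" "germ_of j k \<delta> = germ_of j k \<delta>'" and j01: "\<gamma> 1 = \<delta> 0"
  shows "germ_of i k (path_join \<gamma> \<delta>) = germ_of i k (path_join \<gamma>' \<delta>')"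
proof -
  obtain W H where H: "fam i j W H" "\<gamma> 0 \<in> W" "\<And>r. r \<in> {0..1} \<Longrightarrow> \<gamma> r = H (\<gamma> 0) r" using family_exists[OF i j \<gamma>(1)] by metis
  obtain W' H' where H': "fam i j W' H'" "\<gamma> 0 \<in> W'" "\<And>r. r \<in> {0..1} \<Longrightarrow> \<gamma>' r = H' (\<gamma> 0) r"
    using family_exists[OF i j \<gamma>(2)] \<gamma>(3) by metis
  obtain Y K where K: "fam j k Y K" "\<delta> 0 \<in> Y" "\<And>r. r \<in> {0..1} \<Longrightarrow> \<delta> r = K (\<delta> 0) r" using family_exists[OF j k \<delta>(1)] by metis
  obtain Y' K' where K': "fam j k Y' K'" "\<delta> 0 \<in> Y'" "\<And>r. r \<in> {0..1} \<Longrightarrow> \<delta>' r = K' (\<delta> 0) r"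
    using family_exists[OF j k \<delta>(2)] \<delta>(3) by metis
  obtain A where A: "openin (subtopology X (S i)) A" "\<gamma> 0 \<in> A" "A \<subseteq> W \<inter> W'" "\<And>w. w \<in> A \<Longrightarrow> H w 1 = H' w 1"
    using germ_of_eqD[OF i j H(1) H'(1) H(2) H'(2) H(3) H'(3) \<gamma>(5)] by metis
  obtain B where B: "openin (subtopology X (S j)) B" "\<delta> 0 \<in> B" "B \<subseteq> Y \<inter> Y'" "\<And>w. w \<in> B \<Longrightarrow> K w 1 = K' w 1"
    using germ_of_eqD[OF j k K(1) K'(1) K(2) K'(2) K(3) K'(3) \<delta>(4)] by metis
  have KB: "fam j k B K" "fam j k B K'"
    using leafwise_family_restrict[OF K(1) B(1)] leafwise_family_restrict[OF K'(1) B(1)] B(3) by auto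
  note J = leafwise_family_join[OF H(1) KB(1) transv_subset[OF i]] and J' = leafwise_family_join[OF H'(1) KB(2) transv_subset[OF i]]
  have e: "H (\<gamma> 0) 1 = \<delta> 0" "H' (\<gamma> 0) 1 = \<delta> 0" using H(3)[of 1] H'(3)[of 1] j01 \<gamma>(4) by auto
  show ?thesis
  proof (rule germ_of_eqI[OF i k J J' _ _ _ _ A(1,2)])
    show "\<gamma> 0 \<in> {w \<in> W. H w 1 \<in> B}" "\<gamma> 0 \<in> {w \<in> W'. H' w 1 \<in> B}" using H(2) H'(2) e B(2) by auto
    show "path_join \<gamma> \<delta> r = path_join (H (\<gamma> 0)) (K (H (\<gamma> 0) 1)) r" if "r \<in> {0..1}" for r
      unfolding path_join_def e using that H(3)[of "2 * r"] K(3)[of "2 * r - 1"] by auto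
    show "path_join \<gamma>' \<delta>' r = path_join (H' (\<gamma> 0)) (K' (H' (\<gamma> 0) 1)) r" if "r \<in> {0..1}" for r
      unfolding path_join_def e using that H'(3)[of "2 * r"] K'(3)[of "2 * r - 1"] by auto
  qed (use A(4) B(4) in auto)
qed

text \<open>
  If \<open>\<gamma>\<close> and \<open>\<delta>\<close> have the same holonomy, then moving out along a family for \<open>\<gamma>\<close> and back along one for \<open>\<delta>\<close>
  is a family of loops, so the loop made from \<open>\<gamma>\<close> and the reverse of \<open>\<delta>\<close> has trivial holonomy.
\<close>

lemma leafwise_family_loops:
  assumes H: "fam i j W H" "fam i j W H'" and i: "i \<in> I" and e: "\<And>w. w \<in> W \<Longrightarrow> H w 1 = H' w 1"
  shows "fam i i W (\<lambda>w. path_join (H w) (\<lambda>r. H' w (1 - r)))"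
proof -
  note F = famD[OF H(1) i] and F' = famD[OF H(2) i]
  have tW: "topspace (subtopology X W) = W" using F(3) by auto
  have "continuous_map (prod_topology (subtopology X W) unit_interval) X ((\<lambda>(w, r). H' w r) \<circ> (\<lambda>(w, r). (w, 1 - r)))"
    by (rule continuous_map_compose[OF continuous_map_reparam_snd]) (use H(2) in \<open>auto simp: leafwise_family_def intro!: continuous_intros\<close>)
  then have c: "continuous_map (prod_topology (subtopology X W) unit_interval) X (\<lambda>(w, r). H' w (1 - r))"
    by (simp add: o_def case_prod_unfold)
  have "continuous_map (prod_topology (subtopology X W) unit_interval) X (\<lambda>(w, r). path_join (H w) (\<lambda>r. H' w (1 - r)) r)"
    by (rule continuous_map_path_join[OF _ c]) (use H(1) e tW in \<open>auto simp: leafwise_family_def\<close>)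
  moreover have "pathin L (path_join (H w) (\<lambda>r. H' w (1 - r)))" if "w \<in> W" for w
    using F(4)[OF that] F'(4)[OF that] e[OF that] by (intro pathin_path_join pathin_reverse) auto
  ultimately show ?thesis using F F' by (auto simp: leafwise_family_def)
qed

lemma constant_family: "i \<in> I \<Longrightarrow> fam i i (S i) (\<lambda>w r. w)"
proof -
  assume i: "i \<in> I"
  have SX: "S i \<subseteq> topspace X" by (rule transv_subset[OF i])
  have "continuous_map (prod_topology (subtopology X (S i)) unit_interval) X fst"
    using continuous_map_fst[of "subtopology X (S i)" unit_interval] unfolding continuous_map_in_subtopology by blast
  then have "continuous_map (prod_topology (subtopology X (S i)) unit_interval) X (\<lambda>(w, r). w)" by (simp add: case_prod_unfold)
  then show ?thesis
    using SX leaf_topspace openin_topspace[of "subtopology X (S i)"] by (auto simp: leafwise_family_def inf_absorb2 pathin_def)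
qed

lemma germ_of_loop:
  assumes i: "i \<in> I" and j: "j \<in> I" and \<gamma>: "path_between i j \<gamma>" "path_between i j \<delta>" "\<gamma> 0 = \<delta> 0" "\<gamma> 1 = \<delta> 1"
    and eq: "germ_of i j \<gamma> = germ_of i j \<delta>"
  shows "germ_of i i (path_join \<gamma> (\<lambda>r. \<delta> (1 - r))) = germ_of i i (\<lambda>_. \<gamma> 0)"
proof -
  obtain W H where H: "fam i j W H" "\<gamma> 0 \<in> W" "\<And>r. r \<in> {0..1} \<Longrightarrow> \<gamma> r = H (\<gamma> 0) r" using family_exists[OF i j \<gamma>(1)] by metis
  obtain W' H' where H': "fam i j W' H'" "\<gamma> 0 \<in> W'" "\<And>r. r \<in> {0..1} \<Longrightarrow> \<delta> r = H' (\<gamma> 0) r"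
    using family_exists[OF i j \<gamma>(2)] \<gamma>(3) by metis
  obtain A where A: "openin (subtopology X (S i)) A" "\<gamma> 0 \<in> A" "A \<subseteq> W \<inter> W'" "\<And>w. w \<in> A \<Longrightarrow> H w 1 = H' w 1"
    using germ_of_eqD[OF i j H(1) H'(1) H(2) H'(2) H(3) H'(3) eq] by metis
  have FA: "fam i j A H" "fam i j A H'"
    using leafwise_family_restrict[OF H(1) A(1)] leafwise_family_restrict[OF H'(1) A(1)] A(3) by auto
  have \<gamma>0: "\<gamma> 0 \<in> S i" using \<gamma>(1) by (simp add: path_between_def)
  show ?thesis
  proof (rule germ_of_eqI[OF i i leafwise_family_loops[OF FA i A(4)] constant_family[OF i] A(2) \<gamma>0 _ _ A(1,2)])
    show "path_join \<gamma> (\<lambda>r. \<delta> (1 - r)) r = path_join (H (\<gamma> 0)) (\<lambda>r. H' (\<gamma> 0) (1 - r)) r" if "r \<in> {0..1}" for r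
      unfolding path_join_def using that H(3)[of "2 * r"] H'(3)[of "1 - (2 * r - 1)"] by auto
  qed (use famD(5)[OF FA(2) i] in auto)
qed

end

section \<open>The topology and complex structure of the arrow spaces\<close>

lemma holomorphic_in_empty: "holomorphic_in n {} f"
  by (simp add: holomorphic_in_def)

lemma holomorphic_in_cong_iff:
  assumes "openin (top_of_set (coord_space n)) B" "\<And>z. z \<in> B \<Longrightarrow> g z = f z"
  shows "holomorphic_in n B g \<longleftrightarrow> holomorphic_in n B f"
  using holomorphic_in_cong[OF assms(1,1) order_refl, of g f] holomorphic_in_cong[OF assms(1,1) order_refl, of f g] assms(2)
  by metis

lemma comp_germ_germ:
  assumes "continuous_map (ctop N) (ctop C) q" "y \<in> topspace (ctop N)"
  shows "comp_germ N q y (germ C (q y) f) = germ N y (\<lambda>u. f (q u))"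
proof -
  have "q y \<in> topspace (ctop C)" using assms by (auto simp: continuous_map_def)
  then have "f \<in> germ C (q y) f" by (simp add: mem_germ agree_near_refl)
  show ?thesis
  proof (intro subset_antisym subsetI)
    fix k assume "k \<in> comp_germ N q y (germ C (q y) f)"
    then obtain g where "agree_near (ctop C) (q y) f g" "agree_near (ctop N) y (\<lambda>u. g (q u)) k"
      by (auto simp: mem_comp_germ mem_germ)
    then show "k \<in> germ N y (\<lambda>u. f (q u))"
      using agree_near_compose[OF assms] agree_near_trans unfolding mem_germ by metis
  next
    fix k assume "k \<in> germ N y (\<lambda>u. f (q u))"
    then show "k \<in> comp_germ N q y (germ C (q y) f)"
      using \<open>f \<in> germ C (q y) f\<close> unfolding mem_comp_germ mem_germ by (intro bexI[of _ f]) (simp_all add: mem_germ)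
  qed
qed

lemma germ_eqI:
  assumes "agree_near (ctop N) y f g" shows "germ N y f = germ N y g"
  using agree_near_trans[OF assms] agree_near_trans[OF agree_near_sym[OF assms]]
  by (intro subset_antisym subsetI) (simp_all add: mem_germ)

lemma pulls_all_germsI:
  assumes c: "continuous_map (ctop N) (ctop C) \<Phi>"
    and ex: "\<And>y U f. y \<in> topspace (ctop N) \<Longrightarrow> y \<in> U \<Longrightarrow> holo_on N U f \<Longrightarrow>
      \<exists>k U'. \<Phi> y \<in> U' \<and> holo_on C U' k \<and> agree_near (ctop N) y f (\<lambda>u. k (\<Phi> u))"
  shows "pulls_all_germs N C \<Phi>"
  unfolding pulls_all_germs_def
proof (intro ballI conjI subsetI)
  fix y assume y: "y \<in> topspace (ctop N)"
  then show "\<Phi> y \<in> topspace (ctop C)" using c by (auto simp: continuous_map_def)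
  fix a assume "a \<in> carrier (O_stalk N y)"
  then obtain f U where f: "a = germ N y f" "y \<in> U" "holo_on N U f" by (auto simp: O_stalk_def)
  obtain k U' where k: "\<Phi> y \<in> U'" "holo_on C U' k" "agree_near (ctop N) y f (\<lambda>u. k (\<Phi> u))" using ex[OF y f(2,3)] by blast
  have "a = comp_germ N \<Phi> y (germ C (\<Phi> y) k)"
    using germ_eqI[OF k(3)] comp_germ_germ[OF c y, of k] f(1) by simp
  moreover have "germ C (\<Phi> y) k \<in> carrier (O_stalk C (\<Phi> y))" using k by (auto simp: O_stalk_def)
  ultimately show "a \<in> comp_germ N \<Phi> y ` carrier (O_stalk C (\<Phi> y))" by blast
qed

context adapted_charts
begin

abbreviation "T \<equiv> transverse_mfd X n I c"

lemma transverse_simps: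
  "ctop T = sum_topology (\<lambda>i. subtopology X (S i)) I" "cdim T = n"
  "catlas T = {({i} \<times> S i, \<lambda>p. zcoord (c i) (snd p)) | i. i \<in> I}"
  by (simp_all add: transverse_mfd_def transv_eq)

lemma Sigma_transv: "Sigma I (topspace \<circ> (\<lambda>i. subtopology X (S i))) = Sigma I S"
  by (rule Sigma_cong[OF refl]) (use transv_subset in auto)

lemma topspace_transverse: "topspace (ctop T) = Sigma I S"
  unfolding transverse_simps topspace_sum_topology by (rule Sigma_transv)

lemma openin_transverse:
  "openin (ctop T) O' \<longleftrightarrow> O' \<subseteq> Sigma I S \<and> (\<forall>i\<in>I. openin (subtopology X (S i)) {x. (i, x) \<in> O'})"
  unfolding transverse_simps openin_sum_topology Sigma_transv ..

lemma openin_transverse_slice: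
  assumes i: "i \<in> I" and W: "openin (subtopology X (S i)) W" shows "openin (ctop T) ({i} \<times> W)"
  unfolding openin_transverse
proof (intro conjI ballI)
  show "{i} \<times> W \<subseteq> Sigma I S" using openin_subset[OF W] i by auto
  fix j assume "j \<in> I"
  show "openin (subtopology X (S j)) {x. (j, x) \<in> {i} \<times> W}"
  proof (cases "j = i")
    case True
    then have eq: "{x. (j, x) \<in> {i} \<times> W} = W" by auto
    show ?thesis unfolding eq unfolding True by (rule W)
  next
    case False
    then have eq: "{x. (j, x) \<in> {i} \<times> W} = {}" by auto
    show ?thesis unfolding eq by (rule openin_empty)
  qed
qed

lemma zcoord_inj_transv: "i \<in> I \<Longrightarrow> inj_on (zcoord (c i)) (S i)"
  by (rule inj_on_inverseI[where g = "slice i"]) (rule slice)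

lemma holo_on_transverse:
  "holo_on T O' f \<longleftrightarrow> openin (ctop T) O' \<and>
     (\<forall>i\<in>I. holomorphic_in n (zcoord (c i) ` {w \<in> S i. (i, w) \<in> O'}) (\<lambda>\<zeta>. f (i, slice i \<zeta>)))"
proof (cases "openin (ctop T) O'")
  case True
  have *: "holomorphic_in n ((\<lambda>p. zcoord (c i) (snd p)) ` (O' \<inter> {i} \<times> S i))
      (\<lambda>z. f (the_inv_into ({i} \<times> S i) (\<lambda>p. zcoord (c i) (snd p)) z)) \<longleftrightarrow>
    holomorphic_in n (zcoord (c i) ` {w \<in> S i. (i, w) \<in> O'}) (\<lambda>\<zeta>. f (i, slice i \<zeta>))" if i: "i \<in> I" for i
  proof -
    let ?B = "zcoord (c i) ` {w \<in> S i. (i, w) \<in> O'}"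
    have "O' \<inter> {i} \<times> S i = Pair i ` {w \<in> S i. (i, w) \<in> O'}" by auto
    then have eq: "(\<lambda>p. zcoord (c i) (snd p)) ` (O' \<inter> {i} \<times> S i) = ?B" by (simp only: image_image snd_conv)
    have "openin (subtopology X (S i)) {w. (i, w) \<in> O'}" using True i unfolding openin_transverse by blast
    moreover have "{w. (i, w) \<in> O'} = {w \<in> S i. (i, w) \<in> O'}"
      using openin_subset[OF True] by (auto simp: topspace_transverse)
    ultimately have o: "openin (top_of_set (coord_space n)) ?B" using transversal_image_open[OF i] by simp
    have "the_inv_into ({i} \<times> S i) (\<lambda>p. zcoord (c i) (snd p)) \<zeta> = (i, slice i \<zeta>)" if \<zeta>: "\<zeta> \<in> ?B" for \<zeta>
    proof -
      obtain w where w: "w \<in> S i" "\<zeta> = zcoord (c i) w" using \<zeta> by auto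
      have "inj_on (\<lambda>p. zcoord (c i) (snd p)) ({i} \<times> S i)" using zcoord_inj_transv[OF i] by (auto simp: inj_on_def)
      from the_inv_into_f_f[OF this, of "(i, w)"] show ?thesis using w slice[OF i w(1)] by simp
    qed
    then show ?thesis unfolding eq by (intro holomorphic_in_cong_iff[OF o]) simp
  qed
  have "(\<forall>(W, \<psi>)\<in>catlas T. holomorphic_in n (\<psi> ` (O' \<inter> W)) (\<lambda>z. f (the_inv_into W \<psi> z))) \<longleftrightarrow>
      (\<forall>i\<in>I. holomorphic_in n ((\<lambda>p. zcoord (c i) (snd p)) ` (O' \<inter> {i} \<times> S i))
        (\<lambda>z. f (the_inv_into ({i} \<times> S i) (\<lambda>p. zcoord (c i) (snd p)) z)))"
    unfolding transverse_simps(3) Setcompr_eq_image ball_simps(9) Collect_mem_eq prod.case ..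
  also have "\<dots> \<longleftrightarrow> (\<forall>i\<in>I. holomorphic_in n (zcoord (c i) ` {w \<in> S i. (i, w) \<in> O'}) (\<lambda>\<zeta>. f (i, slice i \<zeta>)))"
    by (rule ball_cong[OF refl *])
  finally show ?thesis unfolding holo_on_def transverse_simps(2) by (rule conj_cong[OF refl])
qed (simp add: holo_on_def)

end

text \<open>
  Monodromy and holonomy classes are treated alike. The second assumption is what makes the arrow
  spaces etale over the transversals: equality of the classes along two families is an open condition.
\<close>

locale path_classes = adapted_charts M V d n I c
  for M :: "'x smooth_mfd" and V d n and I :: "'i set" and c +
  fixes cls :: "'i \<Rightarrow> 'i \<Rightarrow> (real \<Rightarrow> 'x) \<Rightarrow> (real \<Rightarrow> 'x) set"
  assumes cls_cong: "i \<in> I \<Longrightarrow> j \<in> I \<Longrightarrow> path_between i j \<gamma> \<Longrightarrow> (\<And>r. r \<in> {0..1} \<Longrightarrow> \<gamma> r = \<delta> r) \<Longrightarrow> cls i j \<gamma> = cls i j \<delta>"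
    and cls_stable: "i \<in> I \<Longrightarrow> j \<in> I \<Longrightarrow> fam i j W H \<Longrightarrow> fam i j W' H' \<Longrightarrow> p \<in> W \<Longrightarrow> p \<in> W' \<Longrightarrow>
      cls i j (H p) = cls i j (H' p) \<Longrightarrow> H p 1 = H' p 1 \<Longrightarrow>
      \<exists>W0. openin (subtopology X (S i)) W0 \<and> p \<in> W0 \<and> W0 \<subseteq> W \<inter> W' \<and>
        (\<forall>w\<in>W0. cls i j (H w) = cls i j (H' w) \<and> H w 1 = H' w 1)"
begin

abbreviation "A \<equiv> arrow_mfd X L n I c cls"

definition arr :: "'i \<Rightarrow> 'i \<Rightarrow> (real \<Rightarrow> 'x) \<Rightarrow> ('i, 'x) parrow" where
  "arr i j \<gamma> = ((i, \<gamma> 0), cls i j \<gamma>, (j, \<gamma> 1))"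

definition source :: "('i, 'x) parrow \<Rightarrow> 'i \<times> 'x" where "source = (\<lambda>(a, \<Gamma>, b). a)"
definition target :: "('i, 'x) parrow \<Rightarrow> 'i \<times> 'x" where "target = (\<lambda>(a, \<Gamma>, b). b)"

lemma arr_ends [simp]: "source (arr i j \<gamma>) = (i, \<gamma> 0)" "target (arr i j \<gamma>) = (j, \<gamma> 1)" "fst (arr i j \<gamma>) = (i, \<gamma> 0)"
  by (simp_all add: arr_def source_def target_def)

lemma mem_path_arrows: "g \<in> path_arrows L I c cls \<longleftrightarrow> (\<exists>i j \<gamma>. i \<in> I \<and> j \<in> I \<and> path_between i j \<gamma> \<and> g = arr i j \<gamma>)"
  by (auto simp: path_arrows_def path_between_def arr_def transv_eq)

lemma family_arrows_eq: "fam i j W H \<Longrightarrow> i \<in> I \<Longrightarrow> family_arrows cls i j W H = (\<lambda>w. arr i j (H w)) ` W"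
  unfolding family_arrows_def Setcompr_eq_image Collect_mem_eq by (rule image_cong[OF refl]) (simp add: arr_def famD(5))

lemma fam_path_between: "fam i j W H \<Longrightarrow> i \<in> I \<Longrightarrow> w \<in> W \<Longrightarrow> path_between i j (H w)"
  using famD(2,4-6)[of i j W H] by (auto simp: path_between_def)

lemma arrow_mfd_simps:
  "ctop A = topology_generated_by (insert (path_arrows L I c cls) {family_arrows cls i j W H | i j W H. i \<in> I \<and> j \<in> I \<and> fam i j W H})"
  "cdim A = n"
  "catlas A = {(family_arrows cls i j W H, \<lambda>g. zcoord (c i) (snd (fst g))) | i j W H. i \<in> I \<and> j \<in> I \<and> fam i j W H}"
  by (simp_all add: arrow_mfd_def transv_eq)

lemma family_arrows_open: "i \<in> I \<Longrightarrow> j \<in> I \<Longrightarrow> fam i j W H \<Longrightarrow> openin (ctop A) (family_arrows cls i j W H)"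
  unfolding arrow_mfd_simps by (rule topology_generated_by_Basis) blast

lemma topspace_arrows: "topspace (ctop A) = path_arrows L I c cls"
proof -
  have "family_arrows cls i j W H \<subseteq> path_arrows L I c cls" if "i \<in> I" "j \<in> I" "fam i j W H" for i j W H
    using that fam_path_between by (force simp: family_arrows_eq mem_path_arrows)
  then show ?thesis unfolding arrow_mfd_simps topology_generated_by_topspace by blast
qed

lemma arrow_cases:
  assumes "g \<in> topspace (ctop A)"
  obtains i j \<gamma> where "i \<in> I" "j \<in> I" "path_between i j \<gamma>" "g = arr i j \<gamma>"
  using assms by (auto simp: topspace_arrows mem_path_arrows)

lemma arrow_family:
  assumes "i \<in> I" "j \<in> I" "path_between i j \<gamma>"
  obtains W H where "fam i j W H" "\<gamma> 0 \<in> W" "arr i j (H (\<gamma> 0)) = arr i j \<gamma>"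
proof -
  obtain W H where H: "fam i j W H" "\<gamma> 0 \<in> W" "\<And>r. r \<in> {0..1} \<Longrightarrow> H (\<gamma> 0) r = \<gamma> r"
    using family_exists[OF assms] by metis
  have "cls i j (H (\<gamma> 0)) = cls i j \<gamma>" by (rule cls_cong[OF assms(1,2) fam_path_between[OF H(1) assms(1) H(2)] H(3)])
  then show ?thesis using that[OF H(1,2)] H(3)[of 0] H(3)[of 1] by (simp add: arr_def)
qed

lemma arr_stable:
  assumes i: "i \<in> I" and j: "j \<in> I" and H: "fam i j W H" "p \<in> W"
    and i': "i' \<in> I" and j': "j' \<in> I" and H': "fam i' j' W' H'" "p' \<in> W'"
    and eq: "arr i j (H p) = arr i' j' (H' p')"
  shows "\<exists>W0. openin (subtopology X (S i)) W0 \<and> p \<in> W0 \<and> W0 \<subseteq> W \<inter> W' \<and>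
    (\<forall>w\<in>W0. arr i j (H w) = arr i' j' (H' w))"
proof -
  have ij: "i' = i" "j' = j" "H p 0 = H' p' 0" "cls i j (H p) = cls i j (H' p')" "H p 1 = H' p' 1"
    using eq by (auto simp: arr_def)
  have pp: "p' = p" using ij(3) famD(5)[OF H(1) i H(2)] famD(5)[OF H'(1) i' H'(2)] by simp
  obtain W0 where W0: "openin (subtopology X (S i)) W0" "p \<in> W0" "W0 \<subseteq> W \<inter> W'"
      "\<forall>w\<in>W0. cls i j (H w) = cls i j (H' w) \<and> H w 1 = H' w 1"
    using cls_stable[OF i j H(1) H'(1)[unfolded ij] H(2) H'(2)[unfolded pp] ij(4,5)[unfolded pp]] by blast
  have "arr i j (H w) = arr i' j' (H' w)" if w: "w \<in> W0" for w
  proof -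
    have "w \<in> W" "w \<in> W'" using W0(3) w by auto
    then show ?thesis
      using W0(4)[rule_format, OF w] famD(5)[OF H(1) i, of w] famD(5)[OF H'(1) i', of w] by (simp add: arr_def ij)
  qed
  then show ?thesis using W0(1-3) by blast
qed

text \<open>
  If two families define the same arrow at one point, they do so at all nearby points; therefore the
  arrows along families form a basis and not merely a subbase.
\<close>

lemma arrow_basis:
  assumes "openin (ctop A) O'" "g \<in> O'"
  obtains i j W H p where "i \<in> I" "j \<in> I" "fam i j W H" "p \<in> W" "g = arr i j (H p)" "\<And>w. w \<in> W \<Longrightarrow> arr i j (H w) \<in> O'"
proof -
  have "generate_topology_on (insert (path_arrows L I c cls) {family_arrows cls i j W H | i j W H. i \<in> I \<and> j \<in> I \<and> fam i j W H}) O'"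
    using assms(1) by (simp add: arrow_mfd_simps openin_topology_generated_by_iff)
  then have "\<exists>i j W H p. i \<in> I \<and> j \<in> I \<and> fam i j W H \<and> p \<in> W \<and> g = arr i j (H p) \<and> (\<forall>w\<in>W. arr i j (H w) \<in> O')"
    using assms(2)
  proof induction
    case Empty
    then show ?case by simp
  next
    case (Int P Q)
    then have g: "g \<in> P" "g \<in> Q" by auto
    obtain i j W H p where 1: "i \<in> I" "j \<in> I" "fam i j W H" "p \<in> W" "g = arr i j (H p)" "\<forall>w\<in>W. arr i j (H w) \<in> P"
      using Int.IH(1)[OF g(1)] by auto
    obtain i' j' W' H' p' where 2: "i' \<in> I" "j' \<in> I" "fam i' j' W' H'" "p' \<in> W'" "g = arr i' j' (H' p')" "\<forall>w\<in>W'. arr i' j' (H' w) \<in> Q"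
      using Int.IH(2)[OF g(2)] by auto
    have "arr i j (H p) = arr i' j' (H' p')" using 1(5) 2(5) by (rule trans[OF sym])
    then obtain W0 where W0: "openin (subtopology X (S i)) W0" "p \<in> W0" "W0 \<subseteq> W \<inter> W'"
        "\<And>w. w \<in> W0 \<Longrightarrow> arr i j (H w) = arr i' j' (H' w)"
      using arr_stable[OF 1(1-4) 2(1-4)] by blast
    have "arr i j (H w) \<in> P \<inter> Q" if w: "w \<in> W0" for w
    proof
      show "arr i j (H w) \<in> P" using 1(6) W0(3) w by blast
      show "arr i j (H w) \<in> Q" unfolding W0(4)[OF w] using 2(6) W0(3) w by blast
    qed
    moreover have "fam i j W0 H" using leafwise_family_restrict[OF 1(3) W0(1)] W0(3) by blast
    ultimately show ?case
      using 1(1,2,5) W0(2) by (intro exI[of _ i] exI[of _ j] exI[of _ W0] exI[of _ H] exI[of _ p]) auto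
  next
    case (UN \<K>)
    then obtain Q where Q: "Q \<in> \<K>" "g \<in> Q" by blast
    obtain i j W H p where "i \<in> I" "j \<in> I" "fam i j W H" "p \<in> W" "g = arr i j (H p)" "\<forall>w\<in>W. arr i j (H w) \<in> Q"
      using UN.IH[OF Q] by auto
    then show ?case using Q(1)
      by (intro exI[of _ i] exI[of _ j] exI[of _ W] exI[of _ H] exI[of _ p]) auto
  next
    case (Basis P)
    from Basis(1) consider "P = path_arrows L I c cls" | i j W H where "P = family_arrows cls i j W H" "i \<in> I" "j \<in> I" "fam i j W H"
      by blast
    then show ?case
    proof cases
      case 1
      then obtain i j \<gamma> where \<gamma>: "i \<in> I" "j \<in> I" "path_between i j \<gamma>" "g = arr i j \<gamma>"
        using Basis(2) by (auto simp: mem_path_arrows)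
      obtain W H where H: "fam i j W H" "\<gamma> 0 \<in> W" "arr i j (H (\<gamma> 0)) = arr i j \<gamma>" using arrow_family[OF \<gamma>(1-3)] .
      then have "\<forall>w\<in>W. arr i j (H w) \<in> P" using 1 \<gamma> fam_path_between[OF H(1)] by (auto simp: mem_path_arrows)
      then show ?thesis using \<gamma> H
        by (intro exI[of _ i] exI[of _ j] exI[of _ W] exI[of _ H] exI[of _ "\<gamma> 0"]) auto
    next
      case (2 i j W H)
      then obtain p where "p \<in> W" "g = arr i j (H p)" using Basis(2) by (auto simp: family_arrows_eq)
      then show ?thesis using 2
        by (intro exI[of _ i] exI[of _ j] exI[of _ W] exI[of _ H] exI[of _ p]) (auto simp: family_arrows_eq)
    qed
  qed
  then show ?thesis using that by blast
qed

lemma family_preimage_open: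
  assumes O: "openin (ctop A) O'" and i: "i \<in> I" and j: "j \<in> I" and H: "fam i j W H"
  shows "openin (subtopology X (S i)) {w \<in> W. arr i j (H w) \<in> O'}"
proof (subst openin_subopen, intro ballI)
  fix p assume p: "p \<in> {w \<in> W. arr i j (H w) \<in> O'}"
  then obtain i' j' W' H' p' where 2: "i' \<in> I" "j' \<in> I" "fam i' j' W' H'" "p' \<in> W'" "arr i j (H p) = arr i' j' (H' p')"
      "\<And>w. w \<in> W' \<Longrightarrow> arr i' j' (H' w) \<in> O'"
    using arrow_basis[OF O] by (metis (mono_tags, lifting) mem_Collect_eq)
  have pW: "p \<in> W" using p by blast
  obtain W0 where W0: "openin (subtopology X (S i)) W0" "p \<in> W0" "W0 \<subseteq> W \<inter> W'"
      "\<And>w. w \<in> W0 \<Longrightarrow> arr i j (H w) = arr i' j' (H' w)"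
    using arr_stable[OF i j H pW 2(1-5)] by blast
  have "arr i j (H w) \<in> O'" if w: "w \<in> W0" for w
    unfolding W0(4)[OF w] using 2(6) W0(3) w by blast
  then show "\<exists>B. openin (subtopology X (S i)) B \<and> p \<in> B \<and> B \<subseteq> {w \<in> W. arr i j (H w) \<in> O'}"
    using W0 by (intro exI[of _ W0]) auto
qed

text \<open>
  A family parametrises its arrows by points of the transversal, which makes the inverse of the
  coordinate on the arrow space explicit.
\<close>

lemma holo_on_arrows:
  "holo_on A O' f \<longleftrightarrow> openin (ctop A) O' \<and> (\<forall>i j W H. i \<in> I \<longrightarrow> j \<in> I \<longrightarrow> fam i j W H \<longrightarrow>
     holomorphic_in n (zcoord (c i) ` {w \<in> W. arr i j (H w) \<in> O'}) (\<lambda>\<zeta>. f (arr i j (H (slice i \<zeta>)))))"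
proof (cases "openin (ctop A) O'")
  case True
  have *: "holomorphic_in n ((\<lambda>g. zcoord (c i) (snd (fst g))) ` (O' \<inter> family_arrows cls i j W H))
      (\<lambda>z. f (the_inv_into (family_arrows cls i j W H) (\<lambda>g. zcoord (c i) (snd (fst g))) z)) \<longleftrightarrow>
    holomorphic_in n (zcoord (c i) ` {w \<in> W. arr i j (H w) \<in> O'}) (\<lambda>\<zeta>. f (arr i j (H (slice i \<zeta>))))"
    if i: "i \<in> I" and j: "j \<in> I" and H: "fam i j W H" for i j W H
  proof -
    let ?B = "zcoord (c i) ` {w \<in> W. arr i j (H w) \<in> O'}" and ?\<psi> = "\<lambda>g :: ('i, 'x) parrow. zcoord (c i) (snd (fst g))"
    note F = famD[OF H i]
    have \<psi>: "?\<psi> (arr i j (H w)) = zcoord (c i) w" if "w \<in> W" for w using F(5)[OF that] by simp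
    have "O' \<inter> family_arrows cls i j W H = (\<lambda>w. arr i j (H w)) ` {w \<in> W. arr i j (H w) \<in> O'}"
      unfolding family_arrows_eq[OF H i] by blast
    moreover have "?\<psi> ` ((\<lambda>w. arr i j (H w)) ` {w \<in> W. arr i j (H w) \<in> O'}) = ?B"
      unfolding image_image by (rule image_cong[OF refl]) (rule \<psi>, blast)
    ultimately have eq: "?\<psi> ` (O' \<inter> family_arrows cls i j W H) = ?B" by (rule ssubst)
    have o: "openin (top_of_set (coord_space n)) ?B" by (rule transversal_image_open[OF i family_preimage_open[OF True i j H]])
    have "the_inv_into (family_arrows cls i j W H) ?\<psi> \<zeta> = arr i j (H (slice i \<zeta>))" if \<zeta>: "\<zeta> \<in> ?B" for \<zeta>
    proof -
      obtain w where w: "w \<in> W" "\<zeta> = zcoord (c i) w" using \<zeta> by auto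
      have "inj_on (?\<psi> \<circ> (\<lambda>w. arr i j (H w))) W"
        using inj_on_subset[OF zcoord_inj_transv[OF i] F(2)] \<psi> unfolding inj_on_def o_def by metis
      then have "inj_on ?\<psi> (family_arrows cls i j W H)" unfolding family_arrows_eq[OF H i] by (rule inj_on_imageI)
      from the_inv_into_f_f[OF this, of "arr i j (H w)"] show ?thesis
        using w slice[OF i, of w] F(2) \<psi>[OF w(1)] by (auto simp: family_arrows_eq[OF H i])
    qed
    then show ?thesis unfolding eq by (intro holomorphic_in_cong_iff[OF o]) simp
  qed
  show ?thesis
  proof
    assume h: "holo_on A O' f"
    show "openin (ctop A) O' \<and> (\<forall>i j W H. i \<in> I \<longrightarrow> j \<in> I \<longrightarrow> fam i j W H \<longrightarrow>
      holomorphic_in n (zcoord (c i) ` {w \<in> W. arr i j (H w) \<in> O'}) (\<lambda>\<zeta>. f (arr i j (H (slice i \<zeta>)))))"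
    proof (intro conjI allI impI)
      fix i j W H assume iH: "i \<in> I" "j \<in> I" "fam i j W H"
      then have "(family_arrows cls i j W H, \<lambda>g. zcoord (c i) (snd (fst g))) \<in> catlas A" unfolding arrow_mfd_simps by blast
      then show "holomorphic_in n (zcoord (c i) ` {w \<in> W. arr i j (H w) \<in> O'}) (\<lambda>\<zeta>. f (arr i j (H (slice i \<zeta>))))"
        using h unfolding *[OF iH, symmetric] holo_on_def arrow_mfd_simps(2) by blast
    qed (rule True)
  next
    assume h: "openin (ctop A) O' \<and> (\<forall>i j W H. i \<in> I \<longrightarrow> j \<in> I \<longrightarrow> fam i j W H \<longrightarrow>
      holomorphic_in n (zcoord (c i) ` {w \<in> W. arr i j (H w) \<in> O'}) (\<lambda>\<zeta>. f (arr i j (H (slice i \<zeta>)))))"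
    show "holo_on A O' f"
      unfolding holo_on_def arrow_mfd_simps(2)
    proof (intro conjI ballI True)
      fix x assume "x \<in> catlas A"
      then obtain i j W H where x: "x = (family_arrows cls i j W H, \<lambda>g. zcoord (c i) (snd (fst g)))" and iH: "i \<in> I" "j \<in> I" "fam i j W H"
        unfolding arrow_mfd_simps by blast
      show "case x of (W, \<psi>) \<Rightarrow> holomorphic_in n (\<psi> ` (O' \<inter> W)) (\<lambda>z. f (the_inv_into W \<psi> z))"
        unfolding x prod.case *[OF iH] using h iH by blast
    qed
  qed
qed (simp add: holo_on_def)

lemma source_target_continuous:
  "continuous_map (ctop A) (ctop T) source" "continuous_map (ctop A) (ctop T) target"
proof -
  have *: "continuous_map (ctop A) (ctop T) s"
    if in_T: "\<And>g. g \<in> topspace (ctop A) \<Longrightarrow> s g \<in> topspace (ctop T)"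
      and s: "\<And>i j W H. i \<in> I \<Longrightarrow> j \<in> I \<Longrightarrow> fam i j W H \<Longrightarrow> \<exists>k\<in>I. \<exists>e. (\<forall>w\<in>W. s (arr i j (H w)) = (k, e w)) \<and> continuous_map (subtopology X W) X e"
    for s :: "('i, 'x) parrow \<Rightarrow> 'i \<times> 'x"
    unfolding continuous_map_def
  proof (intro conjI funcsetI allI impI in_T)
    fix B assume B: "openin (ctop T) B"
    show "openin (ctop A) {g \<in> topspace (ctop A). s g \<in> B}"
    proof (subst openin_subopen, intro ballI)
      fix g assume g: "g \<in> {g \<in> topspace (ctop A). s g \<in> B}"
      then have "g \<in> topspace (ctop A)" by simp
      then obtain i j W H p where 1: "i \<in> I" "j \<in> I" "fam i j W H" "p \<in> W" "g = arr i j (H p)"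
        using arrow_basis[OF openin_topspace] by metis
      note F = famD[OF 1(3,1)]
      obtain k e where e: "k \<in> I" "\<And>w. w \<in> W \<Longrightarrow> s (arr i j (H w)) = (k, e w)" "continuous_map (subtopology X W) X e"
        using s[OF 1(1-3)] by blast
      have "openin (subtopology X (S k)) {x. (k, x) \<in> B}" using B e(1) unfolding openin_transverse by blast
      then obtain N where N: "openin X N" "{x. (k, x) \<in> B} = N \<inter> S k" by (auto simp: openin_subtopology)
      have eS: "e w \<in> S k" if "w \<in> W" for w
      proof -
        have "arr i j (H w) \<in> topspace (ctop A)" using fam_path_between[OF 1(3,1) that] 1(1,2) by (auto simp: topspace_arrows mem_path_arrows)
        from in_T[OF this] show ?thesis by (simp add: e(2)[OF that] topspace_transverse)
      qed
      have "openin (subtopology X W) {w \<in> W. e w \<in> N}"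
        using openin_continuous_map_preimage[OF e(3) N(1)] F(3) by (simp add: inf_absorb2)
      then have W0: "openin (subtopology X (S i)) {w \<in> W. e w \<in> N}" by (rule openin_subtopology_trans[OF F(1)])
      have fW0: "fam i j {w \<in> W. e w \<in> N} H" by (rule leafwise_family_restrict[OF 1(3) W0]) auto
      have mem: "arr i j (H w) \<in> {g \<in> topspace (ctop A). s g \<in> B} \<longleftrightarrow> e w \<in> N" if "w \<in> W" for w
        using e(2)[OF that] eS[OF that] N(2) fam_path_between[OF 1(3,1) that] 1(1,2) by (auto simp: topspace_arrows mem_path_arrows)
      show "\<exists>C. openin (ctop A) C \<and> g \<in> C \<and> C \<subseteq> {g \<in> topspace (ctop A). s g \<in> B}"
      proof (intro exI conjI)
        show "openin (ctop A) (family_arrows cls i j {w \<in> W. e w \<in> N} H)" by (rule family_arrows_open[OF 1(1,2) fW0])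
        show "g \<in> family_arrows cls i j {w \<in> W. e w \<in> N} H"
          using mem[OF 1(4)] g 1(4,5) unfolding family_arrows_eq[OF fW0 1(1)] by blast
        show "family_arrows cls i j {w \<in> W. e w \<in> N} H \<subseteq> {g \<in> topspace (ctop A). s g \<in> B}"
          using mem unfolding family_arrows_eq[OF fW0 1(1)] by blast
      qed
    qed
  qed
  show "continuous_map (ctop A) (ctop T) source"
  proof (rule *)
    show "source g \<in> topspace (ctop T)" if "g \<in> topspace (ctop A)" for g
      using arrow_cases[OF that] by (metis arr_ends(1) path_between_def mem_Sigma_iff topspace_transverse)
    show "\<exists>k\<in>I. \<exists>e. (\<forall>w\<in>W. source (arr i j (H w)) = (k, e w)) \<and> continuous_map (subtopology X W) X e"
      if "i \<in> I" "j \<in> I" "fam i j W H" for i j W H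
      using that famD(5)[OF that(3,1)] by (intro bexI[of _ i] exI[of _ "\<lambda>w. w"]) (auto intro: continuous_map_from_subtopology)
  qed
  show "continuous_map (ctop A) (ctop T) target"
  proof (rule *)
    show "target g \<in> topspace (ctop T)" if "g \<in> topspace (ctop A)" for g
      using arrow_cases[OF that] by (metis arr_ends(2) path_between_def mem_Sigma_iff topspace_transverse)
    show "\<exists>k\<in>I. \<exists>e. (\<forall>w\<in>W. target (arr i j (H w)) = (k, e w)) \<and> continuous_map (subtopology X W) X e"
      if "i \<in> I" "j \<in> I" "fam i j W H" for i j W H
      using that leafwise_family_end_continuous[OF that(3)] by (intro bexI[of _ j] exI[of _ "\<lambda>w. H w 1"]) auto
  qed
qed

text \<open>
  In the coordinate given by a family the source map is the identity.
\<close>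

lemma source_pulls_all_germs: "pulls_all_germs A T source"
proof (rule pulls_all_germsI[OF source_target_continuous(1)])
  fix g O' f assume g: "g \<in> O'" and f: "holo_on A O' f"
  then have O: "openin (ctop A) O'" by (simp add: holo_on_def)
  obtain i j W H p where 1: "i \<in> I" "j \<in> I" "fam i j W H" "p \<in> W" "g = arr i j (H p)" "\<And>w. w \<in> W \<Longrightarrow> arr i j (H w) \<in> O'"
    using arrow_basis[OF O g] by metis
  note F = famD[OF 1(3,1)]
  define k where "k a = f (arr i j (H (snd a)))" for a :: "'i \<times> 'x"
  have hf: "holomorphic_in n (zcoord (c i) ` {w \<in> W. arr i j (H w) \<in> O'}) (\<lambda>\<zeta>. f (arr i j (H (slice i \<zeta>))))"
    using f 1(1-3) unfolding holo_on_arrows by blast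
  have W: "{w \<in> W. arr i j (H w) \<in> O'} = W" using 1(6) by auto
  have "holomorphic_in n (zcoord (c i') ` {w \<in> S i'. (i', w) \<in> {i} \<times> W}) (\<lambda>\<zeta>. k (i', slice i' \<zeta>))" for i'
  proof (cases "i' = i")
    case True
    then have e: "{w \<in> S i'. (i', w) \<in> {i} \<times> W} = W" using F(2) by auto
    show ?thesis unfolding e unfolding True k_def snd_conv using hf unfolding W .
  next
    case False
    then have e: "{w \<in> S i'. (i', w) \<in> {i} \<times> W} = {}" by auto
    show ?thesis unfolding e image_empty by (rule holomorphic_in_empty)
  qed
  then have "holo_on T ({i} \<times> W) k" unfolding holo_on_transverse using openin_transverse_slice[OF 1(1) F(1)] by blast
  moreover have "agree_near (ctop A) g f (\<lambda>u. k (source u))"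
    unfolding agree_near_def using family_arrows_open[OF 1(1-3)] 1(4,5) F(5)
    by (intro exI[of _ "family_arrows cls i j W H"]) (auto simp: family_arrows_eq[OF 1(3,1)] k_def)
  ultimately show "\<exists>k U'. source g \<in> U' \<and> holo_on T U' k \<and> agree_near (ctop A) g f (\<lambda>u. k (source u))"
    using 1(4,5) F(5)[OF 1(4)] by (intro exI[of _ k] exI[of _ "{i} \<times> W"]) auto
qed

text \<open>
  Near an arrow, the target map is inverted by the holonomy of the reversed path, which is holomorphic.
\<close>

lemma target_pulls_all_germs: "pulls_all_germs A T target"
proof (rule pulls_all_germsI[OF source_target_continuous(2)])
  fix g O' f assume g: "g \<in> O'" and f: "holo_on A O' f"
  then have O: "openin (ctop A) O'" by (simp add: holo_on_def)
  obtain i j W H p where 1: "i \<in> I" "j \<in> I" "fam i j W H" "p \<in> W" "g = arr i j (H p)" "\<And>w. w \<in> W \<Longrightarrow> arr i j (H w) \<in> O'"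
    using arrow_basis[OF O g] by metis
  note F = famD[OF 1(3,1)]
  have Hp: "H p 0 = p" "pathin L (H p)" "H p 1 \<in> S j" using F(4-6) 1(4) by auto
  have rev: "path_between j i (\<lambda>r. H p (1 - r))"
    using pathin_reverse[OF Hp(2)] Hp F(2) 1(4) by (auto simp: path_between_def)
  obtain Y K where K: "fam j i Y K" "H p 1 \<in> Y" "\<And>r. r \<in> {0..1} \<Longrightarrow> K (H p 1) r = H p (1 - r)"
    using family_exists[OF 1(2,1) rev] by auto
  note FK = famD[OF K(1) 1(2)]
  obtain Y' \<Theta> where Y': "openin (subtopology X (S j)) Y'" "H p 1 \<in> Y'" "Y' \<subseteq> Y"
    "\<And>w. w \<in> Y' \<Longrightarrow> zcoord (c i) (K w 1) = \<Theta> (zcoord (c j) w)"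
    "\<And>l. l < n \<Longrightarrow> holomorphic_in n (zcoord (c j) ` Y') (\<lambda>\<zeta>. \<Theta> \<zeta> l)"
    using holonomy_holomorphic[OF 1(2,1) K(1,2)] by metis
  define Y0 where "Y0 = {y \<in> Y'. K y 1 \<in> W}"
  have Y0: "openin (subtopology X (S j)) Y0"
    using famD(1)[OF leafwise_family_join[OF leafwise_family_restrict[OF K(1) Y'(1,3)] 1(3) transv_subset[OF 1(2)]] 1(2)]
    by (simp add: Y0_def)
  have pY0: "H p 1 \<in> Y0" using Y'(2) K(3)[of 1] Hp(1) 1(4) by (simp add: Y0_def)
  define k where "k a = f (arr i j (H (K (snd a) 1)))" for a :: "'i \<times> 'x"
  have hf: "holomorphic_in n (zcoord (c i) ` W) (\<lambda>\<zeta>. f (arr i j (H (slice i \<zeta>))))"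
  proof -
    have "holomorphic_in n (zcoord (c i) ` {w \<in> W. arr i j (H w) \<in> O'}) (\<lambda>\<zeta>. f (arr i j (H (slice i \<zeta>))))"
      using f 1(1-3) unfolding holo_on_arrows by blast
    moreover have "{w \<in> W. arr i j (H w) \<in> O'} = W" using 1(6) by auto
    ultimately show ?thesis by simp
  qed
  note oY0 = transversal_image_open[OF 1(2) Y0]
  have "holomorphic_in n (zcoord (c j) ` Y0) (\<lambda>\<zeta>. f (arr i j (H (slice i (\<Theta> \<zeta>)))))"
  proof (rule holomorphic_in_compose[OF oY0 transversal_image_open[OF 1(1) F(1)] hf])
    show "holomorphic_in n (zcoord (c j) ` Y0) (\<lambda>z. \<Theta> z l)" if "l < n" for l
      by (rule holomorphic_in_cong[OF oY0 transversal_image_open[OF 1(2) Y'(1)] _ Y'(5)[OF that]]) (auto simp: Y0_def)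
    show "\<Theta> \<zeta> \<in> zcoord (c i) ` W" if "\<zeta> \<in> zcoord (c j) ` Y0" for \<zeta>
      using that Y'(4) by (auto simp: Y0_def simp flip: Y'(4))
  qed
  then have hk: "holomorphic_in n (zcoord (c j) ` Y0) (\<lambda>\<zeta>. k (j, slice j \<zeta>))"
  proof (rule holomorphic_in_cong[OF oY0 oY0 order_refl])
    fix \<zeta> assume "\<zeta> \<in> zcoord (c j) ` Y0"
    then obtain y where y: "y \<in> Y'" "K y 1 \<in> W" "\<zeta> = zcoord (c j) y" by (auto simp: Y0_def)
    have "slice j \<zeta> = y" using slice[OF 1(2)] y(1,3) Y'(3) FK(2) by blast
    moreover have "slice i (\<Theta> \<zeta>) = K y 1" using slice[OF 1(1)] Y'(4)[OF y(1)] y(2,3) F(2) by (metis subsetD)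
    ultimately show "k (j, slice j \<zeta>) = f (arr i j (H (slice i (\<Theta> \<zeta>))))" by (simp add: k_def)
  qed
  have "holomorphic_in n (zcoord (c j') ` {w \<in> S j'. (j', w) \<in> {j} \<times> Y0}) (\<lambda>\<zeta>. k (j', slice j' \<zeta>))" for j'
  proof (cases "j' = j")
    case True
    then have e: "{w \<in> S j'. (j', w) \<in> {j} \<times> Y0} = Y0" using openin_subset[OF Y0] by auto
    show ?thesis unfolding e unfolding True by (rule hk)
  next
    case False
    then have e: "{w \<in> S j'. (j', w) \<in> {j} \<times> Y0} = {}" by auto
    show ?thesis unfolding e image_empty by (rule holomorphic_in_empty)
  qed
  then have "holo_on T ({j} \<times> Y0) k" unfolding holo_on_transverse using openin_transverse_slice[OF 1(2) Y0] by blast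
  moreover have "agree_near (ctop A) g f (\<lambda>u. k (target u))"
  proof -
    note J = leafwise_family_join[OF 1(3) K(1) transv_subset[OF 1(1)]]
    have pW1: "p \<in> {w \<in> W. H w 1 \<in> Y}" using 1(4) K(2) by simp
    have hom: "path_homotopic L (path_join (H p) (K (H p 1))) (\<lambda>_. p)"
    proof -
      let ?R = "\<lambda>r. H p (1 - r)"
      have "path_homotopic L (path_join (H p) (K (H p 1))) (path_join (H p) ?R)"
        using path_homotopic_refl[OF Hp(2)] path_homotopic_cong[OF FK(4)[OF K(2)] K(3)] FK(5)[OF K(2)]
        by (intro path_homotopic_join) auto
      also have "path_homotopic L (path_join (H p) ?R) (\<lambda>_. ?R 1)"
        using path_homotopic_inverse[OF pathin_reverse[OF Hp(2)]] by simp
      finally show ?thesis using Hp(1) by simp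
    qed
    have pS: "p \<in> S i" using F(2) 1(4) by auto
    obtain W0 where W0: "openin (subtopology X (S i)) W0" "p \<in> W0" "W0 \<subseteq> {w \<in> W. H w 1 \<in> Y} \<inter> S i"
      "\<And>w. w \<in> W0 \<Longrightarrow> path_join (H w) (K (H w 1)) 1 = w"
      by (rule families_homotopic_near[OF 1(1,1) J constant_family[OF 1(1)] pW1 pS hom]) (rule that)
    have fW0: "fam i j W0 H" using leafwise_family_restrict[OF 1(3) W0(1)] W0(3) by blast
    have "f u = k (target u)" if "u \<in> family_arrows cls i j W0 H" for u
      using that W0(4) by (auto simp: family_arrows_eq[OF fW0 1(1)] k_def)
    then show ?thesis
      unfolding agree_near_def using family_arrows_open[OF 1(1,2) fW0] 1(5) W0(2)
      by (intro exI[of _ "family_arrows cls i j W0 H"]) (auto simp: family_arrows_eq[OF fW0 1(1)])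
  qed
  ultimately show "\<exists>k U'. target g \<in> U' \<and> holo_on T U' k \<and> agree_near (ctop A) g f (\<lambda>u. k (target u))"
    using 1(5) pY0 by (intro exI[of _ k] exI[of _ "{j} \<times> Y0"]) auto
qed

end

section \<open>The monodromy and holonomy groupoids\<close>

lemma UN_constant_on: "a \<in> A \<Longrightarrow> (\<And>x. x \<in> A \<Longrightarrow> f x = f a) \<Longrightarrow> (\<Union>x\<in>A. f x) = f a"
  by blast

text \<open>
  Composition of classes is defined as a union over all representatives; it is composition of
  representatives because the classes are compatible with concatenation.
\<close>

locale path_congruence = path_classes +
  assumes cls_self: "path_between i j \<gamma> \<Longrightarrow> \<gamma> \<in> cls i j \<gamma>"
    and cls_join: "i \<in> I \<Longrightarrow> j \<in> I \<Longrightarrow> k \<in> I \<Longrightarrow> path_between i j \<gamma> \<Longrightarrow> path_between j k \<delta> \<Longrightarrow> \<gamma> 1 = \<delta> 0 \<Longrightarrow>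
      \<gamma>' \<in> cls i j \<gamma> \<Longrightarrow> \<delta>' \<in> cls j k \<delta> \<Longrightarrow> cls i k (path_join \<gamma>' \<delta>') = cls i k (path_join \<gamma> \<delta>)"
begin

abbreviation "G \<equiv> path_groupoid X L n I c cls"

lemma groupoid_simps: "gobj G = T" "garr G = A" "gsrc G = source" "gtgt G = target"
  by (simp_all add: path_groupoid_def source_def target_def)

lemma unit_arr: "gunit G (i, x) = arr i i (\<lambda>_. x)"
  by (simp add: path_groupoid_def arr_def)

lemma mult_arr:
  assumes ijk: "i \<in> I" "j \<in> I" "k \<in> I" and \<gamma>: "path_between i j \<gamma>" and \<delta>: "path_between j k \<delta>" and e: "\<gamma> 1 = \<delta> 0"
  shows "gmult G (arr j k \<delta>) (arr i j \<gamma>) = arr i k (path_join \<gamma> \<delta>)"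
proof -
  note join = cls_join[OF ijk \<gamma> \<delta> e]
  have 1: "(\<Union>\<delta>'\<in>cls j k \<delta>. cls i k (path_join \<gamma>' \<delta>')) = cls i k (path_join \<gamma> \<delta>)" if "\<gamma>' \<in> cls i j \<gamma>" for \<gamma>'
  proof -
    have "(\<Union>\<delta>'\<in>cls j k \<delta>. cls i k (path_join \<gamma>' \<delta>')) = cls i k (path_join \<gamma>' \<delta>)"
      by (rule UN_constant_on[OF cls_self[OF \<delta>]]) (simp only: join[OF that] cls_self[OF \<delta>])
    then show ?thesis by (simp only: join[OF that cls_self[OF \<delta>]])
  qed
  have "(\<Union>\<gamma>'\<in>cls i j \<gamma>. \<Union>\<delta>'\<in>cls j k \<delta>. cls i k (path_join \<gamma>' \<delta>')) =
      (\<Union>\<delta>'\<in>cls j k \<delta>. cls i k (path_join \<gamma> \<delta>'))"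
    by (rule UN_constant_on[OF cls_self[OF \<gamma>]]) (simp only: 1 cls_self[OF \<gamma>])
  also have "\<dots> = cls i k (path_join \<gamma> \<delta>)" by (rule 1[OF cls_self[OF \<gamma>]])
  finally show ?thesis by (simp add: path_groupoid_def arr_def)
qed

lemma arr_in_arrows: "i \<in> I \<Longrightarrow> j \<in> I \<Longrightarrow> path_between i j \<gamma> \<Longrightarrow> arr i j \<gamma> \<in> topspace (ctop A)"
  unfolding topspace_arrows mem_path_arrows by blast

end

context adapted_charts
begin

lemma path_between_join: "path_between i j \<gamma> \<Longrightarrow> path_between j k \<delta> \<Longrightarrow> \<gamma> 1 = \<delta> 0 \<Longrightarrow> path_between i k (path_join \<gamma> \<delta>)"
  by (simp add: path_between_def pathin_path_join)

lemma path_between_reverse: "path_between i j \<gamma> \<Longrightarrow> path_between j i (\<lambda>r. \<gamma> (1 - r))"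
  by (simp add: path_between_def pathin_reverse)

lemma path_between_const: "i \<in> I \<Longrightarrow> x \<in> S i \<Longrightarrow> path_between i i (\<lambda>_. x)"
  using famD(4)[OF constant_family] by (simp add: path_between_def)

lemma homotopic_imp_hol_eq:
  assumes "i \<in> I" "j \<in> I" "path_between i j \<gamma>" "path_homotopic L \<gamma> \<delta>"
  shows "hol i j \<gamma> = hol i j \<delta>"
  using homotopic_imp_germ_eq[OF assms] path_homotopic_ends[OF assms(4)]
  by (subst hol_class_eq_iff) (use assms(3) in \<open>auto simp: path_between_def\<close>)

lemma path_congruence_mon: "path_congruence M V d n I c mon"
proof
  fix i j \<gamma> \<delta>
  assume "i \<in> I" "j \<in> I" "path_between i j \<gamma>" and e: "\<And>r. r \<in> {0..1} \<Longrightarrow> \<gamma> r = \<delta> r"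
  then have "pathin L \<gamma>" by (simp add: path_between_def)
  then show "mon i j \<gamma> = mon i j \<delta>" unfolding mon_class_eq_iff[OF \<open>pathin L \<gamma>\<close>] by (rule path_homotopic_cong) (rule e)
next
  fix i j W H W' H' p
  assume i: "i \<in> I" and j: "j \<in> I" and H: "fam i j W H" "fam i j W' H'" and p: "p \<in> W" "p \<in> W'" and eq: "mon i j (H p) = mon i j (H' p)"
  note P = famD(4)[OF H(1) i]
  have "path_homotopic L (H p) (H' p)" using eq unfolding mon_class_eq_iff[OF P[OF p(1)]] .
  then obtain W0 where W0: "openin (subtopology X (S i)) W0" "p \<in> W0" "W0 \<subseteq> W \<inter> W'"
    "\<And>w. w \<in> W0 \<Longrightarrow> path_homotopic L (H w) (H' w)" "\<And>w. w \<in> W0 \<Longrightarrow> H w 1 = H' w 1"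
    by (rule families_homotopic_near[OF i j H p]) (rule that)
  have "mon i j (H w) = mon i j (H' w)" if w: "w \<in> W0" for w
  proof -
    have "w \<in> W" using w W0(3) by blast
    show ?thesis unfolding mon_class_eq_iff[OF P[OF \<open>w \<in> W\<close>]] by (rule W0(4)[OF w])
  qed
  then show "\<exists>W0. openin (subtopology X (S i)) W0 \<and> p \<in> W0 \<and> W0 \<subseteq> W \<inter> W' \<and>
      (\<forall>w\<in>W0. mon i j (H w) = mon i j (H' w) \<and> H w 1 = H' w 1)"
    using W0(1-3,5) by blast
next
  fix i j \<gamma> assume "path_between i j \<gamma>"
  then show "\<gamma> \<in> mon i j \<gamma>" unfolding mem_mon_class by (intro path_homotopic_refl) (simp add: path_between_def)
next
  fix i j k \<gamma> \<delta> \<gamma>' \<delta>'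
  assume \<gamma>: "path_between i j \<gamma>" and \<delta>: "path_between j k \<delta>" and e: "\<gamma> 1 = \<delta> 0" and m: "\<gamma>' \<in> mon i j \<gamma>" "\<delta>' \<in> mon j k \<delta>"
  have "path_homotopic L (path_join \<gamma> \<delta>) (path_join \<gamma>' \<delta>')"
    using m e unfolding mem_mon_class by (rule path_homotopic_join)
  moreover have "pathin L (path_join \<gamma> \<delta>)" using path_between_join[OF \<gamma> \<delta> e] by (simp add: path_between_def)
  ultimately show "mon i k (path_join \<gamma>' \<delta>') = mon i k (path_join \<gamma> \<delta>)" using mon_class_eq_iff by metis
qed

text \<open>
  For stability, equal holonomy germs at a point mean equal end point maps on a neighbourhood, and
  hence equal germs at all points of this neighbourhood.
\<close>

lemma path_congruence_hol: "path_congruence M V d n I c hol"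
proof
  fix i j \<gamma> \<delta>
  assume "i \<in> I" "j \<in> I" "path_between i j \<gamma>" "\<And>r. r \<in> {0..1} \<Longrightarrow> \<gamma> r = \<delta> r"
  then show "hol i j \<gamma> = hol i j \<delta>"
    by (intro homotopic_imp_hol_eq path_homotopic_cong) (auto simp: path_between_def)
next
  fix i j W H W' H' p
  assume i: "i \<in> I" and j: "j \<in> I" and H: "fam i j W H" "fam i j W' H'" and p: "p \<in> W" "p \<in> W'" and eq: "hol i j (H p) = hol i j (H' p)"
  have "germ_of i j (H p) = germ_of i j (H' p)" using eq hol_class_eq_iff[OF famD(4)[OF H(1) i p(1)], of i j "H' p"] by blast
  then obtain W0 where W0: "openin (subtopology X (S i)) W0" "p \<in> W0" "W0 \<subseteq> W \<inter> W'" "\<And>w. w \<in> W0 \<Longrightarrow> H w 1 = H' w 1"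
    by (rule germ_of_eqD[OF i j H p refl refl]) (rule that)
  have "hol i j (H w) = hol i j (H' w)" if w: "w \<in> W0" for w
  proof -
    have ww: "w \<in> W" "w \<in> W'" using w W0(3) by auto
    have "germ_of i j (H w) = germ_of i j (H' w)"
      by (rule germ_of_eqI[OF i j H ww refl refl W0(1) w]) (rule W0(4))
    moreover have "H w 0 = H' w 0" using famD(5)[OF H(1) i ww(1)] famD(5)[OF H(2) i ww(2)] by simp
    ultimately show ?thesis using hol_class_eq_iff[OF famD(4)[OF H(1) i ww(1)], of i j "H' w"] W0(4)[OF w] by blast
  qed
  then show "\<exists>W0. openin (subtopology X (S i)) W0 \<and> p \<in> W0 \<and> W0 \<subseteq> W \<inter> W' \<and>
      (\<forall>w\<in>W0. hol i j (H w) = hol i j (H' w) \<and> H w 1 = H' w 1)"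
    using W0 by blast
next
  fix i j \<gamma> assume "path_between i j \<gamma>"
  then show "\<gamma> \<in> hol i j \<gamma>" by (simp add: hol_class_def path_between_def)
next
  fix i j k \<gamma> \<delta> \<gamma>' \<delta>'
  assume ijk: "i \<in> I" "j \<in> I" "k \<in> I" and \<gamma>: "path_between i j \<gamma>" and \<delta>: "path_between j k \<delta>" and e: "\<gamma> 1 = \<delta> 0"
    and m: "\<gamma>' \<in> hol i j \<gamma>" "\<delta>' \<in> hol j k \<delta>"
  have m1: "path_between i j \<gamma>'" "\<gamma>' 0 = \<gamma> 0" "\<gamma>' 1 = \<gamma> 1" "germ_of i j \<gamma>' = germ_of i j \<gamma>"
    using m(1) \<gamma> by (auto simp: hol_class_def path_between_def)
  have m2: "path_between j k \<delta>'" "\<delta>' 0 = \<delta> 0" "\<delta>' 1 = \<delta> 1" "germ_of j k \<delta>' = germ_of j k \<delta>"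
    using m(2) \<delta> by (auto simp: hol_class_def path_between_def)
  have e': "\<gamma>' 1 = \<delta>' 0" using e m1(3) m2(2) by simp
  have "germ_of i k (path_join \<gamma>' \<delta>') = germ_of i k (path_join \<gamma> \<delta>)"
    by (rule germ_of_join[OF ijk m1(1) \<gamma> m1(2-4) m2(1) \<delta> m2(2,4) e'])
  moreover have "pathin L (path_join \<gamma>' \<delta>')" using path_between_join[OF m1(1) m2(1) e'] by (simp add: path_between_def)
  ultimately show "hol i k (path_join \<gamma>' \<delta>') = hol i k (path_join \<gamma> \<delta>)"
    using hol_class_eq_iff[of "path_join \<gamma>' \<delta>'" i k "path_join \<gamma> \<delta>"] m1(2) m2(3) by simp
qed

interpretation Mn: path_congruence M V d n I c mon by (rule path_congruence_mon)
interpretation Hl: path_congruence M V d n I c hol by (rule path_congruence_hol)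

abbreviation "Q \<equiv> mon_to_hol M D d c"

lemma quotient_arr:
  assumes i: "i \<in> I" and j: "j \<in> I" and \<gamma>: "path_between i j \<gamma>"
  shows "Q (Mn.arr i j \<gamma>) = Hl.arr i j \<gamma>"
proof -
  have "(\<Union>\<delta>\<in>mon i j \<gamma>. hol i j \<delta>) = hol i j \<gamma>"
    by (rule UN_constant_on[OF Mn.cls_self[OF \<gamma>]])
      (unfold mem_mon_class, rule homotopic_imp_hol_eq[OF i j \<gamma>, symmetric])
  then show ?thesis by (simp add: mon_to_hol_def Mn.arr_def Hl.arr_def)
qed

lemma quotient_ends: "Hl.source (Q g) = Mn.source g" "Hl.target (Q g) = Mn.target g"
  by (simp_all add: Hl.source_def Mn.source_def Hl.target_def Mn.target_def mon_to_hol_def case_prod_unfold)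

lemma quotient_family: "i \<in> I \<Longrightarrow> j \<in> I \<Longrightarrow> fam i j W H \<Longrightarrow> w \<in> W \<Longrightarrow> Q (Mn.arr i j (H w)) = Hl.arr i j (H w)"
  by (intro quotient_arr Mn.fam_path_between)

lemma quotient_image: "Q ` topspace (ctop Mn.A) = topspace (ctop Hl.A)"
proof (intro subset_antisym subsetI)
  fix h assume "h \<in> Q ` topspace (ctop Mn.A)"
  then obtain g where "g \<in> topspace (ctop Mn.A)" "h = Q g" by blast
  then show "h \<in> topspace (ctop Hl.A)" using quotient_arr Hl.arr_in_arrows by (metis Mn.arrow_cases)
next
  fix h assume "h \<in> topspace (ctop Hl.A)"
  then obtain i j \<gamma> where \<gamma>: "i \<in> I" "j \<in> I" "path_between i j \<gamma>" "h = Hl.arr i j \<gamma>" by (rule Hl.arrow_cases)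
  show "h \<in> Q ` topspace (ctop Mn.A)"
    unfolding \<gamma>(4) quotient_arr[OF \<gamma>(1-3), symmetric] by (rule imageI[OF Mn.arr_in_arrows[OF \<gamma>(1-3)]])
qed

lemma quotient_continuous: "continuous_map (ctop Mn.A) (ctop Hl.A) Q"
  unfolding continuous_map_def
proof (intro conjI funcsetI allI impI)
  show "Q g \<in> topspace (ctop Hl.A)" if "g \<in> topspace (ctop Mn.A)" for g using quotient_image that by blast
  fix B assume B: "openin (ctop Hl.A) B"
  show "openin (ctop Mn.A) {g \<in> topspace (ctop Mn.A). Q g \<in> B}"
  proof (subst openin_subopen, intro ballI)
    fix g assume g: "g \<in> {g \<in> topspace (ctop Mn.A). Q g \<in> B}"
    then have "g \<in> topspace (ctop Mn.A)" by simp
    then obtain i j W H p where 1: "i \<in> I" "j \<in> I" "fam i j W H" "p \<in> W" "g = Mn.arr i j (H p)"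
      using Mn.arrow_basis[OF openin_topspace] by metis
    let ?W = "{w \<in> W. Hl.arr i j (H w) \<in> B}"
    have W: "openin (subtopology X (S i)) ?W" by (rule Hl.family_preimage_open[OF B 1(1-3)])
    have f: "fam i j ?W H" by (rule leafwise_family_restrict[OF 1(3) W]) blast
    have mem: "Mn.arr i j (H w) \<in> {g \<in> topspace (ctop Mn.A). Q g \<in> B} \<longleftrightarrow> Hl.arr i j (H w) \<in> B" if "w \<in> W" for w
      using quotient_family[OF 1(1-3) that] Mn.arr_in_arrows[OF 1(1,2) Mn.fam_path_between[OF 1(3,1) that]] by simp
    show "\<exists>C. openin (ctop Mn.A) C \<and> g \<in> C \<and> C \<subseteq> {g \<in> topspace (ctop Mn.A). Q g \<in> B}"
    proof (intro exI conjI)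
      show "openin (ctop Mn.A) (family_arrows mon i j ?W H)" by (rule Mn.family_arrows_open[OF 1(1,2) f])
      show "g \<in> family_arrows mon i j ?W H"
        using mem[OF 1(4)] g 1(4,5) unfolding Mn.family_arrows_eq[OF f 1(1)] by blast
      show "family_arrows mon i j ?W H \<subseteq> {g \<in> topspace (ctop Mn.A). Q g \<in> B}"
        using mem unfolding Mn.family_arrows_eq[OF f 1(1)] by blast
    qed
  qed
qed

lemma quotient_open: "open_map (ctop Mn.A) (ctop Hl.A) Q"
  unfolding open_map_def
proof (intro allI impI)
  fix B assume B: "openin (ctop Mn.A) B"
  show "openin (ctop Hl.A) (Q ` B)"
  proof (subst openin_subopen, intro ballI)
    fix h assume "h \<in> Q ` B"
    then obtain g where g: "g \<in> B" "h = Q g" by blast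
    obtain i j W H p where 1: "i \<in> I" "j \<in> I" "fam i j W H" "p \<in> W" "g = Mn.arr i j (H p)" "\<And>w. w \<in> W \<Longrightarrow> Mn.arr i j (H w) \<in> B"
      using Mn.arrow_basis[OF B g(1)] by metis
    have q: "Hl.arr i j (H w) \<in> Q ` B" if "w \<in> W" for w
      using 1(6)[OF that] quotient_family[OF 1(1-3) that] by (metis imageI)
    show "\<exists>C. openin (ctop Hl.A) C \<and> h \<in> C \<and> C \<subseteq> Q ` B"
    proof (intro exI conjI)
      show "openin (ctop Hl.A) (family_arrows hol i j W H)" by (rule Hl.family_arrows_open[OF 1(1-3)])
      show "h \<in> family_arrows hol i j W H"
        unfolding Hl.family_arrows_eq[OF 1(3,1)] g(2) 1(5) quotient_family[OF 1(1-4)] using 1(4) by blast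
      show "family_arrows hol i j W H \<subseteq> Q ` B" unfolding Hl.family_arrows_eq[OF 1(3,1)] using q by blast
    qed
  qed
qed

lemma quotient_pulls_holomorphic:
  assumes f: "holo_on Hl.A B f"
  shows "holo_on Mn.A {g \<in> topspace (ctop Mn.A). Q g \<in> B} (\<lambda>g. f (Q g))"
  unfolding Mn.holo_on_arrows
proof (intro conjI allI impI)
  have B: "openin (ctop Hl.A) B" using f by (simp add: holo_on_def)
  show "openin (ctop Mn.A) {g \<in> topspace (ctop Mn.A). Q g \<in> B}"
    by (rule openin_continuous_map_preimage[OF quotient_continuous B])
  fix i j W H assume 1: "i \<in> I" "j \<in> I" "fam i j W H"
  let ?W = "{w \<in> W. Hl.arr i j (H w) \<in> B}"
  have eq: "{w \<in> W. Mn.arr i j (H w) \<in> {g \<in> topspace (ctop Mn.A). Q g \<in> B}} = ?W"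
    using quotient_family[OF 1] Mn.arr_in_arrows[OF 1(1,2) Mn.fam_path_between[OF 1(3,1)]] by (auto simp del: Mn.topspace_arrows)
  have o: "openin (top_of_set (coord_space n)) (zcoord (c i) ` ?W)"
    by (rule transversal_image_open[OF 1(1) Hl.family_preimage_open[OF B 1]])
  have h: "holomorphic_in n (zcoord (c i) ` ?W) (\<lambda>\<zeta>. f (Hl.arr i j (H (slice i \<zeta>))))"
    using f 1 unfolding Hl.holo_on_arrows by blast
  show "holomorphic_in n (zcoord (c i) ` {w \<in> W. Mn.arr i j (H w) \<in> {g \<in> topspace (ctop Mn.A). Q g \<in> B}})
      (\<lambda>\<zeta>. f (Q (Mn.arr i j (H (slice i \<zeta>)))))"
    unfolding eq
  proof (rule holomorphic_in_cong[OF o o order_refl h])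
    fix \<zeta> assume "\<zeta> \<in> zcoord (c i) ` ?W"
    then obtain w where w: "w \<in> W" "\<zeta> = zcoord (c i) w" by blast
    have "slice i \<zeta> = w" unfolding w(2) using slice[OF 1(1)] famD(2)[OF 1(3,1)] w(1) by blast
    then show "f (Q (Mn.arr i j (H (slice i \<zeta>)))) = f (Hl.arr i j (H (slice i \<zeta>)))"
      using quotient_family[OF 1 w(1)] by simp
  qed
qed

text \<open>
  Over a family of paths, both arrow spaces have the same coordinate, the transverse coordinate of
  the source; a function of this coordinate is holomorphic on one exactly if it is on the other.
\<close>

lemma quotient_descends_holomorphic:
  assumes f: "holo_on Mn.A B f" and g: "g \<in> B"
  obtains B' k where "Q g \<in> B'" "holo_on Hl.A B' k" "agree_near (ctop Mn.A) g f (\<lambda>u. k (Q u))"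
proof -
  have B: "openin (ctop Mn.A) B" using f by (simp add: holo_on_def)
  obtain i j W H p where 1: "i \<in> I" "j \<in> I" "fam i j W H" "p \<in> W" "g = Mn.arr i j (H p)" "\<And>w. w \<in> W \<Longrightarrow> Mn.arr i j (H w) \<in> B"
    using Mn.arrow_basis[OF B g] by metis
  note F = famD[OF 1(3,1)]
  define k where "k h = f (Mn.arr i j (H (snd (Hl.source h))))" for h
  let ?B = "family_arrows hol i j W H"
  have hf: "holomorphic_in n (zcoord (c i) ` W) (\<lambda>\<zeta>. f (Mn.arr i j (H (slice i \<zeta>))))"
  proof -
    have "holomorphic_in n (zcoord (c i) ` {w \<in> W. Mn.arr i j (H w) \<in> B}) (\<lambda>\<zeta>. f (Mn.arr i j (H (slice i \<zeta>))))"
      using f 1(1-3) unfolding Mn.holo_on_arrows by blast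
    moreover have "{w \<in> W. Mn.arr i j (H w) \<in> B} = W" using 1(6) by auto
    ultimately show ?thesis by simp
  qed
  have oB: "openin (ctop Hl.A) ?B" by (rule Hl.family_arrows_open[OF 1(1-3)])
  have "holo_on Hl.A ?B k"
    unfolding Hl.holo_on_arrows
  proof (intro conjI allI impI oB)
    fix i' j' W' H' assume 2: "i' \<in> I" "j' \<in> I" "fam i' j' W' H'"
    let ?W = "{w \<in> W'. Hl.arr i' j' (H' w) \<in> ?B}"
    have W: "i' = i \<and> w \<in> W" if w: "w \<in> ?W" for w
    proof -
      obtain v where v: "v \<in> W" "Hl.arr i' j' (H' w) = Hl.arr i j (H v)" using w unfolding Hl.family_arrows_eq[OF 1(3,1)] by blast
      have "w \<in> W'" using w by simp
      then show ?thesis using v famD(5)[OF 2(3,1), of w] F(5)[OF v(1)] by (simp add: Hl.arr_def)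
    qed
    show "holomorphic_in n (zcoord (c i') ` ?W) (\<lambda>\<zeta>. k (Hl.arr i' j' (H' (slice i' \<zeta>))))"
    proof (cases "i' = i")
      case False
      then have e: "?W = {}" using W by blast
      show ?thesis unfolding e image_empty by (rule holomorphic_in_empty)
    next
      case True
      show ?thesis
      proof (rule holomorphic_in_cong[OF transversal_image_open[OF 2(1) Hl.family_preimage_open[OF oB 2]]
            transversal_image_open[OF 1(1) F(1)] _ hf])
        show "zcoord (c i') ` ?W \<subseteq> zcoord (c i) ` W" using W True by blast
        fix \<zeta> assume "\<zeta> \<in> zcoord (c i') ` ?W"
        then obtain w where w: "w \<in> ?W" "\<zeta> = zcoord (c i') w" by blast
        have ww: "w \<in> W" "w \<in> W'" using W[OF w(1)] w(1) by auto
        have s: "slice i \<zeta> = w" "slice i' \<zeta> = w" using slice[OF 1(1)] F(2) ww(1) w(2) True by auto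
        show "k (Hl.arr i' j' (H' (slice i' \<zeta>))) = f (Mn.arr i j (H (slice i \<zeta>)))"
          unfolding s k_def Hl.arr_ends snd_conv famD(5)[OF 2(3,1) ww(2)] ..
      qed
    qed
  qed
  moreover have "agree_near (ctop Mn.A) g f (\<lambda>u. k (Q u))"
    unfolding agree_near_def
  proof (intro exI conjI ballI)
    show "openin (ctop Mn.A) (family_arrows mon i j W H)" by (rule Mn.family_arrows_open[OF 1(1-3)])
    show "g \<in> family_arrows mon i j W H" unfolding Mn.family_arrows_eq[OF 1(3,1)] using 1(4,5) by blast
    fix u assume "u \<in> family_arrows mon i j W H"
    then obtain w where w: "w \<in> W" "u = Mn.arr i j (H w)" unfolding Mn.family_arrows_eq[OF 1(3,1)] by blast
    show "f u = k (Q u)" unfolding w(2) quotient_family[OF 1(1-3) w(1)] k_def Hl.arr_ends snd_conv F(5)[OF w(1)] ..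
  qed
  moreover have "Q g \<in> ?B"
    unfolding Hl.family_arrows_eq[OF 1(3,1)] 1(5) quotient_family[OF 1(1-4)] using 1(4) by blast
  ultimately show ?thesis using that by blast
qed

lemma quotient_local_biholo: "local_biholo_onto Mn.A Hl.A Q"
  unfolding local_biholo_onto_def
proof (intro conjI ballI quotient_continuous quotient_open quotient_image)
  fix y assume y: "y \<in> topspace (ctop Mn.A)"
  note cg = comp_germ_germ[OF quotient_continuous y]
  show "comp_germ Mn.A Q y ` carrier (O_stalk Hl.A (Q y)) = carrier (O_stalk Mn.A y)"
  proof (intro subset_antisym subsetI)
    fix a assume "a \<in> comp_germ Mn.A Q y ` carrier (O_stalk Hl.A (Q y))"
    then obtain f B where f: "a = comp_germ Mn.A Q y (germ Hl.A (Q y) f)" "Q y \<in> B" "holo_on Hl.A B f"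
      by (auto simp: O_stalk_def)
    have "a = germ Mn.A y (\<lambda>u. f (Q u))" using f(1) cg by simp
    moreover have "y \<in> {g \<in> topspace (ctop Mn.A). Q g \<in> B}" using y f(2) by simp
    ultimately show "a \<in> carrier (O_stalk Mn.A y)"
      using quotient_pulls_holomorphic[OF f(3)] unfolding O_stalk_def
      by (auto intro!: exI[of _ "\<lambda>u. f (Q u)"] exI[of _ "{g \<in> topspace (ctop Mn.A). Q g \<in> B}"])
  next
    fix a assume "a \<in> carrier (O_stalk Mn.A y)"
    then obtain f B where f: "a = germ Mn.A y f" "y \<in> B" "holo_on Mn.A B f" by (auto simp: O_stalk_def)
    obtain B' k where k: "Q y \<in> B'" "holo_on Hl.A B' k" "agree_near (ctop Mn.A) y f (\<lambda>u. k (Q u))"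
      by (rule quotient_descends_holomorphic[OF f(3,2)]) (rule that)
    have "a = comp_germ Mn.A Q y (germ Hl.A (Q y) k)" unfolding f(1) cg by (rule germ_eqI[OF k(3)])
    moreover have "germ Hl.A (Q y) k \<in> carrier (O_stalk Hl.A (Q y))" using k(1,2) by (auto simp: O_stalk_def)
    ultimately show "a \<in> comp_germ Mn.A Q y ` carrier (O_stalk Hl.A (Q y))" by blast
  qed
qed

text \<open>
  Two arrows with the same holonomy differ by a loop with trivial holonomy: run along the first
  path and back along the second.
\<close>

lemma quotient_fibre:
  assumes g: "g \<in> topspace (ctop Mn.A)" and g': "g' \<in> topspace (ctop Mn.A)" and eq: "Q g = Q g'"
  shows "\<exists>k\<in>kernel_subgroupoid Mn.G Hl.G Q. gsrc Mn.G g' = gtgt Mn.G k \<and> gsrc Mn.G k = gsrc Mn.G g \<and> gmult Mn.G g' k = g"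
proof -
  obtain i j \<gamma> where \<gamma>: "i \<in> I" "j \<in> I" "path_between i j \<gamma>" "g = Mn.arr i j \<gamma>" using g by (rule Mn.arrow_cases)
  obtain i' j' \<delta> where \<delta>: "i' \<in> I" "j' \<in> I" "path_between i' j' \<delta>" "g' = Mn.arr i' j' \<delta>" using g' by (rule Mn.arrow_cases)
  have "Hl.arr i j \<gamma> = Hl.arr i' j' \<delta>"
    using eq unfolding \<gamma>(4) \<delta>(4) quotient_arr[OF \<gamma>(1-3)] quotient_arr[OF \<delta>(1-3)] .
  then have e: "i' = i" "j' = j" "\<gamma> 0 = \<delta> 0" "\<gamma> 1 = \<delta> 1" "hol i j \<gamma> = hol i j \<delta>" by (auto simp: Hl.arr_def)
  note \<delta>' = \<delta>(3)[unfolded e(1,2)]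
  have p: "pathin L \<gamma>" "pathin L \<delta>" using \<gamma>(3) \<delta>' by (auto simp: path_between_def)
  have germ: "germ_of i j \<gamma> = germ_of i j \<delta>" using e(5) unfolding hol_class_eq_iff[OF p(1)] by blast
  let ?l = "path_join \<gamma> (\<lambda>r. \<delta> (1 - r))"
  have l: "path_between i i ?l" by (rule path_between_join[OF \<gamma>(3) path_between_reverse[OF \<delta>']]) (simp add: e(4))
  have "path_homotopic L (path_join ?l \<delta>) (path_join \<gamma> (path_join (\<lambda>r. \<delta> (1 - r)) \<delta>))"
    by (rule path_homotopic_assoc) (use p e(4) in \<open>auto simp: pathin_reverse\<close>)
  also have "path_homotopic L \<dots> (path_join \<gamma> (\<lambda>_. \<delta> 1))"
    by (rule path_homotopic_join[OF path_homotopic_refl[OF p(1)] path_homotopic_inverse[OF p(2)]]) (simp add: e(4))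
  also have "path_homotopic L \<dots> \<gamma>" using path_homotopic_unit(1)[OF p(1)] unfolding e(4) .
  finally have hom: "path_homotopic L (path_join ?l \<delta>) \<gamma>" .
  let ?k = "Mn.arr i i ?l"
  have lx: "pathin L ?l" "?l 0 = \<gamma> 0" "?l 1 = \<gamma> 0" using l e(3) by (auto simp: path_between_def)
  have "Q ?k = Hl.arr i i (\<lambda>_. \<gamma> 0)"
  proof -
    have "hol i i ?l = hol i i (\<lambda>_. \<gamma> 0)"
      unfolding hol_class_eq_iff[OF lx(1)] using lx germ_of_loop[OF \<gamma>(1-3) \<delta>' e(3,4) germ] by simp
    then show ?thesis unfolding quotient_arr[OF \<gamma>(1,1) l] Hl.arr_def lx(2,3) by simp
  qed
  moreover have "Mn.source ?k = (i, \<gamma> 0)" "Mn.target ?k = (i, \<gamma> 0)" unfolding Mn.arr_ends lx(2,3) by (rule refl)+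
  ultimately have "?k \<in> kernel_subgroupoid Mn.G Hl.G Q"
    using Mn.arr_in_arrows[OF \<gamma>(1,1) l]
    unfolding kernel_subgroupoid_def Mn.groupoid_simps by (simp only: mem_Collect_eq Hl.unit_arr simp_thms)
  moreover have "gsrc Mn.G g' = gtgt Mn.G ?k" "gsrc Mn.G ?k = gsrc Mn.G g"
    unfolding Mn.groupoid_simps \<gamma>(4) \<delta>(4) Mn.arr_ends lx(2,3) e(1,2) e(3)[symmetric] by (rule refl)+
  moreover have "gmult Mn.G g' ?k = g"
  proof -
    have lj: "path_between i j (path_join ?l \<delta>)" by (rule path_between_join[OF l \<delta>']) (simp add: e(3) lx(3))
    then have "mon i j (path_join ?l \<delta>) = mon i j \<gamma>"
      using hom by (subst mon_class_eq_iff) (simp_all add: path_between_def)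
    moreover have "gmult Mn.G g' ?k = Mn.arr i j (path_join ?l \<delta>)"
      unfolding \<delta>(4) e(1,2) by (rule Mn.mult_arr[OF \<gamma>(1,1,2) l \<delta>']) (simp add: e(3))
    ultimately show ?thesis unfolding \<gamma>(4) Mn.arr_def by (simp add: e(4))
  qed
  ultimately show ?thesis by blast
qed

lemma Mon_Hol_eq: "Mon M D d n I c = Mn.G" "Hol M D d n I c = Hl.G"
  by (simp_all add: Mon_def Hol_def)

theorem monodromy_holonomy_quotient: "groupoid_quotient (Mon M D d n I c) (Hol M D d n I c) Q"
  unfolding Mon_Hol_eq
proof
  show "gobj Hl.G = gobj Mn.G" unfolding Mn.groupoid_simps Hl.groupoid_simps by (rule refl)
  show "gsrc Mn.G = gsrc Hl.G \<circ> Q" "gtgt Mn.G = gtgt Hl.G \<circ> Q"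
    unfolding Mn.groupoid_simps Hl.groupoid_simps fun_eq_iff o_def quotient_ends by simp_all
  show "local_biholo_onto (garr Mn.G) (garr Hl.G) Q" unfolding Mn.groupoid_simps Hl.groupoid_simps by (rule quotient_local_biholo)
  show "pulls_all_germs (garr Mn.G) (gobj Mn.G) (gsrc Mn.G)" "pulls_all_germs (garr Mn.G) (gobj Mn.G) (gtgt Mn.G)"
    unfolding Mn.groupoid_simps by (rule Mn.source_pulls_all_germs Mn.target_pulls_all_germs)+
  show "\<exists>k\<in>kernel_subgroupoid Mn.G Hl.G Q. gsrc Mn.G g' = gtgt Mn.G k \<and> gsrc Mn.G k = gsrc Mn.G g \<and> gmult Mn.G g' k = g"
    if "g \<in> arrows Mn.G" "g' \<in> arrows Mn.G" "Q g = Q g'" for g g'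
    by (rule quotient_fibre) (use that in \<open>simp_all only: Mn.groupoid_simps\<close>)
next
  fix a assume "a \<in> topspace (ctop (gobj Mn.G))"
  then obtain i x where a: "a = (i, x)" "i \<in> I" "x \<in> S i" unfolding Mn.groupoid_simps topspace_transverse by blast
  note p = path_between_const[OF a(2,3)]
  show "gunit Mn.G a \<in> arrows Mn.G \<and> gsrc Mn.G (gunit Mn.G a) = a \<and> Q (gunit Mn.G a) = gunit Hl.G a"
    unfolding a(1) Mn.unit_arr Hl.unit_arr Mn.groupoid_simps Mn.arr_ends quotient_arr[OF a(2,2) p]
    by (intro conjI refl Mn.arr_in_arrows[OF a(2,2) p])
next
  fix g h assume gh: "g \<in> arrows Mn.G" "h \<in> arrows Mn.G" "gsrc Mn.G g = gtgt Mn.G h"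
  obtain i j \<gamma> where \<gamma>: "i \<in> I" "j \<in> I" "path_between i j \<gamma>" "h = Mn.arr i j \<gamma>"
    using gh(2) unfolding Mn.groupoid_simps by (rule Mn.arrow_cases)
  obtain j' k \<delta> where \<delta>: "j' \<in> I" "k \<in> I" "path_between j' k \<delta>" "g = Mn.arr j' k \<delta>"
    using gh(1) unfolding Mn.groupoid_simps by (rule Mn.arrow_cases)
  have e: "j' = j" "\<gamma> 1 = \<delta> 0" using gh(3) unfolding Mn.groupoid_simps \<gamma>(4) \<delta>(4) Mn.arr_ends by auto
  note \<delta>' = \<delta>(3)[unfolded e(1)]
  note pj = path_between_join[OF \<gamma>(3) \<delta>' e(2)]
  show "gmult Mn.G g h \<in> arrows Mn.G \<and> gsrc Mn.G (gmult Mn.G g h) = gsrc Mn.G h \<and> Q (gmult Mn.G g h) = gmult Hl.G (Q g) (Q h)"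
    unfolding \<gamma>(4) \<delta>(4) e(1) quotient_arr[OF \<gamma>(1-3)] quotient_arr[OF \<gamma>(2) \<delta>(2) \<delta>']
      Mn.mult_arr[OF \<gamma>(1,2) \<delta>(2) \<gamma>(3) \<delta>' e(2)] Hl.mult_arr[OF \<gamma>(1,2) \<delta>(2) \<gamma>(3) \<delta>' e(2)]
      quotient_arr[OF \<gamma>(1) \<delta>(2) pj] Mn.groupoid_simps Mn.arr_ends path_join_ends
    by (intro conjI refl Mn.arr_in_arrows[OF \<gamma>(1) \<delta>(2) pj])
qed

end

theorem corollary7p4:
  fixes X :: "'x smooth_mfd" and V :: "'x \<Rightarrow> 'x cvec set" and d n :: nat
    and I :: "'i set" and c :: "'i \<Rightarrow> 'x adapted"
    and G_mon G_hol :: "('i \<times> 'x, ('i, 'x) parrow) cgroupoid"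
    and q :: "('i, 'x) parrow \<Rightarrow> ('i, 'x) parrow" and K :: "('i, 'x) parrow set"
    and Coh_mon Coh_hol :: "(('i \<times> 'x, ('i, 'x) parrow, 'e) eq_sheaf, 'e \<Rightarrow> 'e) category"
  assumes "smooth_manifold X" and "mdim X = d + 2 * n"
    and "elliptic_involutive_structure X (d + n) V"
    and "complete_transverse_atlas X d n V I c"
  defines "G_mon \<equiv> Mon X (real_distribution V) d n I c"
    and "G_hol \<equiv> Hol X (real_distribution V) d n I c"
    and "q \<equiv> mon_to_hol X (real_distribution V) d c"
    and "K \<equiv> kernel_subgroupoid G_mon G_hol q"
    and "Coh_mon \<equiv> Coh_an G_mon"
    and "Coh_hol \<equiv> Coh_an G_hol"
  shows "fully_faithful Coh_hol Coh_mon (pullback_functor G_mon q) \<and>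
    equivalence_functor Coh_hol (full_subcategory Coh_mon (acts_as_identity G_mon K))
      (pullback_functor G_mon q)"
proof -
  interpret adapted_charts X V d n I c
    using assms(1,2,4) by unfold_locales (auto simp: complete_transverse_atlas_def)
  interpret groupoid_quotient "Mon X (real_distribution V) d n I c" "Hol X (real_distribution V) d n I c"
      "mon_to_hol X (real_distribution V) d c"
    by (rule monodromy_holonomy_quotient)
  show ?thesis
    unfolding G_mon_def G_hol_def q_def K_def Coh_mon_def Coh_hol_def
    by (rule conjI[OF pullback_equivalence])
qed

end
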